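(* Let $(W,S)$ and $(W',S')$ be Coxeter systems with identity elements $e$ and $e'$, let $v\in W$, $v'\in W'$, and let $\psi:[e,v]\to[e',v']$ be an isomorphism of posets between the Bruhat intervals $[e,v]\subseteq W$ and $[e',v']\subseteq W'$. Then for all $x,y\in[e,v]$, $$P_{x,y}=P_{\psi(x),\psi(y)}\qquad\text{and}\qquad R_{x,y}=R_{\psi(x),\psi(y)} .$$
   Context: Coxeter groups are equipped with the Bruhat order $\le$; $[u,v]=\{z: u\le z\le v\}$. $P_{x,y}$ denotes the Kazhdan-Lusztig polynomials and $R_{x,y}$ the $R$-polynomials (in the variable $q$) of the Coxeter group containing $x,y$, with the usual convention that they are $0$ unless $x\le y$. Normalization of $R$: $R_{x,x}=1$, and if $s\in S$, $\ell(sx)>\ell(x)$, $\ell(sy)>\ell(y)$, then $R_{sx,sy}=R_{x,y}$ and $R_{x,sy}=(q-1)R_{x,y}+qR_{sx,y}$. *)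

theory Defs
  imports "HOL-Algebra.Generated_Groups" "HOL-Computational_Algebra.Polynomial"
begin

text \<open>The entry \<open>m s t = 0\<close> encodes \<open>m(s,t) = \<infinity>\<close>.\<close>

definition coxeter_matrix :: "'a set \<Rightarrow> ('a \<Rightarrow> 'a \<Rightarrow> nat) \<Rightarrow> bool" where
  "coxeter_matrix S m \<longleftrightarrow>
     (\<forall>s\<in>S. \<forall>t\<in>S. m s t = m t s \<and> (m s t = 1 \<longleftrightarrow> s = t))"

text \<open>Insertion of a relator \<open>(st)\<^bsup>m(s,t)\<^esup>\<close> at an arbitrary place of a word in the
  generators. For \<open>m s t = 0\<close> the inserted word is empty, so infinite entries impose no
  relation. As \<open>m s s = 1\<close>, the words \<open>[s, s]\<close> are among the relators; hence formal
  inverses of the generators are not needed, and the quotient of the monoid of words by the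
  generated equivalence relation is the group presented by the relators.\<close>

definition relator_insertion ::
    "'a set \<Rightarrow> ('a \<Rightarrow> 'a \<Rightarrow> nat) \<Rightarrow> 'a list \<Rightarrow> 'a list \<Rightarrow> bool" where
  "relator_insertion S m xs ys \<longleftrightarrow>
     (\<exists>us\<in>lists S. \<exists>vs\<in>lists S. \<exists>s\<in>S. \<exists>t\<in>S.
        xs = us @ vs \<and> ys = us @ concat (replicate (m s t) [s, t]) @ vs)"

definition word_prod :: "('a, 'b) monoid_scheme \<Rightarrow> 'a list \<Rightarrow> 'a" where
  "word_prod W xs = foldr (\<otimes>\<^bsub>W\<^esub>) xs \<one>\<^bsub>W\<^esub>"

definition coxeter_system :: "('a, 'b) monoid_scheme \<Rightarrow> 'a set \<Rightarrow> bool" where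
  "coxeter_system W S \<longleftrightarrow>
     group W \<and> S \<subseteq> carrier W \<and> generate W S = carrier W \<and>
     (\<exists>m. coxeter_matrix S m \<and>
        (\<forall>xs\<in>lists S. \<forall>ys\<in>lists S.
           word_prod W xs = word_prod W ys \<longleftrightarrow> equivclp (relator_insertion S m) xs ys))"

definition cox_length :: "('a, 'b) monoid_scheme \<Rightarrow> 'a set \<Rightarrow> 'a \<Rightarrow> nat" where
  "cox_length W S w = (LEAST n. \<exists>xs\<in>lists S. length xs = n \<and> word_prod W xs = w)"

definition reflections :: "('a, 'b) monoid_scheme \<Rightarrow> 'a set \<Rightarrow> 'a set" where
  "reflections W S = {w \<otimes>\<^bsub>W\<^esub> s \<otimes>\<^bsub>W\<^esub> inv\<^bsub>W\<^esub> w | w s. w \<in> carrier W \<and> s \<in> S}"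

inductive bruhat_le :: "('a, 'b) monoid_scheme \<Rightarrow> 'a set \<Rightarrow> 'a \<Rightarrow> 'a \<Rightarrow> bool"
  for W :: "('a, 'b) monoid_scheme" and S :: "'a set" where
  refl: "u \<in> carrier W \<Longrightarrow> bruhat_le W S u u"
| step: "bruhat_le W S u w \<Longrightarrow> t \<in> reflections W S \<Longrightarrow>
    cox_length W S w < cox_length W S (w \<otimes>\<^bsub>W\<^esub> t) \<Longrightarrow> bruhat_le W S u (w \<otimes>\<^bsub>W\<^esub> t)"

definition bruhat_interval :: "('a, 'b) monoid_scheme \<Rightarrow> 'a set \<Rightarrow> 'a \<Rightarrow> 'a \<Rightarrow> 'a set" where
  "bruhat_interval W S u v = {z. bruhat_le W S u z \<and> bruhat_le W S z v}"

text \<open>Integer polynomials in the variable \<open>q = [:0, 1:]\<close>. Since \<open>bruhat_le\<close> only relates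
  elements of the carrier, the vanishing condition also fixes the values outside the carrier,
  so that each family is determined by its defining properties.\<close>

definition is_R_family ::
    "('a, 'b) monoid_scheme \<Rightarrow> 'a set \<Rightarrow> ('a \<Rightarrow> 'a \<Rightarrow> int poly) \<Rightarrow> bool" where
  "is_R_family W S R \<longleftrightarrow>
     (\<forall>x y. \<not> bruhat_le W S x y \<longrightarrow> R x y = 0) \<and>
     (\<forall>x\<in>carrier W. R x x = 1) \<and>
     (\<forall>s\<in>S. \<forall>x\<in>carrier W. \<forall>y\<in>carrier W.
        cox_length W S x < cox_length W S (s \<otimes>\<^bsub>W\<^esub> x) \<longrightarrow>
        cox_length W S y < cox_length W S (s \<otimes>\<^bsub>W\<^esub> y) \<longrightarrow>
        R (s \<otimes>\<^bsub>W\<^esub> x) (s \<otimes>\<^bsub>W\<^esub> y) = R x y \<and>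
        R x (s \<otimes>\<^bsub>W\<^esub> y) = ([:0, 1:] - 1) * R x y + [:0, 1:] * R (s \<otimes>\<^bsub>W\<^esub> x) y)"

definition R_poly :: "('a, 'b) monoid_scheme \<Rightarrow> 'a set \<Rightarrow> 'a \<Rightarrow> 'a \<Rightarrow> int poly" where
  "R_poly W S = (THE R. is_R_family W S R)"

text \<open>\<open>q\<^bsup>d\<^esup> p(q\<^bsup>-1\<^esup>)\<close>, for \<open>p\<close> of degree at most \<open>d\<close>.\<close>

definition poly_reversal :: "nat \<Rightarrow> int poly \<Rightarrow> int poly" where
  "poly_reversal d p = (\<Sum>i\<le>d. monom (coeff p i) (d - i))"

definition is_KL_family ::
    "('a, 'b) monoid_scheme \<Rightarrow> 'a set \<Rightarrow> ('a \<Rightarrow> 'a \<Rightarrow> int poly) \<Rightarrow> bool" where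
  "is_KL_family W S P \<longleftrightarrow>
     (\<forall>x y. \<not> bruhat_le W S x y \<longrightarrow> P x y = 0) \<and>
     (\<forall>x\<in>carrier W. P x x = 1) \<and>
     (\<forall>x y. bruhat_le W S x y \<longrightarrow> x \<noteq> y \<longrightarrow>
        2 * degree (P x y) + 1 \<le> cox_length W S y - cox_length W S x) \<and>
     (\<forall>x y. bruhat_le W S x y \<longrightarrow>
        poly_reversal (cox_length W S y - cox_length W S x) (P x y) =
          (\<Sum>z\<in>bruhat_interval W S x y. R_poly W S x z * P z y))"

definition KL_poly :: "('a, 'b) monoid_scheme \<Rightarrow> 'a set \<Rightarrow> 'a \<Rightarrow> 'a \<Rightarrow> int poly" where
  "KL_poly W S = (THE P. is_KL_family W S P)"

end

theory Submission
  imports Defs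
begin

text \<open>A special matching of \<open>[e,w]\<close> is an involution \<open>M\<close> exchanging every element with one of its
  neighbours in the Hasse diagram, such that \<open>M x \<le> M y\<close> whenever \<open>y \<noteq> M x\<close> covers \<open>x\<close>. Left
  multiplication by a left descent of \<open>w\<close> is one, and special matchings are transported by poset
  isomorphisms. Hence \<open>R\<close> is an invariant of lower intervals as soon as the recursion computing
  \<open>R\<^sub>x\<^sub>,\<^sub>w\<close> from a left descent of \<open>w\<close> holds along every special matching \<open>M\<close> of \<open>[e,w]\<close>; the
  polynomials \<open>P\<close> are determined by \<open>R\<close> and the order.

  This recursion follows by induction on \<open>w\<close> if \<open>M\<close> commutes with the multiplication by some descent
  \<open>q\<close> of \<open>w\<close> for which \<open>M w\<close> is not the corresponding multiple of \<open>w\<close>; it is immediate if \<open>M\<close> is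
  itself a multiplication, and in a dihedral interval, where \<open>R\<close> depends on the length difference
  only. That there are no other cases is the combinatorial heart of the proof. As an element is
  determined by its coatoms outside rank two, \<open>M\<close> is determined by its values on the dihedral
  intervals through \<open>s = M e\<close>, and it commutes with a descent unless it does not do so in some
  dihedral interval. If \<open>M\<close> is \<open>x \<mapsto> xs\<close> or \<open>x \<mapsto> sx\<close> on each of those, a suitable descent is found
  directly; otherwise a minimal dihedral \<open>u\<close> with \<open>M u \<noteq> us\<close> severely restricts the elements
  below \<open>w\<close>, and a parabolic factorization of \<open>w\<close> provides the descent.\<close>

subsection \<open>Coxeter groups with the Bruhat order\<close>

text \<open>An isomorphism turns a left multiplication into a matching of which only order
  properties are known, so the recursion has to be proved for all special matchings, not just for
  those that come from the group. Wild ones do exist: in a dihedral interval every element lies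
  above all shorter ones, so a matching may choose between left and right multiplication anew at
  each rank. This freedom is harmless for \<open>R\<close> inside the dihedral interval; the
  difficulty is to control it where further letters enter. Commutation with a descent
  \<open>q\<close> suffices for the induction because \<open>M\<close> and the multiplication by
  \<open>q\<close> then generate orbits of two or four elements; on an orbit of four the two
  recursions can be interchanged. That \<open>M w\<close> differs from \<open>w q\<close> ensures
  that \<open>M\<close> lowers \<open>w q\<close> as well, and so restricts to a special matching of
  the smaller interval. Two devices recur throughout. Lifting removes from a larger element a
  descent that a smaller one lacks, and a count of lengths then turns the inequality into an
  equation. A minimal coset representative can be compared while the parabolic factor is
  ignored.\<close>

text \<open>The assumptions are invariant under reversing the multiplication, so every fact has a mirror
  image, obtained from \<open>dual\<close>.\<close>

locale cox =
  fixes C :: "'a set" and mul :: "'a \<Rightarrow> 'a \<Rightarrow> 'a" (infixl "\<cdot>" 70) and e :: 'a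
    and S :: "'a set" and len :: "'a \<Rightarrow> nat" and le :: "'a \<Rightarrow> 'a \<Rightarrow> bool" (infix "\<preceq>" 50)
  assumes mul_C[simp]: "x \<in> C \<Longrightarrow> y \<in> C \<Longrightarrow> x \<cdot> y \<in> C"
    and e_C[simp]: "e \<in> C"
    and assoc: "x \<in> C \<Longrightarrow> y \<in> C \<Longrightarrow> z \<in> C \<Longrightarrow> (x \<cdot> y) \<cdot> z = x \<cdot> (y \<cdot> z)"
    and e_l[simp]: "x \<in> C \<Longrightarrow> e \<cdot> x = x"
    and e_r[simp]: "x \<in> C \<Longrightarrow> x \<cdot> e = x"
    and S_C[simp]: "s \<in> S \<Longrightarrow> s \<in> C"
    and inv_S[simp]: "s \<in> S \<Longrightarrow> s \<cdot> s = e"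
    and inverse: "x \<in> C \<Longrightarrow> \<exists>y\<in>C. y \<cdot> x = e \<and> x \<cdot> y = e"
    and len_e: "x \<in> C \<Longrightarrow> len x = 0 \<longleftrightarrow> x = e"
    and len_l: "s \<in> S \<Longrightarrow> x \<in> C \<Longrightarrow> len (s \<cdot> x) = Suc (len x) \<or> len x = Suc (len (s \<cdot> x))"
    and len_r: "s \<in> S \<Longrightarrow> x \<in> C \<Longrightarrow> len (x \<cdot> s) = Suc (len x) \<or> len x = Suc (len (x \<cdot> s))"
    and ex_l: "x \<in> C \<Longrightarrow> x \<noteq> e \<Longrightarrow> \<exists>s\<in>S. len (s \<cdot> x) < len x"
    and ex_r: "x \<in> C \<Longrightarrow> x \<noteq> e \<Longrightarrow> \<exists>s\<in>S. len (x \<cdot> s) < len x"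
    and le_C1: "x \<preceq> y \<Longrightarrow> x \<in> C"
    and le_C2: "x \<preceq> y \<Longrightarrow> y \<in> C"
    and le_refl[simp]: "x \<in> C \<Longrightarrow> x \<preceq> x"
    and le_trans[trans]: "x \<preceq> y \<Longrightarrow> y \<preceq> z \<Longrightarrow> x \<preceq> z"
    and le_len: "x \<preceq> y \<Longrightarrow> x = y \<or> len x < len y"
    and le_up_l: "s \<in> S \<Longrightarrow> x \<in> C \<Longrightarrow> len x < len (s \<cdot> x) \<Longrightarrow> x \<preceq> s \<cdot> x"
    and le_up_r: "s \<in> S \<Longrightarrow> x \<in> C \<Longrightarrow> len x < len (x \<cdot> s) \<Longrightarrow> x \<preceq> x \<cdot> s"
    and lift_l: "s \<in> S \<Longrightarrow> x \<preceq> y \<Longrightarrow> len (s \<cdot> y) < len y \<Longrightarrow> len x < len (s \<cdot> x) \<Longrightarrow> x \<preceq> s \<cdot> y"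
    and lift_r: "s \<in> S \<Longrightarrow> x \<preceq> y \<Longrightarrow> len (y \<cdot> s) < len y \<Longrightarrow> len x < len (x \<cdot> s) \<Longrightarrow> x \<preceq> y \<cdot> s"
    and mono_l: "s \<in> S \<Longrightarrow> x \<preceq> y \<Longrightarrow> len y < len (s \<cdot> y) \<Longrightarrow> s \<cdot> x \<preceq> s \<cdot> y"
    and mono_r: "s \<in> S \<Longrightarrow> x \<preceq> y \<Longrightarrow> len y < len (y \<cdot> s) \<Longrightarrow> x \<cdot> s \<preceq> y \<cdot> s"
begin

lemma dual: "cox C (\<lambda>x y. y \<cdot> x) e S len le"
proof (rule cox.intro, goal_cases)
  case (6 s) then show ?case by (rule S_C)
next
  case (8 x) then show ?case using inverse by fastforce
next
  case (12 x) then show ?case by (rule ex_r)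
next
  case (13 x) then show ?case by (rule ex_l)
qed (fact len_e len_l len_r le_C1 le_C2 le_refl le_trans le_len le_up_l le_up_r lift_l lift_r mono_l mono_r
    | simp add: assoc)+

definition DL :: "'a \<Rightarrow> 'a set" where "DL x = {s\<in>S. len (s \<cdot> x) < len x}"
definition DR :: "'a \<Rightarrow> 'a set" where "DR x = {s\<in>S. len (x \<cdot> s) < len x}"
text \<open>Defined by the order, so that monotonicity is immediate; by \<open>supp_adds\<close> it
  is the set of letters of any reduced word of \<open>x\<close>.\<close>

definition supp :: "'a \<Rightarrow> 'a set" where "supp x = {s\<in>S. s \<preceq> x}"
text \<open>Length additivity takes the place of reduced words: the arguments below factor elements
  and seldom choose a word.\<close>

definition adds :: "'a \<Rightarrow> 'a \<Rightarrow> bool" where "adds x y \<longleftrightarrow> len (x \<cdot> y) = len x + len y"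
definition cov :: "'a \<Rightarrow> 'a \<Rightarrow> bool" where "cov x y \<longleftrightarrow> x \<preceq> y \<and> len y = Suc (len x)"

end

section \<open>Descents, lifting and reduced products\<close>

context cox begin

text \<open>In the mirrored locale these constants are instances at the reversed multiplication.
  Rewriting with \<open>dual_defs\<close> turns them back, so that a mirror image costs a single
  instantiation.\<close>

lemma dual_DL: "cox.DL (\<lambda>x y. mul y x) S len = DR"
  by (rule ext) (simp add: cox.DL_def[OF dual] DR_def)

lemma dual_DR: "cox.DR (\<lambda>x y. mul y x) S len = DL"
  by (rule ext) (simp add: cox.DR_def[OF dual] DL_def)

lemma dual_adds: "cox.adds (\<lambda>x y. mul y x) len x y = adds y x"
  by (simp add: cox.adds_def[OF dual] adds_def add.commute)

lemmas dual_defs = dual_DL dual_DR dual_adds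

lemma DL_S: "s \<in> DL x \<Longrightarrow> s \<in> S" by (simp add: DL_def)
lemmas DR_S = cox.DL_S[OF dual, unfolded dual_defs]

lemma DL_len: "s \<in> DL x \<Longrightarrow> x \<in> C \<Longrightarrow> len x = Suc (len (s \<cdot> x))"
  using len_l[of s x] by (auto simp: DL_def)
lemmas DR_len = cox.DL_len[OF dual, unfolded dual_defs]

lemma nDL_len: "s \<in> S \<Longrightarrow> s \<notin> DL x \<Longrightarrow> x \<in> C \<Longrightarrow> len (s \<cdot> x) = Suc (len x)"
  using len_l[of s x] by (auto simp: DL_def)
lemmas nDR_len = cox.nDL_len[OF dual, unfolded dual_defs]

lemma cancel_l[simp]: "s \<in> S \<Longrightarrow> x \<in> C \<Longrightarrow> s \<cdot> (s \<cdot> x) = x"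
  by (simp add: assoc[symmetric])
lemmas cancel_r[simp] = cox.cancel_l[OF dual]

lemma DL_mul[simp]: "s \<in> S \<Longrightarrow> x \<in> C \<Longrightarrow> s \<in> DL (s \<cdot> x) \<longleftrightarrow> s \<notin> DL x"
  using len_l[of s x] by (auto simp: DL_def)
lemmas DR_mul[simp] = cox.DL_mul[OF dual, unfolded dual_defs]

lemma len_e0[simp]: "len e = 0" using len_e[of e] by simp

lemma DL_e[simp]: "DL e = {}" by (simp add: DL_def)
lemmas DR_e[simp] = cox.DL_e[OF dual, unfolded dual_defs]

lemma len_S[simp]: "s \<in> S \<Longrightarrow> len s = 1"
  using len_l[of s e] by simp

lemma e_notin_S[simp]: "e \<notin> S" using len_S[of e] by auto

lemma ex_DL: "x \<in> C \<Longrightarrow> x \<noteq> e \<Longrightarrow> \<exists>s. s \<in> DL x"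
  using ex_l[of x] by (auto simp: DL_def)
lemmas ex_DR = cox.ex_DL[OF dual, unfolded dual_defs]

lemma up_l: "s \<in> S \<Longrightarrow> s \<notin> DL x \<Longrightarrow> x \<in> C \<Longrightarrow> x \<preceq> s \<cdot> x"
  using le_up_l[of s x] nDL_len[of s x] by simp
lemmas up_r = cox.up_l[OF dual, unfolded dual_defs]

lemma down_l: "s \<in> DL x \<Longrightarrow> x \<in> C \<Longrightarrow> s \<cdot> x \<preceq> x"
  using le_up_l[of s "s \<cdot> x"] DL_S[of s x] DL_len[of s x] by simp
lemmas down_r = cox.down_l[OF dual, unfolded dual_defs]

lemma len_induct[consumes 1, case_names less]:
  assumes "x \<in> C" and "\<And>x. x \<in> C \<Longrightarrow> (\<And>y. y \<in> C \<Longrightarrow> len y < len x \<Longrightarrow> P y) \<Longrightarrow> P x"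
  shows "P x"
  using assms(1) by (induction "len x" arbitrary: x rule: less_induct) (use assms(2) in blast)

lemma e_le[simp]: "x \<in> C \<Longrightarrow> e \<preceq> x"
proof (induction x rule: len_induct)
  case (less x)
  show ?case
  proof (cases "x = e")
    case False
    then obtain s where s: "s \<in> DL x" using ex_DL less by blast
    with less DL_len[OF s] DL_S[OF s] have "e \<preceq> s \<cdot> x" by simp
    with le_trans[OF this down_l[OF s]] less show ?thesis by simp
  qed (use less in simp)
qed

lemma le_eq: "x \<preceq> y \<Longrightarrow> len y \<le> len x \<Longrightarrow> x = y" using le_len[of x y] by auto
lemma le_antisym: "x \<preceq> y \<Longrightarrow> y \<preceq> x \<Longrightarrow> x = y" using le_len[of x y] le_len[of y x] by auto
lemma le_len_le: "x \<preceq> y \<Longrightarrow> len x \<le> len y" using le_len[of x y] by auto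
lemma le_e: "x \<preceq> e \<Longrightarrow> x = e" using le_antisym[of x e] e_le[of x] le_C1[of x e] by simp

lemma liftL1: "x \<preceq> y \<Longrightarrow> s \<in> DL y \<Longrightarrow> s \<notin> DL x \<Longrightarrow> x \<preceq> s \<cdot> y"
  using lift_l[of s x y] nDL_len[of s x] le_C1[of x y] by (auto simp: DL_def)
lemmas liftR1 = cox.liftL1[OF dual, unfolded dual_defs]

lemma liftL4: "x \<preceq> y \<Longrightarrow> s \<in> S \<Longrightarrow> s \<notin> DL y \<Longrightarrow> s \<cdot> x \<preceq> s \<cdot> y"
  using mono_l[of s x y] nDL_len[of s y] le_C2[of x y] by auto
lemmas liftR4 = cox.liftL4[OF dual, unfolded dual_defs]

lemma liftL2: "x \<preceq> y \<Longrightarrow> s \<in> DL y \<Longrightarrow> s \<cdot> x \<preceq> y"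
proof -
  assume a: "x \<preceq> y" "s \<in> DL y"
  note [simp] = DL_S[OF a(2)] le_C1[OF a(1)] le_C2[OF a(1)]
  show ?thesis
  proof (cases "s \<in> DL x")
    case True
    then show ?thesis using le_trans[OF down_l[of s x] a(1)] by simp
  next
    case False
    then show ?thesis using liftL4[OF liftL1[OF a False], of s] a by simp
  qed
qed
lemmas liftR2 = cox.liftL2[OF dual, unfolded dual_defs]

lemma liftL3: "x \<preceq> y \<Longrightarrow> s \<in> DL y \<Longrightarrow> s \<in> DL x \<Longrightarrow> s \<cdot> x \<preceq> s \<cdot> y"
  using liftL1[of "s \<cdot> x" y s] liftL2[of x y s] DL_S[of s x] le_C1[of x y] by simp
lemmas liftR3 = cox.liftL3[OF dual, unfolded dual_defs]

lemma len_mul_le: "x \<in> C \<Longrightarrow> y \<in> C \<Longrightarrow> len (x \<cdot> y) \<le> len x + len y"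
proof (induction x rule: len_induct)
  case (less x)
  show ?case
  proof (cases "x = e")
    case False
    then obtain s where s: "s \<in> DL x" using ex_DL less by blast
    then have [simp]: "s \<in> S" by (rule DL_S)
    have "x \<cdot> y = s \<cdot> ((s \<cdot> x) \<cdot> y)" using less by (simp add: assoc)
    moreover have "len ((s \<cdot> x) \<cdot> y) \<le> len (s \<cdot> x) + len y"
      using less DL_len[OF s] by simp
    ultimately show ?thesis using len_l[of s "(s \<cdot> x) \<cdot> y"] less.hyps less.prems DL_len[OF s] by auto
  qed (use less in simp)
qed

lemma addsD: "adds x y \<Longrightarrow> len (x \<cdot> y) = len x + len y" by (simp add: adds_def)

lemma adds_e[simp]: "x \<in> C \<Longrightarrow> adds x e" "x \<in> C \<Longrightarrow> adds e x" by (simp_all add: adds_def)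

lemma adds_assoc1: "x \<in> C \<Longrightarrow> y \<in> C \<Longrightarrow> z \<in> C \<Longrightarrow> adds x y \<Longrightarrow> adds (x \<cdot> y) z \<Longrightarrow> adds y z \<and> adds x (y \<cdot> z)"
  using len_mul_le[of y z] len_mul_le[of x "y \<cdot> z"] by (simp add: adds_def assoc)

lemma adds_assoc2: "x \<in> C \<Longrightarrow> y \<in> C \<Longrightarrow> z \<in> C \<Longrightarrow> adds y z \<Longrightarrow> adds x (y \<cdot> z) \<Longrightarrow> adds x y \<and> adds (x \<cdot> y) z"
  using len_mul_le[of x y] len_mul_le[of "x \<cdot> y" z] by (simp add: adds_def assoc)

lemma adds_DL: "s \<in> S \<Longrightarrow> x \<in> C \<Longrightarrow> adds s x \<longleftrightarrow> s \<notin> DL x"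
  using len_l[of s x] by (auto simp: DL_def adds_def)
lemmas adds_DR = cox.adds_DL[OF dual, unfolded dual_defs]

lemma DL_adds: assumes "adds x y" "x \<in> C" "y \<in> C" "s \<in> DL x" shows "s \<in> DL (x \<cdot> y)"
proof -
  have s: "s \<in> S" by (rule DL_S[OF assms(4)])
  have "len ((s \<cdot> x) \<cdot> y) \<le> len (s \<cdot> x) + len y" using assms s by (intro len_mul_le) auto
  then show ?thesis using DL_len[OF assms(4,2)] assms(1-3) s by (simp add: DL_def adds_def assoc)
qed
lemmas DR_adds = cox.DL_adds[OF dual, unfolded dual_defs]

lemma factor_l: "s \<in> DL x \<Longrightarrow> x \<in> C \<Longrightarrow> \<exists>y\<in>C. x = s \<cdot> y \<and> s \<notin> DL y \<and> len x = Suc (len y)"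
  by (rule bexI[of _ "s \<cdot> x"]) (auto simp: DL_S DL_len)
lemmas factor_r = cox.factor_l[OF dual, unfolded dual_defs]

text \<open>Peel the last letter \<open>q\<close> off \<open>b\<close>. Lifting removes it from
  \<open>x2\<close> too if \<open>x2\<close> ends in it, and otherwise places \<open>x2\<close>
  below the shortened factor.\<close>

lemma mul_mono: "x1 \<preceq> a \<Longrightarrow> x2 \<preceq> b \<Longrightarrow> adds a b \<Longrightarrow> x1 \<cdot> x2 \<preceq> a \<cdot> b"
proof -
  assume "x2 \<preceq> b"
  then have "b \<in> C" by (rule le_C2)
  then show "x1 \<preceq> a \<Longrightarrow> x2 \<preceq> b \<Longrightarrow> adds a b \<Longrightarrow> x1 \<cdot> x2 \<preceq> a \<cdot> b"
  proof (induction b arbitrary: x2 rule: len_induct)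
    case (less b)
    note [simp] = le_C1[OF less.prems(1)] le_C2[OF less.prems(1)] le_C1[OF less.prems(2)] less.hyps
    show ?case
    proof (cases "b = e")
      case True
      then show ?thesis using less.prems le_e[of x2] by (auto simp: le_C1)
    next
      case False
      then obtain q where "q \<in> DR b" using ex_DR[of b] less.hyps by blast
      then obtain b0 where b0: "b0 \<in> C" "b = b0 \<cdot> q" "q \<notin> DR b0" "len b = Suc (len b0)" and q: "q \<in> DR b" "q \<in> S"
        using factor_r[of q b] DR_S by auto
      have ad: "adds a b0" "adds (a \<cdot> b0) q"
        using adds_assoc2[of a b0 q] less.prems(3) b0 q adds_DR[of q b0] by auto
      then have nd: "q \<notin> DR (a \<cdot> b0)" using adds_DR[of q "a \<cdot> b0"] b0 q by simp
      have ab: "a \<cdot> b = (a \<cdot> b0) \<cdot> q" using b0 q by (simp add: assoc)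
      have up: "a \<cdot> b0 \<preceq> a \<cdot> b" using up_r[OF q(2) nd] b0 ab by simp
      show ?thesis
      proof (cases "q \<in> DR x2")
        case True
        have "x2 \<cdot> q \<preceq> b0" using liftR3[OF less.prems(2) q(1) True] b0 q by simp
        from less.IH[OF b0(1) _ less.prems(1) this ad(1)] b0
        have "x1 \<cdot> (x2 \<cdot> q) \<preceq> a \<cdot> b0" by simp
        from liftR4[OF this q(2) nd] show ?thesis using ab q by (simp add: assoc)
      next
        case False
        have "x2 \<preceq> b0" using liftR1[OF less.prems(2) q(1) False] b0 q by simp
        from less.IH[OF b0(1) _ less.prems(1) this ad(1)] b0 le_trans[OF _ up] show ?thesis by simp
      qed
    qed
  qed
qed

text \<open>The subword property without words: when the last letter \<open>q\<close> is peeled off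
  \<open>b\<close>, the condition \<open>q \<in> DR u\<close> tells whether \<open>u\<close> uses
  it. The splitting of \<open>u\<close> is again reduced, which later length counts exploit.\<close>

lemma subword: "u \<preceq> a \<cdot> b \<Longrightarrow> a \<in> C \<Longrightarrow> b \<in> C \<Longrightarrow> adds a b \<Longrightarrow>
  \<exists>x1 x2. u = x1 \<cdot> x2 \<and> adds x1 x2 \<and> x1 \<preceq> a \<and> x2 \<preceq> b"
proof -
  assume "b \<in> C"
  then show "u \<preceq> a \<cdot> b \<Longrightarrow> a \<in> C \<Longrightarrow> b \<in> C \<Longrightarrow> adds a b \<Longrightarrow> ?thesis"
  proof (induction b arbitrary: u rule: len_induct)
    case (less b)
    note [simp] = le_C1[OF less.prems(1)] less.hyps less.prems(2)
    show ?case
    proof (cases "b = e")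
      case True
      then show ?thesis using less.prems by (intro exI[of _ u] exI[of _ e]) simp
    next
      case False
      then obtain q where "q \<in> DR b" using ex_DR[of b] less.hyps by blast
      then obtain b0 where b0: "b0 \<in> C" "b = b0 \<cdot> q" "q \<notin> DR b0" "len b = Suc (len b0)" and q: "q \<in> DR b" "q \<in> S"
        using factor_r[of q b] DR_S by auto
      have ad: "adds a b0" "adds (a \<cdot> b0) q"
        using adds_assoc2[of a b0 q] less.prems(4) b0 q adds_DR[of q b0] by auto
      then have nd: "q \<notin> DR (a \<cdot> b0)" using adds_DR[of q "a \<cdot> b0"] b0 q by simp
      have ab: "a \<cdot> b = (a \<cdot> b0) \<cdot> q" using b0 q by (simp add: assoc)
      have qd: "q \<in> DR (a \<cdot> b)" using nd ab b0 q by simp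
      have up: "b0 \<preceq> b" using up_r[OF q(2) b0(3)] b0 by simp
      show ?thesis
      proof (cases "q \<in> DR u")
        case True
        have "u \<cdot> q \<preceq> a \<cdot> b0" using liftR3[OF less.prems(1) qd True] ab b0 q by simp
        from less.IH[OF b0(1) _ this] b0 ad obtain x1 x2 where x: "u \<cdot> q = x1 \<cdot> x2" "adds x1 x2" "x1 \<preceq> a" "x2 \<preceq> b0"
          by auto
        have xc[simp]: "x1 \<in> C" "x2 \<in> C" using x by (auto dest: le_C1)
        have u: "u = x1 \<cdot> (x2 \<cdot> q)"
          using x(1) q cancel_r[of q u] by (simp add: assoc[symmetric])
        have "len u = Suc (len x1 + len x2)" using DR_len[OF True] x by (simp add: adds_def)
        then have "adds x1 (x2 \<cdot> q)" using u len_mul_le[of x1 "x2 \<cdot> q"] len_mul_le[of x2 q] q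
          by (simp add: adds_def)
        moreover have "x2 \<cdot> q \<preceq> b" using liftR4[OF x(4) q(2) b0(3)] b0 by simp
        ultimately show ?thesis using u x(3) by (metis (no_types))
      next
        case False
        have "u \<preceq> a \<cdot> b0" using liftR1[OF less.prems(1) qd False] ab b0 q by simp
        from less.IH[OF b0(1) _ this] b0 ad obtain x1 x2 where x: "u = x1 \<cdot> x2" "adds x1 x2" "x1 \<preceq> a" "x2 \<preceq> b0"
          by auto
        show ?thesis using x(1-3) le_trans[OF x(4) up] by (intro exI conjI)
      qed
    qed
  qed
qed

end

section \<open>Supports, parabolic factorizations and dihedral subgroups\<close>

context cox begin

lemma DL_supp: "s \<in> DL x \<Longrightarrow> x \<in> C \<Longrightarrow> s \<in> supp x"
  using liftL4[of e "s \<cdot> x" s] DL_S[of s x] by (auto simp: supp_def)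
lemmas DR_supp = cox.DL_supp[OF dual, unfolded dual_defs]

lemma supp_S: "s \<in> supp x \<Longrightarrow> s \<in> S" by (simp add: supp_def)

lemma supp_mono: "x \<preceq> y \<Longrightarrow> supp x \<subseteq> supp y"
  using le_trans by (auto simp: supp_def)

lemma supp_e[simp]: "supp e = {}"
  by (auto simp: supp_def) (metis le_e e_notin_S)

lemma supp_gen[simp]: "s \<in> S \<Longrightarrow> supp s = {s}"
  using le_len[of _ s] len_e by (fastforce simp: supp_def)

lemma le_adds_l: "adds a b \<Longrightarrow> a \<in> C \<Longrightarrow> b \<in> C \<Longrightarrow> a \<preceq> a \<cdot> b"
  using mul_mono[of a a e b] by simp
lemmas le_adds_r = cox.le_adds_l[OF dual, unfolded dual_defs]

lemma supp_adds: assumes "adds a b" "a \<in> C" "b \<in> C" shows "supp (a \<cdot> b) = supp a \<union> supp b"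
proof
  show "supp (a \<cdot> b) \<subseteq> supp a \<union> supp b"
  proof
    fix s assume s: "s \<in> supp (a \<cdot> b)"
    then have [simp]: "s \<in> S" by (rule supp_S)
    from s obtain x1 x2 where x: "s = x1 \<cdot> x2" "adds x1 x2" "x1 \<preceq> a" "x2 \<preceq> b"
      using subword[of s a b] assms by (auto simp: supp_def)
    have c: "x1 \<in> C" "x2 \<in> C" using x(3,4) by (auto dest: le_C1)
    have "len x1 + len x2 = 1" using x(1) addsD[OF x(2)] len_S[OF \<open>s \<in> S\<close>] by metis
    then have "len x1 = 0 \<or> len x2 = 0" by linarith
    then have "x1 = e \<or> x2 = e" using c len_e by simp
    then show "s \<in> supp a \<union> supp b" using x c \<open>s \<in> S\<close> by (auto simp: supp_def)
  qed
  show "supp a \<union> supp b \<subseteq> supp (a \<cdot> b)"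
    using supp_mono[OF le_adds_l[OF assms]] supp_mono[OF le_adds_r[OF assms(1,3,2)]] by simp
qed

lemma supp_up_l: "s \<in> S \<Longrightarrow> s \<notin> DL x \<Longrightarrow> x \<in> C \<Longrightarrow> supp (s \<cdot> x) = insert s (supp x)"
  using supp_adds[of s x] adds_DL[of s x] by simp
lemmas supp_up_r = cox.supp_up_l[OF dual, unfolded dual_defs]

lemma supp_mul_S: "s \<in> S \<Longrightarrow> x \<in> C \<Longrightarrow> supp (x \<cdot> s) \<subseteq> insert s (supp x)"
  using supp_up_r[of s x] supp_mono[OF down_r[of s x]] by (cases "s \<in> DR x") auto

lemma supp_mul: assumes "x \<in> C" "y \<in> C" shows "supp (x \<cdot> y) \<subseteq> supp x \<union> supp y"
  using assms(2)
proof (induction y rule: len_induct)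
  case (less y)
  show ?case
  proof (cases "y = e")
    case False
    then obtain q where q: "q \<in> DR y" using ex_DR less.hyps by blast
    then obtain y0 where y0: "y0 \<in> C" "y = y0 \<cdot> q" "q \<notin> DR y0" "len y = Suc (len y0)" and qS: "q \<in> S"
      using factor_r[of q y] DR_S less.hyps by blast
    have "supp (x \<cdot> y0) \<subseteq> supp x \<union> supp y0" using less.IH[OF y0(1)] y0(4) by simp
    moreover have "supp ((x \<cdot> y0) \<cdot> q) \<subseteq> insert q (supp (x \<cdot> y0))"
      using supp_mul_S[OF qS] assms(1) y0 by simp
    moreover have "supp y = insert q (supp y0)" using supp_up_r[OF qS y0(3,1)] y0 by simp
    ultimately show ?thesis using y0 qS assms(1) by (auto simp: assoc)
  qed (use assms(1) in simp)
qed

lemma cancel: "a \<in> C \<Longrightarrow> u \<in> C \<Longrightarrow> v \<in> C \<Longrightarrow> a \<cdot> u = a \<cdot> v \<Longrightarrow> u = v"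
proof -
  assume a: "a \<in> C" "u \<in> C" "v \<in> C" "a \<cdot> u = a \<cdot> v"
  obtain b where b: "b \<in> C" "b \<cdot> a = e" using inverse[OF a(1)] by blast
  have "b \<cdot> (a \<cdot> u) = b \<cdot> (a \<cdot> v)" using a(4) by (rule arg_cong)
  then show "u = v" using a b by (metis assoc e_l)
qed
lemmas cancel' = cox.cancel[OF dual]

text \<open>The letters of \<open>z\<close> are stripped from the right. None of them is a right
  descent of \<open>a\<close>, so lifting keeps \<open>a\<close> below what remains. This is the
  main cancellation rule of the development.\<close>

lemma min_le: assumes "a \<preceq> v \<cdot> z" "v \<in> C" "z \<in> C" "supp z \<subseteq> I" "DR a \<inter> I = {}" shows "a \<preceq> v"
  using assms(3,1,4)
proof (induction z rule: len_induct)
  case (less z)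
  show ?case
  proof (cases "z = e")
    case False
    then obtain q where q: "q \<in> DR z" using ex_DR less.hyps by blast
    then obtain z0 where z0: "z0 \<in> C" "z = z0 \<cdot> q" "q \<notin> DR z0" "len z = Suc (len z0)" and qS: "q \<in> S"
      using factor_r[of q z] DR_S less.hyps by blast
    have sz: "supp z = insert q (supp z0)" using supp_up_r[OF qS z0(3,1)] z0 by simp
    then have qa: "q \<notin> DR a" using less.prems assms(5) by auto
    have vz: "v \<cdot> z = (v \<cdot> z0) \<cdot> q" using z0 qS assms(2) by (simp add: assoc)
    have "a \<preceq> v \<cdot> z0"
    proof (cases "q \<in> DR (v \<cdot> z)")
      case True
      then show ?thesis using liftR1[OF less.prems(1) True qa] vz z0 qS assms(2) by simp
    next
      case False
      then have "q \<in> DR (v \<cdot> z0)" using vz z0 qS assms(2) by simp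
      then have "v \<cdot> z \<preceq> v \<cdot> z0" using down_r[of q "v \<cdot> z0"] vz z0 assms(2) by simp
      then show ?thesis using le_trans[OF less.prems(1)] by simp
    qed
    then show ?thesis using less.IH[OF z0(1)] z0 less.prems sz by simp
  qed (use less assms(2) in simp)
qed
lemmas min_le_l = cox.min_le[OF dual, unfolded dual_defs]

text \<open>Otherwise some letter \<open>q\<close> shortens \<open>a y0\<close>, and the shortened
  element splits along \<open>a\<close> and \<open>y0\<close> as \<open>x1 x2\<close> with exactly
  one letter lost. A loss in \<open>y0\<close> contradicts the length of \<open>y0 q\<close>; a loss
  in \<open>a\<close> gives \<open>a y0 = x1 (y0 q)\<close>, hence \<open>a \<le> x1\<close> by
  \<open>min_le\<close>.\<close>

lemma adds_min: assumes "a \<in> C" "y \<in> C" "supp y \<subseteq> I" "DR a \<inter> I = {}" shows "adds a y"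
  using assms(2,3)
proof (induction y rule: len_induct)
  case (less y)
  show ?case
  proof (cases "y = e")
    case False
    then obtain q where q: "q \<in> DR y" using ex_DR less.hyps by blast
    then obtain y0 where y0: "y0 \<in> C" "y = y0 \<cdot> q" "q \<notin> DR y0" "len y = Suc (len y0)" and qS: "q \<in> S"
      using factor_r[of q y] DR_S less.hyps by blast
    have sy: "supp y = insert q (supp y0)" using supp_up_r[OF qS y0(3,1)] y0 by simp
    have ad: "adds a y0" using less.IH[OF y0(1)] y0 less.prems sy by simp
    have "q \<notin> DR (a \<cdot> y0)"
    proof
      assume qd: "q \<in> DR (a \<cdot> y0)"
      then have "a \<cdot> y0 \<cdot> q \<preceq> a \<cdot> y0" using down_r y0 assms(1) by simp
      then obtain x1 x2 where x: "a \<cdot> y0 \<cdot> q = x1 \<cdot> x2" "adds x1 x2" "x1 \<preceq> a" "x2 \<preceq> y0"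
        using subword[of _ a y0] ad y0 assms(1) by blast
      have c[simp]: "x1 \<in> C" "x2 \<in> C" using x(3,4) by (auto dest: le_C1)
      have "len (a \<cdot> y0) = Suc (len (a \<cdot> y0 \<cdot> q))" using DR_len[OF qd] y0 assms(1) by simp
      then have l: "len a + len y0 = Suc (len x1 + len x2)" using x ad by (simp add: adds_def)
      have lx: "len x1 \<le> len a" "len x2 \<le> len y0" using x le_len_le by auto
      show False
      proof (cases "x1 = a")
        case True
        then have "a \<cdot> (y0 \<cdot> q) = a \<cdot> x2" using x y0 qS assms(1) by (simp add: assoc)
        then have "y = x2" using cancel[of a "y0 \<cdot> q" x2] assms(1) y0 qS by simp
        then show False using lx y0 by simp
      next
        case False
        then have "len x1 < len a" using le_len[OF x(3)] by simp
        then have "x2 = y0" using l lx le_eq[OF x(4)] by simp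
        then have "a \<cdot> y0 = x1 \<cdot> (y0 \<cdot> q)" using x(1) cancel_r[of q "a \<cdot> y0"] y0 qS assms(1)
          by (simp add: assoc[symmetric])
        moreover have "a \<preceq> a \<cdot> y0" using le_adds_l ad y0 assms by simp
        ultimately have "a \<preceq> x1" using min_le[of a x1 "y0 \<cdot> q" I] y0 less.prems assms less.hyps by simp
        then show False using \<open>len x1 < len a\<close> le_len_le by fastforce
      qed
    qed
    then have "adds (a \<cdot> y0) q" using adds_DR[of q "a \<cdot> y0"] qS y0 assms(1) by simp
    then show ?thesis using adds_assoc1[of a y0 q] ad y0 qS assms(1) by simp
  qed (use assms(1) in simp)
qed
lemmas adds_min_l = cox.adds_min[OF dual, unfolded dual_defs]

lemma parab: assumes "x \<in> C"
  shows "\<exists>a\<in>C. \<exists>y\<in>C. x = a \<cdot> y \<and> adds a y \<and> supp y \<subseteq> I \<and> DR a \<inter> I = {}"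
  using assms
proof (induction x rule: len_induct)
  case (less x)
  show ?case
  proof (cases "DR x \<inter> I = {}")
    case True
    then show ?thesis using less.hyps by (intro bexI[of _ x] bexI[of _ e]) auto
  next
    case False
    then obtain q where q: "q \<in> DR x" "q \<in> I" by auto
    then obtain x0 where x0: "x0 \<in> C" "x = x0 \<cdot> q" "q \<notin> DR x0" "len x = Suc (len x0)" and qS: "q \<in> S"
      using factor_r[of q x] DR_S less.hyps by blast
    from less.IH[OF x0(1)] x0 obtain a y where ay: "a \<in> C" "y \<in> C" "x0 = a \<cdot> y" "adds a y" "supp y \<subseteq> I" "DR a \<inter> I = {}"
      by auto
    have "supp (y \<cdot> q) \<subseteq> I" using supp_mul_S[OF qS ay(2)] ay(5) q(2) by auto
    moreover have "x = a \<cdot> (y \<cdot> q)" using x0 ay qS by (simp add: assoc)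
    moreover have "adds a (y \<cdot> q)" using adds_min[of a "y \<cdot> q" I] ay qS calculation by simp
    ultimately show ?thesis using ay(1,2,6) qS by (intro bexI[of _ a] bexI[of _ "y \<cdot> q"]) auto
  qed
qed
lemmas parab_l = cox.parab[OF dual, unfolded dual_defs]

lemma DR_parab: assumes "a \<in> C" "y \<in> C" "supp y \<subseteq> I" "DR a \<inter> I = {}" "q \<in> I"
  shows "q \<in> DR (a \<cdot> y) \<longleftrightarrow> q \<in> DR y"
proof
  assume q: "q \<in> DR (a \<cdot> y)"
  then have qS: "q \<in> S" by (rule DR_S)
  show "q \<in> DR y"
  proof (rule ccontr)
    assume n: "q \<notin> DR y"
    have "supp (y \<cdot> q) \<subseteq> I" using supp_mul_S[OF qS assms(2)] assms by auto
    then have "adds a (y \<cdot> q)" using adds_min[of a "y \<cdot> q" I] assms qS by simp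
    moreover have "adds a y" using adds_min assms by blast
    ultimately show False using nDR_len[OF qS n assms(2)] DR_len[OF q] assms qS by (simp add: adds_def assoc)
  qed
qed (use DR_adds[OF adds_min[OF assms(1-4)]] assms in simp)
lemmas DL_parab = cox.DR_parab[OF dual, unfolded dual_defs]

lemma parab_unique: assumes "a \<in> C" "y \<in> C" "supp y \<subseteq> I" "DR a \<inter> I = {}" "a' \<in> C" "y' \<in> C" "supp y' \<subseteq> I" "DR a' \<inter> I = {}"
  "a \<cdot> y = a' \<cdot> y'" shows "a = a' \<and> y = y'"
proof -
  have "a \<preceq> a' \<cdot> y'" using le_adds_l[OF adds_min[OF assms(1-4)] assms(1,2)] assms by simp
  then have 1: "a \<preceq> a'" using min_le assms by blast
  have "a' \<preceq> a \<cdot> y" using le_adds_l[OF adds_min[OF assms(5-8)] assms(5,6)] assms by simp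
  then have "a' \<preceq> a" using min_le assms by blast
  with 1 have "a = a'" by (rule le_antisym)
  then show ?thesis using cancel[of a y y'] assms by simp
qed
lemma DL_pair: "x \<in> C \<Longrightarrow> supp x \<subseteq> I \<Longrightarrow> DL x \<subseteq> I" using DL_supp by blast
lemmas DR_pair = cox.DL_pair[OF dual, unfolded dual_defs]

lemma supp_down_l: "s \<in> DL x \<Longrightarrow> x \<in> C \<Longrightarrow> supp (s \<cdot> x) \<subseteq> supp x" by (intro supp_mono down_l)
lemmas supp_down_r = cox.supp_down_l[OF dual, unfolded dual_defs]

text \<open>A reduced word in two letters alternates, so its first letter and its length determine
  it.\<close>

lemma dih_eq: assumes "x \<in> C" "y \<in> C" "supp x \<subseteq> {s,t}" "supp y \<subseteq> {s,t}" "len x = len y" "f \<in> DL x" "f \<in> DL y"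
  shows "x = y"
  using assms
proof (induction x arbitrary: y f rule: len_induct)
  case (less x)
  let ?x = "f \<cdot> x" and ?y = "f \<cdot> y"
  have fS: "f \<in> S" using less.prems DL_S by blast
  have c: "?x \<in> C" "?y \<in> C" using less fS by auto
  have l: "len x = Suc (len ?x)" "len y = Suc (len ?y)" using DL_len less by auto
  have sx: "supp ?x \<subseteq> {s,t}" "supp ?y \<subseteq> {s,t}"
    using supp_down_l[of f x] supp_down_l[of f y] less.prems less.hyps by auto
  have fd: "f \<notin> DL ?x" "f \<notin> DL ?y" using less fS by auto
  have "?x = ?y"
  proof (cases "?x = e")
    case True
    then show ?thesis using l less.prems len_e[of ?y] c by simp
  next
    case False
    then have "len ?y \<noteq> 0" using l less.prems(4) len_e[of ?x] c by simp
    then have "?y \<noteq> e" using len_e0 by metis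
    then obtain g h where gh: "g \<in> DL ?x" "h \<in> DL ?y" using ex_DL[OF c(1) False] ex_DL[OF c(2)] by blast
    have "g \<in> {s,t}" "h \<in> {s,t}" "f \<in> {s,t}" "g \<noteq> f" "h \<noteq> f"
      using DL_pair[OF c(1) sx(1)] DL_pair[OF c(2) sx(2)] DL_pair[of x "{s,t}"] gh less fd by auto
    then have "g = h" by auto
    then show ?thesis using less.IH[OF c(1) _ c(2) sx _ gh(1)] l less.prems(4) gh by simp
  qed
  then have "f \<cdot> ?x = f \<cdot> ?y" by simp
  then show ?case using less fS by simp
qed
lemmas dih_eq_r = cox.dih_eq[OF dual, unfolded dual_defs]

text \<open>A common first letter is removed. If the first letters differ and the lengths differ by
  one, alternation makes \<open>x\<close> equal to \<open>y\<close> without its first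
  letter.\<close>

lemma dih_le: assumes "x \<in> C" "y \<in> C" "supp x \<subseteq> {s,t}" "supp y \<subseteq> {s,t}" "len x < len y"
  shows "x \<preceq> y"
  using assms(2,1,3-)
proof (induction y arbitrary: x rule: len_induct)
  case (less y)
  have "y \<noteq> e" using less.prems by auto
  then obtain f where f: "f \<in> DL y" using ex_DL less.hyps by blast
  then have fS: "f \<in> S" by (rule DL_S)
  let ?y = "f \<cdot> y"
  have c: "?y \<in> C" and l: "len y = Suc (len ?y)" and sy: "supp ?y \<subseteq> {s,t}" and fy: "f \<notin> DL ?y"
    using DL_len[OF f less.hyps] supp_down_l[OF f less.hyps] less.prems less.hyps fS f by auto
  have yy: "?y \<preceq> y" using down_l f less by simp
  show ?case
  proof (cases "len x < len ?y")
    case True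
    then show ?thesis using less.IH[OF c _ less.prems(1,2) sy] l le_trans[OF _ yy] by simp
  next
    case F: False
    then have lx: "len x = len ?y" using l less.prems by simp
    show ?thesis
    proof (cases "f \<in> DL x")
      case True
      have "f \<cdot> x \<preceq> ?y" using less.IH[OF c, of "f \<cdot> x"] l lx DL_len[OF True less.prems(1)] sy fS less.prems
          supp_down_l[OF True less.prems(1)] by auto
      from liftL4[OF this fS fy] show ?thesis using fS less by simp
    next
      case False
      have "x = ?y"
      proof (cases "x = e")
        case True
        then show ?thesis using lx len_e[OF c] by simp
      next
        case xe: False
        then have "?y \<noteq> e" using lx len_e[OF less.prems(1)] len_e[OF c] by simp
        then obtain g h where gh: "g \<in> DL x" "h \<in> DL ?y" using ex_DL[OF less.prems(1) xe] ex_DL[OF c] by blast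
        have "g \<in> {s,t}" "h \<in> {s,t}" "f \<in> {s,t}" "g \<noteq> f" "h \<noteq> f"
          using DL_pair[OF c sy] DL_pair[OF less.prems(1,2)] DL_pair[OF less.hyps less.prems(3)] gh fy False f by auto
        then have "g = h" by auto
        then show ?thesis using dih_eq[OF less.prems(1) c less.prems(2) sy lx gh(1)] gh by simp
      qed
      then show ?thesis using yy by simp
    qed
  qed
qed

text \<open>An element of the same length as \<open>x\<close> shares its first letter with
  \<open>x\<close>, so it equals \<open>x\<close>, and no letter lengthens \<open>x\<close> on the
  left.\<close>

lemma dih_longest: assumes "x \<in> C" "y \<in> C" "supp x \<subseteq> {s,t}" "supp y \<subseteq> {s,t}" "s \<in> DL x" "t \<in> DL x"
  shows "len y \<le> len x"
  using assms(2,4)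
proof (induction y rule: len_induct)
  case (less y)
  show ?case
  proof (cases "y = e")
    case False
    then obtain f where f: "f \<in> DL y" using ex_DL less.hyps by blast
    then have fS: "f \<in> S" by (rule DL_S)
    let ?y = "f \<cdot> y"
    have c: "?y \<in> C" and l: "len y = Suc (len ?y)" and sy: "supp ?y \<subseteq> {s,t}" and fy: "f \<notin> DL ?y"
      using DL_len[OF f less.hyps] supp_down_l[OF f less.hyps] less.prems less.hyps fS f by auto
    have le: "len ?y \<le> len x" using less.IH[OF c _ sy] l by simp
    have "len ?y \<noteq> len x"
    proof
      assume eq: "len ?y = len x"
      have "x \<noteq> e" using assms(5) by auto
      then have "?y \<noteq> e" using eq len_e[OF assms(1)] len_e[OF c] by simp
      then obtain g where g: "g \<in> DL ?y" using ex_DL[OF c] by blast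
      have "g \<in> {s,t}" "f \<in> {s,t}" using DL_pair[OF c sy] DL_pair[OF less.hyps less.prems] g f by auto
      then have "?y = x" using dih_eq[OF c assms(1) sy assms(3) eq g] assms by auto
      then show False using fy \<open>f \<in> {s,t}\<close> assms by auto
    qed
    then show ?thesis using le l by simp
  qed simp
qed
lemmas dih_longest_r = cox.dih_longest[OF dual, unfolded dual_defs]

text \<open>The left factor of \<open>x\<close> in the subgroup of \<open>f\<close> and
  \<open>h\<close> has both as left descents. As they do not commute, it has at least three letters,
  so another \<open>f\<close> is left when the first one is removed.\<close>

lemma two_desc: assumes "x \<in> C" "f \<in> DL x" "h \<in> DL x" "f \<noteq> h" "f \<cdot> h \<noteq> h \<cdot> f" shows "f \<in> supp (f \<cdot> x)"
proof -
  note S = DL_S[OF assms(2)] DL_S[OF assms(3)]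
  obtain z y where zy: "z \<in> C" "y \<in> C" "x = y \<cdot> z" "adds y z" "supp y \<subseteq> {f,h}" "DL z \<inter> {f,h} = {}"
    using parab_l[OF assms(1), of "{f,h}"] by auto
  have fy: "f \<in> DL y" and hy: "h \<in> DL y" using DL_parab[OF zy(1,2,5,6)] zy(3) assms by auto
  define y1 where "y1 = f \<cdot> y"
  have y1: "y1 \<in> C" "f \<notin> DL y1" "y = f \<cdot> y1" "supp y1 \<subseteq> {f,h}"
    using fy S zy supp_down_l[of f y] by (auto simp: y1_def)
  have "y1 \<noteq> e"
  proof
    assume "y1 = e"
    then have "h \<in> supp f" using y1 S DL_supp[OF hy zy(2)] by simp
    then show False using S assms by simp
  qed
  then obtain g where g: "g \<in> DL y1" using ex_DL y1 by blast
  then have "g \<in> {f,h}" using DL_pair[OF y1(1,4)] by auto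
  then have hy1: "h \<in> DL y1" using g y1 by auto
  define y2 where "y2 = h \<cdot> y1"
  have y2: "y2 \<in> C" "h \<notin> DL y2" "y1 = h \<cdot> y2" "supp y2 \<subseteq> {f,h}"
    using hy1 S y1 supp_down_l[of h y1] by (auto simp: y2_def)
  have "y2 \<noteq> e"
  proof
    assume "y2 = e"
    then have y: "y = f \<cdot> h" using y1 y2 S by simp
    have d: "h \<notin> DL f" "f \<notin> DL h" using DL_supp[of h f] DL_supp[of f h] S assms by auto
    have "f \<cdot> h = h \<cdot> f" using dih_eq[of "f \<cdot> h" "h \<cdot> f" f h h] nDL_len[OF S(2) d(1)] nDL_len[OF S(1) d(2)]
      S hy y d supp_up_l[OF S(1) d(2)] supp_up_l[OF S(2) d(1)] by auto
    then show False using assms by simp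
  qed
  then obtain g where g: "g \<in> DL y2" using ex_DL y2 by blast
  then have "g \<in> {f,h}" using DL_pair[OF y2(1,4)] by auto
  then have "f \<in> supp y2" using g y2 DL_supp by auto
  then have "f \<in> supp y1" using supp_up_l[OF S(2) y2(2,1)] y2 by simp
  moreover have "f \<cdot> x = y1 \<cdot> z" using zy S by (simp add: assoc y1_def)
  moreover have "adds y1 z" using adds_assoc1[of f y1 z] adds_DL[of f y1] y1 zy S by simp
  ultimately show ?thesis using supp_adds[of y1 z] y1 zy by simp
qed
lemma not_supp_DL: "x \<in> C \<Longrightarrow> c \<notin> supp x \<Longrightarrow> c \<notin> DL x" using DL_supp by blast
lemmas not_supp_DR = cox.not_supp_DL[OF dual, unfolded dual_defs]

text \<open>If \<open>h\<close> did not commute with \<open>c\<close>, then \<open>two_desc\<close>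
  would find a second \<open>c\<close>, inside \<open>v\<close>.\<close>

lemma DL_new: assumes "v \<in> C" "c \<in> S" "c \<notin> supp v" "h \<in> DL (c \<cdot> v)" "h \<noteq> c"
  shows "h \<cdot> c = c \<cdot> h \<and> h \<in> DL v"
proof -
  have S: "h \<in> S" using DL_S assms by blast
  have cd: "c \<in> DL (c \<cdot> v)" using assms not_supp_DL[of v c] by simp
  have comm: "h \<cdot> c = c \<cdot> h"
  proof (rule ccontr)
    assume "h \<cdot> c \<noteq> c \<cdot> h"
    then have "c \<in> supp (c \<cdot> (c \<cdot> v))" using two_desc[OF _ cd assms(4)] assms by fastforce
    then show False using assms by simp
  qed
  have "c \<notin> supp (h \<cdot> v)" using supp_mul[of h v] assms S by auto
  then have l: "len (c \<cdot> (h \<cdot> v)) = Suc (len (h \<cdot> v))" "len (c \<cdot> v) = Suc (len v)"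
    using nDL_len[of c] not_supp_DL assms S by auto
  have "h \<cdot> (c \<cdot> v) = c \<cdot> (h \<cdot> v)" using comm assms S by (simp add: assoc[symmetric])
  then have "len (h \<cdot> v) < len v" using DL_len[OF assms(4)] l assms by simp
  then show ?thesis using comm S by (simp add: DL_def)
qed
lemmas DR_new = cox.DL_new[OF dual, unfolded dual_defs]

text \<open>A form of the exchange condition: lifting puts \<open>v\<close> below
  \<open>c v h\<close>, which has the same length.\<close>

lemma DR_new2: assumes "v \<in> C" "c \<in> S" "c \<notin> DL v" "h \<in> DR (c \<cdot> v)" "h \<notin> DR v" shows "c \<cdot> v = v \<cdot> h"
proof -
  have S: "h \<in> S" using DR_S assms by blast
  have "v \<preceq> c \<cdot> v" using up_l assms by simp
  from liftR1[OF this assms(4,5)] have "v \<preceq> c \<cdot> v \<cdot> h" .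
  moreover have "len v = len (c \<cdot> v \<cdot> h)" using nDL_len[OF assms(2,3,1)] DR_len[OF assms(4)] assms by simp
  ultimately have "v = c \<cdot> v \<cdot> h" using le_eq by simp
  then have "v \<cdot> h = c \<cdot> v \<cdot> h \<cdot> h" by simp
  then show ?thesis using S assms by simp
qed
lemmas DL_new2 = cox.DR_new2[OF dual, unfolded dual_defs]

text \<open>The first letter of \<open>v\<close> is a left descent of \<open>v c = c v\<close>, so
  it commutes with \<open>c\<close> by \<open>DL_new\<close> and can be cancelled.\<close>

lemma comm_supp: assumes "v \<in> C" "c \<in> S" "c \<notin> supp v" "c \<cdot> v = v \<cdot> c" "h \<in> supp v" shows "h \<cdot> c = c \<cdot> h"
  using assms(1,3-)
proof (induction v rule: len_induct)
  case (less v)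
  have "v \<noteq> e" using less.prems by auto
  then obtain g where g: "g \<in> DL v" using ex_DL less.hyps by blast
  then have gS: "g \<in> S" by (rule DL_S)
  define v1 where "v1 = g \<cdot> v"
  have v1: "v1 \<in> C" "g \<notin> DL v1" "v = g \<cdot> v1" "len v = Suc (len v1)" "supp v = insert g (supp v1)"
    using g gS less.hyps DL_len[OF g] supp_up_l[of g "g \<cdot> v"] by (auto simp: v1_def)
  have "adds v c" using adds_DR[OF assms(2) less.hyps] not_supp_DR less by simp
  then have "g \<in> DL (c \<cdot> v)" using DL_adds[of v c g] g less assms(2) by simp
  then have gc: "g \<cdot> c = c \<cdot> g" using DL_new[of v c g] less assms(2) v1 by blast
  have "g \<cdot> (c \<cdot> v1) = g \<cdot> (v1 \<cdot> c)"
    using less.prems(2) v1 gc gS assms(2) by (metis assoc S_C)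
  then have "c \<cdot> v1 = v1 \<cdot> c" using cancel[of g "c \<cdot> v1" "v1 \<cdot> c"] v1 gS assms(2) by simp
  then show ?case using less.IH[OF v1(1)] v1 less.prems gc by auto
qed

text \<open>Shorten \<open>a\<close> from the right until \<open>t\<close> becomes a right descent.
  The letter removed last does not commute with \<open>t\<close>, since otherwise \<open>t\<close>
  could be moved past it to the end.\<close>

lemma ex_next: assumes "a \<in> C" "t \<in> S" "t \<preceq> a" "t \<notin> DR a"
  shows "\<exists>f\<in>S. t \<cdot> f \<preceq> a \<and> t \<cdot> f \<noteq> f \<cdot> t"
  using assms(1,3,4)
proof (induction a rule: len_induct)
  case (less a)
  have "a \<noteq> e" using less.prems(1) le_e assms(2) e_notin_S by metis
  then obtain q where q: "q \<in> DR a" using ex_DR less.hyps by blast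
  then obtain a0 where a0: "a0 \<in> C" "a = a0 \<cdot> q" "q \<notin> DR a0" "len a = Suc (len a0)" and qS: "q \<in> S"
    using factor_r[of q a] DR_S less.hyps by blast
  have qt: "q \<noteq> t" using q less.prems by auto
  then have nd: "q \<notin> DR t" using DR_supp[of q t] assms(2) by auto
  have ta: "t \<preceq> a0" using liftR1[OF less.prems(1) q nd] a0 qS by simp
  have aa: "a0 \<preceq> a" using up_r[OF qS a0(3,1)] a0 by simp
  show ?case
  proof (cases "t \<in> DR a0")
    case False
    with less.IH[OF a0(1) _ ta] a0(4) obtain f where "f \<in> S" "t \<cdot> f \<preceq> a0" "t \<cdot> f \<noteq> f \<cdot> t" by auto
    then show ?thesis using le_trans[OF _ aa] by blast
  next
    case True
    then obtain a1 where a1: "a1 \<in> C" "a0 = a1 \<cdot> t" "len a0 = Suc (len a1)"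
      using factor_r[of t a0] a0 by blast
    have "t \<cdot> q \<noteq> q \<cdot> t"
    proof
      assume "t \<cdot> q = q \<cdot> t"
      then have "a \<cdot> t = a1 \<cdot> q" using a0 a1 assms(2) qS by (simp add: assoc)
      then have "len (a \<cdot> t) \<le> len a0" using len_mul_le[of a1 q] a1 qS by simp
      then show False using less.prems(2) a0(4) assms(2) by (simp add: DR_def)
    qed
    moreover have "t \<cdot> q \<preceq> a" using liftR4[OF ta qS a0(3)] a0 by simp
    ultimately show ?thesis using qS by blast
  qed
qed
lemmas ex_next_l = cox.ex_next[OF dual, unfolded dual_defs]

text \<open>The descents of \<open>u\<close> and \<open>v\<close> are disjoint: a common left
  descent \<open>a\<close> would make \<open>a u\<close> a coatom of \<open>v\<close>, and lifting
  would give \<open>u \<le> v\<close> at equal length. For \<open>a \<in> DL u\<close> and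
  \<open>b \<in> DL v\<close>, split off left factors in the subgroup of \<open>a\<close> and
  \<open>b\<close>. By \<open>min_le_l\<close> the remaining factors lie below each other, so they
  agree; a last letter of them would be a common right descent.\<close>

lemma coatoms: assumes "u \<in> C" "v \<in> C" "u \<noteq> v" "\<And>c. cov c u \<longleftrightarrow> cov c v"
  shows "\<exists>a\<in>S. \<exists>b\<in>S. supp u \<subseteq> {a,b} \<and> supp v \<subseteq> {a,b}"
proof -
  have covD: "\<And>x a. x \<in> C \<Longrightarrow> a \<in> DL x \<Longrightarrow> cov (a \<cdot> x) x" "\<And>x a. x \<in> C \<Longrightarrow> a \<in> DR x \<Longrightarrow> cov (x \<cdot> a) x"
    using down_l down_r DL_len DR_len by (auto simp: cov_def)
  have dis: "DL x \<inter> DL y = {}" "DR x \<inter> DR y = {}" if x: "x \<in> C" "y \<in> C" "x \<noteq> y" "\<And>c. cov c x \<longleftrightarrow> cov c y" for x y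
  proof -
    have False if a: "a \<in> DL x" "a \<in> DL y" for a
    proof -
      have aS: "a \<in> S" using a DL_S by blast
      have c: "cov (a \<cdot> x) y" using covD(1)[OF x(1) a(1)] x by simp
      then have "a \<cdot> (a \<cdot> x) \<preceq> y" using liftL2[OF _ a(2)] by (simp add: cov_def)
      then have "x \<preceq> y" using x aS by simp
      moreover have "len x = len y" using c DL_len[OF a(1) x(1)] by (simp add: cov_def)
      ultimately show False using le_eq x by simp
    qed
    moreover have False if a: "a \<in> DR x" "a \<in> DR y" for a
    proof -
      have aS: "a \<in> S" using a DR_S by blast
      have c: "cov (x \<cdot> a) y" using covD(2)[OF x(1) a(1)] x by simp
      then have "(x \<cdot> a) \<cdot> a \<preceq> y" using liftR2[OF _ a(2)] by (simp add: cov_def)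
      then have "x \<preceq> y" using x aS by simp
      moreover have "len x = len y" using c DR_len[OF a(1) x(1)] by (simp add: cov_def)
      ultimately show False using le_eq x by simp
    qed
    ultimately show "DL x \<inter> DL y = {}" "DR x \<inter> DR y = {}" by auto
  qed
  have ne: "u \<noteq> e"
  proof
    assume "u = e"
    then have "v \<noteq> e" using assms by simp
    then obtain a where "a \<in> DL v" using ex_DL assms by blast
    then have "cov (a \<cdot> v) u" using covD assms by simp
    then show False using \<open>u = e\<close> by (simp add: cov_def)
  qed
  then obtain a where a: "a \<in> DL u" using ex_DL assms by blast
  have "cov (a \<cdot> u) v" using covD(1)[OF assms(1) a] assms(4) by blast
  then have ne': "v \<noteq> e" by (auto simp: cov_def)
  then obtain b where b: "b \<in> DL v" using ex_DL assms by blast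
  note S = DL_S[OF a] DL_S[OF b]
  have dec: "\<exists>z\<in>C. \<exists>y\<in>C. x = y \<cdot> z \<and> adds y z \<and> supp y \<subseteq> {a,b} \<and> DL z \<inter> {a,b} = {}" if "x \<in> C" for x
    using parab_l[OF that, of "{a,b}"] .
  obtain z y where zy: "z \<in> C" "y \<in> C" "u = y \<cdot> z" "adds y z" "supp y \<subseteq> {a,b}" "DL z \<inter> {a,b} = {}"
    using dec[OF assms(1)] by blast
  obtain z' y' where zy': "z' \<in> C" "y' \<in> C" "v = y' \<cdot> z'" "adds y' z'" "supp y' \<subseteq> {a,b}" "DL z' \<inter> {a,b} = {}"
    using dec[OF assms(2)] by blast
  have sub: "z1 \<preceq> z2" if "z1 \<in> C" "y1 \<in> C" "u1 = y1 \<cdot> z1" "adds y1 z1" "supp y1 \<subseteq> {a,b}" "DL z1 \<inter> {a,b} = {}"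
    "z2 \<in> C" "y2 \<in> C" "u2 = y2 \<cdot> z2" "supp y2 \<subseteq> {a,b}" "r \<in> DL u1" "r \<in> {a,b}" "cov (r \<cdot> u1) u2" for z1 y1 u1 z2 y2 u2 r
  proof -
    have rS: "r \<in> S" using DL_S that by blast
    have "supp (r \<cdot> y1) \<subseteq> {a,b}" using supp_mul[of r y1] that rS by auto
    then have ad: "adds (r \<cdot> y1) z1" using adds_min_l[of z1 "r \<cdot> y1" "{a,b}"] that rS by simp
    have "z1 \<preceq> r \<cdot> u1" using le_adds_r[OF ad] that rS by (simp add: assoc)
    also have "r \<cdot> u1 \<preceq> y2 \<cdot> z2" using that by (simp add: cov_def)
    finally show ?thesis using min_le_l[of z1 y2 z2 "{a,b}"] that by auto
  qed
  have "z \<preceq> z'" by (rule sub[of z y u z' y' v a]) (use zy zy' a covD(1)[OF assms(1) a] assms(4) in auto)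
  moreover have "z' \<preceq> z" by (rule sub[of z' y' v z y u b]) (use zy zy' b covD(1)[OF assms(2) b] assms(4) in auto)
  ultimately have zz: "z = z'" by (rule le_antisym)
  have "z = e"
  proof (rule ccontr)
    assume "z \<noteq> e"
    then obtain c where "c \<in> DR z" using ex_DR zy by blast
    then have "c \<in> DR u" "c \<in> DR v" using DR_adds[OF _ _ _ \<open>c \<in> DR z\<close>] zy zy' zz by auto
    then show False using dis(2)[OF assms] by auto
  qed
  then show ?thesis using zy zy' zz S by auto
qed

text \<open>If a letter \<open>h\<close> prepended to \<open>y0\<close> became a descent after the
  insertion, lifting and length would give \<open>h y0 x = y0 c x\<close>, where only the right side
  contains \<open>c\<close>.\<close>

lemma insert_len: assumes "y \<in> C" "x \<in> C" "adds y x" "c \<in> S" "c \<notin> supp y" "c \<notin> supp x"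
  shows "len (y \<cdot> (c \<cdot> x)) = Suc (len (y \<cdot> x)) \<and> y \<cdot> x \<preceq> y \<cdot> (c \<cdot> x) \<and> c \<preceq> y \<cdot> (c \<cdot> x)"
  using assms(1,3,5)
proof (induction y rule: len_induct)
  case (less y)
  have cx: "c \<notin> DL x" using not_supp_DL assms by blast
  show ?case
  proof (cases "y = e")
    case True
    then show ?thesis using nDL_len[OF assms(4) cx assms(2)] up_l[OF assms(4) cx assms(2)]
        liftL4[of e x c] cx assms by simp
  next
    case False
    then obtain h where h: "h \<in> DL y" using ex_DL less.hyps by blast
    then obtain y0 where y0: "y0 \<in> C" "y = h \<cdot> y0" "h \<notin> DL y0" "len y = Suc (len y0)" and hS: "h \<in> S"
      using factor_l[of h y] DL_S less.hyps by blast
    have ad: "adds y0 x" "adds h (y0 \<cdot> x)" using adds_assoc1[of h y0 x] adds_DL[of h y0] y0 hS assms less.prems by auto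
    have sy: "supp y = insert h (supp y0)" using supp_up_l y0 hS by simp
    have hn: "h \<notin> DL (y0 \<cdot> x)" using ad(2) adds_DL[of h "y0 \<cdot> x"] y0 hS assms by simp
    let ?e = "y0 \<cdot> (c \<cdot> x)"
    have eC[simp]: "?e \<in> C" using y0 assms by simp
    have IH: "len ?e = Suc (len (y0 \<cdot> x))" "y0 \<cdot> x \<preceq> ?e" "c \<preceq> ?e" using less.IH[OF y0(1) _ ad(1)] y0(4) sy less.prems by auto
    have "h \<notin> DL ?e"
    proof
      assume hd: "h \<in> DL ?e"
      have "h \<cdot> (y0 \<cdot> x) \<preceq> ?e" using liftL2[OF IH(2) hd] .
      moreover have "len (h \<cdot> (y0 \<cdot> x)) = len ?e" using nDL_len[OF hS hn] IH y0 assms by simp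
      ultimately have "h \<cdot> (y0 \<cdot> x) = ?e" using le_eq by simp
      then have "c \<in> supp (y \<cdot> x)" using IH(3) assms y0 hS by (simp add: supp_def assoc)
      then show False using supp_adds[of y x] less assms by simp
    qed
    then have "len (h \<cdot> ?e) = Suc (len ?e)" "h \<cdot> (y0 \<cdot> x) \<preceq> h \<cdot> ?e" "?e \<preceq> h \<cdot> ?e"
      using nDL_len[OF hS _ eC] liftL4[OF IH(2) hS] up_l[OF hS _ eC] by auto
    then show ?thesis using y0 hS assms IH nDL_len[OF hS hn] le_trans[OF IH(3)] by (simp add: assoc)
  qed
qed

text \<open>Last letters of \<open>w\<close> other than \<open>t\<close> and \<open>t'\<close> are
  removed without losing \<open>u\<close> or \<open>u'\<close>. As soon as the last letter is
  \<open>t'\<close>, say, \<open>u\<close> lies below the rest and \<open>t'\<close> can be appended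
  to it.\<close>

lemma two_ends: assumes "w \<in> C" "DR u = {t}" "DR u' = {t'}" "u \<preceq> w" "u' \<preceq> w" "t \<noteq> t'"
  shows "u \<cdot> t' \<preceq> w \<or> u' \<cdot> t \<preceq> w"
  using assms(1,4,5)
proof (induction w rule: len_induct)
  case (less w)
  have "w \<noteq> e" using less.prems(1) le_e assms(2) DR_e by fastforce
  then obtain f where f: "f \<in> DR w" using ex_DR less.hyps by blast
  then obtain w0 where w0: "w0 \<in> C" "w = w0 \<cdot> f" "f \<notin> DR w0" "len w = Suc (len w0)" and fS: "f \<in> S"
    using factor_r[of f w] DR_S less.hyps by blast
  have ww: "w0 \<preceq> w" using up_r w0 fS by simp
  have l: "v \<preceq> w0" if "v \<preceq> w" "f \<notin> DR v" for v using liftR1[OF that(1) f that(2)] w0 fS by simp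
  consider "f = t" | "f = t'" | "f \<noteq> t" "f \<noteq> t'" by auto
  then show ?case
  proof cases
    case 1
    then show ?thesis using liftR4[OF l[OF less.prems(2)] fS w0(3)] assms w0 by auto
  next
    case 2
    then show ?thesis using liftR4[OF l[OF less.prems(1)] fS w0(3)] assms w0 by auto
  next
    case 3
    then have "u \<cdot> t' \<preceq> w0 \<or> u' \<cdot> t \<preceq> w0" using less.IH[OF w0(1)] l less.prems assms w0 by auto
    then show ?thesis using le_trans[OF _ ww] by blast
  qed
qed

end

section \<open>Coatoms and special matchings\<close>

context cox begin

text \<open>Gradedness comes out of lifting: a cover of \<open>s x\<close> below \<open>s y\<close>
  is multiplied back by \<open>s\<close>, unless it is \<open>x\<close> itself.\<close>

lemma ex_cov: assumes "x \<preceq> y" "x \<noteq> y" shows "\<exists>z. cov x z \<and> z \<preceq> y"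
proof -
  have "y \<in> C" using assms by (rule_tac le_C2)
  then show ?thesis using assms
  proof (induction y arbitrary: x rule: len_induct)
    case (less y)
    have "y \<noteq> e" using less.prems le_e by blast
    then obtain s where s: "s \<in> DL y" using ex_DL[OF less.hyps] by blast
    note sS = DL_S[OF s] and xC = le_C1[OF less.prems(1)]
    have yl: "len y = Suc (len (s \<cdot> y))" "s \<cdot> y \<preceq> y" "s \<cdot> y \<in> C" "s \<notin> DL (s \<cdot> y)"
      using DL_len[OF s] down_l[OF s] less.hyps sS s by auto
    have IH: "\<exists>z. cov x' z \<and> z \<preceq> s \<cdot> y" if "x' \<preceq> s \<cdot> y" "x' \<noteq> s \<cdot> y" for x'
      using less.IH[OF yl(3) _ that] yl(1) by simp
    have via: ?case if "x \<preceq> s \<cdot> y"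
    proof (cases "x = s \<cdot> y")
      case True
      then show ?thesis using yl less.hyps by (intro exI[of _ y]) (auto simp: cov_def)
    next
      case False
      then show ?thesis using IH[OF that] le_trans[OF _ yl(2)] by blast
    qed
    show ?case
    proof (cases "s \<in> DL x")
      case False
      show ?thesis by (rule via) (rule liftL1[OF less.prems(1) s False])
    next
      case True
      have le: "s \<cdot> x \<preceq> s \<cdot> y" using liftL3[OF less.prems(1) s True] .
      have "s \<cdot> x \<noteq> s \<cdot> y" using cancel[OF S_C[OF sS] xC less.hyps] less.prems(2) by blast
      with IH[OF le] obtain z where z: "cov (s \<cdot> x) z" "z \<preceq> s \<cdot> y" by blast
      have xl: "len x = Suc (len (s \<cdot> x))" using DL_len[OF True xC] .
      have zC: "z \<in> C" using z(2) by (rule le_C1)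
      show ?thesis
      proof (cases "z = x")
        case True
        then show ?thesis using via z by simp
      next
        case zx: False
        have nz: "s \<notin> DL z"
        proof
          assume "s \<in> DL z"
          then have "s \<cdot> (s \<cdot> x) \<preceq> z" using liftL2[of "s \<cdot> x" z s] z(1) by (simp add: cov_def)
          then have "x \<preceq> z" using sS xC by simp
          then show False using le_eq[of x z] z(1) xl zx by (simp add: cov_def)
        qed
        have "s \<cdot> (s \<cdot> x) \<preceq> s \<cdot> z" using liftL4[of "s \<cdot> x" z s] z(1) sS nz by (simp add: cov_def)
        then have "cov x (s \<cdot> z)" using sS xC xl nDL_len[OF sS nz zC] z(1) by (simp add: cov_def)
        moreover have "s \<cdot> z \<preceq> y" using liftL4[OF z(2) sS yl(4)] sS less.hyps by simp
        ultimately show ?thesis by blast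
      qed
    qed
  qed
qed

lemma len1: "x \<in> C \<Longrightarrow> len x = 1 \<Longrightarrow> x \<in> S"
proof -
  assume x: "x \<in> C" "len x = 1"
  then have "x \<noteq> e" by auto
  then obtain f where f: "f \<in> DL x" using ex_DL[OF x(1)] by blast
  then have "len (f \<cdot> x) = 0" using DL_len[OF f x(1)] x by simp
  then have "f \<cdot> x = e" using len_e[of "f \<cdot> x"] x DL_S[OF f] by simp
  then have "f \<cdot> (f \<cdot> x) = f" using DL_S[OF f] by simp
  then show "x \<in> S" using x DL_S[OF f] by simp
qed

lemma covD: "cov x y \<Longrightarrow> x \<preceq> y" "cov x y \<Longrightarrow> len y = Suc (len x)" by (auto simp: cov_def)

text \<open>The counterpart of \<open>cov_M\<close>: multiplications and special matchings produce
  the coatoms of a raised element by the same rule, which is what allows \<open>coatoms\<close> to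
  identify them.\<close>

lemma cov_mul_r: assumes "x \<in> C" "q \<in> S" "q \<notin> DR x"
  shows "cov c (x \<cdot> q) \<longleftrightarrow> c = x \<or> (\<exists>y. cov y x \<and> q \<notin> DR y \<and> c = y \<cdot> q)"
proof
  have qd: "q \<in> DR (x \<cdot> q)" using assms by simp
  have lx: "len (x \<cdot> q) = Suc (len x)" using nDR_len[OF assms(2,3,1)] .
  assume c: "cov c (x \<cdot> q)"
  have cC: "c \<in> C" using covD(1)[OF c] by (rule le_C1)
  show "c = x \<or> (\<exists>y. cov y x \<and> q \<notin> DR y \<and> c = y \<cdot> q)"
  proof (cases "q \<in> DR c")
    case True
    have "c \<cdot> q \<preceq> x" using liftR3[OF covD(1)[OF c] qd True] assms by simp
    then have "cov (c \<cdot> q) x" using DR_len[OF True cC] covD(2)[OF c] lx by (simp add: cov_def)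
    moreover have "q \<notin> DR (c \<cdot> q)" "c = (c \<cdot> q) \<cdot> q" using True assms(2) cC by simp_all
    ultimately show ?thesis by blast
  next
    case False
    have "c \<preceq> x" using liftR1[OF covD(1)[OF c] qd False] assms by simp
    then show ?thesis using le_eq[of c x] covD(2)[OF c] lx by simp
  qed
next
  assume "c = x \<or> (\<exists>y. cov y x \<and> q \<notin> DR y \<and> c = y \<cdot> q)"
  then show "cov c (x \<cdot> q)"
  proof
    assume "c = x"
    then show ?thesis using up_r[OF assms(2,3,1)] nDR_len[OF assms(2,3,1)] by (simp add: cov_def)
  next
    assume "\<exists>y. cov y x \<and> q \<notin> DR y \<and> c = y \<cdot> q"
    then obtain y where y: "cov y x" "q \<notin> DR y" "c = y \<cdot> q" by blast
    have yC: "y \<in> C" using covD(1)[OF y(1)] by (rule le_C1)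
    show ?thesis using liftR4[OF covD(1)[OF y(1)] assms(2,3)] nDR_len[OF assms(2,3,1)] nDR_len[OF assms(2) y(2) yC]
      covD(2)[OF y(1)] y(3) by (simp add: cov_def)
  qed
qed

definition special :: "('a \<Rightarrow> 'a) \<Rightarrow> 'a \<Rightarrow> bool" where
  "special M w \<longleftrightarrow> w \<in> C \<and> (\<forall>x. x \<preceq> w \<longrightarrow> M x \<preceq> w \<and> M (M x) = x \<and> (cov x (M x) \<or> cov (M x) x)) \<and>
     (\<forall>x y. cov x y \<longrightarrow> y \<preceq> w \<longrightarrow> M x \<noteq> y \<longrightarrow> M x \<preceq> M y)"

end

subsection \<open>Special matchings\<close>

locale spm = cox C mul e S len le
  for C :: "'a set" and mul :: "'a \<Rightarrow> 'a \<Rightarrow> 'a" (infixl "\<cdot>" 70) and e :: 'a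
    and S :: "'a set" and len :: "'a \<Rightarrow> nat" and le :: "'a \<Rightarrow> 'a \<Rightarrow> bool" (infix "\<preceq>" 50) +
  fixes M :: "'a \<Rightarrow> 'a" and w :: 'a
  assumes special: "special M w"
begin

lemma dualM: "spm C (\<lambda>x y. y \<cdot> x) e S len le M w"
  using dual special by (simp add: spm_def spm_axioms_def cox.special_def[OF dual] special_def)

abbreviation s where "s \<equiv> M e"
definition up :: "'a \<Rightarrow> bool" where "up x \<longleftrightarrow> len x < len (M x)"

lemma wC[simp]: "w \<in> C" using special by (simp add: special_def)
lemma M_le: "x \<preceq> w \<Longrightarrow> M x \<preceq> w" using special by (simp add: special_def)
lemma MM: "x \<preceq> w \<Longrightarrow> M (M x) = x" using special by (simp add: special_def)
lemma M_inj: "x \<preceq> w \<Longrightarrow> y \<preceq> w \<Longrightarrow> M x = M y \<Longrightarrow> x = y" using MM by metis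
lemma up_neq: "x \<preceq> w \<Longrightarrow> up x \<Longrightarrow> up y \<Longrightarrow> M x \<noteq> y"
  using MM[of x] by (auto simp: up_def)
lemma M_cov: "x \<preceq> w \<Longrightarrow> cov x (M x) \<or> cov (M x) x" using special by (simp add: special_def)
lemma M_sp: "cov x y \<Longrightarrow> y \<preceq> w \<Longrightarrow> M x \<noteq> y \<Longrightarrow> M x \<preceq> M y" using special by (simp add: special_def)
lemma M_C: "x \<preceq> w \<Longrightarrow> M x \<in> C" using M_le le_C1 by blast

lemma up_cov: "x \<preceq> w \<Longrightarrow> up x \<Longrightarrow> cov x (M x)" using M_cov[of x] by (auto simp: up_def cov_def)
lemma dn_cov: "x \<preceq> w \<Longrightarrow> \<not> up x \<Longrightarrow> cov (M x) x" using M_cov[of x] by (auto simp: up_def cov_def)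
lemmas up_len = covD(2)[OF up_cov] and up_leM = covD(1)[OF up_cov]
lemmas dn_len = covD(2)[OF dn_cov] and dn_leM = covD(1)[OF dn_cov]

lemma up_M: "x \<preceq> w \<Longrightarrow> up (M x) \<longleftrightarrow> \<not> up x"
proof -
  assume x: "x \<preceq> w"
  show ?thesis unfolding up_def MM[OF x] using M_cov[OF x] by (auto dest: covD(2))
qed

lemma up_e[simp]: "up e"
proof -
  have "e \<preceq> w" by simp
  show ?thesis using dn_len[OF \<open>e \<preceq> w\<close>] by (cases "up e") auto
qed

lemma s_S[simp]: "s \<in> S"
  using up_len[OF e_le[OF wC] up_e] len1[of s] M_C[OF e_le[OF wC]] by simp

lemma s_w: "s \<preceq> w" using M_le e_le by simp

text \<open>The lifting property with \<open>M\<close> in the place of a generator. Climb from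
  \<open>x\<close> to \<open>y\<close> through a cover \<open>z\<close> of \<open>x\<close>: either
  \<open>M\<close> exchanges \<open>x\<close> and \<open>z\<close>, or it preserves their
  order.\<close>

lemma Mlift: assumes "x \<preceq> y" "y \<preceq> w" "\<not> up y"
  shows "(up x \<longrightarrow> M x \<preceq> y \<and> x \<preceq> M y) \<and> (\<not> up x \<longrightarrow> M x \<preceq> M y)"
  using assms(1)
proof (induction "len y - len x" arbitrary: x rule: less_induct)
  case less
  note xw = le_trans[OF less.prems assms(2)] and MyC = M_C[OF assms(2)]
  show ?case
  proof (cases "x = y")
    case True
    then show ?thesis using assms MyC by simp
  next
    case False
    obtain z where z: "cov x z" "z \<preceq> y" using ex_cov[OF less.prems False] by blast
    have zw: "z \<preceq> w" using le_trans[OF z(2) assms(2)] .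
    have l: "len y - len z < len y - len x" using covD(2)[OF z(1)] le_len_le[OF z(2)] by simp
    note IH = less.hyps[OF l z(2)]
    show ?thesis
    proof (cases "M x = z")
      case True
      then have "M z = x" using MM[OF xw] by simp
      then have u: "up x" "\<not> up z" using True covD(2)[OF z(1)] by (auto simp: up_def)
      then show ?thesis using IH True z(2) \<open>M z = x\<close> by simp
    next
      case nz: False
      have sp: "M x \<preceq> M z" using M_sp[OF z(1) zw nz] .
      have ne: "M x \<noteq> M z" using M_inj[OF xw zw] covD(2)[OF z(1)] by fastforce
      then have ll: "len (M x) < len (M z)" using le_len[OF sp] by blast
      show ?thesis
      proof (cases "up x")
        case True
        then have uz: "up z" using ll up_len[OF xw True] covD(2)[OF z(1)] by (simp add: up_def)
        have "M x \<preceq> y" using le_trans[OF sp] IH uz by blast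
        moreover have "x \<preceq> M y" using le_trans[OF covD(1)[OF z(1)]] IH uz by blast
        ultimately show ?thesis using True by simp
      next
        case dx: False
        have "M x \<preceq> M y"
        proof (cases "up z")
          case True
          have "M x \<preceq> z" using le_trans[OF dn_leM[OF xw dx] covD(1)[OF z(1)]] .
          then show ?thesis using le_trans[of "M x" z "M y"] IH True by blast
        next
          case False
          then show ?thesis using le_trans[OF sp] IH by blast
        qed
        then show ?thesis using dx by simp
      qed
    qed
  qed
qed

lemma Mlift1: "x \<preceq> y \<Longrightarrow> y \<preceq> w \<Longrightarrow> \<not> up y \<Longrightarrow> up x \<Longrightarrow> M x \<preceq> y" using Mlift by blast
lemma Mlift2: "x \<preceq> y \<Longrightarrow> y \<preceq> w \<Longrightarrow> \<not> up y \<Longrightarrow> up x \<Longrightarrow> x \<preceq> M y" using Mlift by blast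
lemma Mlift3: "x \<preceq> y \<Longrightarrow> y \<preceq> w \<Longrightarrow> \<not> up y \<Longrightarrow> \<not> up x \<Longrightarrow> M x \<preceq> M y" using Mlift by blast
lemma Mmono: assumes "x \<preceq> y" "y \<preceq> w" "up x" "up y" shows "M x \<preceq> M y"
  using Mlift1[OF le_trans[OF assms(1) up_leM[OF assms(2,4)]] M_le[OF assms(2)]] up_M assms by simp
lemma Mdown_le: assumes "x \<preceq> y" "y \<preceq> w" "\<not> up y" shows "M x \<preceq> y"
  using Mlift1[OF assms] Mlift3[OF assms] le_trans[OF _ dn_leM[OF assms(2,3)]] by blast

lemma w_dn: "\<not> up w"
  using M_le[OF le_refl[OF wC]] le_len_le[of "M w" w] by (auto simp: up_def)

lemma sfree_up: "x \<preceq> w \<Longrightarrow> s \<notin> supp x \<Longrightarrow> up x"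
  using Mlift1[of e x] e_le[of x] le_C1[of x w] by (auto simp: supp_def)

lemma s_supp_M: assumes "x \<preceq> w" "up x" shows "s \<in> supp (M x)"
  using Mlift1[of e "M x"] M_le[OF assms(1)] up_M assms M_C[OF assms(1)] by (simp add: supp_def)

lemma up_gen: "c \<in> S \<Longrightarrow> c \<preceq> w \<Longrightarrow> c \<noteq> s \<Longrightarrow> up c"
proof (rule ccontr)
  assume c: "c \<in> S" "c \<preceq> w" "c \<noteq> s" "\<not> up c"
  then have "len (M c) = 0" using dn_len[of c] by simp
  then have "M c = e" using len_e M_C c by blast
  then show False using MM[OF c(2)] c by simp
qed

text \<open>A generator other than \<open>s\<close> is raised by \<open>M\<close>, so lifting brings
  it from \<open>M x\<close> down to \<open>x\<close>.\<close>

lemma supp_M: assumes "x \<preceq> w" shows "supp (M x) \<subseteq> insert s (supp x)"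
proof (cases "up x")
  case True
  show ?thesis
  proof
    fix c assume c: "c \<in> supp (M x)"
    have "c \<preceq> x" if "c \<noteq> s"
    proof -
      have c': "c \<in> S" "c \<preceq> M x" using c by (auto simp: supp_def)
      then have "up c" using up_gen that le_trans[OF _ M_le[OF assms]] by blast
      then show ?thesis using Mlift2[OF c'(2) M_le[OF assms]] up_M[OF assms] MM[OF assms] True by simp
    qed
    then show "c \<in> insert s (supp x)" using c by (auto simp: supp_def)
  qed
next
  case False
  then show ?thesis using supp_mono[OF dn_leM[OF assms]] by auto
qed

lemma supp_M': assumes "x \<preceq> w" shows "supp x \<subseteq> insert s (supp (M x))"
  using supp_M[OF M_le[OF assms]] MM[OF assms] by simp

lemma M_gen: assumes "c \<in> S" "c \<preceq> w" "c \<noteq> s" shows "M c = c \<cdot> s \<or> M c = s \<cdot> c"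
proof -
  note u = up_gen[OF assms]
  have len: "len (M c) = 2" using up_len[OF assms(2) u] assms by simp
  have MC: "M c \<in> C" using M_C assms by blast
  have sM: "s \<preceq> M c" using s_supp_M[OF assms(2) u] by (simp add: supp_def)
  have "M c \<noteq> e" using len len_e0 by (metis zero_neq_numeral)
  then obtain h where h: "h \<in> DL (M c)" using ex_DL[OF MC] by blast
  note hS = DL_S[OF h]
  define g where "g = h \<cdot> M c"
  have gC: "g \<in> C" and eq: "M c = h \<cdot> g" using hS MC by (simp_all add: g_def)
  have "len g = 1" using DL_len[OF h MC] len by (simp add: g_def)
  then have gS: "g \<in> S" using len1 gC by blast
  have "h \<notin> DL g" using h hS gC unfolding eq by simp
  then have "supp (M c) = {h, g}" using supp_up_l[OF hS _ gC] gS unfolding eq by simp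
  moreover have "c \<in> supp (M c)" "s \<in> supp (M c)" using up_leM[OF assms(2) u] assms s_supp_M[OF assms(2) u]
    by (auto simp: supp_def)
  ultimately have "(h = c \<and> g = s) \<or> (h = s \<and> g = c)" using assms(3) by auto
  then show ?thesis unfolding eq by blast
qed

lemma cov_M: assumes "x \<preceq> w" "up x"
  shows "cov c (M x) \<longleftrightarrow> c = x \<or> (\<exists>y. cov y x \<and> up y \<and> c = M y)"
proof
  note Mw = M_le[OF assms(1)]
  have dM: "\<not> up (M x)" using up_M assms by simp
  assume c: "cov c (M x)"
  have cw: "c \<preceq> w" using le_trans[OF covD(1)[OF c] Mw] .
  show "c = x \<or> (\<exists>y. cov y x \<and> up y \<and> c = M y)"
  proof (cases "up c")
    case True
    have "c \<preceq> x" using Mlift2[OF covD(1)[OF c] Mw dM True] MM[OF assms(1)] by simp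
    then show ?thesis using le_eq[of c x] covD(2)[OF c] up_len[OF assms] by simp
  next
    case False
    have "M c \<preceq> x" using Mlift3[OF covD(1)[OF c] Mw dM False] MM[OF assms(1)] by simp
    then have "cov (M c) x" using covD(2)[OF c] up_len[OF assms] dn_len[OF cw False] by (simp add: cov_def)
    moreover have "up (M c)" "c = M (M c)" using up_M[OF cw] False MM[OF cw] by auto
    ultimately show ?thesis by blast
  qed
next
  assume "c = x \<or> (\<exists>y. cov y x \<and> up y \<and> c = M y)"
  then show "cov c (M x)"
  proof
    assume "c = x"
    then show ?thesis using up_cov[OF assms] by simp
  next
    assume "\<exists>y. cov y x \<and> up y \<and> c = M y"
    then obtain y where y: "cov y x" "up y" "c = M y" by blast
    have yw: "y \<preceq> w" using le_trans[OF covD(1)[OF y(1)] assms(1)] .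
    show ?thesis using Mmono[OF covD(1)[OF y(1)] assms(1) y(2) assms(2)] up_len[OF assms] up_len[OF yw y(2)]
      covD(2)[OF y(1)] y(3) by (simp add: cov_def)
  qed
qed

text \<open>A special matching is determined by its restriction to the dihedral elements: two elements
  with the same coatoms are equal or lie in a common rank two parabolic subgroup.\<close>

lemma eq_mult_r: assumes a: "a \<preceq> w"
  and dih: "\<And>x c. x \<preceq> a \<Longrightarrow> c \<in> S \<Longrightarrow> supp x \<subseteq> {s, c} \<Longrightarrow> up x \<Longrightarrow> M x = x \<cdot> s"
  and x: "x \<preceq> a" shows "M x = x \<cdot> s"
proof -
  have "x \<in> C" using x by (rule le_C1)
  then show ?thesis using x
  proof (induction x rule: len_induct)
    case (less x)
    note xw = le_trans[OF less.prems a]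
    show ?case
    proof (cases "up x \<and> s \<notin> DR x")
      case True
      have IH: "M y = y \<cdot> s" if "cov y x" for y
        using less.IH[of y] le_trans[OF covD(1)[OF that] less.prems] covD(2)[OF that] le_C1[OF covD(1)[OF that]] by simp
      have ups: "up y \<longleftrightarrow> s \<notin> DR y" if "cov y x" for y
        using IH[OF that] nDR_len[OF s_S, of y] DR_len[of s y] le_C1[OF covD(1)[OF that]] by (auto simp: up_def)
      have "cov c (M x) \<longleftrightarrow> cov c (x \<cdot> s)" for c
        unfolding cov_M[OF xw conjunct1[OF True]] cov_mul_r[OF less.hyps s_S conjunct2[OF True]]
        using IH ups by auto
      then have "M x = x \<cdot> s \<or> (\<exists>a\<in>S. \<exists>b\<in>S. supp (M x) \<subseteq> {a,b} \<and> supp (x \<cdot> s) \<subseteq> {a,b})"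
        using coatoms[OF M_C[OF xw] mul_C[OF less.hyps S_C[OF s_S]]] by blast
      then show ?thesis
      proof
        assume "\<exists>a\<in>S. \<exists>b\<in>S. supp (M x) \<subseteq> {a,b} \<and> supp (x \<cdot> s) \<subseteq> {a,b}"
        then obtain a' b where ab: "a' \<in> S" "b \<in> S" "supp (x \<cdot> s) \<subseteq> {a',b}" by blast
        have sx: "supp (x \<cdot> s) = insert s (supp x)" using supp_up_r True less.hyps by simp
        then have "\<exists>c\<in>S. supp x \<subseteq> {s, c}" using ab by auto
        then show ?thesis using dih less.prems True by blast
      qed
    next
      case False
      show ?thesis
      proof (cases "up x")
        case True
        then have sx: "s \<in> DR x" using False by simp
        let ?y = "x \<cdot> s"
        have y: "?y \<in> C" "len ?y < len x" "?y \<preceq> a" using DR_len[OF sx less.hyps] less.hyps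
          le_trans[OF down_r[OF sx less.hyps] less.prems] by auto
        have "M ?y = x" using less.IH[OF y] less.hyps by simp
        then have "M x = ?y" using MM[OF le_trans[OF y(3) a]] by simp
        then show ?thesis .
      next
        case dn: False
        have y: "M x \<in> C" "len (M x) < len x" "M x \<preceq> a" using M_C[OF xw] dn_len[OF xw dn]
          le_trans[OF dn_leM[OF xw dn] less.prems] by auto
        have "x = M x \<cdot> s" using less.IH[OF y] MM[OF xw] by simp
        then have "x \<cdot> s = M x" using y(1) by (metis cancel_r s_S)
        then show ?thesis by simp
      qed
    qed
  qed
qed
lemmas eq_mult_l = spm.eq_mult_r[OF dualM]

text \<open>For \<open>x\<close> satisfying \<open>condR q x\<close> the matching should commute with the right multiplication by \<open>q\<close>;
  by coatoms, a minimal failure \<open>badR\<close> lies in a rank two parabolic subgroup containing \<open>s\<close>.\<close>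

definition condR :: "'a \<Rightarrow> 'a \<Rightarrow> bool" where
  "condR q x \<longleftrightarrow> x \<in> C \<and> up x \<and> q \<in> S \<and> q \<notin> DR x \<and> x \<cdot> q \<preceq> w \<and> M x \<noteq> x \<cdot> q"
definition condL :: "'a \<Rightarrow> 'a \<Rightarrow> bool" where
  "condL q x \<longleftrightarrow> x \<in> C \<and> up x \<and> q \<in> S \<and> q \<notin> DL x \<and> q \<cdot> x \<preceq> w \<and> M x \<noteq> q \<cdot> x"
definition badR :: "'a \<Rightarrow> 'a \<Rightarrow> bool" where
  "badR q y \<longleftrightarrow> condR q y \<and> M (y \<cdot> q) \<noteq> M y \<cdot> q \<and> (\<exists>c\<in>S. supp (M (y \<cdot> q)) \<subseteq> {q,c} \<and> s \<in> {q,c})"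
definition badL :: "'a \<Rightarrow> 'a \<Rightarrow> bool" where
  "badL q y \<longleftrightarrow> condL q y \<and> M (q \<cdot> y) \<noteq> q \<cdot> M y \<and> (\<exists>c\<in>S. supp (M (q \<cdot> y)) \<subseteq> {q,c} \<and> s \<in> {q,c})"

lemma dual_condR: "spm.condR C (\<lambda>x y. y \<cdot> x) S len le M w = condL"
  by (intro ext) (simp add: spm.condR_def[OF dualM] condL_def dual_defs spm.up_def[OF dualM] up_def)
lemma dual_condL: "spm.condL C (\<lambda>x y. y \<cdot> x) S len le M w = condR"
  by (intro ext) (simp add: spm.condL_def[OF dualM] condR_def dual_defs spm.up_def[OF dualM] up_def)
lemma dual_badR: "spm.badR C (\<lambda>x y. y \<cdot> x) e S len le M w = badL"
  by (intro ext) (simp add: spm.badR_def[OF dualM] badL_def dual_condR)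
lemma dual_badL: "spm.badL C (\<lambda>x y. y \<cdot> x) e S len le M w = badR"
  by (intro ext) (simp add: spm.badL_def[OF dualM] badR_def dual_condL)
lemmas dualM_defs = dual_defs dual_condR dual_condL dual_badR dual_badL

lemma condR_w: "condR q x \<Longrightarrow> x \<preceq> w"
  using le_trans[OF up_r[of q x]] by (auto simp: condR_def)

lemma condR_up: assumes "condR q x" shows "up (x \<cdot> q)" "q \<notin> DR (M x)" "M x \<preceq> M (x \<cdot> q)"
proof -
  note c = assms[unfolded condR_def]
  note xw = condR_w[OF assms]
  have xx: "cov x (x \<cdot> q)" using up_r[of q x] nDR_len[of q x] c by (auto simp: cov_def)
  show le: "M x \<preceq> M (x \<cdot> q)" using M_sp[OF xx] c by blast
  have "M x \<noteq> M (x \<cdot> q)" using M_inj[OF xw, of "x \<cdot> q"] c covD(2)[OF xx] by (metis n_not_Suc_n)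
  then have "len (M x) < len (M (x \<cdot> q))" using le_len[OF le] by simp
  then show "up (x \<cdot> q)" using up_len[OF xw] c covD(2)[OF xx] by (simp add: up_def)
  show "q \<notin> DR (M x)"
  proof
    assume "q \<in> DR (M x)"
    then have "x \<cdot> q \<preceq> M x" using liftR2[OF up_leM[OF xw]] c by blast
    then have "x \<cdot> q = M x" using le_eq[of "x \<cdot> q" "M x"] up_len[OF xw] c covD(2)[OF xx] by (metis order_refl)
    then show False using c by metis
  qed
qed

text \<open>Put \<open>y = z q\<close>. If \<open>M\<close> raises \<open>y\<close>, commutation at
  \<open>y\<close> gives \<open>M z = M y q\<close>. Suppose it lowers \<open>y\<close> to
  \<open>v\<close>. If \<open>q\<close> is a right descent of \<open>v\<close>, the claim for
  \<open>v\<close> makes it one of \<open>M v = y\<close>, which it is not; otherwise commutation at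
  \<open>v\<close> shows that \<open>M\<close> lowers \<open>z\<close>, although \<open>z\<close> is
  raised.\<close>

lemma comm_step: assumes IH: "\<And>y. y \<preceq> x \<Longrightarrow> y \<noteq> x \<Longrightarrow> condR q y \<Longrightarrow> M (y \<cdot> q) = M y \<cdot> q"
  and z: "z \<preceq> x" "x \<preceq> w" "up z" "q \<in> DR z" shows "q \<in> DR (M z)"
proof -
  have "z \<in> C" using z(1) by (rule le_C1)
  then show ?thesis using z(1,3,4)
  proof (induction z rule: len_induct)
    case (less z)
    have qS: "q \<in> S" using less.prems DR_S by blast
    have zw: "z \<preceq> w" using le_trans[OF less.prems(1) z(2)] .
    define y where "y = z \<cdot> q"
    have y: "y \<in> C" "z = y \<cdot> q" "q \<notin> DR y" "len z = Suc (len y)" "y \<preceq> z"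
      using less.prems(3) qS less.hyps DR_len[OF less.prems(3)] down_r[OF less.prems(3)] by (auto simp: y_def)
    have yx: "y \<preceq> x" "y \<noteq> x" using le_trans[OF y(5) less.prems(1)] le_len_le[OF less.prems(1)] y(4) by auto
    have yw: "y \<preceq> w" using le_trans[OF yx(1) z(2)] .
    show ?case
    proof (cases "up y")
      case True
      have "M y \<noteq> z" using up_neq[OF yw True less.prems(2)] .
      then have "condR q y" using True y qS zw by (simp add: condR_def)
      then have "M z = M y \<cdot> q" "q \<notin> DR (M y)" using IH[OF yx] condR_up(2) y by auto
      then show ?thesis using qS M_C[OF yw] by simp
    next
      case False
      define v where "v = M y"
      have v: "v \<preceq> w" "v \<in> C" "up v" "M v = y" "len y = Suc (len v)" "v \<preceq> y"
        using M_le[OF yw] M_C[OF yw] up_M[OF yw] False MM[OF yw] dn_len[OF yw False] dn_leM[OF yw False] by (auto simp: v_def)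
      have vx: "v \<preceq> x" "v \<noteq> x" using le_trans[OF v(6) yx(1)] le_len_le[OF yx(1)] v(5) by auto
      show ?thesis
      proof (cases "q \<in> DR v")
        case True
        then show ?thesis using less.IH[OF v(2) _ vx(1) v(3)] v(4,5) y(3,4) by simp
      next
        case nv: False
        have "v \<cdot> q \<noteq> y" using y(3) nv v(2) qS by auto
        moreover have "v \<cdot> q \<preceq> w" using le_trans[OF liftR4[OF v(6) qS y(3)]] y zw by simp
        ultimately have "condR q v" using v nv qS by (auto simp: condR_def)
        then have "M (v \<cdot> q) = z" using IH[OF vx] v y by simp
        moreover have "up (v \<cdot> q)" using condR_up(1)[OF \<open>condR q v\<close>] .
        ultimately show ?thesis using up_M[of "v \<cdot> q"] \<open>v \<cdot> q \<preceq> w\<close> less.prems(2) by simp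
      qed
    qed
  qed
qed

text \<open>By induction \<open>M (x q)\<close> and \<open>M x q\<close> have the same coatoms,
  where \<open>dyq\<close> matches the two ways of indexing them. If they still differ, they are
  dihedral, and \<open>x\<close> itself is a failure of the kind \<open>badR\<close>.\<close>

lemma comm_r: assumes "condR q x" "\<And>y. y \<preceq> x \<Longrightarrow> \<not> badR q y" shows "M (x \<cdot> q) = M x \<cdot> q"
proof -
  have "x \<in> C" using assms(1) by (simp add: condR_def)
  then show ?thesis using assms
  proof (induction x rule: len_induct)
    case (less x)
    note c = less.prems(1)[unfolded condR_def]
    have xw: "x \<preceq> w" using condR_w[OF less.prems(1)] .
    have qS: "q \<in> S" using c by simp
    have IH: "M (y \<cdot> q) = M y \<cdot> q" if "y \<preceq> x" "y \<noteq> x" "condR q y" for y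
      using less.IH[of y] that le_len[OF that(1)] less.prems(2) le_trans[OF _ that(1)] le_C1[OF that(1)] by blast
    note st = comm_step[OF IH _ xw]
    note cu = condR_up[OF less.prems(1)]
    have dyq: "up y \<and> q \<notin> DR (M y) \<longleftrightarrow> q \<notin> DR y \<and> up (y \<cdot> q)" if y: "cov y x" for y
    proof
      have yx: "y \<preceq> x" "y \<noteq> x" "y \<in> C" using covD[OF y] le_C1 by auto
      have yw: "y \<preceq> w" using le_trans[OF yx(1) xw] .
      have yqw: "y \<cdot> q \<preceq> w" using le_trans[OF liftR4[OF yx(1) qS]] c by blast
      {
        assume a: "up y \<and> q \<notin> DR (M y)"
        then have nq: "q \<notin> DR y" using st[OF _ _ _ yx(1)] by blast
        have "M y \<noteq> y \<cdot> q" using a nq qS yx by auto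
        then have "condR q y" using a nq qS yx yqw by (simp add: condR_def)
        then show "q \<notin> DR y \<and> up (y \<cdot> q)" using nq condR_up by blast
      }
      {
        assume a: "q \<notin> DR y \<and> up (y \<cdot> q)"
        have uy: "up y"
        proof (rule ccontr)
          assume dn: "\<not> up y"
          define v where "v = M y"
          have v: "v \<preceq> w" "v \<in> C" "up v" "M v = y" "len y = Suc (len v)" "v \<preceq> y"
            using M_le[OF yw] M_C[OF yw] up_M[OF yw] dn MM[OF yw] dn_len[OF yw dn] dn_leM[OF yw dn] by (auto simp: v_def)
          have vx: "v \<preceq> x" "v \<noteq> x" using le_trans[OF v(6) yx(1)] le_len_le[OF yx(1)] v(5) by auto
          have nv: "q \<notin> DR v" using st[OF _ _ _ vx(1) v(3)] v(4) a by blast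
          have "v \<cdot> q \<noteq> y" using a nv v(2) qS by auto
          moreover have vqw: "v \<cdot> q \<preceq> w" using le_trans[OF liftR4[OF v(6) qS] yqw] a by blast
          ultimately have cv: "condR q v" using v nv qS by (auto simp: condR_def)
          then have "M (v \<cdot> q) = y \<cdot> q" using IH[OF vx cv] v by simp
          then show False using up_M[OF vqw] condR_up(1)[OF cv] a by simp
        qed
        have "M y \<noteq> y \<cdot> q" using up_neq[OF yw uy] a by blast
        then have "condR q y" using a uy qS yx yqw by (simp add: condR_def)
        then show "up y \<and> q \<notin> DR (M y)" using uy condR_up by blast
      }
    qed
    have eqy: "M (y \<cdot> q) = M y \<cdot> q" if y: "cov y x" "up y" "q \<notin> DR (M y)" for y
    proof -
      have yx: "y \<preceq> x" "y \<noteq> x" "y \<in> C" using covD[OF y(1)] le_C1 by auto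
      have yqw: "y \<cdot> q \<preceq> w" using le_trans[OF liftR4[OF yx(1) qS]] c by blast
      have nq: "q \<notin> DR y" using dyq y by blast
      have "M y \<noteq> y \<cdot> q" using y nq qS yx by auto
      then show ?thesis using IH[OF yx(1,2)] y nq qS yx yqw by (simp add: condR_def)
    qed
    have s1: "cov c (M (x \<cdot> q)) \<longleftrightarrow> c = x \<cdot> q \<or> c = M x \<or> (\<exists>y. cov y x \<and> q \<notin> DR y \<and> up (y \<cdot> q) \<and> c = M (y \<cdot> q))" for c
      unfolding cov_M[OF conjunct1[OF conjunct2[OF conjunct2[OF conjunct2[OF conjunct2[OF c]]]]] cu(1)]
        cov_mul_r[OF less.hyps qS conjunct1[OF conjunct2[OF conjunct2[OF conjunct2[OF c]]]]]
      using c by blast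
    have nx: "q \<notin> DR x" "up x" using c by auto
    have s2: "cov c (M x \<cdot> q) \<longleftrightarrow> c = x \<cdot> q \<or> c = M x \<or> (\<exists>y. cov y x \<and> up y \<and> q \<notin> DR (M y) \<and> c = M y \<cdot> q)" for c
      unfolding cov_mul_r[OF M_C[OF xw] qS cu(2)] cov_M[OF xw nx(2)] using nx by blast
    have "cov c (M (x \<cdot> q)) \<longleftrightarrow> cov c (M x \<cdot> q)" for c
      unfolding s1 s2 using dyq eqy by metis
    then have "M (x \<cdot> q) = M x \<cdot> q \<or> (\<exists>a\<in>S. \<exists>b\<in>S. supp (M (x \<cdot> q)) \<subseteq> {a,b})"
      using coatoms[OF M_C[of "x \<cdot> q"] mul_C[OF M_C[OF xw] S_C[OF qS]]] c by blast
    then show ?case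
    proof
      assume "\<exists>a\<in>S. \<exists>b\<in>S. supp (M (x \<cdot> q)) \<subseteq> {a,b}"
      then obtain a b where ab: "a \<in> S" "b \<in> S" "supp (M (x \<cdot> q)) \<subseteq> {a,b}" by blast
      have xqw: "x \<cdot> q \<preceq> w" using c by blast
      have "q \<in> supp (M (x \<cdot> q))" "s \<in> supp (M (x \<cdot> q))"
        using supp_mono[OF up_leM[OF xqw cu(1)]] supp_up_r[OF qS nx(1) less.hyps] s_supp_M[OF xqw cu(1)] by auto
      then have "\<exists>c\<in>S. supp (M (x \<cdot> q)) \<subseteq> {q,c} \<and> s \<in> {q,c}" using ab by auto
      then show ?thesis using less.prems(2)[OF le_refl[OF less.hyps]] less.prems(1) by (auto simp: badR_def)
    qed
  qed
qed
lemmas comm_l = spm.comm_r[OF dualM, unfolded dualM_defs]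

text \<open>As \<open>q\<close> is a descent of \<open>w\<close>, multiplication by \<open>q\<close>
  preserves the interval. Apart from those with \<open>M y = y q\<close>, the elements outside
  \<open>condR\<close> are reached by \<open>q\<close> or \<open>M\<close> from elements
  inside.\<close>

lemma comm_all_r: assumes "q \<in> DR w" "\<And>y. \<not> badR q y" "x \<preceq> w" shows "M (x \<cdot> q) = M x \<cdot> q"
proof -
  have qS: "q \<in> S" using assms(1) by (rule DR_S)
  have q_le: "y \<cdot> q \<preceq> w" if "y \<preceq> w" for y using liftR2[OF that assms(1)] .
  have cr: "M (y \<cdot> q) = M y \<cdot> q" if "condR q y" for y using comm_r[OF that] assms(2) by blast
  have upc: "M (y \<cdot> q) = M y \<cdot> q" if y: "y \<preceq> w" "up y" for y
  proof -
    have yC: "y \<in> C" using y le_C1 by blast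
    show ?thesis
    proof (cases "q \<in> DR y")
      case False
      show ?thesis
      proof (cases "M y = y \<cdot> q")
        case True
        then show ?thesis using MM[OF y(1)] yC qS by (metis cancel_r)
      next
        case ne: False
        then show ?thesis using cr y False qS q_le[OF y(1)] yC by (simp add: condR_def)
      qed
    next
      case True
      define v where "v = y \<cdot> q"
      have v: "v \<in> C" "y = v \<cdot> q" "q \<notin> DR v" "v \<preceq> w" using True qS yC q_le[OF y(1)] by (auto simp: v_def)
      have "up v"
      proof (rule ccontr)
        assume dn: "\<not> up v"
        define u where "u = M v"
        have u: "u \<preceq> w" "u \<in> C" "up u" "M u = v" "u \<preceq> v"
          using M_le[OF v(4)] M_C[OF v(4)] up_M[OF v(4)] dn MM[OF v(4)] dn_leM[OF v(4) dn] by (auto simp: u_def)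
        have nu: "q \<notin> DR u" using comm_step[of w q u, OF cr u(1) le_refl[OF wC] u(3)] u(4) v(3) by blast
        have "u \<cdot> q \<noteq> v" using v(3) nu u(2) qS by auto
        then have cu: "condR q u" using u nu qS q_le[OF u(1)] by (auto simp: condR_def)
        then have "M (u \<cdot> q) = y" using cr[OF cu] u v by simp
        then show False using up_M[OF q_le[OF u(1)]] condR_up(1)[OF cu] y by simp
      qed
      moreover have "M v \<noteq> y" using up_neq[OF v(4) \<open>up v\<close> y(2)] .
      ultimately have "condR q v" using v qS y(1) by (simp add: condR_def)
      then have "M y = M v \<cdot> q" using cr v by simp
      then show ?thesis using M_C[OF v(4)] qS v by simp
    qed
  qed
  show ?thesis
  proof (cases "up x")
    case True
    then show ?thesis using upc assms by blast
  next
    case False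
    have "M (M x \<cdot> q) = x \<cdot> q" using upc[OF M_le[OF assms(3)]] up_M[OF assms(3)] False MM[OF assms(3)] by simp
    then show ?thesis using MM[OF q_le[OF M_le[OF assms(3)]]] by simp
  qed
qed
lemmas comm_all_l = spm.comm_all_r[OF dualM, unfolded dualM_defs]

end

section \<open>Short products, and descents on opposite sides\<close>

context cox begin

lemma DL_gen[simp]: "t \<in> S \<Longrightarrow> DL t = {t}"
  using DL_supp[of _ t] DL_mul[of t e] by fastforce
lemmas DR_gen[simp] = cox.DL_gen[OF dual, unfolded dual_defs]

lemma DL_chain: assumes "v \<in> C" "c \<in> S" "c \<notin> supp v" "DL v \<subseteq> {t}" "t \<in> S" "c \<cdot> t \<noteq> t \<cdot> c" shows "DL (c \<cdot> v) = {c}"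
proof -
  have "h = c" if "h \<in> DL (c \<cdot> v)" for h
    using DL_new[OF assms(1-3) that] assms(4,6) by (cases "h = c") auto
  moreover have "c \<in> DL (c \<cdot> v)" using assms not_supp_DL by simp
  ultimately show ?thesis by blast
qed
lemmas DR_chain = cox.DL_chain[OF dual, unfolded dual_defs]

lemma DL_two: "c \<in> S \<Longrightarrow> t \<in> S \<Longrightarrow> c \<cdot> t \<noteq> t \<cdot> c \<Longrightarrow> DL (c \<cdot> t) = {c}"
  by (rule DL_chain[of t c t]) auto
lemmas DR_two = cox.DL_two[OF dual, unfolded dual_defs]

lemma len_supp_l: "v \<in> C \<Longrightarrow> c \<in> S \<Longrightarrow> c \<notin> supp v \<Longrightarrow> len (c \<cdot> v) = Suc (len v)"
  using nDL_len not_supp_DL by blast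
lemmas len_supp_r = cox.len_supp_l[OF dual]

lemma supp_supp_l: "v \<in> C \<Longrightarrow> c \<in> S \<Longrightarrow> c \<notin> supp v \<Longrightarrow> supp (c \<cdot> v) = insert c (supp v)"
  using supp_up_l not_supp_DL by blast
lemmas supp_supp_r = cox.supp_supp_l[OF dual]

lemma len_two: "c \<in> S \<Longrightarrow> t \<in> S \<Longrightarrow> c \<noteq> t \<Longrightarrow> len (c \<cdot> t) = 2"
  using len_supp_l[of t c] by simp

lemma supp_two: "c \<in> S \<Longrightarrow> t \<in> S \<Longrightarrow> supp (c \<cdot> t) \<subseteq> {c,t}"
  using supp_mul[of c t] by auto

lemma comm_dih: assumes "a \<in> S" "b \<in> S" "a \<noteq> b" "a \<cdot> b = b \<cdot> a" "x \<in> C" "supp x \<subseteq> {a,b}"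
  shows "x = e \<or> x = a \<or> x = b \<or> x = a \<cdot> b"
proof (cases "len x \<le> 1")
  case True
  then have "len x = 0 \<or> len x = 1" by linarith
  then have "x = e \<or> x \<in> S" using len_e[OF assms(5)] len1[OF assms(5)] by blast
  then show ?thesis using assms(6) by auto
next
  case False
  have sup: "supp (a \<cdot> b) \<subseteq> {a,b}" using supp_two[OF assms(1,2)] .
  have d1: "a \<in> DL (a \<cdot> b)" using assms(1-3) by simp
  have "b \<in> DL (b \<cdot> a)" using assms(1-3) by simp
  then have d2: "b \<in> DL (a \<cdot> b)" unfolding assms(4) .
  from d1 d2 have "len x \<le> len (a \<cdot> b)" using dih_longest[of "a \<cdot> b" x a b] assms sup by simp
  then have lx: "len x = len (a \<cdot> b)" using False len_two[OF assms(1-3)] by simp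
  have "x \<noteq> e" using False by auto
  then obtain f where f: "f \<in> DL x" using ex_DL assms(5) by blast
  then have "f \<in> {a,b}" using DL_pair assms by blast
  then have "f \<in> DL (a \<cdot> b)" using d1 d2 by blast
  then show ?thesis using dih_eq[of x "a \<cdot> b" a b f] assms sup lx f by simp
qed

lemma supp_single: assumes "x \<in> C" "supp x \<subseteq> {s}" shows "x = e \<or> x = s"
proof (cases "x = e")
  case False
  then obtain f where f: "f \<in> DL x" using ex_DL assms by blast
  have fs: "f = s" using DL_pair[OF assms] f by blast
  have sS: "s \<in> S" using f fs DL_S by blast
  have "s \<cdot> x = e"
  proof (rule ccontr)
    assume "s \<cdot> x \<noteq> e"
    then obtain g where g: "g \<in> DL (s \<cdot> x)" using ex_DL assms sS by fastforce
    have "supp (s \<cdot> x) \<subseteq> {s}" using supp_down_l[of s x] f fs assms by auto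
    then have "g = s" using DL_pair[of "s \<cdot> x" "{s}"] g assms sS by auto
    then show False using g f fs assms sS by simp
  qed
  then have "s \<cdot> (s \<cdot> x) = s" using sS by simp
  then show ?thesis using assms sS by simp
qed simp

lemma le_genD: "x \<preceq> y \<Longrightarrow> x \<in> S \<Longrightarrow> x \<in> supp y" by (simp add: supp_def)

text \<open>To be used when \<open>q\<close> and \<open>r\<close> both commute with
  \<open>M\<close>: as \<open>r w\<close> and \<open>w q\<close> differ, \<open>M w\<close> is
  different from at least one of them, and the corresponding descent serves the induction.\<close>

lemma two_tops: assumes "w \<in> C" "q \<in> DR w" "w \<cdot> q \<noteq> e" "r \<in> DL (w \<cdot> q)"
  shows "r \<in> DL w \<and> r \<cdot> w \<noteq> w \<cdot> q"
proof
  have q: "q \<in> S" "w = (w \<cdot> q) \<cdot> q" "adds (w \<cdot> q) q" using assms DR_S[OF assms(2)] adds_DR[of q "w \<cdot> q"] by auto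
  have rS: "r \<in> S" using assms DL_S by blast
  show r: "r \<in> DL w" using DL_adds[OF q(3) _ _ assms(4)] q assms by simp
  show "r \<cdot> w \<noteq> w \<cdot> q"
  proof
    assume "r \<cdot> w = w \<cdot> q"
    then have "r \<in> DL (r \<cdot> w)" using assms by simp
    then show False using r rS assms by simp
  qed
qed
end

section \<open>The letters of w relative to s; matchings that are multiplications on all dihedral
  intervals\<close>

context spm begin

text \<open>A generator \<open>c \<noteq> s\<close> below \<open>w\<close> commutes with \<open>s\<close> (\<open>K\<close>), or \<open>M c = cs\<close> (\<open>A\<close>), or \<open>M c = sc\<close> (\<open>B\<close>). On the
  dihedral interval of \<open>s, c\<close> the matching may be a right (\<open>rho c\<close>) or a left (\<open>lam c\<close>) multiplication.\<close>

definition A where "A = {c\<in>S. c \<preceq> w \<and> c \<noteq> s \<and> M c = c \<cdot> s \<and> c \<cdot> s \<noteq> s \<cdot> c}"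
definition B where "B = {c\<in>S. c \<preceq> w \<and> c \<noteq> s \<and> M c = s \<cdot> c \<and> c \<cdot> s \<noteq> s \<cdot> c}"
definition K where "K = {c\<in>S. c \<preceq> w \<and> c \<noteq> s \<and> c \<cdot> s = s \<cdot> c}"
definition rho where "rho c \<longleftrightarrow> (\<forall>x. x \<preceq> w \<longrightarrow> supp x \<subseteq> {s,c} \<longrightarrow> M x = x \<cdot> s)"
definition lam where "lam c \<longleftrightarrow> (\<forall>x. x \<preceq> w \<longrightarrow> supp x \<subseteq> {s,c} \<longrightarrow> M x = s \<cdot> x)"
text \<open>By \<open>comm_all_r\<close>, right multiplication by a right descent \<open>q\<close>
  of \<open>w\<close> with this property commutes with \<open>M\<close> on the whole
  interval.\<close>

definition goodR where "goodR q \<longleftrightarrow> (\<forall>y. \<not> badR q y)"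
definition goodL where "goodL q \<longleftrightarrow> (\<forall>y. \<not> badL q y)"
definition settled where "settled \<longleftrightarrow>
   (\<exists>q\<in>DR w. goodR q \<and> M w \<noteq> w \<cdot> q) \<or> (\<exists>q\<in>DL w. goodL q \<and> M w \<noteq> q \<cdot> w) \<or>
   (\<forall>x. x \<preceq> w \<longrightarrow> M x = x \<cdot> s) \<or> (\<forall>x. x \<preceq> w \<longrightarrow> M x = s \<cdot> x) \<or>
   (\<exists>a\<in>S. \<exists>b\<in>S. supp w \<subseteq> {a,b})"

lemma dual_A: "spm.A (\<lambda>x y. y \<cdot> x) e S le M w = B"
  unfolding spm.A_def[OF dualM] B_def by (auto simp: eq_commute)
lemma dual_B: "spm.B (\<lambda>x y. y \<cdot> x) e S le M w = A"
  unfolding spm.B_def[OF dualM] A_def by (auto simp: eq_commute)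
lemma dual_K: "spm.K (\<lambda>x y. y \<cdot> x) e S le M w = K"
  unfolding spm.K_def[OF dualM] K_def by (auto simp: eq_commute)
lemma dual_rho: "spm.rho (\<lambda>x y. y \<cdot> x) e S le M w = lam"
  by (intro ext) (simp add: spm.rho_def[OF dualM] lam_def)
lemma dual_lam: "spm.lam (\<lambda>x y. y \<cdot> x) e S le M w = rho"
  by (intro ext) (simp add: spm.lam_def[OF dualM] rho_def)
lemma dual_goodR: "spm.goodR C (\<lambda>x y. y \<cdot> x) e S len le M w = goodL"
  by (intro ext) (simp add: spm.goodR_def[OF dualM] goodL_def dual_badR)
lemma dual_goodL: "spm.goodL C (\<lambda>x y. y \<cdot> x) e S len le M w = goodR"
  by (intro ext) (simp add: spm.goodL_def[OF dualM] goodR_def dual_badL)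
lemma dual_settled: "spm.settled C (\<lambda>x y. y \<cdot> x) e S len le M w = settled"
  unfolding spm.settled_def[OF dualM] settled_def dual_goodR dual_goodL dual_defs by blast
lemmas dualM_defs2 = dualM_defs dual_A dual_B dual_K dual_rho dual_lam dual_goodR dual_goodL dual_settled

lemma AD: "c \<in> A \<Longrightarrow> c \<in> S" "c \<in> A \<Longrightarrow> c \<preceq> w" "c \<in> A \<Longrightarrow> c \<noteq> s" "c \<in> A \<Longrightarrow> M c = c \<cdot> s" "c \<in> A \<Longrightarrow> c \<cdot> s \<noteq> s \<cdot> c"
  by (auto simp: A_def)
lemma BD: "c \<in> B \<Longrightarrow> c \<in> S" "c \<in> B \<Longrightarrow> c \<preceq> w" "c \<in> B \<Longrightarrow> c \<noteq> s" "c \<in> B \<Longrightarrow> M c = s \<cdot> c" "c \<in> B \<Longrightarrow> c \<cdot> s \<noteq> s \<cdot> c"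
  by (auto simp: B_def)
lemma KD: "c \<in> K \<Longrightarrow> c \<in> S" "c \<in> K \<Longrightarrow> c \<preceq> w" "c \<in> K \<Longrightarrow> c \<noteq> s" "c \<in> K \<Longrightarrow> M c = c \<cdot> s" "c \<in> K \<Longrightarrow> M c = s \<cdot> c" "c \<in> K \<Longrightarrow> c \<cdot> s = s \<cdot> c"
  using M_gen[of c] by (auto simp: K_def)
lemma cases_ABK: "c \<in> S \<Longrightarrow> c \<preceq> w \<Longrightarrow> c = s \<or> c \<in> A \<or> c \<in> B \<or> c \<in> K"
  using M_gen[of c] by (auto simp: A_def B_def K_def)
lemma AB: "c \<in> A \<Longrightarrow> c \<notin> B" by (auto simp: A_def B_def)
lemma AK: "c \<in> A \<Longrightarrow> c \<notin> K" by (auto simp: A_def K_def)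
lemma Ms: "M s = e" using MM[of e] by simp

text \<open>When \<open>c\<close> and \<open>s\<close> commute, the dihedral group consists of
  \<open>e\<close>, \<open>s\<close>, \<open>c\<close> and \<open>s c\<close>, and both
  multiplications by \<open>s\<close> agree on it.\<close>

lemma rho_K: assumes "c \<in> K" shows "rho c"
  unfolding rho_def
proof (intro allI impI)
  fix x assume x: "x \<preceq> w" "supp x \<subseteq> {s,c}"
  note k = KD(1,3,4,6)[OF assms]
  have "x = e \<or> x = s \<or> x = c \<or> x = s \<cdot> c"
    using comm_dih[of s c x] x le_C1[OF x(1)] k by auto
  moreover have "M (s \<cdot> c) = c" using MM[OF KD(2)[OF assms]] k(3,4) by simp
  moreover have "s \<cdot> c \<cdot> s = c" unfolding k(4)[symmetric] using k(1) by simp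
  ultimately show "M x = x \<cdot> s" using k(1,3) Ms by auto
qed
lemmas lam_K = spm.rho_K[OF dualM, unfolded dualM_defs2]

lemma rho_s: "rho s"
  unfolding rho_def
proof (intro allI impI)
  fix x assume x: "x \<preceq> w" "supp x \<subseteq> {s,s}"
  then have "x = e \<or> x = s" using supp_single[of x s] le_C1[of x w] by simp
  then show "M x = x \<cdot> s" using Ms by auto
qed
lemmas lam_s = spm.rho_s[OF dualM, unfolded dualM_defs2]

lemma rho_out: assumes "c \<in> S" "\<not> c \<preceq> w" shows "rho c"
  unfolding rho_def
proof (intro allI impI)
  fix x assume x: "x \<preceq> w" "supp x \<subseteq> {s,c}"
  have "supp x \<subseteq> {s,s}" using x assms le_trans[of c x w] by (auto simp: supp_def)
  then show "M x = x \<cdot> s" using rho_s x unfolding rho_def by blast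
qed

lemma badR_supp: assumes "badR q y" shows "\<exists>c\<in>S. s \<in> {q,c} \<and> supp y \<subseteq> {q,c} \<and> supp (y \<cdot> q) \<subseteq> {q,c}"
proof -
  have c: "condR q y" using assms by (simp add: badR_def)
  obtain c where "c \<in> S" "supp (M (y \<cdot> q)) \<subseteq> {q,c}" "s \<in> {q,c}" using assms unfolding badR_def by blast
  moreover have "supp (y \<cdot> q) \<subseteq> insert s (supp (M (y \<cdot> q)))" using supp_M' c unfolding condR_def by blast
  moreover have "supp y \<subseteq> supp (y \<cdot> q)" using supp_mono[OF up_r[of q y]] c by (auto simp: condR_def)
  ultimately show ?thesis by blast
qed

text \<open>A minimal failure lives in the subgroup of \<open>s\<close> and \<open>q\<close>, where
  \<open>M\<close> is a left multiplication and so commutes with right ones.\<close>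

lemma goodR_lam: assumes "q \<in> S" "q \<noteq> s" "lam q" shows "goodR q"
  unfolding goodR_def
proof
  fix y show "\<not> badR q y"
  proof
    assume b: "badR q y"
    then have c: "condR q y" by (simp add: badR_def)
    obtain c where "s \<in> {q,c}" "supp y \<subseteq> {q,c}" "supp (y \<cdot> q) \<subseteq> {q,c}" using badR_supp[OF b] by blast
    then have "supp y \<subseteq> {s,q}" "supp (y \<cdot> q) \<subseteq> {s,q}" using assms(2) by auto
    then have "M y = s \<cdot> y" "M (y \<cdot> q) = s \<cdot> (y \<cdot> q)"
      using assms(3) condR_w[OF c] c unfolding lam_def condR_def by blast+
    moreover have "M (y \<cdot> q) \<noteq> M y \<cdot> q" "y \<in> C" using b c unfolding badR_def condR_def by blast+
    ultimately show False using assoc[of s y q] assms(1) by simp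
  qed
qed
lemmas goodL_rho = spm.goodR_lam[OF dualM, unfolded dualM_defs2]

text \<open>For \<open>q = s\<close> the second letter of the dihedral subgroup is arbitrary, hence
  the hypothesis on all \<open>c\<close>. Where \<open>M\<close> is right multiplication by
  \<open>s\<close>, \<open>condR\<close> fails; where it is the left one, it commutes with the right
  one.\<close>

lemma goodR_s: assumes "\<And>c. c \<in> S \<Longrightarrow> rho c \<or> lam c" shows "goodR s"
  unfolding goodR_def
proof
  fix y show "\<not> badR s y"
  proof
    assume b: "badR s y"
    then have c: "condR s y" by (simp add: badR_def)
    obtain c where cc: "c \<in> S" "supp y \<subseteq> {s,c}" "supp (y \<cdot> s) \<subseteq> {s,c}" using badR_supp[OF b] by blast
    show False
    proof (cases "rho c")
      case True
      then have "M y = y \<cdot> s" using cc condR_w[OF c] unfolding rho_def by blast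
      then show False using c unfolding condR_def by blast
    next
      case False
      then have "lam c" using assms cc by blast
      then have "M y = s \<cdot> y" "M (y \<cdot> s) = s \<cdot> (y \<cdot> s)"
        using cc condR_w[OF c] c unfolding lam_def condR_def by blast+
      moreover have "M (y \<cdot> s) \<noteq> M y \<cdot> s" "y \<in> C" using b c unfolding badR_def condR_def by blast+
      ultimately show False using assoc[of s y s] by simp
    qed
  qed
qed
lemmas goodL_s = spm.goodR_s[OF dualM, unfolded dualM_defs2]

text \<open>One half of \<open>BsA\<close>, whose mirror image is the other half.
  \<open>M (c s t)\<close> lies above \<open>M c = s c\<close> and \<open>M t = t s\<close>.
  Removing a left descent other than \<open>c\<close> would leave exactly \<open>c s t\<close>,
  still above \<open>s c\<close> or \<open>t s\<close>, and it is above neither.\<close>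

lemma BsA_DL: assumes "c \<in> B" "t \<in> A" "c \<cdot> (s \<cdot> t) \<preceq> w"
  shows "DL (M (c \<cdot> (s \<cdot> t))) = {c} \<and> len (M (c \<cdot> (s \<cdot> t))) = 4 \<and> s \<cdot> c \<preceq> M (c \<cdot> (s \<cdot> t)) \<and> t \<cdot> s \<preceq> M (c \<cdot> (s \<cdot> t))"
proof -
  note b = BD[OF assms(1)] and a = AD[OF assms(2)]
  have ct: "c \<noteq> t" using AB assms by blast
  let ?x = "c \<cdot> (s \<cdot> t)" and ?y = "M (c \<cdot> (s \<cdot> t))"
  have sst: "supp (s \<cdot> t) = {s,t}" using supp_supp_l[of t s] a by simp
  have lst: "len (s \<cdot> t) = 2" using len_two[of s t] a by simp
  have lx: "len ?x = 3" using len_supp_l[of "s \<cdot> t" c] sst ct a b lst by simp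
  have D: "DL ?x = {c}" "DL (s \<cdot> c) = {s}" "DL (t \<cdot> s) = {t}" "DL (s \<cdot> t) = {s}"
    using DL_two[of s c] DL_two[of t s] DL_two[of s t] DL_chain[of "s \<cdot> t" c s] a b sst ct s_S by auto
  have ad: "adds c (s \<cdot> t)" using lx lst b by (simp add: adds_def)
  have stx: "s \<cdot> t \<preceq> ?x" "c \<preceq> ?x" using le_adds_r[OF ad] le_adds_l[OF ad] a b by auto
  have stw: "s \<cdot> t \<preceq> w" using le_trans[OF stx(1) assms(3)] .
  have tst: "t \<preceq> s \<cdot> t" using le_adds_r[of s t] a lst by (simp add: adds_def)
  have c1: "cov t (s \<cdot> t)" "cov (s \<cdot> t) ?x" using tst stx lst lx a by (auto simp: cov_def)
  have "M t \<preceq> M (s \<cdot> t)" using M_sp[OF c1(1) stw] a by auto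
  then have ust: "up (s \<cdot> t)" using le_len_le[of "M t" "M (s \<cdot> t)"] a(4) len_two[of t s] a dn_len[OF stw] lst by fastforce
  have "c \<notin> supp (M (s \<cdot> t))" using supp_M[OF stw] sst ct b by auto
  moreover have "c \<in> supp ?x" using le_genD[OF stx(2) b(1)] .
  ultimately have "M (s \<cdot> t) \<noteq> ?x" by auto
  then have "M (s \<cdot> t) \<preceq> ?y" using M_sp[OF c1(2) assms(3)] by blast
  then have upx: "up ?x" using le_len_le[of "M (s \<cdot> t)" ?y] up_len[OF stw ust] lst lx by (simp add: up_def) (use dn_len[OF assms(3)] in \<open>fastforce simp: up_def\<close>)
  have ly: "len ?y = 4" using up_len[OF assms(3) upx] lx by simp
  have yC: "?y \<in> C" using M_C[OF assms(3)] .
  have m: "s \<cdot> c \<preceq> ?y" "t \<cdot> s \<preceq> ?y" using Mmono[OF stx(2) assms(3) up_gen upx]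
      Mmono[OF le_trans[OF tst stx(1)] assms(3) up_gen upx] a b by auto
  have nx: "h \<notin> DL ?y" if h: "h \<noteq> c" for h
  proof
    assume hy: "h \<in> DL ?y"
    have hS: "h \<in> S" using hy DL_S by blast
    have "?x \<preceq> h \<cdot> ?y" using liftL1[OF up_leM[OF assms(3) upx] hy] D h by auto
    then have xh: "?x = h \<cdot> ?y" using le_eq[of ?x "h \<cdot> ?y"] DL_len[OF hy yC] ly lx by simp
    have cx: "c \<in> DL ?x" "c \<cdot> ?x = s \<cdot> t" using D a b by auto
    show False
    proof (cases "h = s")
      case False
      then have "s \<cdot> c \<preceq> ?x" using liftL1[OF m(1) hy] D xh by simp
      then have "s \<cdot> c \<preceq> s \<cdot> t" using liftL1[of "s \<cdot> c" ?x c] cx D b by simp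
      then have "supp (s \<cdot> c) \<subseteq> {s,t}" using supp_mono sst by blast
      then show False using supp_supp_l[of c s] b ct by auto
    next
      case True
      then have "t \<cdot> s \<preceq> ?x" using liftL1[OF m(2) hy] D xh a by simp
      then have "t \<cdot> s \<preceq> s \<cdot> t" using liftL1[of "t \<cdot> s" ?x c] cx D ct by simp
      then have "t \<cdot> s = s \<cdot> t" using le_eq lst len_two[of t s] a by simp
      then show False using a by simp
    qed
  qed
  have "?y \<noteq> e" using ly by (metis len_e0 zero_neq_numeral)
  then obtain h where h: "h \<in> DL ?y" using ex_DL[OF yC] by blast
  then have "h = c" using nx by blast
  then have "DL ?y = {c}" using nx h by auto
  then show ?thesis using ly m by blast
qed
lemmas BsA_DR = spm.BsA_DL[OF dualM, unfolded dualM_defs2]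

text \<open>Removing the forced first letter \<open>c\<close> and last letter \<open>t\<close> from
  \<open>M (c s t)\<close> leaves \<open>s c\<close>, so that \<open>M (c s t) t = c s c\<close>. By
  lifting this lies above \<open>t s\<close>, although it lacks the letter \<open>t\<close>.\<close>

lemma BsA: assumes "c \<in> B" "t \<in> A" shows "\<not> c \<cdot> (s \<cdot> t) \<preceq> w"
proof
  assume x: "c \<cdot> (s \<cdot> t) \<preceq> w"
  note b = BD[OF assms(1)] and a = AD[OF assms(2)]
  have ct: "c \<noteq> t" using AB assms by blast
  let ?y = "M (c \<cdot> (s \<cdot> t))"
  have as: "c \<cdot> s \<cdot> t = c \<cdot> (s \<cdot> t)" using a b by (simp add: assoc)
  note L = BsA_DL[OF assms x] and R = BsA_DR[OF assms(2,1), unfolded as, OF x]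
  have yC: "?y \<in> C" using M_C[OF x] .
  define y1 where "y1 = c \<cdot> ?y"
  have cy: "c \<in> DL ?y" and ty: "t \<in> DR ?y" using L R by auto
  have y1: "y1 \<in> C" "?y = c \<cdot> y1" "len y1 = 3" "adds c y1"
    using cy yC b L DL_len[OF cy yC] adds_DL[of c y1] by (auto simp: y1_def)
  have D: "DL (s \<cdot> c) = {s}" "DR (s \<cdot> c) = {c}" "DR (t \<cdot> s) = {s}"
    using DL_two[of s c] DR_two[of c s] DR_two[of s t] a b s_S by auto
  have sc: "s \<cdot> c \<preceq> y1" using liftL1[OF _ cy, of "s \<cdot> c"] L D b by (auto simp: y1_def)
  have "y1 \<noteq> e" using y1 by auto
  then obtain h where h: "h \<in> DR y1" using ex_DR y1 by blast
  then have "h \<in> DR ?y" using DR_adds[OF y1(4,1) _ h] y1(2) b by simp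
  then have t1: "t \<in> DR y1" using R h by auto
  have "s \<cdot> c \<preceq> y1 \<cdot> t" using liftR1[OF sc t1] D ct by auto
  then have "y1 \<cdot> t = s \<cdot> c" using le_eq[of "s \<cdot> c" "y1 \<cdot> t"] DR_len[OF t1 y1(1)] y1 len_two[of s c] b by simp
  then have yt: "?y \<cdot> t = c \<cdot> (s \<cdot> c)" using y1 a b by (simp add: assoc)
  have "t \<cdot> s \<preceq> ?y \<cdot> t" using liftR1[OF _ ty, of "t \<cdot> s"] L D a by auto
  then have "t \<in> supp (c \<cdot> (s \<cdot> c))" using supp_mono[of "t \<cdot> s" "?y \<cdot> t"] supp_supp_l[of s t] a unfolding yt by auto
  moreover have "supp (c \<cdot> (s \<cdot> c)) \<subseteq> {s,c}" using supp_mul[of c "s \<cdot> c"] supp_two[of s c] b by auto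
  ultimately show False using ct a by auto
qed

text \<open>Below an element without \<open>s\<close> the only candidate for a minimal failure of
  commutation is \<open>e\<close>, and there \<open>M q = s q\<close> is the commutation
  required.\<close>

lemma sfree_mul_r: assumes "x \<preceq> w" "s \<notin> supp x" "q \<in> DR x" "q \<in> B \<union> K" shows "M x = M (x \<cdot> q) \<cdot> q"
proof -
  have xC: "x \<in> C" using assms(1) le_C1 by blast
  have qS: "q \<in> S" using assms DR_S by blast
  let ?v = "x \<cdot> q"
  have v: "?v \<preceq> x" "?v \<in> C" "q \<notin> DR ?v" "x = ?v \<cdot> q" using down_r[OF assms(3) xC] assms xC qS by auto
  have vw: "?v \<preceq> w" using le_trans[OF v(1) assms(1)] .
  have sv: "s \<notin> supp ?v" using supp_mono[OF v(1)] assms by blast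
  have uv: "up ?v" using sfree_up[OF vw sv] .
  have "M ?v \<noteq> x" using s_supp_M[OF vw uv] assms(2) by auto
  then have c: "condR q ?v" using uv v assms qS by (simp add: condR_def)
  have "\<not> badR q y" if y: "y \<preceq> ?v" for y
  proof
    assume b: "badR q y"
    then have cy: "condR q y" by (simp add: badR_def)
    then have yC: "y \<in> C" by (simp add: condR_def)
    obtain c where c: "s \<in> {q,c}" "supp y \<subseteq> {q,c}" using badR_supp[OF b] by blast
    have qs: "q \<noteq> s" using assms(4) BD(3) KD(3) by blast
    then have "supp y \<subseteq> {q}" using c supp_mono[OF y] sv by auto
    moreover have "q \<notin> DR y" using cy by (simp add: condR_def)
    ultimately have "y = e" using ex_DR[OF yC] DR_pair[OF yC] by blast
    then have "M (y \<cdot> q) = M y \<cdot> q" using assms(4) BD(4) KD(5) qS by auto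
    then show False using b by (simp add: badR_def)
  qed
  then show ?thesis using comm_r[OF c] v by simp
qed
text \<open>If all right descents were in \<open>A\<close>, then \<open>M x\<close> would lie above
  some \<open>s c\<close> and \<open>t s\<close>, which prevents \<open>s\<close> from being a
  descent of \<open>M x\<close> on either side. A left descent \<open>h\<close> of
  \<open>M x\<close> is then one of \<open>x\<close>, induction gives
  \<open>M (h x) = h x s\<close>, and comparison with \<open>M x\<close> forces
  \<open>M x = x s\<close> or \<open>x = M (h x)\<close>; both are absurd. So there is a right
  descent in \<open>B\<close> or \<open>K\<close>, and \<open>sfree_mul_r\<close> passes to a
  shorter element.\<close>

lemma sfree_core: assumes x: "x \<preceq> w" "s \<notin> supp x" "DL x \<subseteq> B"
  and IH: "\<And>y. y \<preceq> w \<Longrightarrow> len y < len x \<Longrightarrow> s \<notin> supp y \<Longrightarrow> (DL y \<subseteq> B \<longrightarrow> M y = s \<cdot> y) \<and> (DR y \<subseteq> A \<longrightarrow> M y = y \<cdot> s)"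
  shows "M x = s \<cdot> x \<and> (x \<noteq> e \<longrightarrow> \<not> DR x \<subseteq> A)"
proof -
  have xC: "x \<in> C" using x(1) le_C1 by blast
  have nA: "\<not> DR x \<subseteq> A" if xe: "x \<noteq> e"
  proof
    assume RA: "DR x \<subseteq> A"
    let ?y = "M x"
    have ux: "up x" using sfree_up x by blast
    have yC: "?y \<in> C" using M_C x by blast
    have sy: "s \<in> supp ?y" using s_supp_M[OF x(1) ux] .
    have ly: "len ?y = Suc (len x)" using up_len[OF x(1) ux] .
    have xy: "x \<preceq> ?y" using up_leM[OF x(1) ux] .
    obtain t where t: "t \<in> DR x" using ex_DR[OF xC xe] by blast
    then have tA: "t \<in> A" using RA by blast
    note a = AD[OF tA]
    have tx: "t \<preceq> x" using DR_supp[OF t xC] by (simp add: supp_def)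
    have ts: "t \<cdot> s \<preceq> ?y" using Mmono[OF tx x(1) up_gen ux] a by simp
    obtain c where c: "c \<in> DL x" using ex_DL[OF xC xe] by blast
    then have cB: "c \<in> B" using x by blast
    note b = BD[OF cB]
    have cx: "c \<preceq> x" using DL_supp[OF c xC] by (simp add: supp_def)
    have sc: "s \<cdot> c \<preceq> ?y" using Mmono[OF cx x(1) up_gen ux] b by simp
    have D: "DL (t \<cdot> s) = {t}" "DR (s \<cdot> c) = {c}" using DL_two[of t s] DR_two[of c s] a b s_S by auto
    have n1: "s \<notin> DL ?y"
    proof
      assume d: "s \<in> DL ?y"
      have "s \<notin> DL x" using not_supp_DL[OF xC x(2)] .
      then have "x \<preceq> s \<cdot> ?y" using liftL1[OF xy d] by blast
      then have eq: "s \<cdot> ?y = x" using le_eq[of x "s \<cdot> ?y"] DL_len[OF d yC] ly by simp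
      have "t \<cdot> s \<preceq> x" using liftL1[OF ts d] D a eq by simp
      then have "s \<in> supp x" using supp_mono[of "t \<cdot> s" x] supp_supp_l[of s t] a by auto
      then show False using x by blast
    qed
    have n2: "s \<notin> DR ?y"
    proof
      assume d: "s \<in> DR ?y"
      have "s \<notin> DR x" using not_supp_DR[OF xC x(2)] .
      then have "x \<preceq> ?y \<cdot> s" using liftR1[OF xy d] by blast
      then have eq: "?y \<cdot> s = x" using le_eq[of x "?y \<cdot> s"] DR_len[OF d yC] ly by simp
      have "s \<cdot> c \<preceq> x" using liftR1[OF sc d] D b eq by simp
      then have "s \<in> supp x" using supp_mono[of "s \<cdot> c" x] supp_supp_l[of c s] b by auto
      then show False using x by blast
    qed
    have "?y \<noteq> e" using ly by (metis len_e0 Zero_not_Suc)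
    then obtain h where h: "h \<in> DL ?y" using ex_DL[OF yC] by blast
    have hS: "h \<in> S" using h DL_S by blast
    have hs: "h \<noteq> s" using n1 h by blast
    have hx: "h \<in> DL x"
    proof (rule ccontr)
      assume "h \<notin> DL x"
      then have "x \<preceq> h \<cdot> ?y" using liftL1[OF xy h] by blast
      then have "h \<cdot> ?y = x" using le_eq[of x "h \<cdot> ?y"] DL_len[OF h yC] ly by simp
      then have "?y = h \<cdot> x" using cancel_l[OF hS yC] by simp
      then have "s \<in> insert h (supp x)" using supp_mul[of h x] hS xC sy by auto
      then show False using hs x by blast
    qed
    let ?z = "h \<cdot> x"
    have z: "?z \<in> C" "?z \<preceq> x" "len x = Suc (len ?z)" using hS xC down_l[OF hx xC] DL_len[OF hx xC] by auto
    have zw: "?z \<preceq> w" using le_trans[OF z(2) x(1)] .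
    have sz: "s \<notin> supp ?z" using supp_mono[OF z(2)] x by blast
    have "DR ?z \<subseteq> DR x" using DR_adds[of h ?z] adds_DL[of h ?z] hS hx xC by auto
    then have Mz: "M ?z = ?z \<cdot> s" using IH[OF zw _ sz] z RA by auto
    have cz: "cov ?z x" using z by (simp add: cov_def)
    have uz: "up ?z" using sfree_up[OF zw sz] .
    have "M ?z \<preceq> ?y" using Mmono[OF z(2) x(1) uz ux] .
    show False
    proof (cases "h \<in> DL (M ?z)")
      case False
      have "M ?z \<preceq> h \<cdot> ?y" using liftL1[OF \<open>M ?z \<preceq> ?y\<close> h False] .
      then have "M ?z = h \<cdot> ?y" using le_eq[of "M ?z" "h \<cdot> ?y"] DL_len[OF h yC] ly up_len[OF zw uz] z by simp
      then have "h \<cdot> ?y = h \<cdot> (x \<cdot> s)" using Mz hS xC by (simp add: assoc)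
      then have "?y = x \<cdot> s" using cancel[of h ?y "x \<cdot> s"] hS yC xC by simp
      moreover have "s \<notin> DR x" using not_supp_DR[OF xC x(2)] .
      ultimately show False using n2 xC by simp
    next
      case True
      have "h \<cdot> ?z \<preceq> M ?z" using liftL2[OF up_leM[OF zw uz] True] .
      then have "x = M ?z" using le_eq[of x "M ?z"] up_len[OF zw uz] z hS xC by simp
      then show False using s_supp_M[OF zw uz] x by simp
    qed
  qed
  have "M x = s \<cdot> x"
  proof (cases "x = e")
    case False
    then obtain q where q: "q \<in> DR x" "q \<notin> A" using nA by blast
    have qS: "q \<in> S" using q DR_S by blast
    have "q \<in> supp x" using DR_supp q xC by blast
    then have "q \<preceq> w" "q \<noteq> s" using x le_trans[of q x w] by (auto simp: supp_def)
    then have qB: "q \<in> B \<union> K" using cases_ABK[OF qS] q by blast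
    let ?z = "x \<cdot> q"
    have z: "?z \<in> C" "?z \<preceq> x" "len x = Suc (len ?z)" using qS xC down_r[OF q(1) xC] DR_len[OF q(1) xC] by auto
    have "DL ?z \<subseteq> DL x" using DL_adds[of ?z q] adds_DR[of q ?z] qS q xC by auto
    then have "M ?z = s \<cdot> ?z" using IH[of ?z] le_trans[OF z(2) x(1)] z supp_mono[OF z(2)] x by auto
    then show ?thesis using sfree_mul_r[OF x(1,2) q(1) qB] qS xC by (simp add: assoc)
  qed simp
  then show ?thesis using nA by blast
qed
lemmas sfree_core' = spm.sfree_core[OF dualM, unfolded dualM_defs2]

lemma sfree: assumes "x \<preceq> w" "s \<notin> supp x"
  shows "(DL x \<subseteq> B \<longrightarrow> M x = s \<cdot> x) \<and> (DR x \<subseteq> A \<longrightarrow> M x = x \<cdot> s)"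
proof -
  have "x \<in> C" using assms(1) by (rule le_C1)
  then show ?thesis using assms
  proof (induction x rule: len_induct)
    case (less x)
    have IH: "(DL y \<subseteq> B \<longrightarrow> M y = s \<cdot> y) \<and> (DR y \<subseteq> A \<longrightarrow> M y = y \<cdot> s)" if "y \<preceq> w" "len y < len x" "s \<notin> supp y" for y
      using less.IH[OF le_C1[OF that(1)] that(2,1,3)] .
    show ?case using sfree_core[OF less.prems _ IH] sfree_core'[OF less.prems, OF _ conj_commute[THEN iffD1, OF IH]] by blast
  qed
qed

text \<open>All left descents of \<open>w\<close> are good. A right descent outside \<open>A\<close>
  is good as well, and \<open>two_tops\<close> selects one of the two. If all right descents lie in
  \<open>A\<close>, a letter of \<open>B\<close> would conflict with \<open>BsA\<close> or
  \<open>sfree\<close>; so \<open>B\<close> is empty, \<open>M\<close> is right multiplication by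
  \<open>s\<close> on every dihedral interval, and \<open>eq_mult_r\<close> extends this to all of
  \<open>[e,w]\<close>.\<close>

lemma settled_one_sided: assumes e0: "\<And>c. c \<in> S \<Longrightarrow> c \<preceq> w \<Longrightarrow> rho c \<or> lam c" and D: "DL w \<inter> B = {}" shows settled
proof -
  have all: "rho c \<or> lam c" if "c \<in> S" for c using e0 rho_out that by blast
  have rA: "rho c" if "c \<in> A" for c
  proof (rule ccontr)
    assume "\<not> rho c"
    then have "lam c" using e0 AD that by blast
    moreover have "supp c \<subseteq> {s,c}" using AD(1)[OF that] by simp
    ultimately have "M c = s \<cdot> c" using AD(2)[OF that] unfolding lam_def by blast
    then show False using AD[OF that] by simp
  qed
  have lB: "lam c" if "c \<in> B" for c
  proof (rule ccontr)
    assume "\<not> lam c"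
    then have "rho c" using e0 BD that by blast
    moreover have "supp c \<subseteq> {s,c}" using BD(1)[OF that] by simp
    ultimately have "M c = c \<cdot> s" using BD(2)[OF that] unfolding rho_def by blast
    then show False using BD[OF that] by simp
  qed
  have gL: "goodL r" if "r \<in> DL w" for r
  proof -
    have rw: "r \<in> S" "r \<preceq> w" using DL_supp[OF that wC] unfolding supp_def by blast+
    have "r \<notin> B" using D that by blast
    with cases_ABK[OF rw] show ?thesis
    proof (elim disjE)
      assume 1: "r = s"
      have "lam c \<or> rho c" if "c \<in> S" for c using all[OF that] by blast
      from goodL_s[OF this] show ?thesis unfolding 1 .
    next
      assume 2: "r \<in> A"
      show ?thesis by (rule goodL_rho[OF AD(1,3)[OF 2] rA[OF 2]])
    next
      assume 3: "r \<in> K"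
      show ?thesis by (rule goodL_rho[OF KD(1,3)[OF 3] rho_K[OF 3]])
    qed simp
  qed
  show ?thesis
  proof (cases "\<exists>q\<in>DR w. q \<notin> A")
    case True
    then obtain q where q: "q \<in> DR w" "q \<notin> A" by blast
    have qS: "q \<in> S" "q \<preceq> w" using DR_supp[OF q(1) wC] by (auto simp: supp_def)
    from cases_ABK[OF qS] q(2) have gq: "goodR q"
    proof (elim disjE)
      assume 1: "q = s"
      from goodR_s[OF all] show ?thesis unfolding 1 .
    next
      assume 2: "q \<in> B"
      show ?thesis by (rule goodR_lam[OF BD(1,3)[OF 2] lB[OF 2]])
    next
      assume 3: "q \<in> K"
      show ?thesis by (rule goodR_lam[OF KD(1,3)[OF 3] lam_K[OF 3]])
    qed simp
    show ?thesis
    proof (cases "w \<cdot> q = e")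
      case True
      then have "w = q" using cancel_r[OF qS(1) wC] qS by simp
      then have "supp w \<subseteq> {q,q}" using qS by simp
      then show ?thesis using qS unfolding settled_def by blast
    next
      case False
      then obtain r where r: "r \<in> DL (w \<cdot> q)" using ex_DL qS by fastforce
      note tt = two_tops[OF wC q(1) False r]
      then have "goodL r" using gL by blast
      then show ?thesis using gq tt q unfolding settled_def by metis
    qed
  next
    case False
    then have RA: "DR w \<subseteq> A" by blast
    have "B = {}"
    proof (rule ccontr)
      assume "B \<noteq> {}"
      then obtain c where c: "c \<in> B" by blast
      note b = BD[OF c]
      \<comment> \<open>The factor \<open>g\<close> can only end in \<open>s\<close>, while
        \<open>h\<close> is free of \<open>s\<close>, so that \<open>sfree\<close> determines
        \<open>M h\<close>.\<close>
      obtain g h where gh: "g \<in> C" "h \<in> C" "w = g \<cdot> h" "adds g h" "supp h \<subseteq> S - {s}" "DR g \<inter> (S - {s}) = {}"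
        using parab[OF wC, of "S - {s}"] by blast
      have hA: "DR h \<subseteq> A" using DR_adds[OF gh(4,2,1)] gh(3) RA by auto
      have hw: "h \<preceq> w" "g \<preceq> w" using le_adds_r[of g h] le_adds_l[of g h] gh by auto
      have sh: "s \<notin> supp h" using gh by blast
      have "h \<noteq> e"
      proof
        assume "h = e"
        then have "DR w \<subseteq> {s}" using gh DR_S by auto
        moreover have "w \<noteq> e" using b(1,2) le_e e_notin_S by metis
        ultimately have "s \<in> A" using RA ex_DR[OF wC] by blast
        then show False using AD by blast
      qed
      then obtain t where t: "t \<in> DR h" using ex_DR gh by blast
      then have tA: "t \<in> A" using hA by blast
      have Mh: "M h = h \<cdot> s" using sfree[OF hw(1) sh] hA by blast
      have cgh: "c \<in> supp g \<union> supp h" using supp_adds[OF gh(4,1,2)] gh(3) b by (auto simp: supp_def)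
      show False
      proof (cases "c \<in> supp g")
        case True
        then have cg: "c \<preceq> g" by (simp add: supp_def)
        have "g \<noteq> e" using True by auto
        then obtain f where "f \<in> DR g" using ex_DR gh by blast
        then have "s \<in> DR g" using gh(6) DR_S by auto
        then have "c \<cdot> s \<preceq> g" using liftR2[OF cg] by blast
        moreover have "t \<preceq> h" using DR_supp[OF t gh(2)] by (simp add: supp_def)
        ultimately have "(c \<cdot> s) \<cdot> t \<preceq> w" using mul_mono gh by metis
        then show False using BsA[OF c tA] AD[OF tA] b by (simp add: assoc)
      next
        case False
        then have ch: "c \<preceq> h" using cgh by (auto simp: supp_def)
        have "s \<cdot> c \<preceq> h \<cdot> s" using Mmono[OF ch hw(1) up_gen[OF b(1-3)] sfree_up[OF hw(1) sh]] b Mh by simp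
        moreover have "s \<in> DR (h \<cdot> s)" using not_supp_DR[OF gh(2) sh] gh by simp
        moreover have "s \<notin> DR (s \<cdot> c)" using DR_two[of c s] b s_S by auto
        ultimately have "s \<cdot> c \<preceq> h" using liftR1[of "s \<cdot> c" "h \<cdot> s" s] gh by simp
        then have "s \<in> supp h" using supp_mono[of "s \<cdot> c" h] supp_supp_l[of c s] b by auto
        then show False using sh by blast
      qed
    qed
    then have rho: "rho c" if "c \<in> S" "c \<noteq> s" for c using cases_ABK[OF that(1)] rA rho_K rho_out[OF that(1)] that by blast
    have "M x = x \<cdot> s" if "x \<preceq> w" "c \<in> S" "supp x \<subseteq> {s,c}" "up x" for x c
      using rho[OF that(2)] rho_s that unfolding rho_def by (cases "c = s") blast+
    then have "M x = x \<cdot> s" if "x \<preceq> w" for x using eq_mult_r[OF le_refl[OF wC] _ that] by blast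
    then show ?thesis unfolding settled_def by blast
  qed
qed
lemmas settled_one_sided' = spm.settled_one_sided[OF dualM, unfolded dualM_defs2]

text \<open>If \<open>w\<close> began with some \<open>c \<in> B\<close> and ended with some
  \<open>t \<in> A\<close>, then \<open>s \<le> w\<close> would lift to
  \<open>c s t \<le> w\<close>, against \<open>BsA\<close>. So one of the two one-sided cases
  occurs.\<close>

lemma settled_mult: assumes "\<And>c. c \<in> S \<Longrightarrow> c \<preceq> w \<Longrightarrow> rho c \<or> lam c" shows settled
proof (cases "DL w \<inter> B = {}")
  case True
  then show ?thesis using settled_one_sided assms by blast
next
  case False
  then obtain c where c: "c \<in> DL w" "c \<in> B" by blast
  note b = BD[OF c(2)]
  have "DR w \<inter> A = {}"
  proof (rule ccontr)
    assume "DR w \<inter> A \<noteq> {}"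
    then obtain t where t: "t \<in> DR w" "t \<in> A" by blast
    note a = AD[OF t(2)]
    have "c \<cdot> s \<preceq> w" using liftL2[OF s_w c(1)] .
    then have "c \<cdot> s \<cdot> t \<preceq> w" using liftR2 t by blast
    then show False using BsA[OF c(2) t(2)] a b by (simp add: assoc)
  qed
  then show ?thesis using settled_one_sided' assms by blast
qed

end

section \<open>Inserting a new letter into a dihedral element\<close>

context cox begin

lemma comm_all: assumes "v \<in> C" "c \<in> S" "\<And>h. h \<in> supp v \<Longrightarrow> h \<cdot> c = c \<cdot> h" shows "c \<cdot> v = v \<cdot> c"
  using assms(1,3)
proof (induction v rule: len_induct)
  case (less v)
  show ?case
  proof (cases "v = e")
    case False
    then obtain g where g: "g \<in> DL v" using ex_DL less.hyps by blast
    then obtain v1 where v1: "v1 \<in> C" "v = g \<cdot> v1" "g \<notin> DL v1" "len v = Suc (len v1)" and gS: "g \<in> S"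
      using factor_l[of g v] DL_S less.hyps by blast
    have sv: "supp v = insert g (supp v1)" using supp_up_l gS v1 by simp
    have "c \<cdot> v1 = v1 \<cdot> c" using less.IH[OF v1(1)] v1(4) less.prems sv by simp
    moreover have "g \<cdot> c = c \<cdot> g" using less.prems sv by simp
    ultimately show ?thesis using v1 gS assms(2) by (metis assoc S_C)
  qed (use assms(2) in simp)
qed

text \<open>A left descent of \<open>c x\<close> in \<open>{s,t}\<close> commutes with
  \<open>c\<close>, so there is at most one. After its removal \<open>min_le_l\<close> discards
  \<open>v\<close>, and lifting cancels \<open>c\<close>.\<close>

lemma insert_cancel: assumes c: "c \<in> S" "c \<notin> {s,t}" and nc: "\<not> (s \<cdot> c = c \<cdot> s \<and> t \<cdot> c = c \<cdot> t)"
  and X: "x \<in> C" "x1 \<in> C" "v \<in> C" "supp x \<subseteq> {s,t}" "supp x1 \<subseteq> {s,t}" "supp v \<subseteq> {s,t}"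
  and le: "c \<cdot> x \<preceq> v \<cdot> (c \<cdot> x1)"
  shows "x \<preceq> x1 \<or> (\<exists>h\<in>DL x. h \<cdot> x \<preceq> x1)"
proof -
  have fin: "z \<preceq> x1" if z: "z \<in> C" "supp z \<subseteq> {s,t}" "c \<cdot> z \<preceq> c \<cdot> x1" for z
  proof -
    have "c \<in> DL (c \<cdot> z)" "c \<in> DL (c \<cdot> x1)" using not_supp_DL[of _ c] z X c by auto
    then have "c \<cdot> (c \<cdot> z) \<preceq> c \<cdot> (c \<cdot> x1)" using liftL3[OF z(3)] by blast
    then show ?thesis using z X c by simp
  qed
  have cx: "c \<notin> supp x" using X c by auto
  show ?thesis
  proof (cases "DL (c \<cdot> x) \<inter> {s,t} = {}")
    case True
    then have "c \<cdot> x \<preceq> c \<cdot> x1" using min_le_l[of "c \<cdot> x" v "c \<cdot> x1" "{s,t}"] le X c by simp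
    then show ?thesis using fin X by blast
  next
    case False
    then obtain h where h: "h \<in> DL (c \<cdot> x)" "h \<in> {s,t}" by blast
    have hd: "h \<cdot> c = c \<cdot> h" "h \<in> DL x" using DL_new[OF X(1) c(1) cx h(1)] h(2) c by auto
    have hS: "h \<in> S" using h DL_S by blast
    let ?z = "h \<cdot> x"
    have z: "?z \<in> C" "supp ?z \<subseteq> {s,t}" "c \<notin> supp ?z" using hS X supp_down_l[OF hd(2) X(1)] cx by auto
    have "c \<cdot> ?z = h \<cdot> (c \<cdot> x)" using hd hS c X by (metis assoc S_C)
    then have "c \<cdot> ?z \<preceq> c \<cdot> x" using down_l[OF h(1)] c X by simp
    then have "c \<cdot> ?z \<preceq> v \<cdot> (c \<cdot> x1)" using le_trans[OF _ le] by blast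
    moreover have "DL (c \<cdot> ?z) \<inter> {s,t} = {}"
    proof (rule ccontr)
      assume "DL (c \<cdot> ?z) \<inter> {s,t} \<noteq> {}"
      then obtain k where k: "k \<in> DL (c \<cdot> ?z)" "k \<in> {s,t}" by blast
      have "k \<cdot> c = c \<cdot> k" "k \<in> DL ?z" using DL_new[OF z(1) c(1) z(3) k(1)] k(2) c by auto
      moreover have "k \<noteq> h" using \<open>k \<in> DL ?z\<close> hd hS X by auto
      ultimately show False using nc hd k(2) h(2) by auto
    qed
    ultimately have "c \<cdot> ?z \<preceq> c \<cdot> x1" using min_le_l[of "c \<cdot> ?z" v "c \<cdot> x1" "{s,t}"] X c by simp
    then show ?thesis using fin z hd by blast
  qed
qed

end

context spm begin

text \<open>This propagates left multiplication to a cover with a new letter \<open>c\<close>.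
  \<open>M e0\<close> lies above \<open>M g = f g\<close>. Removing a left descent \<open>h\<close>
  other than \<open>f\<close> would leave exactly \<open>f g\<close>; then \<open>h\<close> must be
  \<open>c\<close>, and \<open>e0\<close> lies below \<open>f g\<close>, which lacks
  \<open>c\<close>. So \<open>f\<close> is the only left descent of \<open>M e0\<close>, and
  removing it leaves \<open>e0\<close>.\<close>

lemma ns_l: assumes g: "g \<preceq> w" "up g" "M g = f \<cdot> g" "DL (f \<cdot> g) = {f}"
  and e0: "e0 \<preceq> w" "cov g e0" and c: "c \<in> supp e0" "c \<notin> supp g" "c \<noteq> s" "c \<notin> DL e0"
  shows "M e0 = f \<cdot> e0 \<and> up e0"
proof -
  have fS: "f \<in> S" using g(4) DL_S by blast
  have cS: "c \<in> S" using c supp_S by blast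
  have gC: "g \<in> C" "e0 \<in> C" using g(1) e0(1) le_C1 by blast+
  have cM: "c \<notin> supp (f \<cdot> g)" using supp_M[OF g(1)] g(3) c by auto
  then have ne: "M g \<noteq> e0" using g(3) c(1) by auto
  let ?y = "M e0"
  have le: "f \<cdot> g \<preceq> ?y" using M_sp[OF e0(2,1) ne] g(3) by simp
  have lg: "len (f \<cdot> g) = Suc (len g)" "len e0 = Suc (len g)" using up_len[OF g(1,2)] g(3) covD(2)[OF e0(2)] by auto
  have up: "up e0" using le_len_le[OF le] lg dn_len[OF e0(1)] by fastforce
  have ly: "len ?y = Suc (len e0)" using up_len[OF e0(1) up] .
  have yC: "?y \<in> C" using M_C[OF e0(1)] .
  have ey: "e0 \<preceq> ?y" using up_leM[OF e0(1) up] .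
  have only: "h = f" if h: "h \<in> DL ?y" for h
  proof (rule ccontr)
    assume hf: "h \<noteq> f"
    have hS: "h \<in> S" using h DL_S by blast
    have "f \<cdot> g \<preceq> h \<cdot> ?y" using liftL1[OF le h] g(4) hf by simp
    then have hy: "f \<cdot> g = h \<cdot> ?y" using le_eq[of "f \<cdot> g" "h \<cdot> ?y"] DL_len[OF h yC] ly lg by simp
    have "c \<in> supp ?y" using supp_mono[OF ey] c(1) by blast
    moreover have "?y = h \<cdot> (f \<cdot> g)" using hy cancel_l[OF hS yC] by simp
    ultimately have "c \<in> insert h (supp (f \<cdot> g))" using supp_mul[of h "f \<cdot> g"] hS fS gC by auto
    then have ch: "c = h" using cM by blast
    have "e0 \<preceq> h \<cdot> ?y" using liftL1[OF ey h] c(4) ch by blast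
    then show False using supp_mono[of e0 "h \<cdot> ?y"] hy c(1) cM by auto
  qed
  have "?y \<noteq> e" using ly len_e0 by (metis Zero_not_Suc)
  then obtain h where "h \<in> DL ?y" using ex_DL[OF yC] by blast
  then have fy: "f \<in> DL ?y" using only by blast
  have "f \<notin> DL g" using lg by (simp add: DL_def)
  have "f \<notin> DL e0"
  proof
    assume "f \<in> DL e0"
    then have "f \<cdot> g \<preceq> e0" using liftL2[OF covD(1)[OF e0(2)]] by blast
    then have "f \<cdot> g = e0" using le_eq lg by simp
    then show False using ne g(3) by simp
  qed
  then have "e0 \<preceq> f \<cdot> ?y" using liftL1[OF ey fy] by blast
  then have "e0 = f \<cdot> ?y" using le_eq[of e0 "f \<cdot> ?y"] DL_len[OF fy yC] ly by simp
  then have "f \<cdot> e0 = ?y" using cancel_l[OF fS yC] by simp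
  then show ?thesis using up by simp
qed
lemmas ns_r = spm.ns_l[OF dualM, unfolded dualM_defs2]

end

subsection \<open>Matchings that are no multiplication on some dihedral interval\<close>

text \<open>Here \<open>u\<close> is minimal among the elements of the parabolic subgroup of \<open>s, t\<close> that \<open>M\<close> raises but does
  not multiply by \<open>s\<close> on the right; then \<open>M u = pu\<close> multiplies it on the other side.\<close>

locale spmU = spm C mul e S len le M w
  for C :: "'a set" and mul :: "'a \<Rightarrow> 'a \<Rightarrow> 'a" (infixl "\<cdot>" 70) and e :: 'a
    and S :: "'a set" and len :: "'a \<Rightarrow> nat" and le :: "'a \<Rightarrow> 'a \<Rightarrow> bool" (infix "\<preceq>" 50)
    and M :: "'a \<Rightarrow> 'a" and w :: 'a +
  fixes t u p p' :: 'a
  assumes tA: "t \<in> A" and u_w: "u \<preceq> w" and u_up: "up u" and u_supp: "supp u \<subseteq> {s,t}"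
    and Mu: "M u = p \<cdot> u" and pp: "{p,p'} = {s,t}" "p \<noteq> p'" and DLu: "DL u = {p'}" and DRu: "DR u = {t}"
    and DLpu: "DL (p \<cdot> u) = {p}" and DRpu: "DR (p \<cdot> u) = {t}"
    and below: "\<And>x. x \<preceq> w \<Longrightarrow> supp x \<subseteq> {s,t} \<Longrightarrow> len x < len u \<Longrightarrow> M x = x \<cdot> s"
    and n2: "2 \<le> len u"

context spm begin

lemma spmU_I: "t \<in> A \<Longrightarrow> u \<preceq> w \<Longrightarrow> up u \<Longrightarrow> supp u \<subseteq> {s,t} \<Longrightarrow> M u = p \<cdot> u \<Longrightarrow> {p,p'} = {s,t} \<Longrightarrow> p \<noteq> p' \<Longrightarrow>
   DL u = {p'} \<Longrightarrow> DR u = {t} \<Longrightarrow> DL (p \<cdot> u) = {p} \<Longrightarrow> DR (p \<cdot> u) = {t} \<Longrightarrow>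
   (\<And>x. x \<preceq> w \<Longrightarrow> supp x \<subseteq> {s,t} \<Longrightarrow> len x < len u \<Longrightarrow> M x = x \<cdot> s) \<Longrightarrow> 2 \<le> len u \<Longrightarrow>
   spmU C mul e S len le M w t u p p'"
  by (intro spmU.intro spmU_axioms.intro spm_axioms) assumption+

text \<open>Choose \<open>u\<close> shortest with \<open>M u \<noteq> u s\<close>. The two sides
  have the same length in a dihedral group, so they share neither the first nor the last letter.
  Hence \<open>M u\<close> ends in \<open>t\<close> and begins with the letter that \<open>u\<close>
  does not begin with, which makes it \<open>p u\<close>.\<close>

lemma ex_spmU: assumes tA: "t \<in> A" and n: "\<not> rho t"
  shows "\<exists>u p p'. spmU C mul e S len le M w t u p p'"
proof -
  note a = AD[OF tA]
  define P where "P x \<longleftrightarrow> x \<preceq> w \<and> supp x \<subseteq> {s,t} \<and> M x \<noteq> x \<cdot> s" for x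
  have "\<exists>x. P x" using n unfolding rho_def P_def by blast
  then obtain u where u: "P u" "\<And>x. P x \<Longrightarrow> len u \<le> len x" using ex_has_least_nat[of P _ len] by blast
  have uw: "u \<preceq> w" and us: "supp u \<subseteq> {s,t}" and nu: "M u \<noteq> u \<cdot> s" using u(1) by (auto simp: P_def)
  have uC: "u \<in> C" using uw le_C1 by blast
  have below: "M x = x \<cdot> s" if "x \<preceq> w" "supp x \<subseteq> {s,t}" "len x < len u" for x
    using u(2)[of x] that unfolding P_def by fastforce
  have sM: "supp (M u) \<subseteq> {s,t}" using supp_M[OF uw] us by auto
  have MC: "M u \<in> C" using M_C[OF uw] .
  have upu: "up u"
  proof (rule ccontr)
    assume d: "\<not> up u"
    have "M (M u) = M u \<cdot> s" using below[OF M_le[OF uw] sM] dn_len[OF uw d] by simp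
    then have "u \<cdot> s = M u \<cdot> s \<cdot> s" using MM[OF uw] by simp
    then show False using nu MC by simp
  qed
  have ne: "u \<noteq> e" using nu by auto
  have snu: "s \<notin> DR u"
  proof
    assume d: "s \<in> DR u"
    have v: "u \<cdot> s \<preceq> w" using le_trans[OF down_r[OF d uC] uw] .
    have "M (u \<cdot> s) = u \<cdot> s \<cdot> s" using below[OF v] supp_down_r[OF d uC] us DR_len[OF d uC] by auto
    then have "M (u \<cdot> s) = u" using uC by simp
    then show False using MM[OF v] nu by simp
  qed
  have DRu: "DR u = {t}" using DR_pair[OF uC us] ex_DR[OF uC ne] snu by blast
  have lM: "len (M u) = Suc (len u)" using up_len[OF uw upu] .
  have lus: "len (u \<cdot> s) = Suc (len u)" using nDR_len[OF s_S snu uC] .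
  have sus: "supp (u \<cdot> s) \<subseteq> {s,t}" using supp_mul_S[OF s_S uC] us by auto
  have usC: "u \<cdot> s \<in> C" using uC by simp
  have disj: "h \<notin> DL (M u)" if h: "h \<in> DL u" for h
  proof
    assume hM: "h \<in> DL (M u)"
    have "adds u s" using lus by (simp add: adds_def)
    then have "h \<in> DL (u \<cdot> s)" using DL_adds[OF _ uC _ h] by simp
    then have "M u = u \<cdot> s" using dih_eq[OF MC usC sM sus _ hM] lM lus by simp
    then show False using nu by blast
  qed
  have "M u \<noteq> e" using lM len_e0 by (metis Zero_not_Suc)
  then obtain p where p: "p \<in> DL (M u)" using ex_DL[OF MC] by blast
  obtain p' where p': "p' \<in> DL u" using ex_DL[OF uC ne] by blast
  have pp: "p \<in> {s,t}" "p' \<in> {s,t}" "p \<noteq> p'" using DL_pair[OF MC sM] DL_pair[OF uC us] p p' disj by blast+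
  have pS: "p \<in> S" using p DL_S by blast
  have pu: "p \<notin> DL u" using disj p by blast
  have "u \<preceq> p \<cdot> M u" using liftL1[OF up_leM[OF uw upu] p pu] .
  then have "u = p \<cdot> M u" using le_eq[of u "p \<cdot> M u"] DL_len[OF p MC] lM by simp
  then have Mu: "M u = p \<cdot> u" using cancel_l[OF pS MC] by simp
  have DLu: "DL u = {p'}" using DL_pair[OF uC us] p' pu pp by auto
  have DLM: "DL (M u) = {p}" using DL_pair[OF MC sM] p disj[OF p'] pp by auto
  have "s \<notin> DR (M u)"
  proof
    assume "s \<in> DR (M u)"
    moreover have "s \<in> DR (u \<cdot> s)" using snu uC by simp
    ultimately have "M u = u \<cdot> s" using dih_eq_r[OF MC usC sM sus] lM lus by simp
    then show False using nu by blast
  qed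
  then have DRM: "DR (M u) = {t}" using DR_pair[OF MC sM] ex_DR[OF MC \<open>M u \<noteq> e\<close>] by blast
  have n2: "2 \<le> len u"
  proof (rule ccontr)
    assume "\<not> 2 \<le> len u"
    then have "len u = 1" using len_e[OF uC] ne by linarith
    then have "u \<in> S" using len1 uC by blast
    then have "u = t" using DRu by simp
    then show False using nu a(4) by simp
  qed
  have "spmU C mul e S len le M w t u p p'"
  proof (rule spmU_I[OF tA uw upu us Mu _ pp(3) DLu DRu _ _ below n2])
    show "{p,p'} = {s,t}" using pp by auto
    show "DL (p \<cdot> u) = {p}" "DR (p \<cdot> u) = {t}" using DLM DRM Mu by simp_all
  qed
  then show ?thesis by blast
qed

text \<open>If \<open>M\<close> lowered \<open>z\<close>, then \<open>M z\<close> would still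
  dominate \<open>u\<close> and \<open>v\<close>. Above \<open>u\<close>, the letter
  \<open>c\<close> is no left descent because of \<open>BsA\<close>; a left descent of
  \<open>z\<close> besides \<open>p'\<close> could be removed by lifting, against minimality.
  Removing from \<open>M z\<close> a left descent other than \<open>p\<close> would give another
  minimal dominating element, and then \<open>p'\<close> could be removed from that as well.\<close>

lemma min_dominating: assumes c: "c \<in> B" and t: "t \<in> A"
  and u: "u \<preceq> w" "up u" "M u = p \<cdot> u" "DL (p \<cdot> u) = {p}" "DL u = {p'}" "s \<cdot> t \<preceq> u" "p \<noteq> p'" "c \<noteq> p'"
  and v: "v \<preceq> w" "up v" "DL v = {c}" "DL (M v) = {c}"
  and z: "z \<preceq> w" "u \<preceq> z" "v \<preceq> z" "\<And>z'. z' \<preceq> w \<Longrightarrow> u \<preceq> z' \<Longrightarrow> v \<preceq> z' \<Longrightarrow> len z \<le> len z'"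
  shows "up z \<and> DL z = {p'} \<and> M z = p \<cdot> z"
proof -
  note b = BD[OF c] and a = AD[OF t]
  have zC: "z \<in> C" using z(1) le_C1 by blast
  have upz: "up z"
  proof (rule ccontr)
    assume d: "\<not> up z"
    have "len z \<le> len (M z)" using z(4)[OF M_le[OF z(1)] Mlift2[OF z(2,1) d u(2)] Mlift2[OF z(3,1) d v(2)]] .
    then show False using dn_len[OF z(1) d] by simp
  qed
  have cn: "c \<notin> DL x" if x: "x \<preceq> w" "u \<preceq> x" for x
  proof
    assume "c \<in> DL x"
    then have "c \<cdot> (s \<cdot> t) \<preceq> x" using liftL2[OF le_trans[OF u(6) x(2)]] by blast
    then show False using BsA[OF c t] le_trans[OF _ x(1)] by blast
  qed
  have mini: "DL x = {p'}" if x: "x \<preceq> w" "u \<preceq> x" "v \<preceq> x" "len x = len z" for x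
  proof -
    have xC: "x \<in> C" using x(1) le_C1 by blast
    have "h = p'" if h: "h \<in> DL x" for h
    proof (rule ccontr)
      assume hp: "h \<noteq> p'"
      have hc: "h \<noteq> c" using cn[OF x(1,2)] h by blast
      have "u \<preceq> h \<cdot> x" "v \<preceq> h \<cdot> x" using liftL1[OF x(2) h] liftL1[OF x(3) h] u(5) v(3) hp hc by auto
      then have "len z \<le> len (h \<cdot> x)" using z(4)[OF le_trans[OF down_l[OF h xC] x(1)]] by blast
      then show False using DL_len[OF h xC] x(4) by simp
    qed
    moreover have "x \<noteq> e" using x(2) le_e u(5) DL_e by blast
    ultimately show ?thesis using ex_DL[OF xC] by blast
  qed
  let ?y = "M z"
  have yC: "?y \<in> C" and yw: "?y \<preceq> w" using M_C[OF z(1)] M_le[OF z(1)] by auto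
  have ly: "len ?y = Suc (len z)" and zy: "z \<preceq> ?y" using up_len[OF z(1) upz] up_leM[OF z(1) upz] by auto
  have m: "p \<cdot> u \<preceq> ?y" "M v \<preceq> ?y" using Mmono[OF z(2,1) u(2) upz] Mmono[OF z(3,1) v(2) upz] u(3) by auto
  have pS: "p \<in> S" using u(4) DL_S by blast
  have p'S: "p' \<in> S" using u(5) DL_S by blast
  have upu: "u \<preceq> p \<cdot> u" using up_leM[OF u(1,2)] u(3) by simp
  have vMv: "v \<preceq> M v" using up_leM[OF v(1,2)] .
  have only: "h = p" if h: "h \<in> DL ?y" for h
  proof (rule ccontr)
    assume hp: "h \<noteq> p"
    have hc: "h \<noteq> c" using cn[OF yw le_trans[OF z(2) zy]] h by blast
    have l1: "p \<cdot> u \<preceq> h \<cdot> ?y" "M v \<preceq> h \<cdot> ?y" using liftL1[OF m(1) h] liftL1[OF m(2) h] u(4) v(4) hp hc by auto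
    let ?x = "h \<cdot> ?y"
    have x: "?x \<preceq> w" "u \<preceq> ?x" "v \<preceq> ?x" "len ?x = len z"
      using le_trans[OF down_l[OF h yC] yw] le_trans[OF upu l1(1)] le_trans[OF vMv l1(2)] DL_len[OF h yC] ly by auto
    have xC: "?x \<in> C" using x(1) le_C1 by blast
    have d: "p' \<in> DL ?x" using mini[OF x] by blast
    have "p \<cdot> u \<preceq> p' \<cdot> ?x" using liftL1[OF l1(1) d] u(4,7) by auto
    then have "u \<preceq> p' \<cdot> ?x" using le_trans[OF upu] by blast
    moreover have "v \<preceq> p' \<cdot> ?x" using liftL1[OF x(3) d] v(3) u(8) by auto
    ultimately have "len z \<le> len (p' \<cdot> ?x)" using z(4)[OF le_trans[OF down_l[OF d xC] x(1)]] by blast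
    then show False using DL_len[OF d xC] x(4) by simp
  qed
  have "?y \<noteq> e" using ly len_e0 by (metis Zero_not_Suc)
  then obtain h where "h \<in> DL ?y" using ex_DL[OF yC] by blast
  then have py: "p \<in> DL ?y" using only by blast
  have Dz: "DL z = {p'}" using mini[OF z(1-3)] by simp
  have "z \<preceq> p \<cdot> ?y" using liftL1[OF zy py] Dz u(7) by auto
  then have "z = p \<cdot> ?y" using le_eq[of z "p \<cdot> ?y"] DL_len[OF py yC] ly by simp
  then have "?y = p \<cdot> z" using cancel_l[OF pS yC] by simp
  then show ?thesis using upz Dz by blast
qed
lemmas min_dominating' = spm.min_dominating[OF dualM, unfolded dualM_defs2]

end

section \<open>Restrictions on the elements below w imposed by u\<close>

context spmU begin

lemma J: "t \<in> S" "t \<noteq> s" "t \<cdot> s \<noteq> s \<cdot> t" "p \<in> S" "p' \<in> S" "p \<in> {s,t}" "p' \<in> {s,t}" "u \<in> C" "t \<preceq> w" "M t = t \<cdot> s"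
proof -
  show "t \<in> S" "t \<noteq> s" "t \<cdot> s \<noteq> s \<cdot> t" "t \<preceq> w" "M t = t \<cdot> s" using AD[OF tA] by auto
  show "u \<in> C" using u_w by (rule le_C1)
  show p: "p \<in> {s,t}" "p' \<in> {s,t}" using pp(1) by blast+
  show "p \<in> S" "p' \<in> S" using p s_S AD(1)[OF tA] by blast+
qed

lemma u_facts: "s \<cdot> t \<preceq> u" "s \<in> supp u" "t \<in> supp u"
proof -
  have t: "t \<in> DR u" using DRu by simp
  show "t \<in> supp u" using DR_supp t J by blast
  have "u \<cdot> t \<noteq> e" using DR_len[OF t J(8)] n2 len_e0 by fastforce
  then obtain h where h: "h \<in> DR (u \<cdot> t)" using ex_DR[of "u \<cdot> t"] J by auto
  have d: "u \<cdot> t \<preceq> u" using down_r[OF t J(8)] .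
  have "h \<in> supp (u \<cdot> t)" using DR_supp[OF h] J by simp
  then have "h \<in> {s,t}" using supp_mono[OF d] u_supp by blast
  moreover have "h \<noteq> t" using h t J by auto
  ultimately have "s \<in> supp (u \<cdot> t)" using \<open>h \<in> supp (u \<cdot> t)\<close> by auto
  then show "s \<in> supp u" using supp_mono[OF d] by blast
  then have "s \<preceq> u" by (simp add: supp_def)
  then show "s \<cdot> t \<preceq> u" using liftR2 t by blast
qed

lemma len_pu: "len (p \<cdot> u) = Suc (len u)" using up_len[OF u_w u_up] Mu by simp

lemma uc_comm: assumes "c \<in> S" "c \<notin> {s,t}" "c \<in> DL (u \<cdot> c)" shows "s \<cdot> c = c \<cdot> s \<and> t \<cdot> c = c \<cdot> t"
proof -
  have cu: "c \<notin> supp u" using assms u_supp by blast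
  have "u \<cdot> c = c \<cdot> u" using DL_new2[of u c c] assms cu not_supp_DL not_supp_DR J by auto
  then show ?thesis using comm_supp[OF J(8) assms(1) cu] u_facts by simp
qed

lemma M_uc: assumes "c \<in> S" "c \<notin> {s,t}" "u \<cdot> c \<preceq> w" "c \<notin> DL (u \<cdot> c)" shows "M (u \<cdot> c) = p \<cdot> (u \<cdot> c) \<and> up (u \<cdot> c)"
proof -
  have cu: "c \<notin> supp u" using assms u_supp by blast
  have "cov u (u \<cdot> c)" using up_r[of c u] nDR_len[of c u] not_supp_DR cu assms J by (auto simp: cov_def)
  moreover have "c \<in> supp (u \<cdot> c)" using supp_supp_r cu assms J by simp
  ultimately show ?thesis using ns_l[OF u_w u_up Mu DLpu assms(3) _ _ cu] assms by blast
qed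

text \<open>\<open>M (u c) = p u c\<close> would lie above \<open>M c = c s\<close>. Its last letter
  \<open>c\<close> is removed by lifting, which leaves \<open>c s\<close> below \<open>p u\<close>,
  an element without \<open>c\<close>.\<close>

lemma uA_not_le: assumes "c \<in> A" "c \<noteq> t" shows "\<not> u \<cdot> c \<preceq> w"
proof
  assume l: "u \<cdot> c \<preceq> w"
  note a = AD[OF assms(1)]
  have c: "c \<notin> {s,t}" using a assms by simp
  have cu: "c \<notin> supp u" using c u_supp by blast
  have "c \<notin> DL (u \<cdot> c)" using uc_comm[OF a(1) c] a by metis
  with M_uc[OF a(1) c l] have m: "M (u \<cdot> c) = p \<cdot> (u \<cdot> c)" "up (u \<cdot> c)" by auto
  have "c \<preceq> u \<cdot> c" using le_adds_r[of u c] adds_DR not_supp_DR cu a J by simp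
  then have le: "c \<cdot> s \<preceq> p \<cdot> u \<cdot> c" using Mmono[OF _ l up_gen[OF a(1-3)] m(2)] m(1) a J by (simp add: assoc)
  have cpu: "c \<notin> supp (p \<cdot> u)" using supp_mul[of p u] J a cu c by auto
  then have d: "c \<in> DR (p \<cdot> u \<cdot> c)" using not_supp_DR J a by simp
  have "c \<notin> DR (c \<cdot> s)" using DR_two[OF s_S a(1,5)] a(3) by simp
  then have "c \<cdot> s \<preceq> p \<cdot> u \<cdot> c \<cdot> c" by (rule liftR1[OF le d])
  then have "c \<cdot> s \<preceq> p \<cdot> u" using cancel_r[OF a(1), of "p \<cdot> u"] J(4,8) by simp
  moreover have "c \<in> supp (c \<cdot> s)" using supp_supp_l[of s c] a(1,3) by simp
  ultimately have "c \<in> supp (p \<cdot> u)" using supp_mono by blast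
  then show False using cpu by blast
qed

text \<open>If \<open>c\<close> commutes with neither part, then it is no descent of
  \<open>y1 c x1\<close> on either side. So \<open>ns_l\<close> gives
  \<open>M (y1 c x1) = p y1 c x1\<close>, and \<open>ns_r\<close> gives
  \<open>M (c x1) = c x1 s\<close> because \<open>x1\<close> is shorter than \<open>u\<close>.
  Monotonicity and \<open>insert_cancel\<close> leave \<open>x1 s\<close> below \<open>x1\<close> up
  to one first letter \<open>h\<close>. For reasons of length \<open>x1 s = h x1\<close>, which
  would make \<open>x1\<close> end in \<open>s\<close> instead of \<open>t\<close>.\<close>

lemma split: assumes u: "u = y1 \<cdot> x1" "adds y1 x1" "y1 \<noteq> e" "x1 \<noteq> e" "y1 \<in> C" "x1 \<in> C"
  and c: "c \<in> S" "c \<notin> {s,t}" and e0w: "y1 \<cdot> (c \<cdot> x1) \<preceq> w"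
  shows "(c \<cdot> u \<preceq> w \<and> (\<forall>h\<in>supp y1. h \<cdot> c = c \<cdot> h)) \<or> (u \<cdot> c \<preceq> w \<and> (\<forall>h\<in>supp x1. h \<cdot> c = c \<cdot> h))"
proof (rule ccontr)
  assume neg: "\<not> ?thesis"
  let ?e = "y1 \<cdot> (c \<cdot> x1)"
  have su: "supp y1 \<subseteq> {s,t}" "supp x1 \<subseteq> {s,t}" using supp_adds[OF u(2,5,6)] u(1) u_supp by auto
  have cn: "c \<notin> supp y1" "c \<notin> supp x1" "c \<notin> supp u" using su c u_supp by blast+
  note ins = insert_len[OF u(5,6,2) c(1) cn(1,2)]
  have eC: "?e \<in> C" using e0w le_C1 by blast
  have le: "len ?e = Suc (len u)" "u \<preceq> ?e" "c \<in> supp ?e" using ins u(1) c by (auto simp: supp_def)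
  have cov: "cov u ?e" using le by (simp add: cov_def)
  have nL: "c \<notin> DL ?e"
  proof
    assume d: "c \<in> DL ?e"
    have "u \<preceq> c \<cdot> ?e" using liftL1[OF le(2) d] not_supp_DL J cn by blast
    then have "u = c \<cdot> ?e" using le_eq[of u "c \<cdot> ?e"] DL_len[OF d eC] le by simp
    then have eq: "?e = c \<cdot> u" using cancel_l[OF c(1) eC] by simp
    then have "(y1 \<cdot> c) \<cdot> x1 = (c \<cdot> y1) \<cdot> x1" using u c by (simp add: assoc)
    then have "y1 \<cdot> c = c \<cdot> y1" using cancel'[of x1 "y1 \<cdot> c" "c \<cdot> y1"] u c by simp
    then have "\<forall>h\<in>supp y1. h \<cdot> c = c \<cdot> h" using comm_supp[OF u(5) c(1) cn(1)] by simp
    then show False using neg eq e0w by simp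
  qed
  have nR: "c \<notin> DR ?e"
  proof
    assume d: "c \<in> DR ?e"
    have "u \<preceq> ?e \<cdot> c" using liftR1[OF le(2) d] not_supp_DR J cn by blast
    then have "u = ?e \<cdot> c" using le_eq[of u "?e \<cdot> c"] DR_len[OF d eC] le by simp
    then have eq: "?e = u \<cdot> c" using cancel_r[OF c(1) eC] by simp
    then have "y1 \<cdot> (c \<cdot> x1) = y1 \<cdot> (x1 \<cdot> c)" using u c by (simp add: assoc)
    then have "c \<cdot> x1 = x1 \<cdot> c" using cancel[of y1 "c \<cdot> x1" "x1 \<cdot> c"] u c by simp
    then have "\<forall>h\<in>supp x1. h \<cdot> c = c \<cdot> h" using comm_supp[OF u(6) c(1) cn(2)] by simp
    then show False using neg eq e0w by simp
  qed
  have nc: "\<not> (s \<cdot> c = c \<cdot> s \<and> t \<cdot> c = c \<cdot> t)"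
  proof
    assume "s \<cdot> c = c \<cdot> s \<and> t \<cdot> c = c \<cdot> t"
    then have "c \<cdot> y1 = y1 \<cdot> c" using comm_all[OF u(5) c(1)] su by auto
    then have "?e = c \<cdot> u" using u c by (simp add: assoc[symmetric])
    then show False using nL not_supp_DL[OF J(8) cn(3)] c J by simp
  qed
  have m: "M ?e = p \<cdot> ?e" "up ?e" using ns_l[OF u_w u_up Mu DLpu e0w cov le(3) cn(3) _ nL] c by auto
  have x1u: "x1 \<preceq> u" using le_adds_r[OF u(2)] u by simp
  have x1w: "x1 \<preceq> w" using le_trans[OF x1u u_w] .
  have lx: "len x1 < len u" using addsD[OF u(2)] u(1,3) len_e[OF u(5)] by simp
  have DRx: "DR x1 = {t}" using DR_adds[OF u(2,6,5)] u(1) DRu ex_DR[OF u(6,4)] by auto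
  have Mx: "M x1 = x1 \<cdot> s" using below[OF x1w su(2) lx] .
  have sx: "s \<notin> DR x1" using DRx J by simp
  have lxs: "len (x1 \<cdot> s) = Suc (len x1)" using nDR_len[OF s_S sx u(6)] .
  have upx: "up x1" using Mx lxs by (simp add: up_def)
  have sxs: "supp (x1 \<cdot> s) \<subseteq> {s,t}" using supp_mul_S[OF s_S u(6)] su by auto
  have spu: "supp (p \<cdot> u) \<subseteq> {s,t}" using supp_M[OF u_w] u_supp Mu by auto
  have "t \<notin> DR (x1 \<cdot> s)"
  proof
    assume "t \<in> DR (x1 \<cdot> s)"
    moreover have "s \<in> DR (x1 \<cdot> s)" using sx u by simp
    ultimately have "len (p \<cdot> u) \<le> len (x1 \<cdot> s)" using dih_longest_r[of "x1 \<cdot> s" "p \<cdot> u" s t] sxs spu u J by simp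
    then show False using len_pu lxs lx by simp
  qed
  then have DRxs: "DR (x1 \<cdot> s) = {s}" using DR_pair[OF _ sxs] sx u by auto
  have lcx: "len (c \<cdot> x1) = Suc (len x1)" using len_supp_l[OF u(6) c(1) cn(2)] .
  have cx: "c \<cdot> x1 \<in> C" "adds c x1" "adds y1 (c \<cdot> x1)" using u(6) c(1) lcx ins addsD[OF u(2)] by (simp_all add: adds_def)
  have cxe: "c \<cdot> x1 \<preceq> ?e" using le_adds_r[OF cx(3)] u cx by simp
  have cxw: "c \<cdot> x1 \<preceq> w" using le_trans[OF cxe e0w] .
  have covx: "cov x1 (c \<cdot> x1)" using up_l[OF c(1) not_supp_DL[OF u(6) cn(2)] u(6)] lcx by (simp add: cov_def)
  have nRx: "c \<notin> DR (c \<cdot> x1)" using DR_adds[OF cx(3,1)] u nR by blast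
  have m1: "M (c \<cdot> x1) = (c \<cdot> x1) \<cdot> s" "up (c \<cdot> x1)"
    using ns_r[OF x1w upx Mx DRxs cxw covx _ cn(2) _ nRx] supp_supp_l cn u c by auto
  have "(c \<cdot> x1) \<cdot> s \<preceq> p \<cdot> ?e" using Mmono[OF cxe e0w m1(2) m(2)] m m1 by simp
  then have main: "c \<cdot> (x1 \<cdot> s) \<preceq> (p \<cdot> y1) \<cdot> (c \<cdot> x1)" using u c J by (simp add: assoc)
  have "supp (p \<cdot> y1) \<subseteq> {s,t}" using supp_mul[of p y1] J u su by auto
  then have "x1 \<cdot> s \<preceq> x1 \<or> (\<exists>h\<in>DL (x1 \<cdot> s). h \<cdot> (x1 \<cdot> s) \<preceq> x1)"
    using insert_cancel[OF c nc _ u(6) _ sxs su(2) _ main] u J by simp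
  then show False
  proof
    assume "x1 \<cdot> s \<preceq> x1"
    then show False using le_len_le lxs by fastforce
  next
    assume "\<exists>h\<in>DL (x1 \<cdot> s). h \<cdot> (x1 \<cdot> s) \<preceq> x1"
    then obtain h where h: "h \<in> DL (x1 \<cdot> s)" "h \<cdot> (x1 \<cdot> s) \<preceq> x1" by blast
    have hS: "h \<in> S" using h DL_S by blast
    have xsC: "x1 \<cdot> s \<in> C" using u by simp
    have eq: "h \<cdot> (x1 \<cdot> s) = x1" using le_eq[OF h(2)] DL_len[OF h(1) xsC] lxs by simp
    have "adds h (h \<cdot> (x1 \<cdot> s))" using adds_DL[OF hS] h hS u by simp
    then have "adds h x1" "h \<cdot> x1 = x1 \<cdot> s" using eq cancel_l[OF hS xsC] by simp_all
    then have "DR x1 \<subseteq> {s}" using DR_adds[of h x1] hS u DRxs by auto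
    then show False using DRx J by simp
  qed
qed

text \<open>A second failure supplies an element \<open>u2\<close> ending in \<open>c\<close>. By
  \<open>two_ends\<close>, \<open>u c\<close> or \<open>u2 t\<close> lies below \<open>w\<close>;
  \<open>uA_not_le\<close> forbids both.\<close>

lemma rho_A: assumes "c \<in> A" "c \<noteq> t" shows "rho c"
proof (rule ccontr)
  assume "\<not> rho c"
  then obtain u2 q q' where "spmU C mul e S len le M w c u2 q q'" using ex_spmU assms by blast
  then interpret c: spmU C mul e S len le M w c u2 q q' .
  show False using two_ends[OF wC DRu c.DRu u_w c.u_w] uA_not_le[OF assms] c.uA_not_le[OF tA] assms by auto
qed

text \<open>A failure supplies a mirrored element \<open>v\<close>. At a shortest \<open>z\<close>
  above \<open>u\<close> and \<open>v\<close>, \<open>M\<close> is both left multiplication by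
  \<open>p\<close> and right multiplication by \<open>q\<close>. From
  \<open>p u \<le> M z = z q\<close>, lifting removes \<open>q\<close> on the right and then
  \<open>p'\<close> on the left. So \<open>p' z\<close> still dominates \<open>u\<close> and
  \<open>v\<close>, against minimality.\<close>

lemma lam_B: assumes "c \<in> B" shows "lam c"
proof (rule ccontr)
  assume "\<not> lam c"
  then obtain v q q' where v: "spmU C (\<lambda>x y. y \<cdot> x) e S len le M w c v q q'"
    using spm.ex_spmU[OF dualM, unfolded dualM_defs2] assms by blast
  note V = spmU.u_w[OF v] spmU.u_up[OF v] spmU.Mu[OF v]
    spmU.DLpu[OF v, unfolded dualM_defs2] spmU.DRpu[OF v, unfolded dualM_defs2] spmU.DLu[OF v, unfolded dualM_defs2]
    spmU.DRu[OF v, unfolded dualM_defs2] spmU.u_facts(1)[OF v] spmU.pp[OF v]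
  note b = BD[OF assms] and a = AD[OF tA]
  have ct: "c \<noteq> t" using AB assms tA by blast
  have q: "q \<in> {s,c}" "q' \<in> {s,c}" using V(9) by auto
  define P where "P z \<longleftrightarrow> z \<preceq> w \<and> u \<preceq> z \<and> v \<preceq> z" for z
  have "P w" using u_w V(1) by (simp add: P_def)
  then obtain z where z: "P z" "\<And>z'. P z' \<Longrightarrow> len z \<le> len z'" using ex_has_least_nat[of P w len] by blast
  have z1: "z \<preceq> w" "u \<preceq> z" "v \<preceq> z" using z(1) by (auto simp: P_def)
  have z2: "len z \<le> len z'" if "z' \<preceq> w" "u \<preceq> z'" "v \<preceq> z'" for z' using z(2)[of z'] that by (simp add: P_def)
  have zC: "z \<in> C" using z1 le_C1 by blast
  have L: "up z" "DL z = {p'}" "M z = p \<cdot> z"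
    using min_dominating[OF assms tA u_w u_up Mu DLpu DLu u_facts(1) pp(2) _ V(1,2) _ _ z1 z2] V pp ct b by auto
  have R: "M z = z \<cdot> q"
    using min_dominating'[OF tA assms V(1,2,3,4,6,8,10) _ u_w u_up DRu _ z1(1,3,2) z2] Mu DRpu q a ct by auto
  have vM: "v \<cdot> q \<preceq> M z" "p \<cdot> u \<preceq> M z" using Mmono[OF z1(3,1) V(2) L(1)] Mmono[OF z1(2,1) u_up L(1)] V(3) Mu by auto
  have p'z: "p' \<in> DL z" using L by simp
  have qS: "q \<in> S" using V(4) DR_S by blast
  have "len (z \<cdot> q) = Suc (len z)" using up_len[OF z1(1) L(1)] R by simp
  then have qz: "q \<in> DR (z \<cdot> q)" using qS zC by (simp add: DR_def)
  have "q \<noteq> t" using q a(3) ct by blast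
  then have "q \<notin> DR (p \<cdot> u)" using DRpu by simp
  then have "p \<cdot> u \<preceq> z \<cdot> q \<cdot> q" using liftR1[OF _ qz] vM(2) R by simp
  then have pz: "p \<cdot> u \<preceq> z" using cancel_r[OF qS zC] by simp
  have "p \<cdot> u \<preceq> p' \<cdot> z" using liftL1[OF pz p'z] DLpu pp by auto
  then have 1: "u \<preceq> p' \<cdot> z" using le_trans[of u "p \<cdot> u"] up_leM[OF u_w u_up] Mu by simp
  have "p' \<notin> DL v" using V(7) pp ct b by auto
  then have 2: "v \<preceq> p' \<cdot> z" using liftL1[OF z1(3) p'z] by blast
  have "len z \<le> len (p' \<cdot> z)" using z2[OF le_trans[OF down_l[OF p'z zC] z1(1)] 1 2] .
  then show False using DL_len[OF p'z zC] by simp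
qed

lemma rho_or_lam: assumes "c \<in> S" "c \<noteq> t" shows "rho c \<or> lam c"
proof (cases "c \<preceq> w")
  case True
  from cases_ABK[OF assms(1) True] show ?thesis
    using rho_s rho_A[OF _ assms(2)] lam_B rho_K by (elim disjE) auto
qed (use rho_out assms in blast)

lemma goodL_A: "c \<in> A \<Longrightarrow> c \<noteq> t \<Longrightarrow> goodL c" using goodL_rho[OF AD(1,3) rho_A] by blast
lemma goodL_K: "c \<in> K \<Longrightarrow> goodL c" using goodL_rho[OF KD(1,3) rho_K] by blast
lemma goodR_K: "c \<in> K \<Longrightarrow> goodR c" using goodR_lam[OF KD(1,3) lam_K] by blast
lemma goodR_B: "c \<in> B \<Longrightarrow> goodR c" using goodR_lam[OF BD(1,3) lam_B] by blast

end

context cox begin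

lemma DR_left_new: assumes "v \<in> C" "c \<in> S" "c \<notin> supp v" "t \<in> supp v" "c \<cdot> t \<noteq> t \<cdot> c" shows "DR (c \<cdot> v) = DR v"
proof
  show "DR (c \<cdot> v) \<subseteq> DR v"
  proof
    fix h assume h: "h \<in> DR (c \<cdot> v)"
    show "h \<in> DR v"
    proof (rule ccontr)
      assume n: "h \<notin> DR v"
      have cv: "c \<cdot> v = v \<cdot> h" using DR_new2[OF assms(1,2) not_supp_DL[OF assms(1,3)] h n] .
      have hS: "h \<in> S" using h DR_S by blast
      have "c \<in> supp (v \<cdot> h)" using supp_supp_l[OF assms(1-3)] cv by simp
      then have "h = c" using supp_mul_S[OF hS assms(1)] assms(3) by auto
      then have "t \<cdot> c = c \<cdot> t" using comm_supp[OF assms(1-3) _ assms(4)] cv by simp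
      then show False using assms(5) by simp
    qed
  qed
  show "DR v \<subseteq> DR (c \<cdot> v)" using DR_adds[of c v] adds_DL[of c v] not_supp_DL assms by auto
qed
lemmas DL_right_new = cox.DR_left_new[OF dual, unfolded dual_defs]

end

section \<open>Good descents from factorizations of w\<close>

context spm begin

text \<open>As \<open>b\<close> is raised, it lies below \<open>M w\<close>. If
  \<open>M w = w q = y0 (b q)\<close>, then \<open>min_le_l\<close> discards \<open>y0\<close> and
  leaves \<open>b \<le> b q\<close>, which is shorter than \<open>b\<close>.\<close>

lemma exitR: assumes "w = y0 \<cdot> b" "y0 \<in> C" "b \<in> C" "supp y0 \<subseteq> I" "DL b \<inter> I = {}" "up b" "q \<in> DR b" "goodR q" shows settled
proof -
  have ad: "adds y0 b" using adds_min_l[OF assms(3,2,4,5)] .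
  have bw: "b \<preceq> w" using le_adds_r[OF ad assms(3,2)] assms(1) by simp
  have qw: "q \<in> DR w" using DR_adds[OF ad assms(3,2,7)] assms(1) by simp
  have qS: "q \<in> S" using assms(7) DR_S by blast
  have "M w \<noteq> w \<cdot> q"
  proof
    assume eq: "M w = w \<cdot> q"
    have "b \<preceq> M w" using Mlift2[OF bw le_refl[OF wC] w_dn assms(6)] .
    then have "b \<preceq> y0 \<cdot> (b \<cdot> q)" using eq assms(1-3) qS by (simp add: assoc)
    then have "b \<preceq> b \<cdot> q" using min_le_l[of b y0 "b \<cdot> q" I] assms qS by simp
    then show False using le_len_le DR_len[OF assms(7,3)] by fastforce
  qed
  then show ?thesis using qw assms(8) unfolding settled_def by blast
qed
lemmas exitL = spm.exitR[OF dualM, unfolded dualM_defs2]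

text \<open>\<open>M (y q)\<close> and \<open>M y q\<close> have the same length in a dihedral group
  but differ, so \<open>M (y q)\<close> ends in \<open>l\<close>. On the other hand
  \<open>y q\<close> does not end in \<open>l\<close>, since it is not longest. Lifting then makes
  \<open>M (y q)\<close> the element \<open>y q\<close> followed by \<open>l\<close>.\<close>

lemma bad_shape: assumes b: "badR q y" and l: "l \<in> S" "l \<noteq> q" "supp (M (y \<cdot> q)) \<subseteq> {q,l}"
  shows "y \<in> C \<and> q \<in> S \<and> up y \<and> q \<notin> DR y \<and> y \<cdot> q \<preceq> w \<and> supp y \<subseteq> {q,l} \<and> supp (M y) \<subseteq> {q,l} \<and> s \<in> {q,l} \<and> up (y \<cdot> q) \<and>
    M (y \<cdot> q) = y \<cdot> q \<cdot> l \<and> DR (M (y \<cdot> q)) = {l} \<and> DR (M y) = {l}"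
proof -
  have cnd: "condR q y" using b by (simp add: badR_def)
  note c = cnd[unfolded condR_def]
  note cu = condR_up[OF cnd]
  have yC: "y \<in> C" "q \<in> S" and yqw: "y \<cdot> q \<preceq> w" and nq: "q \<notin> DR y" and upy: "up y" using c by blast+
  have yw: "y \<preceq> w" using condR_w[OF cnd] .
  have yqC: "y \<cdot> q \<in> C" using yC by simp
  have s: "s \<in> {q,l}" using s_supp_M[OF yqw cu(1)] l by blast
  have syq: "supp (y \<cdot> q) \<subseteq> {q,l}" using supp_M'[OF yqw] l s by blast
  have sy: "supp y \<subseteq> {q,l}" using syq supp_mono[OF up_r[OF yC(2) nq yC(1)]] by blast
  have sMy: "supp (M y) \<subseteq> {q,l}" using supp_M[OF yw] sy s by blast
  have MyC: "M y \<in> C" "M (y \<cdot> q) \<in> C" using M_C[OF yw] M_C[OF yqw] by auto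
  have lMy: "len (M y) = Suc (len y)" using up_len[OF yw upy] .
  have lyq: "len (y \<cdot> q) = Suc (len y)" using nDR_len[OF yC(2) nq yC(1)] .
  have lM: "len (M (y \<cdot> q)) = Suc (Suc (len y))" using up_len[OF yqw cu(1)] lyq by simp
  have "M y \<noteq> e" "M (y \<cdot> q) \<noteq> e" using lMy lM len_e0 by (metis Zero_not_Suc)+
  then obtain h h' where h: "h \<in> DR (M y)" "h' \<in> DR (M (y \<cdot> q))" using ex_DR MyC by blast
  have DRMy: "DR (M y) = {l}" using DR_pair[OF MyC(1) sMy] h cu(2) by blast
  have sMq: "supp (M y \<cdot> q) \<subseteq> {q,l}" using supp_mul_S[OF yC(2) MyC(1)] sMy by blast
  have nb: "M (y \<cdot> q) \<noteq> M y \<cdot> q" using b by (simp add: badR_def)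
  have "q \<notin> DR (M (y \<cdot> q))"
  proof
    assume q: "q \<in> DR (M (y \<cdot> q))"
    have "q \<in> DR (M y \<cdot> q)" using cu(2) yC MyC by simp
    moreover have "len (M y \<cdot> q) = len (M (y \<cdot> q))" using nDR_len[OF yC(2) cu(2) MyC(1)] lMy lM by simp
    moreover have "M y \<cdot> q \<in> C" using MyC yC by simp
    ultimately show False using dih_eq_r[OF MyC(2) _ l(3) sMq _ q] nb by simp
  qed
  then have DRM: "DR (M (y \<cdot> q)) = {l}" using DR_pair[OF MyC(2) l(3)] h by blast
  have "l \<notin> DR (y \<cdot> q)"
  proof
    assume "l \<in> DR (y \<cdot> q)"
    moreover have "q \<in> DR (y \<cdot> q)" using nq yC by simp
    ultimately have "len (M (y \<cdot> q)) \<le> len (y \<cdot> q)" using dih_longest_r[OF yqC MyC(2) syq l(3)] by blast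
    then show False using lM lyq by simp
  qed
  then have "y \<cdot> q \<preceq> M (y \<cdot> q) \<cdot> l" using liftR1[OF up_leM[OF yqw cu(1)]] DRM by blast
  then have eq: "y \<cdot> q = M (y \<cdot> q) \<cdot> l"
  proof (rule le_eq)
    show "len (M (y \<cdot> q) \<cdot> l) \<le> len (y \<cdot> q)" using DR_len[of l "M (y \<cdot> q)"] DRM MyC lM lyq by simp
  qed
  have "y \<cdot> q \<cdot> l = M (y \<cdot> q) \<cdot> l \<cdot> l" by (rule arg_cong[OF eq, of "\<lambda>x. x \<cdot> l"])
  then have "M (y \<cdot> q) = y \<cdot> q \<cdot> l" unfolding cancel_r[OF l(1) MyC(2)] by (rule sym)
  with DRM DRMy show ?thesis using yC upy nq yqw sy sMy s cu(1) by blast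
qed

lemma no_bad: assumes b: "badR q y" and l: "l \<in> S" "l \<noteq> q" "supp (M (y \<cdot> q)) \<subseteq> {q,l}" and ye: "y \<noteq> e"
  and w: "w = y0 \<cdot> v" "adds y0 v" "y0 \<in> C" "v \<in> C" and v: "l \<notin> supp v" "q \<in> supp v" "q \<notin> DL v"
  and g: "\<And>f. f \<in> supp v \<Longrightarrow> f \<noteq> q \<Longrightarrow> goodR f"
  shows False
proof -
  note sh = bad_shape[OF b l]
  have yC: "y \<in> C" "q \<in> S" and upy: "up y" and nq: "q \<notin> DR y" and yqw: "y \<cdot> q \<preceq> w" and sy: "supp y \<subseteq> {q,l}"
    and sMy: "supp (M y) \<subseteq> {q,l}" and s: "s \<in> {q,l}" and upyq: "up (y \<cdot> q)" and Myq: "M (y \<cdot> q) = y \<cdot> q \<cdot> l"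
    and DRM: "DR (y \<cdot> q \<cdot> l) = {l}" and DRMy: "DR (M y) = {l}" using sh by auto
  have cnd: "condR q y" using b by (simp add: badR_def)
  have yw: "y \<preceq> w" using condR_w[OF cnd] .
  have MyC: "M y \<in> C" using M_C[OF yw] .
  have DRy: "DR y = {l}" using DR_pair[OF yC(1) sy] ex_DR[OF yC(1) ye] nq by blast
  have yy0: "y \<preceq> y0" using min_le[of y y0 v "supp v"] yw w DRy v by auto
  obtain f where f: "f \<in> S" "f \<cdot> q \<preceq> v" "f \<cdot> q \<noteq> q \<cdot> f" using ex_next_l[OF w(4) yC(2) _ v(3)] v(2) by (auto simp: supp_def)
  have fq: "f \<noteq> q" using f by auto
  have sfq: "supp (f \<cdot> q) = {f,q}" using supp_supp_l[of q f] f yC fq by simp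
  then have fv: "f \<in> supp v" using supp_mono[OF f(2)] by blast
  then have fl: "f \<noteq> l" using v by blast
  have fs: "f \<noteq> s" using s fq fl by blast
  have fC: "f \<in> C" using f by simp
  have fy: "f \<notin> supp y" "f \<notin> supp (y \<cdot> q)" using sy fq fl supp_mul_S[OF yC(2,1)] by auto
  let ?e = "y \<cdot> (f \<cdot> q)"
  have e0w: "?e \<preceq> w" using mul_mono[OF yy0 f(2) w(2)] w(1) by simp
  have eC: "?e \<in> C" using e0w le_C1 by blast
  have ad: "adds y q" using adds_DR[OF yC(2,1)] nq by simp
  have fq': "f \<notin> supp q" using fq yC by simp
  note ins = insert_len[OF yC(1) S_C[OF yC(2)] ad f(1) fy(1) fq']
  have ins': "len ?e = Suc (len (y \<cdot> q))" "y \<cdot> q \<preceq> ?e" "f \<in> supp ?e" using ins f(1) by (simp_all add: supp_def)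
  have cov: "cov (y \<cdot> q) ?e" using ins' by (simp add: cov_def)
  have lyq: "len (y \<cdot> q) = Suc (len y)" using nDR_len[OF yC(2) nq yC(1)] .
  have nf: "f \<notin> DR ?e"
  proof
    assume d: "f \<in> DR ?e"
    have "y \<cdot> q \<preceq> ?e \<cdot> f" using liftR1[OF ins'(2) d] not_supp_DR fy yC by simp
    then have "y \<cdot> q = ?e \<cdot> f" using le_eq[of "y \<cdot> q" "?e \<cdot> f"] DR_len[OF d eC] ins' by simp
    then have "y \<cdot> q \<cdot> f = ?e" using cancel_r[OF f(1) eC] by simp
    then have "y \<cdot> (q \<cdot> f) = y \<cdot> (f \<cdot> q)" using yC f by (simp add: assoc)
    then have "q \<cdot> f = f \<cdot> q" using cancel[of y "q \<cdot> f" "f \<cdot> q"] yC f by simp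
    then show False using f by simp
  qed
  have Me: "M ?e = ?e \<cdot> l" "up ?e" using ns_r[OF yqw upyq Myq DRM e0w cov ins'(3) fy(2) fs nf] by auto
  have nl: "l \<notin> DR ?e" using up_len[OF e0w Me(2)] Me(1) by (auto simp: DR_def)
  have fqv: "f \<preceq> v" using fv by (simp add: supp_def)
  have yfw: "y \<cdot> f \<preceq> w" using mul_mono[OF yy0 fqv w(2)] w(1) by simp
  have nfy: "f \<notin> DR y" using not_supp_DR fy yC by blast
  have lyf: "len (y \<cdot> f) = Suc (len y)" using nDR_len[OF f(1) nfy yC(1)] .
  have fMy: "f \<notin> supp (M y)" using sMy fq fl by auto
  have "M y \<noteq> y \<cdot> f" using fMy supp_supp_r[OF yC(1) f(1) fy(1)] by auto
  then have cf: "condR f y" using yC upy f nfy yfw by (simp add: condR_def)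
  have Myf: "M (y \<cdot> f) = M y \<cdot> f" using comm_r[OF cf] g[OF fv fq] by (simp add: goodR_def)
  have e_eq: "?e = y \<cdot> f \<cdot> q" using yC f by (simp add: assoc)
  have "q \<notin> DR (y \<cdot> f)" using ins'(1) lyq lyf unfolding e_eq by (auto simp: DR_def)
  then have qe: "y \<cdot> f \<preceq> ?e" "q \<in> DR ?e" using up_r[OF yC(2)] yC f unfolding e_eq by auto
  have le: "M y \<cdot> f \<preceq> ?e \<cdot> l" using Mmono[OF qe(1) e0w condR_up(1)[OF cf] Me(2)] Myf Me by simp
  have ld: "l \<in> DR (?e \<cdot> l)" using nl l eC by simp
  have ell: "?e \<cdot> l \<cdot> l = ?e" using cancel_r[OF l(1) eC] .
  have eqq: "?e \<cdot> q = y \<cdot> f" unfolding e_eq using cancel_r[OF yC(2), of "y \<cdot> f"] yC f by simp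
  have lMy: "len (M y) = Suc (len y)" using up_len[OF yw upy] .
  have lMf: "len (M y \<cdot> f) = Suc (Suc (len y))" using len_supp_r[OF MyC f(1) fMy] lMy by simp
  show False
  proof (cases "f \<cdot> l = l \<cdot> f")
    case False
    have D: "DR (M y \<cdot> f) = {f}" using DR_chain[OF MyC f(1) fMy _ l(1)] DRMy False by auto
    have "M y \<cdot> f \<preceq> ?e" using liftR1[OF le ld] D fl ell by auto
    then have "M y \<cdot> f \<preceq> y \<cdot> f" using liftR1[OF _ qe(2)] D fq eqq by auto
    then show False using le_len_le lMf lyf by fastforce
  next
    \<comment> \<open>Here the final \<open>l\<close> of \<open>M y\<close> moves past
      \<open>f\<close> and is stripped too. The comparison then identifies \<open>y\<close> with
      \<open>M y\<close> without its last letter; but \<open>y\<close> itself ends in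
      \<open>l\<close>.\<close>
    case True
    define m where "m = M y \<cdot> l"
    have lM: "l \<in> DR (M y)" using DRMy by simp
    have m: "m \<in> C" "M y = m \<cdot> l" "l \<notin> DR m" "len m = len y" using lM MyC l DR_len[OF lM MyC] lMy by (auto simp: m_def)
    have eq1: "M y \<cdot> f \<cdot> l = m \<cdot> f"
    proof -
      have "M y \<cdot> f \<cdot> l = m \<cdot> (l \<cdot> f) \<cdot> l" using m(1) l f unfolding m(2) by (simp add: assoc)
      also have "\<dots> = m \<cdot> (f \<cdot> l) \<cdot> l" using True by simp
      also have "\<dots> = m \<cdot> f" using m(1) l f by (simp add: assoc)
      finally show ?thesis .
    qed
    have fm: "f \<notin> supp m" using supp_mono[OF down_r[OF lM MyC]] fMy by (auto simp: m_def)
    have lmf: "len (m \<cdot> f) = Suc (len y)" using len_supp_r[OF m(1) f(1) fm] m by simp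
    have "l \<in> DR (M y \<cdot> f)" using eq1 lmf lMf l by (simp add: DR_def)
    then have "m \<cdot> f \<preceq> ?e" using liftR3[OF le ld] eq1 ell by simp
    moreover have "q \<notin> DR (m \<cdot> f)" using DR_new[OF m(1) f(1) fm, of q] fq f by metis
    ultimately have "m \<cdot> f \<preceq> y \<cdot> f" using liftR1[OF _ qe(2)] eqq by auto
    then have "m \<cdot> f = y \<cdot> f" using le_eq lmf lyf by simp
    then have "m = y" using cancel'[of f m y] m yC f by simp
    then show False using m DRy by simp
  qed
qed
lemmas no_bad_l = spm.no_bad[OF dualM, unfolded dualM_defs2]

lemma badR_s: assumes "badR s y" "supp (M (y \<cdot> s)) \<subseteq> {s,c}" "rho c \<or> lam c" shows False
proof -
  have cnd: "condR s y" using assms by (simp add: badR_def)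
  note c = cnd[unfolded condR_def]
  have yqw: "y \<cdot> s \<preceq> w" and yC: "y \<in> C" using c by blast+
  have s2: "supp (y \<cdot> s) \<subseteq> {s,c}" using supp_M'[OF yqw] assms(2) by blast
  have s1: "supp y \<subseteq> {s,c}" using s2 supp_mono[OF up_r[of s y]] c by blast
  show False using assms(3)
  proof
    assume "rho c"
    then have "M y = y \<cdot> s" using condR_w[OF cnd] s1 unfolding rho_def by blast
    then show False using c by blast
  next
    assume "lam c"
    then have "M y = s \<cdot> y" "M (y \<cdot> s) = s \<cdot> (y \<cdot> s)"
      using condR_w[OF cnd] yqw s1 s2 unfolding lam_def by blast+
    moreover have "M (y \<cdot> s) \<noteq> M y \<cdot> s" using assms(1) unfolding badR_def by blast
    ultimately show False using assoc[of s y s] yC by simp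
  qed
qed
lemmas badL_s = spm.badR_s[OF dualM, unfolded dualM_defs2]

end

section \<open>The cases of nonempty B and of a second letter in A\<close>

context spmU begin

text \<open>For \<open>q = s\<close> the dihedral subgroup might involve any second letter;
  \<open>rho_or_lam\<close> excludes all but \<open>t\<close>.\<close>

lemma badR_J: assumes "badR q y" "q \<in> {s,t}" shows "supp (M (y \<cdot> q)) \<subseteq> {s,t}"
proof -
  obtain c where c: "c \<in> S" "supp (M (y \<cdot> q)) \<subseteq> {q,c}" "s \<in> {q,c}" using assms unfolding badR_def by blast
  show ?thesis
  proof (cases "q = s")
    case True
    show ?thesis
    proof (cases "c = t")
      case False
      then show ?thesis using badR_s[of y c] assms(1) c rho_or_lam[OF c(1)] unfolding True by blast
    qed (use c True in auto)
  qed (use c assms in auto)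
qed

lemma badL_J: assumes "badL q y" "q \<in> {s,t}" shows "supp (M (q \<cdot> y)) \<subseteq> {s,t}"
proof -
  obtain c where c: "c \<in> S" "supp (M (q \<cdot> y)) \<subseteq> {q,c}" "s \<in> {q,c}" using assms unfolding badL_def by blast
  show ?thesis
  proof (cases "q = s")
    case True
    show ?thesis
    proof (cases "c = t")
      case False
      then show ?thesis using badL_s[of y c] assms(1) c rho_or_lam[OF c(1)] unfolding True by blast
    qed (use c True in auto)
  qed (use c assms in auto)
qed

lemma goodR_s_at: assumes w: "w = y0 \<cdot> v" "adds y0 v" "y0 \<in> C" "v \<in> C" and v: "t \<notin> supp v" "s \<in> supp v" "s \<notin> DL v"
  and g: "\<And>f. f \<in> supp v \<Longrightarrow> f \<noteq> s \<Longrightarrow> goodR f" shows "goodR s"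
  unfolding goodR_def
proof
  fix y show "\<not> badR s y"
  proof
    assume b: "badR s y"
    have "y \<noteq> e" using b unfolding badR_def condR_def by auto
    then show False using no_bad[OF b J(1,2) badR_J[OF b] _ w v g] by blast
  qed
qed

lemma goodL_p_at: assumes w: "w = v \<cdot> y0" "adds v y0" "y0 \<in> C" "v \<in> C" and v: "p' \<notin> supp v" "p \<in> supp v" "p \<notin> DR v"
  and g: "\<And>f. f \<in> supp v \<Longrightarrow> f \<noteq> p \<Longrightarrow> goodL f" shows "goodL p"
  unfolding goodL_def
proof
  fix y show "\<not> badL p y"
  proof
    assume b: "badL p y"
    have ye: "y \<noteq> e"
    proof
      assume y: "y = e"
      then have "M e \<noteq> p \<cdot> e" "M (p \<cdot> e) \<noteq> p \<cdot> M e" using b unfolding badL_def condL_def by blast+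
      then have "p \<noteq> s" "M p \<noteq> p \<cdot> s" using J by auto
      then show False using J by auto
    qed
    have sup: "supp (M (p \<cdot> y)) \<subseteq> {p,p'}" using badL_J[OF b] J pp by blast
    show False using no_bad_l[OF b J(5) _ sup ye w v g] pp by blast
  qed
qed

text \<open>Strip from \<open>w\<close> a left factor free of \<open>B\<close>, so that the rest
  \<open>b\<close> begins with letters of \<open>B\<close> only. By \<open>BsA\<close> and
  \<open>sfree\<close>, no letter of \<open>A\<close> occurs in \<open>b\<close>. So
  \<open>M\<close> is left multiplication by \<open>s\<close> on \<open>b\<close>, every right
  descent of \<open>b\<close> is good (for \<open>s\<close> because \<open>t\<close> is absent from
  \<open>b\<close>), and \<open>exitR\<close> applies.\<close>

lemma settled_B_nonempty: assumes "B \<noteq> {}" shows settled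
proof -
  obtain c0 where c0: "c0 \<in> B" using assms by blast
  obtain b y0 where by0: "b \<in> C" "y0 \<in> C" "w = y0 \<cdot> b" "adds y0 b" "supp y0 \<subseteq> S - B" "DL b \<inter> (S - B) = {}"
    using parab_l[OF wC, of "S - B"] by blast
  have Db: "DL b \<subseteq> B" using by0(6) DL_S by blast
  have bw: "b \<preceq> w" using le_adds_r[OF by0(4,1,2)] by0(3) by simp
  have "b \<noteq> e"
  proof
    assume "b = e"
    then have "supp w \<subseteq> S - B" using by0 by simp
    then show False using c0 BD(1,2)[OF c0] by (auto simp: supp_def)
  qed
  then obtain f q where f: "f \<in> DL b" and q: "q \<in> DR b" using ex_DL ex_DR by0(1) by blast
  have fB: "f \<in> B" using f Db by blast
  have nA: "c \<notin> supp b" if c: "c \<in> A" for c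
  proof
    assume cb: "c \<in> supp b"
    note a = AD[OF c]
    obtain g h where gh: "g \<in> C" "h \<in> C" "b = h \<cdot> g" "adds h g" "supp h \<subseteq> S - {s}" "DL g \<inter> (S - {s}) = {}"
      using parab_l[OF by0(1), of "S - {s}"] by blast
    have hb: "h \<preceq> b" "g \<preceq> b" using le_adds_l[OF gh(4,2,1)] le_adds_r[OF gh(4,1,2)] gh(3) by auto
    have "c \<in> supp h \<union> supp g" using supp_adds[OF gh(4,2,1)] gh(3) cb by simp
    then show False
    proof
      assume "c \<in> supp g"
      then have cg: "c \<preceq> g" by (simp add: supp_def)
      have "g \<noteq> e" using le_e[of c] cg a(1) e_notin_S by metis
      obtain k where "k \<in> DL g" using ex_DL[OF gh(1) \<open>g \<noteq> e\<close>] by blast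
      then have "s \<in> DL g" using gh(6) DL_S by blast
      then have "s \<cdot> c \<preceq> b" using le_trans[OF liftL2[OF cg(1)] hb(2)] by blast
      then have "f \<cdot> (s \<cdot> c) \<preceq> b" using liftL2 f by blast
      then show False using BsA[OF fB c] le_trans[OF _ bw] by blast
    next
      assume "c \<in> supp h"
      then have ch: "c \<preceq> h" by (auto simp: supp_def)
      have hw: "h \<preceq> w" using le_trans[OF hb(1) bw] .
      have sh: "s \<notin> supp h" using gh(5) by blast
      have "DL h \<subseteq> DL b" using DL_adds[OF gh(4,2,1)] gh(3) by auto
      then have Mh: "M h = s \<cdot> h" using sfree[OF hw sh] Db by blast
      have "c \<cdot> s \<preceq> s \<cdot> h" using Mmono[OF ch hw up_gen[OF a(1-3)] sfree_up[OF hw sh]] a(4) Mh by simp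
      moreover have "s \<in> DL (s \<cdot> h)" using not_supp_DL[OF gh(2) sh] gh by simp
      moreover have "s \<notin> DL (c \<cdot> s)" using DL_two[OF a(1) s_S a(5)] a(3) by simp
      ultimately have "c \<cdot> s \<preceq> h" using liftL1[of "c \<cdot> s" "s \<cdot> h" s] gh by simp
      then have "s \<in> supp h" using supp_mono[of "c \<cdot> s" h] supp_supp_l[of s c] a(1,3) by auto
      then show False using sh by blast
    qed
  qed
  have sb: "c = s \<or> c \<in> B \<or> c \<in> K" if "c \<in> supp b" for c
    using cases_ABK[of c] supp_mono[OF bw] nA that by (auto simp: supp_def)
  have "M b = s \<cdot> b"
  proof (rule eq_mult_l[OF bw _ le_refl[OF by0(1)]])
    fix x c assume x: "x \<preceq> b" "c \<in> S" "supp x \<subseteq> {s,c}" "up x"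
    have xw: "x \<preceq> w" using le_trans[OF x(1) bw] .
    show "M x = s \<cdot> x"
    proof (cases "c \<in> supp b")
      case True
      then have "lam c" using sb[OF True] lam_s lam_B lam_K by blast
      then show ?thesis using xw x(3) unfolding lam_def by blast
    next
      case False
      then have "supp x \<subseteq> {s,s}" using x(3) supp_mono[OF x(1)] by blast
      then show ?thesis using lam_s xw unfolding lam_def by blast
    qed
  qed
  moreover have sd: "s \<notin> DL b" using Db BD(3) by blast
  ultimately have upb: "up b" using nDL_len[OF s_S sd by0(1)] by (simp add: up_def)
  have gd: "goodR c" if "c \<in> supp b" "c \<noteq> s" for c using sb[OF that(1)] that(2) goodR_B goodR_K by blast
  have qb: "q \<in> supp b" using DR_supp[OF q by0(1)] .
  have "goodR q"
  proof (cases "q = s")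
    case True
    show ?thesis unfolding True using goodR_s_at[OF by0(3,4,2,1) nA[OF tA] _ sd gd] qb True by blast
  qed (use gd qb in blast)
  then show ?thesis using exitR[OF by0(3,2,1,5,6) upb q] by blast
qed

lemma pu': "p' \<cdot> u \<in> C" "u = p' \<cdot> (p' \<cdot> u)" "adds p' (p' \<cdot> u)" "p' \<cdot> u \<noteq> e" "p' \<cdot> u \<preceq> u" "t \<in> supp (p' \<cdot> u)" "DR (p' \<cdot> u) = {t}"
proof -
  have d: "p' \<in> DL u" using DLu by simp
  show c: "p' \<cdot> u \<in> C" and eq: "u = p' \<cdot> (p' \<cdot> u)" using J by auto
  show ad: "adds p' (p' \<cdot> u)" using adds_DL[of p' "p' \<cdot> u"] J d by simp
  show ne: "p' \<cdot> u \<noteq> e" using DL_len[OF d J(8)] n2 len_e0 by fastforce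
  show "p' \<cdot> u \<preceq> u" using down_l[OF d J(8)] .
  have "DR (p' \<cdot> u) \<subseteq> {t}" using DR_adds[OF ad c] eq DRu J by auto
  then show D: "DR (p' \<cdot> u) = {t}" using ex_DR[OF c ne] by blast
  then show "t \<in> supp (p' \<cdot> u)" using DR_supp[of t "p' \<cdot> u"] c by blast
qed

text \<open>By alternation \<open>u\<close> begins with \<open>p' p\<close>. If nothing followed,
  then \<open>p = t\<close>, because \<open>u\<close> ends in \<open>t\<close>, and \<open>u\<close>
  would be \<open>s t\<close>.\<close>

lemma u_long_factor: assumes "u \<noteq> s \<cdot> t"
  obtains x where "x \<in> C" "u = p' \<cdot> p \<cdot> x" "adds (p' \<cdot> p) x" "x \<noteq> e" "x \<preceq> p' \<cdot> u" "t \<in> supp x" "supp (p' \<cdot> p) = {s,t}" "p' \<cdot> p \<noteq> e"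
proof -
  let ?v = "p' \<cdot> u"
  have sv: "supp ?v \<subseteq> {s,t}" using supp_mono[OF pu'(5)] u_supp by blast
  obtain h where h: "h \<in> DL ?v" using ex_DL[OF pu'(1,4)] by blast
  have "p' \<notin> DL ?v" using DLu J by simp
  then have "h = p" using DL_pair[OF pu'(1) sv] h pp by blast
  then have pv: "p \<in> DL ?v" using h by simp
  let ?x = "p \<cdot> ?v"
  have x: "?x \<in> C" "?v = p \<cdot> ?x" "adds p ?x" "?x \<preceq> ?v" using J pu'(1) adds_DL[of p ?x] pv down_l[OF pv pu'(1)] by auto
  have two: "len (p' \<cdot> p) = 2" using len_two[of p' p] J pp by simp
  have u: "u = p' \<cdot> p \<cdot> ?x" using pu'(2) x J by (simp add: assoc)
  have sp: "supp (p' \<cdot> p) = {s,t}" using supp_supp_l[of p p'] J pp by auto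
  have "len u = 2 + len ?x" using addsD[OF pu'(3)] addsD[OF x(3)] x(2) pu'(2) J by simp
  then have ad: "adds (p' \<cdot> p) ?x" using two u by (simp add: adds_def)
  have ne: "?x \<noteq> e"
  proof
    assume "?x = e"
    then have u2: "u = p' \<cdot> p" using u J by simp
    have "p \<in> DR (p' \<cdot> p)" using not_supp_DR[of p' p] J pp by simp
    then have "p = t" using DRu u2 by simp
    then have "p' = s" using pp by auto
    then show False using u2 \<open>p = t\<close> assms by simp
  qed
  have "DR ?x \<subseteq> {t}" using DR_adds[OF x(3,1)] x(2) pu'(7) J by auto
  then have "t \<in> DR ?x" using ex_DR[OF x(1) ne] by blast
  then have "t \<in> supp ?x" using DR_supp x(1) by blast
  then show ?thesis using that[of ?x] x u ad ne sp two len_e0 by (metis zero_neq_numeral)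
qed

text \<open>Without \<open>p'\<close> the exceptional dihedral subgroup contributes below
  \<open>a\<close> only \<open>e\<close> and \<open>p\<close>, where \<open>M\<close> is known to be
  right multiplication by \<open>s\<close>.\<close>

lemma rho_below_a: assumes "a \<preceq> w" "p' \<notin> supp a" "\<And>c. c \<in> supp a \<Longrightarrow> c \<in> A \<or> c \<in> K \<or> c = s" "s \<notin> DR a"
  shows "M a = a \<cdot> s \<and> up a"
proof -
  have aC: "a \<in> C" using assms(1) le_C1 by blast
  have "M a = a \<cdot> s"
  proof (rule eq_mult_r[OF assms(1) _ le_refl[OF aC]])
    fix x c assume x: "x \<preceq> a" "c \<in> S" "supp x \<subseteq> {s,c}" "up x"
    have xw: "x \<preceq> w" using le_trans[OF x(1) assms(1)] .
    have xC: "x \<in> C" using xw le_C1 by blast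
    have sx: "supp x \<subseteq> supp a" using supp_mono[OF x(1)] .
    show "M x = x \<cdot> s"
    proof (cases "c \<in> supp a \<and> c \<noteq> t")
      case True
      then have "rho c" using assms(3)[of c] rho_s rho_A rho_K by blast
      then show ?thesis using xw x(3) unfolding rho_def by blast
    next
      case False
      then have "supp x \<subseteq> {s,t}" using sx x(3) by blast
      then have "supp x \<subseteq> {p}" using sx assms(2) pp by blast
      then have "x = e \<or> x = p" using supp_single xC by blast
      then have "x = e \<or> x = s \<or> x = t" using J by blast
      then show ?thesis using J Ms by auto
    qed
  qed
  then show ?thesis using nDR_len[OF s_S assms(4) aC] by (simp add: up_def)
qed

text \<open>The left factor \<open>a\<close> of \<open>w\<close> ends only in letters of
  \<open>A\<close> other than \<open>t\<close>. Such a last letter \<open>f\<close> can be inserted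
  wherever \<open>u\<close> is split along \<open>a\<close> and \<open>y\<close>, which by
  \<open>split\<close> restricts the left part. The aim is that \<open>p'\<close> does not occur in
  \<open>a\<close>: then \<open>M\<close> is right multiplication by \<open>s\<close> on
  \<open>a\<close>, the left descents of \<open>a\<close> are good, and \<open>exitL\<close>
  applies.\<close>

lemma settled_A_two: assumes B: "B = {}" and c0: "c0 \<in> A" "c0 \<noteq> t" shows settled
proof -
  let ?A = "A - {t}"
  obtain a y where ay: "a \<in> C" "y \<in> C" "w = a \<cdot> y" "adds a y" "supp y \<subseteq> S - ?A" "DR a \<inter> (S - ?A) = {}"
    using parab[OF wC, of "S - ?A"] by blast
  have Da: "DR a \<subseteq> ?A" using ay(6) DR_S by blast
  have aw: "a \<preceq> w" "y \<preceq> w" using le_adds_l[OF ay(4,1,2)] le_adds_r[OF ay(4,2,1)] ay(3) by auto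
  have ane: "a \<noteq> e"
  proof
    assume "a = e"
    then have "supp w \<subseteq> S - ?A" using ay by simp
    then show False using c0 AD(1,2)[OF c0(1)] by (auto simp: supp_def)
  qed
  then obtain f where f: "f \<in> DR a" using ex_DR ay(1) by blast
  have fA: "f \<in> A" "f \<noteq> t" using f Da by auto
  note a = AD[OF fA(1)]
  have fJ: "f \<notin> {s,t}" using a fA by auto
  have nuf: "\<not> u \<cdot> f \<preceq> w" using uA_not_le[OF fA] .
  have into: "y1 \<cdot> (f \<cdot> x1) \<preceq> w" if "y1 \<preceq> a" "x1 \<preceq> y" for y1 x1
  proof -
    have "(y1 \<cdot> f) \<cdot> x1 \<preceq> w" using mul_mono[OF liftR2[OF that(1) f] that(2) ay(4)] ay(3) by simp
    then show ?thesis using that a le_C1 by (metis assoc S_C)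
  qed
  \<comment> \<open>\<open>split\<close> would put \<open>u f\<close> below \<open>w\<close> or make
    \<open>f\<close> commute with \<open>s\<close>.\<close>
  have noc: False if "y1 \<preceq> a" "x1 \<preceq> y" "u = y1 \<cdot> x1" "adds y1 x1" "y1 \<noteq> e" "x1 \<noteq> e" "s \<in> supp y1" for y1 x1
    using split[OF that(3-6) le_C1[OF that(1)] le_C1[OF that(2)] a(1) fJ into[OF that(1,2)]] nuf that(7) a(5) by metis
  obtain y1 x1 where yx: "u = y1 \<cdot> x1" "adds y1 x1" "y1 \<preceq> a" "x1 \<preceq> y" using subword[of u a y] u_w ay by blast
  have yxC: "y1 \<in> C" "x1 \<in> C" using yx le_C1 by blast+
  have x1e: "x1 \<noteq> e"
  proof
    assume "x1 = e"
    then have "u \<preceq> a" using yx yxC by simp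
    then have "u \<cdot> f \<preceq> w" using liftR2[OF _ f] le_trans[OF _ aw(1)] by blast
    then show False using nuf by blast
  qed
  \<comment> \<open>A left part of \<open>u\<close> without the letter \<open>s\<close> is at most
    the single letter \<open>t\<close>.\<close>
  have x'y: "p' \<cdot> u \<preceq> y"
  proof (cases "y1 = e")
    case True
    then show ?thesis using yx yxC le_trans[OF pu'(5)] by simp
  next
    case False
    have "s \<notin> supp y1" using noc[OF yx(3,4,1,2) False x1e] by blast
    then have "supp y1 \<subseteq> {t}" using supp_adds[OF yx(2) yxC] yx(1) u_supp by auto
    then have y1t: "y1 = t" using supp_single[OF yxC(1)] False by blast
    then have "t \<in> DL u" using DL_adds[OF yx(2) yxC, of t] yx(1) J by simp
    then have "p' = t" using DLu by simp
    then have "p' \<cdot> u = x1" using yx(1) y1t J yxC by simp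
    then show ?thesis using yx by simp
  qed
  have p'a: "p' \<notin> supp a"
  proof
    assume "p' \<in> supp a"
    then have pa: "p' \<preceq> a" by (simp add: supp_def)
    show False
    proof (cases "p' = s")
      case True
      have "p' \<noteq> e" unfolding True using s_S e_notin_S by metis
      moreover have "s \<in> supp p'" unfolding True using s_S by simp
      ultimately show False using noc[OF pa x'y pu'(2,3) _ pu'(4)] by blast
    next
      case p's: False
      then have p't: "p' = t" and ps: "p = s" using pp by auto
      have "t \<notin> DR a" using Da by blast
      \<comment> \<open>\<open>t\<close> occurs in \<open>a\<close> but is no last letter of it, so
        a letter that does not commute with \<open>t\<close> follows.\<close>
      then obtain f2 where f2: "f2 \<in> S" "t \<cdot> f2 \<preceq> a" "t \<cdot> f2 \<noteq> f2 \<cdot> t" using ex_next[OF ay(1) J(1)] pa p't by blast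
      have ust: "u \<noteq> s \<cdot> t"
      proof
        assume "u = s \<cdot> t"
        then have "DL u = {s}" using DL_two[of s t] J by auto
        then show False using DLu p's by simp
      qed
      show False
      proof (cases "f2 = s")
        case True
        obtain x where x: "x \<in> C" "u = p' \<cdot> p \<cdot> x" "adds (p' \<cdot> p) x" "x \<noteq> e" "x \<preceq> p' \<cdot> u" "supp (p' \<cdot> p) = {s,t}" "p' \<cdot> p \<noteq> e"
          using u_long_factor[OF ust] by blast
        show False using noc[OF _ le_trans[OF x(5) x'y] x(2,3,7,4)] x(6) f2 True p't ps by auto
      next
        \<comment> \<open>Insert \<open>f2\<close> behind the first letter \<open>t\<close> of
          \<open>u\<close>. The letter \<open>t\<close> occurs on both sides of the insertion, so
          \<open>split\<close> cannot hold.\<close>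
        case False
        have f2J: "f2 \<notin> {s,t}" using False f2 by auto
        have f2a: "f2 \<in> supp a" using supp_mono[OF f2(2)] supp_supp_l[of f2 t] f2 f2J J by auto
        have "(t \<cdot> f2) \<cdot> (p' \<cdot> u) \<preceq> w" using mul_mono[OF f2(2) x'y ay(4)] ay(3) by simp
        then have le: "p' \<cdot> (f2 \<cdot> (p' \<cdot> u)) \<preceq> w" using p't J f2 pu'(1) by (simp add: assoc)
        have "\<forall>h\<in>supp p'. h \<cdot> f2 = f2 \<cdot> h \<Longrightarrow> False" using f2 p't J by simp
        moreover have "u \<cdot> f2 \<preceq> w" "\<forall>h\<in>supp (p' \<cdot> u). h \<cdot> f2 = f2 \<cdot> h" if "\<not> (\<forall>h\<in>supp p'. h \<cdot> f2 = f2 \<cdot> h)"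
          using split[OF pu'(2,3) _ pu'(4) _ pu'(1) f2(1) f2J le] J that e_notin_S by (metis S_C)+
        ultimately have "t \<cdot> f2 = f2 \<cdot> t" using pu'(6) by blast
        then show False using f2 by blast
      qed
    qed
  qed
  have sa: "c \<in> A \<or> c \<in> K \<or> c = s" if "c \<in> supp a" for c
    using cases_ABK[of c] supp_mono[OF aw(1)] B that by (auto simp: supp_def)
  have sd: "s \<notin> DR a" using Da AD(3) by blast
  have upa: "up a" using rho_below_a[OF aw(1) p'a sa sd] by blast
  have gd: "goodL c" if "c \<in> supp a" "c \<noteq> p" for c
  proof -
    have "c \<notin> {s,t}" using that p'a pp by blast
    then show ?thesis using sa[OF that(1)] goodL_A goodL_K by blast
  qed
  obtain r where r: "r \<in> DL a" using ex_DL ay(1) ane by blast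
  have ra: "r \<in> supp a" using DL_supp[OF r ay(1)] .
  have "goodL r"
  proof (cases "r = p")
    case True
    have "p \<notin> DR a" using sd J Da by blast
    then show ?thesis using goodL_p_at[OF ay(3,4,2,1) p'a _ _ gd] ra True by blast
  qed (use gd ra in blast)
  then show ?thesis using exitL[OF ay(3,2,1,5,6) upa r] by blast
qed

end

section \<open>The case where t is the only letter of A and B is empty\<close>

context spmU begin

lemma Kst: assumes "c \<in> K" shows "c \<in> S" "c \<notin> {s,t}" "c \<cdot> s = s \<cdot> c" "goodR c" "goodL c"
  using KD[OF assms] AK[OF tA] assms goodR_K goodL_K by auto

lemma pu_facts: "p \<cdot> u \<in> C" "len (p \<cdot> u) = Suc (len u)" "supp (p \<cdot> u) \<subseteq> {s,t}" "u \<preceq> p \<cdot> u"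
proof -
  have n: "p \<notin> DL u" using DLu pp by simp
  show "p \<cdot> u \<in> C" "len (p \<cdot> u) = Suc (len u)" "u \<preceq> p \<cdot> u" using J n nDL_len up_l by auto
  show "supp (p \<cdot> u) \<subseteq> {s,t}" using supp_up_l[of p u] n u_supp J by auto
qed

text \<open>Letters of \<open>K\<close> are good, so they can be appended one at a time. The
  exception \<open>M (u y) = u y q\<close> is ruled out by the uniqueness of parabolic
  factorizations.\<close>

lemma M_u_mult: assumes "x \<in> C" "supp x \<subseteq> K" "u \<cdot> x \<preceq> w" shows "M (u \<cdot> x) = p \<cdot> u \<cdot> x \<and> up (u \<cdot> x)"
  using assms
proof (induction x rule: len_induct)
  case (less x)
  show ?case
  proof (cases "x = e")
    case True
    then show ?thesis using Mu u_up J pu_facts by simp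
  next
    case False
    then obtain q where q: "q \<in> DR x" using ex_DR less.hyps by blast
    obtain y where y: "y \<in> C" "x = y \<cdot> q" "q \<notin> DR y" "len x = Suc (len y)" using factor_r[OF q less.hyps] by blast
    have "q \<in> K" using DR_supp[OF q less.hyps] less.prems by blast
    note k = Kst[OF this] and qK = this
    have sx: "supp y \<subseteq> K" using supp_down_r[OF q less.hyps] y less.prems k by simp
    have Ku: "DR u \<inter> K = {}" "DR (p \<cdot> u) \<inter> K = {}" using DRu DRpu AK[OF tA] by auto
    have nq: "q \<notin> DR (u \<cdot> y)" using DR_parab[OF J(8) y(1) sx Ku(1) qK] y by simp
    have eq: "u \<cdot> x = u \<cdot> y \<cdot> q" using y J k by (simp add: assoc)
    have uyC: "u \<cdot> y \<in> C" using J y by simp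
    have le: "u \<cdot> y \<preceq> u \<cdot> x" unfolding eq using up_r[OF k(1) nq uyC] .
    have IH: "M (u \<cdot> y) = p \<cdot> u \<cdot> y" "up (u \<cdot> y)" using less.IH[OF y(1) _ sx le_trans[OF le less.prems(2)]] y by auto
    have ne: "M (u \<cdot> y) \<noteq> u \<cdot> y \<cdot> q"
    proof
      assume "M (u \<cdot> y) = u \<cdot> y \<cdot> q"
      then have "p \<cdot> u \<cdot> y = u \<cdot> x" using IH eq by simp
      then have "p \<cdot> u = u" using parab_unique[OF pu_facts(1) y(1) sx Ku(2) J(8) less.hyps less.prems(1) Ku(1)] by blast
      then show False using pu_facts(2) by simp
    qed
    have c: "condR q (u \<cdot> y)" unfolding condR_def using uyC IH(2) k(1) nq ne less.prems(2) eq by auto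
    have "M (u \<cdot> y \<cdot> q) = M (u \<cdot> y) \<cdot> q" using comm_r[OF c] k(4) unfolding goodR_def by blast
    then show ?thesis using condR_up(1)[OF c] eq IH(1) y pu_facts(1) k(1) by (simp add: assoc)
  qed
qed

lemma M_mult_t: assumes "x \<in> C" "supp x \<subseteq> K" "x \<cdot> t \<preceq> w" shows "M (x \<cdot> t) = x \<cdot> t \<cdot> s \<and> up (x \<cdot> t)"
  using assms
proof (induction x rule: len_induct)
  case (less x)
  show ?case
  proof (cases "x = e")
    case True
    then show ?thesis using J up_gen[of t] by simp
  next
    case False
    then obtain q where q: "q \<in> DL x" using ex_DL less.hyps by blast
    obtain y where y: "y \<in> C" "x = q \<cdot> y" "q \<notin> DL y" "len x = Suc (len y)" using factor_l[OF q less.hyps] by blast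
    have "q \<in> K" using DL_supp[OF q less.hyps] less.prems by blast
    note k = Kst[OF this] and qK = this
    have sx: "supp y \<subseteq> K" using supp_down_l[OF q less.hyps] y less.prems k by simp
    have tK: "t \<notin> K" "s \<notin> K" using AK[OF tA] Kst(2) by blast+
    have ytC: "y \<cdot> t \<in> C" using y J by simp
    have eq: "x \<cdot> t = q \<cdot> (y \<cdot> t)" using y J k by (simp add: assoc)
    have txy: "t \<notin> supp x" "t \<notin> supp y" using tK sx less.prems(1) by blast+
    have sp: "supp (x \<cdot> t) = insert t (supp x)" "supp (y \<cdot> t) = insert t (supp y)"
      using supp_supp_r[OF less.hyps J(1) txy(1)] supp_supp_r[OF y(1) J(1) txy(2)] by auto
    have nq: "q \<notin> DL (y \<cdot> t)"
    proof -
      have "len (x \<cdot> t) = Suc (len x)" "len (y \<cdot> t) = Suc (len y)" using len_supp_r[OF less.hyps J(1) txy(1)] len_supp_r[OF y(1) J(1) txy(2)] by auto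
      then show ?thesis using eq y by (auto simp: DL_def)
    qed
    have le: "y \<cdot> t \<preceq> x \<cdot> t" unfolding eq using up_l[OF k(1) nq ytC] .
    have IH: "M (y \<cdot> t) = y \<cdot> t \<cdot> s" "up (y \<cdot> t)" using less.IH[OF y(1) _ sx le_trans[OF le less.prems(2)]] y by auto
    have ne: "M (y \<cdot> t) \<noteq> q \<cdot> (y \<cdot> t)"
    proof
      assume a: "M (y \<cdot> t) = q \<cdot> (y \<cdot> t)"
      have "y \<cdot> t \<preceq> w" using le_trans[OF le less.prems(2)] .
      then have "s \<in> supp (M (y \<cdot> t))" using s_supp_M IH(2) by blast
      then have "s \<in> supp (x \<cdot> t)" using a eq by simp
      then show False using sp J less.prems(1) tK by auto
    qed
    have c: "condL q (y \<cdot> t)" unfolding condL_def using ytC IH(2) k(1) nq ne less.prems(2) eq by auto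
    have "M (q \<cdot> (y \<cdot> t)) = q \<cdot> M (y \<cdot> t)" using comm_l[OF c] k(5) unfolding goodL_def by blast
    moreover have "up (q \<cdot> (y \<cdot> t))" using spm.condR_up(1)[OF dualM, unfolded dualM_defs, OF c]
      unfolding spm.up_def[OF dualM] up_def .
    ultimately show ?thesis using eq IH(1) y J k(1) by (simp add: assoc)
  qed
qed

lemma ust: assumes "u = s \<cdot> t" shows "p' = s" "p = t" "len u = 2" "len (p \<cdot> u) = 3" "DL (p \<cdot> u) = {t}"
proof -
  have "DL u = {s}" using DL_two[of s t] J assms s_S by simp
  then show p: "p' = s" using DLu by simp
  then show "p = t" using pp by auto
  then show "DL (p \<cdot> u) = {t}" using DLpu by simp
  show "len u = 2" using assms len_two[of s t] J s_S by simp
  then show "len (p \<cdot> u) = 3" using pu_facts by simp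
qed

text \<open>This and \<open>stfst_not_le\<close> serve the case \<open>u = s t\<close>, which is too
  short for \<open>u_long_factor\<close>. The image of \<open>s t h t\<close> can only end in
  \<open>t\<close>, hence is \<open>t s t h t\<close>, and it lies above
  \<open>M (h t) = h t s\<close>. Splitting \<open>h t s\<close> along \<open>t s\<close> and
  \<open>t h t\<close> puts its \<open>s\<close> into the left part, so \<open>h t s\<close> begins
  with \<open>s\<close> or \<open>t\<close>. By exchange it then equals \<open>s h t\<close> or
  \<open>t h t\<close>. The first would make \<open>s\<close> commute with \<open>t\<close>; the
  second lacks \<open>s\<close>.\<close>

lemma stht_not_le: assumes us: "u = s \<cdot> t" and h: "h \<in> C" "supp h \<subseteq> K" "t \<notin> DL (h \<cdot> t)" "DR (t \<cdot> (h \<cdot> t)) = {t}"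
  shows "\<not> u \<cdot> (h \<cdot> t) \<preceq> w"
proof
  note us' = ust[OF us]
  let ?v = "t \<cdot> (h \<cdot> t)" and ?P = "p \<cdot> u"
  let ?e = "u \<cdot> (h \<cdot> t)"
  assume ew: "?e \<preceq> w"
  have sS: "s \<in> S" by simp
  have tK: "t \<notin> K" "s \<notin> K" using AK[OF tA] Kst(2) by blast+
  have C: "h \<cdot> t \<in> C" "?v \<in> C" "u \<cdot> h \<in> C" "?e \<in> C" "?P \<in> C" using h J pu_facts by auto
  have ths: "t \<notin> supp h" "s \<notin> supp h" using tK h by auto
  have sht: "supp (h \<cdot> t) = insert t (supp h)" using supp_supp_r[of h t] h J ths by simp
  have lht: "len (h \<cdot> t) = Suc (len h)" using len_supp_r[of h t] h J ths by simp
  have sv: "supp ?v = insert t (supp h)" using supp_up_l[of t "h \<cdot> t"] sht h C J by simp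
  have lv: "len ?v = Suc (Suc (len h))" using nDL_len[of t "h \<cdot> t"] lht h C J by simp
  have svn: "s \<notin> supp ?v" using sv ths J by auto
  have e_eq: "?e = s \<cdot> ?v" using us h J sS by (simp add: assoc)
  have e_eq2: "?e = u \<cdot> h \<cdot> t" using h J by (simp add: assoc)
  have se: "supp ?e = insert s (insert t (supp h))" using supp_supp_l[OF C(2) sS svn] e_eq sv by simp
  have le: "len ?e = 3 + len h" using len_supp_l[OF C(2) sS svn] e_eq lv by simp
  have De: "DR ?e = {t}" unfolding e_eq using DR_left_new[OF C(2) sS svn _ J(3)[symmetric]] sv h(4) by simp
  have luh: "len (u \<cdot> h) = 2 + len h"
  proof -
    have "adds u h" using adds_min[OF J(8) h(1,2)] DRu tK by auto
    then show ?thesis using us'(3) by (simp add: adds_def)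
  qed
  have te: "t \<in> DR ?e" using De by simp
  have uh: "?e \<cdot> t = u \<cdot> h" using e_eq2 C J by simp
  have cov: "cov (u \<cdot> h) ?e" using down_r[OF te C(4)] le luh uh by (simp add: cov_def)
  have uhw: "u \<cdot> h \<preceq> w" using le_trans[OF covD(1)[OF cov] ew] .
  have Muh: "M (u \<cdot> h) = ?P \<cdot> h" "up (u \<cdot> h)" using M_u_mult[OF h(1,2) uhw] by auto
  have aPh: "adds ?P h" using adds_min[OF C(5) h(1,2)] DRpu tK by auto
  have lPh: "len (?P \<cdot> h) = 3 + len h" using aPh us' by (simp add: adds_def)
  have PPh: "?P \<preceq> ?P \<cdot> h" using le_adds_l[OF aPh C(5) h(1)] .
  have nP: "\<not> ?P \<preceq> ?e"
  proof
    assume "?P \<preceq> ?e"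
    then obtain x1 x2 where x: "?P = x1 \<cdot> x2" "adds x1 x2" "x1 \<preceq> s" "x2 \<preceq> ?v"
      using subword[of ?P s ?v] e_eq C adds_DL[OF sS C(2)] not_supp_DL[OF C(2) svn] by auto
    have xC: "x1 \<in> C" "x2 \<in> C" using x le_C1 by blast+
    have "x1 = e \<or> x1 = s" using supp_single[OF xC(1), of s] supp_mono[OF x(3)] sS by simp
    then show False
    proof
      assume "x1 = e"
      then have "?P \<preceq> ?v" using x xC by simp
      then have "s \<in> supp ?v" using supp_mono supp_mono[OF pu_facts(4)] u_facts(2) by blast
      then show False using svn by simp
    next
      assume "x1 = s"
      then have "s \<in> DL ?P" using DL_adds[OF x(2) xC] sS x(1) by simp
      then show False using us' J by simp
    qed
  qed
  have "M (u \<cdot> h) \<noteq> ?e" using Muh PPh nP by auto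
  then have le1: "?P \<cdot> h \<preceq> M ?e" using M_sp[OF cov ew] Muh by simp
  have upe: "up ?e"
  proof (rule ccontr)
    assume "\<not> up ?e"
    then have "len ?e = Suc (len (M ?e))" using dn_len[OF ew] by simp
    then show False using le_len_le[OF le1] lPh le by simp
  qed
  let ?y = "M ?e"
  have yC: "?y \<in> C" using M_C[OF ew] .
  have ly: "len ?y = 4 + len h" using up_len[OF ew upe] le by simp
  have Py: "?P \<preceq> ?y" using le_trans[OF PPh le1] .
  have y1: "g = t" if g: "g \<in> DR ?y" for g
  proof (rule ccontr)
    assume n: "g \<noteq> t"
    have "?e \<preceq> ?y \<cdot> g" using liftR1[OF up_leM[OF ew upe] g] De n by simp
    moreover have "len (?y \<cdot> g) = len ?e" using DR_len[OF g yC] ly le by simp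
    ultimately have "?e = ?y \<cdot> g" using le_eq by fastforce
    moreover have "?P \<preceq> ?y \<cdot> g" using liftR1[OF Py g] DRpu n by simp
    ultimately show False using nP by simp
  qed
  have "?y \<noteq> e" using ly len_e0 by (metis add_is_0 zero_neq_numeral)
  then have ty: "t \<in> DR ?y" using ex_DR[OF yC] y1 by blast
  have P_eq: "?P = t \<cdot> s \<cdot> t" using us us' J sS by (simp add: assoc)
  have ts: "DR (t \<cdot> s) = {s}" using DR_two[of s t] J sS by simp
  have tsC: "t \<cdot> s \<in> C" "t \<cdot> h \<in> C" using J sS h by auto
  have th: "supp (t \<cdot> h) \<subseteq> insert t K" using supp_supp_l[of h t] h J ths by auto
  have Ph: "?P \<cdot> h = t \<cdot> s \<cdot> (t \<cdot> h)" unfolding P_eq using J sS h by (simp add: assoc)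
  have nth: "t \<notin> DR (t \<cdot> h)"
  proof
    assume a: "t \<in> DR (t \<cdot> h)"
    have "len (t \<cdot> h \<cdot> t) < len (t \<cdot> h)" using a by (simp add: DR_def)
    moreover have "len (t \<cdot> h) = Suc (len h)" using len_supp_l[of h t] h J ths by simp
    ultimately show False using lv h J by (simp add: assoc)
  qed
  have ntP: "t \<notin> DR (?P \<cdot> h)" unfolding Ph using DR_parab[OF tsC th, of t] ts tK J nth by auto
  have "?P \<cdot> h \<preceq> ?y \<cdot> t" using liftR1[OF le1 ty ntP] .
  moreover have "len (?y \<cdot> t) = len (?P \<cdot> h)" using DR_len[OF ty yC] ly lPh by simp
  ultimately have "?P \<cdot> h = ?y \<cdot> t" using le_eq by fastforce
  then have "?P \<cdot> h \<cdot> t = ?y" using yC J by simp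
  then have y_eq: "?y = t \<cdot> s \<cdot> ?v" unfolding Ph using J sS h by (simp add: assoc)
  have htu: "h \<cdot> t \<preceq> ?e" using le_trans[OF up_l[OF J(1) h(3) C(1)]] e_eq up_l[OF sS not_supp_DL[OF C(2) svn] C(2)] by simp
  have htw: "h \<cdot> t \<preceq> w" using le_trans[OF htu ew] .
  have "h \<cdot> t \<cdot> s \<preceq> ?y" using Mmono[OF htu ew _ upe] M_mult_t[OF h(1,2) htw] by simp
  moreover have "adds (t \<cdot> s) ?v"
  proof -
    have "len (t \<cdot> s) = 2" using len_two[of t s] J sS by simp
    then show ?thesis using ly lv y_eq by (simp add: adds_def)
  qed
  ultimately obtain x1 x2 where x: "h \<cdot> t \<cdot> s = x1 \<cdot> x2" "adds x1 x2" "x1 \<preceq> t \<cdot> s" "x2 \<preceq> ?v"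
    using subword[of "h \<cdot> t \<cdot> s" "t \<cdot> s" ?v] y_eq C(2) tsC by auto
  have xC: "x1 \<in> C" "x2 \<in> C" using x le_C1 by blast+
  have nsht: "s \<notin> supp (h \<cdot> t)" using sht ths J by auto
  have "s \<in> supp (h \<cdot> t \<cdot> s)" using supp_supp_r[OF C(1) sS nsht] by simp
  moreover have "s \<notin> supp x2" using supp_mono[OF x(4)] svn by blast
  ultimately have sx1: "s \<in> supp x1" using supp_adds[OF x(2) xC] x(1) by simp
  then have "x1 \<noteq> e" by auto
  then obtain g where g: "g \<in> DL x1" using ex_DL xC by blast
  have gD: "g \<in> DL (h \<cdot> t \<cdot> s)" using DL_adds[OF x(2) xC g] x(1) by simp
  have gst: "g = s \<or> g = t" using DL_supp[OF g xC(1)] supp_mono[OF x(3)] supp_two[of t s] J sS by blast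
  have ng: "g \<notin> DL (h \<cdot> t)" using gst h(3) not_supp_DL[OF C(1) nsht] by blast
  have nr: "s \<notin> DR (h \<cdot> t)" using not_supp_DR[OF C(1) nsht] .
  have eq: "h \<cdot> t \<cdot> s = g \<cdot> (h \<cdot> t)" using DL_new2[OF C(1) sS nr gD ng] .
  show False using gst
  proof
    assume "g = s"
    then have "s \<cdot> (h \<cdot> t) = h \<cdot> t \<cdot> s" using eq by simp
    then have "t \<cdot> s = s \<cdot> t" using comm_supp[OF C(1) sS nsht] sht by blast
    then show False using J by simp
  next
    assume "g = t"
    then show False using eq \<open>s \<in> supp (h \<cdot> t \<cdot> s)\<close> svn by simp
  qed
qed

text \<open>Write \<open>P = p u = t s t\<close> and \<open>E = s t f s t\<close>. Then
  \<open>M E\<close> lies above \<open>P f\<close>, \<open>f P\<close> and \<open>f t s\<close>, the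
  images of \<open>u f\<close>, \<open>f u\<close> and \<open>f t\<close>. As neither
  \<open>P f\<close> nor \<open>f P\<close> is below \<open>E\<close>, \<open>M E\<close> begins
  only with \<open>s\<close> and ends only with \<open>t\<close>. Removing both letters leaves an
  element of length 4, which is \<open>P f\<close>, still above \<open>f t s\<close>. Then
  \<open>min_le\<close> removes the last \<open>f\<close> and gives \<open>f t s \<le> P\<close>,
  although \<open>P\<close> lacks \<open>f\<close>.\<close>

lemma stfst_not_le: assumes us: "u = s \<cdot> t" and f: "f \<in> K" "f \<cdot> t \<noteq> t \<cdot> f" shows "\<not> u \<cdot> (f \<cdot> u) \<preceq> w"
proof
  note us' = ust[OF us]
  let ?P = "p \<cdot> u" and ?E = "u \<cdot> (f \<cdot> u)"
  assume Ew: "?E \<preceq> w"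
  note k = Kst[OF f(1)]
  have sS: "s \<in> S" by simp
  have uC: "u \<in> C" and PC: "?P \<in> C" and fC: "f \<in> C" using J pu_facts k by auto
  have fu: "f \<notin> supp u" "f \<notin> supp ?P" using u_supp pu_facts(3) k(2) by blast+
  have C: "u \<cdot> f \<in> C" "f \<cdot> u \<in> C" "?P \<cdot> f \<in> C" "f \<cdot> ?P \<in> C" "?E \<in> C" "f \<cdot> t \<in> C" "s \<cdot> ?E \<in> C" "t \<cdot> s \<in> C" "s \<cdot> t \<in> C" "t \<cdot> f \<in> C"
    using uC PC fC J sS by auto
  have nK: "DR u \<inter> K = {}" using DRu AK[OF tA] by auto
  have D1: "DR (u \<cdot> f) = {f}" using DR_chain[OF uC k(1) fu(1) _ J(1)] DRu f by auto
  have D2: "DL (f \<cdot> ?P) = {f}" using DL_chain[OF PC k(1) fu(2) _ J(1)] us' f by auto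
  have tP: "t \<in> supp ?P" using supp_mono[OF pu_facts(4)] u_facts by blast
  have D3: "DL (?P \<cdot> f) = {t}" using DL_right_new[OF PC k(1) fu(2) tP] f us' by auto
  have D4: "DR (f \<cdot> ?P) = {t}" using DR_left_new[OF PC k(1) fu(2) tP] f DRpu by auto
  have D5: "DR (?P \<cdot> f) = {f}" using DR_chain[OF PC k(1) fu(2) _ J(1)] DRpu f by auto
  have ad: "adds (u \<cdot> f) u" using adds_min[OF C(1) uC u_supp] D1 k(2) by auto
  have E_eq: "?E = u \<cdot> f \<cdot> u" using uC fC by (simp add: assoc)
  have luf: "len (u \<cdot> f) = 3" "len (f \<cdot> u) = 3" "len (?P \<cdot> f) = 4" "len (f \<cdot> ?P) = 4"
    using len_supp_r[OF uC k(1) fu(1)] len_supp_l[OF uC k(1) fu(1)] len_supp_r[OF PC k(1) fu(2)] len_supp_l[OF PC k(1) fu(2)] us' by auto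
  have lE: "len ?E = 5" using ad us' luf E_eq by (simp add: adds_def)
  have ufE: "u \<cdot> f \<preceq> ?E" using le_adds_l[OF ad C(1) uC] E_eq by simp
  have ad2: "adds u (f \<cdot> u)" using lE us' luf by (simp add: adds_def)
  have fuE: "f \<cdot> u \<preceq> ?E" using le_adds_r[OF ad2 C(2) uC] by simp
  have ufw: "u \<cdot> f \<preceq> w" and fuw: "f \<cdot> u \<preceq> w" using le_trans[OF ufE Ew] le_trans[OF fuE Ew] by auto
  have Mf: "M (u \<cdot> f) = ?P \<cdot> f" "up (u \<cdot> f)" using M_u_mult[OF fC _ ufw] f(1) k(1) by auto
  have nf: "f \<notin> DL u" using not_supp_DL[OF uC fu(1)] .
  have "condL f u"
  proof -
    have "M u \<noteq> f \<cdot> u"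
    proof
      assume "M u = f \<cdot> u"
      then have "f \<in> supp ?P" using Mu supp_supp_l[OF uC k(1) fu(1)] by simp
      then show False using fu by simp
    qed
    then show ?thesis unfolding condL_def using uC u_up k(1) nf fuw by auto
  qed
  then have Mfu: "M (f \<cdot> u) = f \<cdot> ?P" "up (f \<cdot> u)"
    using comm_l[of f u] k(5) Mu spm.condR_up(1)[OF dualM, unfolded dualM_defs, of f u, unfolded spm.up_def[OF dualM], folded up_def]
    unfolding goodL_def by auto
  have ftu: "f \<cdot> t \<preceq> f \<cdot> u"
  proof -
    have "t \<preceq> u" using u_facts by (simp add: supp_def)
    then show ?thesis using liftL4 k(1) nf by blast
  qed
  have ftE: "f \<cdot> t \<preceq> ?E" using le_trans[OF ftu fuE] .
  have ftw: "f \<cdot> t \<preceq> w" using le_trans[OF ftE Ew] .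
  have Mft: "M (f \<cdot> t) = f \<cdot> t \<cdot> s" "up (f \<cdot> t)" using M_mult_t[OF fC _ ftw] f(1) k(1) by auto
  have sv: "?E = s \<cdot> (t \<cdot> (f \<cdot> u))" using us uC fC J sS by (simp add: assoc)
  have sE: "s \<cdot> ?E = t \<cdot> (f \<cdot> u)" unfolding sv using uC fC J sS by simp
  have eqs: "f \<cdot> u = s \<cdot> (f \<cdot> t)"
  proof -
    have "f \<cdot> u = f \<cdot> s \<cdot> t" unfolding us using fC J sS by (simp add: assoc)
    also have "\<dots> = s \<cdot> (f \<cdot> t)" unfolding k(3) using fC J sS by (simp add: assoc)
    finally show ?thesis .
  qed
  have Dft: "DL (f \<cdot> t) = {f}" "DR (f \<cdot> t) = {t}" "DL (t \<cdot> f) = {t}" "DL (t \<cdot> s) = {t}" "DR (t \<cdot> s) = {s}"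
    using DL_two[of f t] DR_two[of t f] DL_two[of t f] DL_two[of t s] DR_two[of s t] f k(1) J sS by auto
  have sts: "DR (u \<cdot> s) = {s}"
  proof -
    have sus: "supp (u \<cdot> s) \<subseteq> {s,t}" using supp_mul_S[OF sS uC] u_supp by blast
    have n: "s \<notin> DR u" using DRu J by simp
    have l: "len (u \<cdot> s) = 3" using nDR_len[OF sS n uC] us' by simp
    have "t \<notin> DR (u \<cdot> s)"
    proof
      assume "t \<in> DR (u \<cdot> s)"
      then have "u \<cdot> s = ?P" using dih_eq_r[of "u \<cdot> s" ?P s t t] sus pu_facts uC PC sS l us' DRpu by auto
      moreover have "s \<in> DL (u \<cdot> s)" using DL_adds[of u s s] adds_DR[of s u] n uC sS DLu us' by simp
      ultimately show False using us' J by simp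
    qed
    moreover have "s \<in> DR (u \<cdot> s)" using n uC sS by simp
    moreover have "DR (u \<cdot> s) \<subseteq> {s,t}" using DR_pair[OF _ sus] uC sS by simp
    ultimately show ?thesis by blast
  qed
  have E2: "?E = u \<cdot> s \<cdot> (f \<cdot> t)" unfolding eqs using uC sS fC J by (simp add: assoc)
  have sup_ft: "supp (f \<cdot> t) \<subseteq> {t,f}" using supp_two[OF k(1) J(1)] by blast
  have suppE: "supp ?E \<subseteq> {s,t,f}" unfolding E_eq using supp_adds[OF ad C(1) uC] supp_supp_r[OF uC k(1) fu(1)] u_supp by auto
  have DE: "DR ?E = {t}"
  proof -
    have "s \<notin> DR ?E" unfolding E_eq using DR_parab[OF C(1) uC u_supp, of s] D1 k(2) DRu J by auto
    moreover have "t \<in> DR ?E" unfolding E_eq using DR_adds[OF ad uC C(1)] DRu by simp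
    moreover have "f \<notin> DR ?E" unfolding E2 using DR_parab[of "u \<cdot> s" "f \<cdot> t" "{t,f}" f] sts Dft sup_ft uC sS fC J k(2) by auto
    ultimately show ?thesis using DR_pair[OF C(5) suppE] by blast
  qed
  have DtE: "s \<notin> DL (s \<cdot> ?E)" "f \<notin> DL (s \<cdot> ?E)"
  proof -
    have eq1: "s \<cdot> ?E = t \<cdot> s \<cdot> (f \<cdot> t)" unfolding sE unfolding eqs using J sS fC by (simp add: assoc)
    have "supp (t \<cdot> s) \<subseteq> {s,t}" using supp_two[OF J(1) sS] by blast
    then show "s \<notin> DL (s \<cdot> ?E)" unfolding eq1
      using DL_parab[of "f \<cdot> t" "t \<cdot> s" "{s,t}" s] Dft k(2) C J sS by auto
    have eq2: "s \<cdot> ?E = t \<cdot> f \<cdot> (s \<cdot> t)" unfolding sE unfolding us using J sS fC by (simp add: assoc)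
    show "f \<notin> DL (s \<cdot> ?E)" unfolding eq2
      using DL_parab[of "s \<cdot> t" "t \<cdot> f" "{t,f}" f] Dft DLu us us' k(1,2) C J sS supp_two[of t f] by auto
  qed
  have lsE: "len (s \<cdot> ?E) = 4"
    using nDL_len[OF sS DtE(1) C(7)] lE C sS by simp
  have sdE: "s \<in> DL ?E" using DtE(1) C(5) sS by simp
  have DLE: "DL ?E = {s}"
  proof -
    have "t \<notin> DL ?E" unfolding E2 using DL_parab[of "f \<cdot> t" "u \<cdot> s" "{s,t}" t] Dft k(2) C uC sS supp_mul_S[OF sS uC] u_supp
    proof -
      have "t \<notin> DL (u \<cdot> s)"
      proof
        assume a: "t \<in> DL (u \<cdot> s)"
        have n: "s \<notin> DR u" using DRu J by simp
        have "s \<in> DL (u \<cdot> s)" using DL_adds[of u s s] adds_DR[of s u] n uC sS DLu us' by simp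
        moreover have "supp (u \<cdot> s) \<subseteq> {s,t}" using supp_mul_S[OF sS uC] u_supp by blast
        moreover have "len (u \<cdot> s) = 3" using nDR_len[OF sS n uC] us' by simp
        ultimately have "u \<cdot> s = ?P" using dih_eq[of "u \<cdot> s" ?P s t t] a pu_facts uC PC sS us' by auto
        then show False using sts DRpu J by simp
      qed
      moreover have "supp (u \<cdot> s) \<subseteq> {s,t}" using supp_mul_S[OF sS uC] u_supp by blast
      moreover have "DL (f \<cdot> t) \<inter> {s,t} = {}" using Dft k(2) by auto
      ultimately show "t \<notin> DL (u \<cdot> s \<cdot> (f \<cdot> t))" using DL_parab[of "f \<cdot> t" "u \<cdot> s" "{s,t}" t] C uC sS by simp
    qed
    moreover have "f \<notin> DL ?E"
    proof -
      have "?E = s \<cdot> (s \<cdot> ?E)" using C sS by simp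
      moreover have "f \<notin> DL (s \<cdot> (s \<cdot> ?E))" using DL_parab[of "s \<cdot> ?E" s "{s,f}" f] DtE C(7) sS k(1,2) by auto
      ultimately show ?thesis by simp
    qed
    ultimately show ?thesis using DL_pair[OF C(5) suppE] sdE by blast
  qed
  have X1: "\<not> ?P \<cdot> f \<preceq> ?E"
  proof
    assume "?P \<cdot> f \<preceq> ?E"
    then have "?P \<cdot> f \<preceq> s \<cdot> ?E" using liftL1 sdE D3 J by auto
    then have "?P \<cdot> f = s \<cdot> ?E" by (rule le_eq) (simp add: luf lsE)
    then have fr: "f \<in> DR (s \<cdot> ?E)" using D5 by simp
    have "adds s (s \<cdot> ?E)" using adds_DL[OF sS C(7)] DtE by simp
    then have "f \<in> DR (s \<cdot> (s \<cdot> ?E))" using DR_adds C(7) sS fr by simp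
    then have "f \<in> DR ?E" using C(5) sS by simp
    then show False using DE k(2) by simp
  qed
  have X3: "\<not> f \<cdot> ?P \<preceq> ?E"
  proof
    assume "f \<cdot> ?P \<preceq> ?E"
    then have "f \<cdot> ?P \<preceq> s \<cdot> ?E" using liftL1 sdE D2 k(2) by auto
    then have "f \<cdot> ?P = s \<cdot> ?E" by (rule le_eq) (simp add: luf lsE)
    then have "f \<in> DL (s \<cdot> ?E)" using D2 by simp
    then show False using DtE by simp
  qed
  have upE: "up ?E" using Mlift1[OF ufE Ew _ Mf(2)] Mf(1) X1 by auto
  let ?y = "M ?E"
  have yC: "?y \<in> C" using M_C[OF Ew] .
  have ly: "len ?y = 6" using up_len[OF Ew upE] lE by simp
  have Ey: "?E \<preceq> ?y" using up_leM[OF Ew upE] .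
  have y1: "?P \<cdot> f \<preceq> ?y" using Mmono[OF ufE Ew Mf(2) upE] Mf by simp
  have y3: "f \<cdot> ?P \<preceq> ?y" using Mmono[OF fuE Ew Mfu(2) upE] Mfu by simp
  have y4: "f \<cdot> t \<cdot> s \<preceq> ?y" using Mmono[OF ftE Ew Mft(2) upE] Mft by simp
  have ne: "?y \<noteq> e" using ly by (metis len_e0 zero_neq_numeral)
  have DLy: "h = s" if h: "h \<in> DL ?y" for h
  proof (rule ccontr)
    assume n: "h \<noteq> s"
    have "?E \<preceq> h \<cdot> ?y" using liftL1[OF Ey h] DLE n by simp
    then have eq: "?E = h \<cdot> ?y" by (rule le_eq) (use DL_len[OF h yC] ly lE in simp)
    show False
    proof (cases "h = t")
      case True
      then show False using liftL1[OF y3 h] D2 k(2) X3 eq by auto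
    next
      case False
      then show False using liftL1[OF y1 h] D3 X1 eq by auto
    qed
  qed
  have DRy: "h = t" if h: "h \<in> DR ?y" for h
  proof (rule ccontr)
    assume n: "h \<noteq> t"
    have "?E \<preceq> ?y \<cdot> h" using liftR1[OF Ey h] DE n by simp
    then have eq: "?E = ?y \<cdot> h" by (rule le_eq) (use DR_len[OF h yC] ly lE in simp)
    show False using liftR1[OF y3 h] D4 n X3 eq by auto
  qed
  have sy: "s \<in> DL ?y" using ex_DL[OF yC ne] DLy by blast
  let ?z = "s \<cdot> ?y"
  have zC: "?z \<in> C" and yz: "?y = s \<cdot> ?z" using yC sS by auto
  have lz: "len ?z = 5" using DL_len[OF sy yC] ly by simp
  have "?z \<noteq> e" using lz by (metis len_e0 zero_neq_numeral)
  then obtain g where g: "g \<in> DR ?z" using ex_DR zC by blast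
  have adz: "adds s ?z" using DL_len[OF sy yC] yz sS by (simp add: adds_def)
  have "g \<in> DR ?y" using DR_adds[OF adz zC _ g] sS yz by simp
  then have tz: "t \<in> DR ?z" using DRy g by blast
  have lzt: "len (?z \<cdot> t) = 4" using DR_len[OF tz zC] lz by simp
  have "?P \<cdot> f \<preceq> ?z" using liftL1[OF y1 sy] D3 J by simp
  then have "?P \<cdot> f \<preceq> ?z \<cdot> t" using liftR1[OF _ tz] D5 k(2) by auto
  then have eq: "?P \<cdot> f = ?z \<cdot> t" by (rule le_eq) (simp add: luf lzt)
  have nsft: "s \<notin> supp (f \<cdot> t)" using sup_ft k(2) J by auto
  have tft: "t \<in> supp (f \<cdot> t)" using DR_supp[of t "f \<cdot> t"] Dft C by simp
  have DLfts: "DL (f \<cdot> t \<cdot> s) = {f}" using DL_right_new[OF C(6) sS nsft tft] J Dft by simp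
  have DRfts: "DR (f \<cdot> t \<cdot> s) = {s}" using DR_chain[OF C(6) sS nsft _ J(1)] J Dft by auto
  have "f \<cdot> t \<cdot> s \<preceq> ?z" using liftL1[OF y4 sy] DLfts k(2) by auto
  then have "f \<cdot> t \<cdot> s \<preceq> ?z \<cdot> t" using liftR1[OF _ tz] DRfts J by auto
  then have "f \<cdot> t \<cdot> s \<preceq> ?P \<cdot> f" using eq by simp
  then have "f \<cdot> t \<cdot> s \<preceq> ?P" using min_le[of "f \<cdot> t \<cdot> s" ?P f "{f}"] PC fC k(1,2) DRfts by auto
  then have "supp (f \<cdot> t \<cdot> s) \<subseteq> supp ?P" by (rule supp_mono)
  moreover have "f \<in> supp (f \<cdot> t \<cdot> s)" using DL_supp[of f "f \<cdot> t \<cdot> s"] DLfts C(6) sS by simp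
  ultimately show False using fu by blast
qed

text \<open>Factor \<open>w = a y x1\<close> with \<open>x1\<close> over \<open>K\<close> and
  \<open>y\<close> over \<open>{s,t}\<close>. A last letter \<open>f\<close> of \<open>a\<close>
  lies in \<open>K\<close> and does not commute with \<open>t\<close>, since otherwise it would move
  past \<open>y\<close>; it is the letter to insert in \<open>split\<close>. Again \<open>p'\<close>
  is kept out of \<open>a\<close>, so that a left descent of \<open>a\<close> is good. If
  \<open>x1\<close> is nontrivial, its right descents are good too and \<open>two_tops\<close>
  decides.\<close>

lemma settled_A_single: assumes B: "B = {}" and A: "A \<subseteq> {t}" shows settled
proof -
  have sS: "s \<in> S" by simp
  obtain w' x1 where wx: "w' \<in> C" "x1 \<in> C" "w = w' \<cdot> x1" "adds w' x1" "supp x1 \<subseteq> K" "DR w' \<inter> K = {}"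
    using parab[OF wC, of K] by blast
  obtain a y where ay: "a \<in> C" "y \<in> C" "w' = a \<cdot> y" "adds a y" "supp y \<subseteq> {s,t}" "DR a \<inter> {s,t} = {}"
    using parab[OF wx(1), of "{s,t}"] by blast
  have yxC: "y \<cdot> x1 \<in> C" using ay wx by simp
  have ad: "adds y x1" "adds a (y \<cdot> x1)" using adds_assoc1[OF ay(1,2) wx(2) ay(4)] wx(4) ay(3) by auto
  have w_eq: "w = a \<cdot> (y \<cdot> x1)" using wx(3) ay(1-3) wx(2) by (simp add: assoc)
  have w'w: "w' \<preceq> w" using le_adds_l[OF wx(4,1,2)] wx(3) by simp
  have aw': "a \<preceq> w'" using le_adds_l[OF ay(4,1,2)] ay(3) by simp
  have aw: "a \<preceq> w" using le_trans[OF aw' w'w] .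
  have x1w: "x1 \<preceq> w" using le_adds_r[OF wx(4,2,1)] wx(3) by simp
  have cs: "c = s \<or> c = t \<or> c \<in> K" if "c \<in> supp w" for c
    using cases_ABK[of c] that B A by (auto simp: supp_def)
  have tK: "t \<notin> K" "s \<notin> K" using AK[OF tA] Kst(2) by blast+
  show ?thesis
  proof (cases "a = e")
    case True
    have w2: "w = y \<cdot> x1" using w_eq True yxC by simp
    show ?thesis
    proof (cases "x1 = e")
      case True
      then have "supp w \<subseteq> {s,t}" using w2 ay by simp
      then show ?thesis unfolding settled_def using sS J(1) by blast
    next
      case False
      then obtain q where q: "q \<in> DR x1" using ex_DR wx by blast
      have "q \<in> K" using DR_supp[OF q wx(2)] wx(5) by blast
      then have gq: "goodR q" by (rule goodR_K)
      have D: "DL x1 \<inter> {s,t} = {}" using DL_pair[OF wx(2,5)] tK by blast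
      have "up x1" using sfree_up[OF x1w] wx(5) tK by blast
      then show ?thesis using exitR[OF w2 ay(2) wx(2) ay(5) D _ q gq] by blast
    qed
  next
    case False
    then obtain f where f: "f \<in> DR a" using ex_DR ay(1) by blast
    have fsa: "f \<in> supp a" using DR_supp[OF f ay(1)] .
    have fK: "f \<in> K" using cs supp_mono[OF aw] fsa f ay(6) by blast
    note k = Kst[OF fK]
    have fC: "f \<in> C" using k by simp
    have nfw: "f \<notin> DR w'" using wx(6) fK by blast
    have ftt: "t \<in> supp y \<and> f \<cdot> t \<noteq> t \<cdot> f"
    proof (rule ccontr)
      assume n: "\<not> ?thesis"
      have "\<And>h. h \<in> supp y \<Longrightarrow> h \<cdot> f = f \<cdot> h" using n ay(5) k(3) by fastforce
      then have "f \<cdot> y = y \<cdot> f" using comm_all[of y f] ay(2) k(1) by blast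
      moreover have "f \<notin> DR y" using not_supp_DR[OF ay(2)] ay(5) k(2) by blast
      moreover obtain b where b: "b \<in> C" "a = b \<cdot> f" "f \<notin> DR b" "len a = Suc (len b)" using factor_r[OF f ay(1)] by blast
      ultimately have "w' \<cdot> f = b \<cdot> y" using ay(2,3) fC k(1) assoc[of b f y] assoc[of b y f, symmetric] by simp
      then have "len (w' \<cdot> f) \<le> len b + len y" using len_mul_le b ay by simp
      moreover have "len w' = len a + len y" using ay(3,4) by (simp add: adds_def)
      ultimately have "f \<in> DR w'" using b(4) k(1) by (simp add: DR_def)
      then show False using nfw by simp
    qed
    then have tsy: "t \<preceq> y" and ft: "f \<cdot> t \<noteq> t \<cdot> f" by (auto simp: supp_def)
    have into: "y1 \<cdot> (f \<cdot> z) \<preceq> w" if "y1 \<preceq> a" "z \<preceq> y" for y1 z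
    proof -
      have "(y1 \<cdot> f) \<cdot> z \<preceq> w'" using mul_mono[OF liftR2[OF that(1) f] that(2) ay(4)] ay(3) by simp
      then have "y1 \<cdot> (f \<cdot> z) \<preceq> w'" using le_C1[OF that(1)] le_C1[OF that(2)] fC assoc by simp
      then show ?thesis using le_trans[OF _ w'w] by blast
    qed
    \<comment> \<open>By \<open>split\<close>, \<open>f\<close> commutes with all letters of one
      part. It does not commute with \<open>t\<close>, which occurs in \<open>z\<close>, so
      \<open>t\<close> cannot occur in \<open>y1\<close>.\<close>
    have sp: "t \<notin> supp y1 \<and> t \<notin> supp z \<or> t \<notin> supp y1" if "y1 \<preceq> a" "z \<preceq> y" "u = y1 \<cdot> z" "adds y1 z" "y1 \<noteq> e" "z \<noteq> e" "t \<in> supp z" for y1 z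
      using split[OF that(3-6) le_C1[OF that(1)] le_C1[OF that(2)] k(1,2) into[OF that(1,2)]] that(7) ft by metis
    have ex_t: "t \<in> supp z" if z: "u = y1 \<cdot> z" "adds y1 z" "z \<noteq> e" "y1 \<in> C" "z \<in> C" for y1 z
    proof -
      obtain g where g: "g \<in> DR z" using ex_DR[OF z(5,3)] by blast
      then have "g = t" using DR_adds[OF z(2,5,4) g] z(1) DRu by simp
      then show ?thesis using DR_supp[OF g z(5)] by simp
    qed
    have only_s: "y1 = s" if "y1 \<preceq> a" "z \<preceq> y" "u = y1 \<cdot> z" "adds y1 z" "y1 \<noteq> e" "z \<noteq> e" for y1 z
    proof -
      have C: "y1 \<in> C" "z \<in> C" using that le_C1 by blast+
      have "t \<notin> supp y1" using sp[OF that ex_t[OF that(3,4,6) C]] by blast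
      moreover have "supp y1 \<subseteq> {s,t}" using supp_adds[OF that(4) C] that(3) u_supp by blast
      ultimately have "supp y1 \<subseteq> {s}" by blast
      then show ?thesis using supp_single[OF C(1)] that(5) by blast
    qed
    have tu: "t \<in> DR u" using DRu by simp
    have lut: "len u = Suc (len (u \<cdot> t))" using DR_len[OF tu J(8)] .
    have adut: "adds (u \<cdot> t) t" using lut J by (simp add: adds_def)
    have utne: "u \<cdot> t \<noteq> e" using lut n2 len_e0 by fastforce
    have tne: "t \<noteq> e" using J e_notin_S by metis
    have ut: "u = u \<cdot> t \<cdot> t" using J by simp
    have x'y: "p' \<cdot> u \<preceq> y"
    proof -
      have "u \<preceq> w' \<cdot> x1" using u_w wx(3) by simp
      then have "u \<preceq> w'" using min_le wx(1,2,5) DRu tK by auto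
      then obtain y1 z where yz: "u = y1 \<cdot> z" "adds y1 z" "y1 \<preceq> a" "z \<preceq> y" using subword[of u a y] ay by blast
      have C: "y1 \<in> C" "z \<in> C" using yz le_C1 by blast+
      consider "y1 = e" | "z = e" | "y1 \<noteq> e" "z \<noteq> e" by blast
      then show ?thesis
      proof cases
        case 1
        then show ?thesis using yz C le_trans[OF pu'(5)] by simp
      next
        case 2
        then have "u \<preceq> a" using yz C by simp
        then have "u \<cdot> t \<preceq> a" using le_trans[OF down_r[OF tu J(8)]] by blast
        then have us: "u \<cdot> t = s" using only_s[OF _ tsy ut adut utne tne] by blast
        have "u = s \<cdot> t" using ut us by simp
        then have "p' \<cdot> u = t" using ust(1) J sS by simp
        then show ?thesis using tsy by simp
      next
        case 3
        have y1s: "y1 = s" using only_s[OF yz(3,4,1,2) 3] .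
        then have "s \<in> DL u" using DL_adds[OF yz(2) C, of s] yz(1) sS by simp
        then have "p' = s" using DLu by simp
        then have "p' \<cdot> u = z" using yz(1) y1s C sS by simp
        then show ?thesis using yz by simp
      qed
    qed
    have p'a: "p' \<notin> supp a"
    proof
      assume pa: "p' \<in> supp a"
      then have pa': "p' \<preceq> a" by (simp add: supp_def)
      have p'e: "p' \<noteq> e" using J e_notin_S by metis
      have p's: "p' = s" using only_s[OF pa' x'y pu'(2,3) p'e pu'(4)] .
      then have ps: "p = t" using pp by auto
      obtain f2 where f2: "f2 \<in> S" "s \<cdot> f2 \<preceq> a" "s \<cdot> f2 \<noteq> f2 \<cdot> s" using ex_next[OF ay(1) sS] pa' p's ay(6) by blast
      have f2s: "f2 \<noteq> s" using f2 by auto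
      have "supp (s \<cdot> f2) = {s,f2}" using supp_supp_l[of f2 s] f2 f2s sS by simp
      then have "f2 \<in> supp a" using supp_mono[OF f2(2)] by blast
      then have "f2 = t" using cs[of f2] supp_mono[OF aw] f2 Kst(3)[of f2] f2s by auto
      then have sta: "s \<cdot> t \<preceq> a" using f2 by simp
      show False
      proof (cases "u = s \<cdot> t")
        case False
        obtain x where x: "x \<in> C" "u = p' \<cdot> p \<cdot> x" "adds (p' \<cdot> p) x" "x \<noteq> e" "x \<preceq> p' \<cdot> u" "supp (p' \<cdot> p) = {s,t}" "p' \<cdot> p \<noteq> e"
          using u_long_factor[OF False] by blast
        have "p' \<cdot> p = s" using only_s[OF _ le_trans[OF x(5) x'y] x(2,3,7,4)] sta p's ps by simp
        then have "supp (p' \<cdot> p) = {s}" using sS by simp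
        then show False using x(6) J by auto
      next
        \<comment> \<open>Now \<open>p' p\<close> is all of \<open>u\<close>. Instead take the right
          factor \<open>h\<close> of \<open>a\<close> over \<open>K\<close>: the rest
          \<open>b\<close> of \<open>a\<close> lies above \<open>s t\<close>, and \<open>y\<close>
          above \<open>t\<close>, so \<open>s t h t\<close> lies below \<open>w\<close>. To
          contradict \<open>stht_not_le\<close> it must be shown that \<open>t h t\<close> ends only
          in \<open>t\<close>.\<close>
        case us: True
        have nst: "\<not> s \<cdot> t \<preceq> y" using stfst_not_le[OF us fK ft] into[OF sta] unfolding us by blast
        obtain b h where bh: "b \<in> C" "h \<in> C" "a = b \<cdot> h" "adds b h" "supp h \<subseteq> K" "DR b \<inter> K = {}"
          using parab[OF ay(1), of K] by blast
        have fh: "f \<in> supp h" using DR_parab[OF bh(1,2,5,6) fK] f bh(3) DR_supp bh(2) by simp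
        have Dst: "DR (s \<cdot> t) = {t}" using DR_two[of t s] J sS by simp
        have stb: "s \<cdot> t \<preceq> b" using min_le[of "s \<cdot> t" b h K] sta bh Dst tK by auto
        have "b \<noteq> e"
        proof
          assume "b = e"
          then have "s \<cdot> t = e" using le_e stb by simp
          then show False using Dst by simp
        qed
        then obtain g where g: "g \<in> DR b" using ex_DR bh(1) by blast
        have bw: "b \<preceq> w" using le_trans[OF le_adds_l[OF bh(4,1,2)]] aw bh(3) by simp
        have "g \<in> supp w" using DR_supp[OF g bh(1)] supp_mono[OF bw] by blast
        then have gst: "g = s \<or> g = t" using cs bh(6) g by blast
        have "g \<noteq> s"
        proof
          assume gs: "g = s"
          have "\<And>c. c \<in> supp h \<Longrightarrow> c \<cdot> s = s \<cdot> c" using bh(5) Kst(3) by blast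
          then have hs: "s \<cdot> h = h \<cdot> s" using comm_all[of h s] bh(2) sS by blast
          obtain b' where b': "b' \<in> C" "b = b' \<cdot> s" "len b = Suc (len b')" using factor_r[OF g bh(1)] gs by blast
          have "a = b' \<cdot> (s \<cdot> h)" using bh b' sS by (simp add: assoc)
          then have "a \<cdot> s = b' \<cdot> h" using hs b' bh(2) sS assoc[of b' "h \<cdot> s" s] by simp
          then have "len (a \<cdot> s) \<le> len b' + len h" using len_mul_le b' bh by simp
          moreover have "len a = len b + len h" using bh(3,4) by (simp add: adds_def)
          ultimately have "s \<in> DR a" using b'(3) sS by (simp add: DR_def)
          then show False using ay(6) by blast
        qed
        then have tb: "t \<in> DR b" using gst g by blast
        obtain b' where b': "b' \<in> C" "b = b' \<cdot> t" "len b = Suc (len b')" using factor_r[OF tb bh(1)] by blast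
        have th: "t \<notin> supp h" using bh(5) tK by blast
        have htC: "h \<cdot> t \<in> C" using bh J by simp
        have tDL: "t \<notin> DL (h \<cdot> t)"
        proof
          assume d: "t \<in> DL (h \<cdot> t)"
          have "h \<cdot> t = t \<cdot> h" using DL_new2[OF bh(2) J(1) not_supp_DR[OF bh(2) th] d not_supp_DL[OF bh(2) th]] .
          then have "f \<cdot> t = t \<cdot> f" using comm_supp[OF bh(2) J(1) th _ fh] by simp
          then show False using ft by simp
        qed
        let ?v = "t \<cdot> (h \<cdot> t)"
        have vC: "?v \<in> C" using htC J by simp
        \<comment> \<open>\<open>stfst_not_le\<close> keeps \<open>s t\<close> from being below
          \<open>y\<close>, so \<open>y\<close> is \<open>t\<close> or \<open>t s\<close>.\<close>
        obtain z where z: "z \<in> C" "y = t \<cdot> z" "adds t z" "z = e \<or> z = s"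
        proof -
          have "y \<noteq> e" using tsy le_e tne by blast
          then obtain g2 where g2: "g2 \<in> DL y" using ex_DL ay(2) by blast
          have "s \<notin> DL y"
          proof
            assume sd: "s \<in> DL y"
            have "s \<notin> DL t" using J by simp
            then have "s \<cdot> t \<preceq> y" using liftL2[OF tsy sd] by simp
            then show False using nst by simp
          qed
          then have ty: "t \<in> DL y" using g2 DL_pair[OF ay(2,5)] by blast
          obtain z where z: "z \<in> C" "y = t \<cdot> z" "t \<notin> DL z" using factor_l[OF ty ay(2)] by blast
          have adz: "adds t z" using adds_DL J z by simp
          have zy: "z \<preceq> y" using le_adds_r[OF adz z(1)] J z by simp
          have "t \<notin> supp z"
          proof
            assume "t \<in> supp z"
            then have tz: "t \<preceq> z" by (simp add: supp_def)
            have "z \<noteq> e" using le_e tne tz by blast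
            then obtain g3 where g3: "g3 \<in> DL z" using ex_DL z by blast
            have "g3 \<in> {s,t}" using DL_supp[OF g3 z(1)] supp_mono[OF zy] ay(5) by blast
            then have sz: "s \<in> DL z" using g3 z(3) by blast
            have "s \<cdot> t \<preceq> z" using liftL2[OF tz sz] .
            then show False using nst le_trans[OF _ zy] by blast
          qed
          then have "supp z \<subseteq> {s}" using supp_mono[OF zy] ay(5) by blast
          then show ?thesis using that[OF z(1,2) adz] supp_single[OF z(1)] by blast
        qed
        have tE: "t \<in> supp ?v" "t \<in> DR ?v"
        proof -
          have vt: "supp ?v = insert t (supp h)" using supp_up_l[OF J(1) tDL htC] supp_supp_r[OF bh(2) J(1) th] by simp
          show "t \<in> supp ?v" using vt by simp
          have "t \<notin> DR (t \<cdot> h)"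
          proof
            assume a: "t \<in> DR (t \<cdot> h)"
            have "len (t \<cdot> h \<cdot> t) < len (t \<cdot> h)" using a by (simp add: DR_def)
            moreover have "len (t \<cdot> h) = Suc (len h)" using len_supp_l[OF bh(2) J(1) th] .
            moreover have "len ?v = Suc (Suc (len h))" using nDL_len[OF J(1) tDL htC] len_supp_r[OF bh(2) J(1) th] by simp
            ultimately show False using bh(2) J by (simp add: assoc)
          qed
          moreover have "t \<cdot> h \<in> C" "?v = t \<cdot> h \<cdot> t" using bh J by (simp_all add: assoc)
          ultimately show "t \<in> DR ?v" using J by simp
        qed
        have w'_eq: "w' = b' \<cdot> (?v \<cdot> z)"
          using ay(3) bh(2,3) b'(1,2) z(1,2) J by (simp add: assoc)
        have lenv: "len ?v = Suc (Suc (len h))" using nDL_len[OF J(1) tDL htC] len_supp_r[OF bh(2) J(1) th] by simp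
        have lw': "len w' = len b' + (len ?v + len z)"
          using ay(3,4) bh(3,4) b'(3) z(2,3) J lenv by (simp add: adds_def)
        have "DR ?v = {t}"
        proof -
          have "g = t" if g: "g \<in> DR ?v" for g
          proof (rule ccontr)
            assume n: "g \<noteq> t"
            have "g \<in> insert t (supp h)" using DR_supp[OF g vC] supp_up_l[OF J(1) tDL htC] supp_supp_r[OF bh(2) J(1) th] by simp
            then have gK: "g \<in> K" using n bh(5) by blast
            note kg = Kst[OF gK]
            \<comment> \<open>A last letter of \<open>t h t\<close> in \<open>K\<close> commutes
              with \<open>z\<close> and would become a right descent of \<open>w'\<close>.\<close>
            have zg: "z \<cdot> g = g \<cdot> z" using z(4) kg by auto
            have "w' \<cdot> g = b' \<cdot> (?v \<cdot> g \<cdot> z)" unfolding w'_eq using zg b'(1) z(1) vC S_C[OF kg(1)] assoc[of b'] assoc[of ?v] mul_C by metis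
            then have "len (w' \<cdot> g) \<le> len b' + (len (?v \<cdot> g) + len z)"
              using len_mul_le[of b' "?v \<cdot> g \<cdot> z"] len_mul_le[of "?v \<cdot> g" z] b'(1) z(1) vC S_C[OF kg(1)] by simp
            then have "len (w' \<cdot> g) < len w'" using lw' DR_len[OF g vC] by simp
            then have "g \<in> DR w'" using kg by (simp add: DR_def)
            then show False using wx(6) gK by blast
          qed
          then show ?thesis using tE by blast
        qed
        then have nle: "\<not> u \<cdot> (h \<cdot> t) \<preceq> w" using stht_not_le[OF us bh(2,5) tDL] by blast
        have "s \<cdot> t \<cdot> h \<preceq> b \<cdot> h" using mul_mono[OF stb le_refl[OF bh(2)] bh(4)] .
        then have "u \<cdot> h \<preceq> a" using us bh(3) by simp
        then have "u \<cdot> h \<cdot> t \<preceq> a \<cdot> y" using mul_mono[OF _ tsy ay(4)] by blast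
        then have "u \<cdot> (h \<cdot> t) \<preceq> w'" using ay(3) J bh(2) by (simp add: assoc)
        then show False using nle le_trans[OF _ w'w] by blast
      qed
    qed
    have sa: "c \<in> A \<or> c \<in> K \<or> c = s" if "c \<in> supp a" for c
      using cs[of c] supp_mono[OF aw] tA that by blast
    have sd: "s \<notin> DR a" using ay(6) by blast
    have upa: "up a" using rho_below_a[OF aw p'a sa sd] by blast
    have gd: "goodL c" if "c \<in> supp a" "c \<noteq> p" for c
    proof -
      have "c \<in> K" using that p'a pp cs[of c] supp_mono[OF aw] by blast
      then show ?thesis by (rule goodL_K)
    qed
    obtain r where r: "r \<in> DL a" using ex_DL ay(1) False by blast
    have ra: "r \<in> supp a" using DL_supp[OF r ay(1)] .
    have gr: "goodL r"
    proof (cases "r = p")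
      case True
      have "p \<notin> DR a" using ay(6) J by blast
      then show ?thesis using goodL_p_at[OF w_eq ad(2) yxC ay(1) p'a _ _ gd] ra True by blast
    qed (use gd ra in blast)
    show ?thesis
    proof (cases "x1 = e")
      case True
      have w2: "w = a \<cdot> y" using w_eq True ay by simp
      show ?thesis using exitL[OF w2 ay(2,1,5,6) upa r gr] .
    next
      case x1e: False
      obtain q where q: "q \<in> DR x1" using ex_DR[OF wx(2) x1e] by blast
      have qK: "q \<in> K" using DR_supp[OF q wx(2)] wx(5) by blast
      have gq: "goodR q" using goodR_K qK by blast
      have qS: "q \<in> S" using DR_S q by blast
      have qw: "q \<in> DR w" using DR_adds[OF wx(4,2,1) q] wx(3) by simp
      have xqC: "x1 \<cdot> q \<in> C" using wx qS by simp
      have sxq: "supp (x1 \<cdot> q) \<subseteq> K" using supp_down_r[OF q wx(2)] wx(5) by blast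
      have "adds w' (x1 \<cdot> q)" using adds_min[OF wx(1) xqC sxq wx(6)] .
      then have "adds a (y \<cdot> (x1 \<cdot> q))" using adds_assoc1[OF ay(1,2) xqC ay(4)] ay(3) by simp
      moreover have wq: "w \<cdot> q = a \<cdot> (y \<cdot> (x1 \<cdot> q))" unfolding w_eq using ay wx(2) qS by (simp add: assoc)
      moreover have yxq: "y \<cdot> (x1 \<cdot> q) \<in> C" using ay xqC by simp
      ultimately have rq: "r \<in> DL (w \<cdot> q)" using DL_adds[OF _ ay(1) _ r] by simp
      then have wqe: "w \<cdot> q \<noteq> e" using DL_e by (metis empty_iff)
      note tt = two_tops[OF wC qw wqe rq]
      then show ?thesis using gq gr qw unfolding settled_def by metis
    qed
  qed
qed

end

context spm begin

lemma settled_A: assumes "c \<in> A" "\<not> rho c" shows settled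
proof -
  obtain u p p' where "spmU C mul e S len le M w c u p p'" using ex_spmU[OF assms] by blast
  then interpret U: spmU C mul e S len le M w c u p p' .
  show ?thesis
  proof (cases "B = {}")
    case True
    then show ?thesis using U.settled_A_two U.settled_A_single by blast
  qed (use U.settled_B_nonempty in blast)
qed
lemmas settled_B = spm.settled_A[OF dualM, unfolded dualM_defs2]

theorem settled: settled
proof (cases "\<forall>c\<in>S. c \<preceq> w \<longrightarrow> rho c \<or> lam c")
  case True
  then show ?thesis using settled_mult by blast
next
  case False
  then obtain c where c: "c \<in> S" "c \<preceq> w" "\<not> rho c" "\<not> lam c" by blast
  then show ?thesis using cases_ABK[OF c(1,2)] rho_s rho_K settled_A settled_B by blast
qed

end

subsection \<open>\<open>R\<close>-polynomials\<close>

definition qv :: "int poly" where "qv = [:0, 1:]"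

lemma qv_nz[simp]: "qv \<noteq> 0" by (simp add: qv_def)

context cox begin

text \<open>The recursions for \<open>R\<close> are operators on functions \<open>C \<Rightarrow> \<int>[q]\<close> acting on the left or on the right. That
  applying them along a reduced word depends on the product only is reduced to evaluation at \<open>e\<close>,
  because the right operators commute with the left ones and transport \<open>e\<close> to any other element.\<close>

definition Lop :: "int poly \<Rightarrow> int poly \<Rightarrow> int poly \<Rightarrow> int poly \<Rightarrow> 'a \<Rightarrow> ('a \<Rightarrow> int poly) \<Rightarrow> 'a \<Rightarrow> int poly" where
  "Lop \<alpha> \<beta> \<gamma> \<delta> s f x = (if x \<in> C then if s \<in> DL x then \<alpha> * f (s \<cdot> x) + \<beta> * f x else \<gamma> * f (s \<cdot> x) + \<delta> * f x else 0)"
definition Rop :: "int poly \<Rightarrow> int poly \<Rightarrow> int poly \<Rightarrow> int poly \<Rightarrow> 'a \<Rightarrow> ('a \<Rightarrow> int poly) \<Rightarrow> 'a \<Rightarrow> int poly" where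
  "Rop \<alpha> \<beta> \<gamma> \<delta> s f x = (if x \<in> C then if s \<in> DR x then \<alpha> * f (x \<cdot> s) + \<beta> * f x else \<gamma> * f (x \<cdot> s) + \<delta> * f x else 0)"

lemma dual_Lop: "cox.Lop C (\<lambda>x y. y \<cdot> x) S len = Rop"
  by (intro ext) (simp add: cox.Lop_def[OF dual] Rop_def dual_defs)
text \<open>If \<open>s\<close> were a left descent of only one of \<open>x\<close> and
  \<open>x t\<close>, exchange (\<open>DL_new2\<close>) would give \<open>s x = x t\<close>.\<close>

lemma orbit: assumes "x \<in> C" "s \<in> S" "t \<in> S" "s \<cdot> x \<noteq> x \<cdot> t" shows "s \<in> DL (x \<cdot> t) \<longleftrightarrow> s \<in> DL x"
proof (cases "t \<in> DR x")
  case True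
  obtain y where y: "y \<in> C" "x = y \<cdot> t" "t \<notin> DR y" using factor_r[OF True assms(1)] by blast
  have yt: "x \<cdot> t = y" using y assms by simp
  show ?thesis
  proof
    assume "s \<in> DL (x \<cdot> t)"
    then show "s \<in> DL x" using DL_adds[of y t s] adds_DR[of t y] y yt assms by simp
  next
    assume s: "s \<in> DL x"
    show "s \<in> DL (x \<cdot> t)"
    proof (rule ccontr)
      assume "s \<notin> DL (x \<cdot> t)"
      then have "y \<cdot> t = s \<cdot> y" using DL_new2[of y t s] y s yt assms by simp
      then have "s \<cdot> x = y" using y(1,2) assms(2) by simp
      then show False using assms(4) yt by simp
    qed
  qed
next
  case False
  show ?thesis
  proof
    assume "s \<in> DL x"
    then show "s \<in> DL (x \<cdot> t)" using DL_adds[of x t s] adds_DR[of t x] False assms by simp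
  next
    assume s: "s \<in> DL (x \<cdot> t)"
    show "s \<in> DL x"
    proof (rule ccontr)
      assume "s \<notin> DL x"
      then have "x \<cdot> t = s \<cdot> x" using DL_new2[of x t s] False s assms by simp
      then show False using assms(4) by simp
    qed
  qed
qed
lemmas orbit_r = cox.orbit[OF dual, unfolded dual_defs]

text \<open>True for arbitrary coefficients. If \<open>s x = x t\<close>, the two multiplications
  and their descent conditions agree on the pair. Otherwise \<open>orbit\<close> shows that each
  multiplication leaves the descent condition of the other unchanged.\<close>

lemma LR_comm: assumes "s \<in> S" "t \<in> S" shows "Lop \<alpha> \<beta> \<gamma> \<delta> s (Rop \<alpha> \<beta> \<gamma> \<delta> t f) = Rop \<alpha> \<beta> \<gamma> \<delta> t (Lop \<alpha> \<beta> \<gamma> \<delta> s f)"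
proof
  fix x
  show "Lop \<alpha> \<beta> \<gamma> \<delta> s (Rop \<alpha> \<beta> \<gamma> \<delta> t f) x = Rop \<alpha> \<beta> \<gamma> \<delta> t (Lop \<alpha> \<beta> \<gamma> \<delta> s f) x"
  proof (cases "x \<in> C")
    case x: True
    have C: "s \<cdot> x \<in> C" "x \<cdot> t \<in> C" using assms x by auto
    show ?thesis
    proof (cases "s \<cdot> x = x \<cdot> t")
      case True
      have st: "s \<in> DL x \<longleftrightarrow> t \<in> DR x" using True assms by (simp add: DL_def DR_def)
      have 1: "s \<cdot> x \<cdot> t = x" unfolding True using x assms by simp
      have 2: "s \<cdot> (x \<cdot> t) = x" unfolding True[symmetric] using x assms by simp
      have 3: "t \<in> DR (s \<cdot> x) \<longleftrightarrow> t \<notin> DR x" unfolding True using x assms by simp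
      have 4: "s \<in> DL (x \<cdot> t) \<longleftrightarrow> s \<notin> DL x" unfolding True[symmetric] using x assms by simp
      show ?thesis using x C 1 2 3 4 st True by (simp add: Lop_def Rop_def)
    next
      case False
      have 1: "s \<in> DL (x \<cdot> t) \<longleftrightarrow> s \<in> DL x" using orbit[OF x assms False] .
      have 2: "t \<in> DR (s \<cdot> x) \<longleftrightarrow> t \<in> DR x" using orbit_r[OF x assms(2,1)] False by simp
      have 3: "s \<cdot> x \<cdot> t = s \<cdot> (x \<cdot> t)" using x assms by (simp add: assoc)
      show ?thesis using x C 1 2 3 assms by (auto simp: Lop_def Rop_def algebra_simps)
    qed
  qed (simp add: Lop_def Rop_def)
qed

text \<open>\<open>aop s\<close> is the action of the Hecke algebra: if \<open>f x\<close> is the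
  value of a linear form at \<open>T_x\<close>, then \<open>aop s f x\<close> is its value at
  \<open>T_s T_x\<close>. \<open>Aop s\<close> is the recursion for \<open>R\<close> in the first
  argument; \<open>bop\<close> and \<open>Bop\<close> are the mirror images.\<close>

definition aop where "aop = Lop qv (qv - 1) 1 0"
definition bop where "bop = Rop qv (qv - 1) 1 0"
definition Aop where "Aop = Lop 1 0 qv (qv - 1)"
definition Bop where "Bop = Rop 1 0 qv (qv - 1)"

definition wprod :: "'a list \<Rightarrow> 'a" where "wprod xs = foldr mul xs e"

lemma wprod_simps[simp]: "wprod [] = e" "wprod (s # xs) = s \<cdot> wprod xs" by (simp_all add: wprod_def)
lemma wprod_C[simp]: "set xs \<subseteq> S \<Longrightarrow> wprod xs \<in> C" by (induction xs) auto
lemma wprod_snoc: "set xs \<subseteq> S \<Longrightarrow> s \<in> S \<Longrightarrow> wprod (xs @ [s]) = wprod xs \<cdot> s" by (induction xs) (auto simp: assoc)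
lemma len_wprod: "set xs \<subseteq> S \<Longrightarrow> len (wprod xs) \<le> length xs"
proof (induction xs)
  case (Cons s xs)
  then show ?case using len_l[of s "wprod xs"] by auto
qed simp

definition redw :: "'a list \<Rightarrow> 'a \<Rightarrow> bool" where "redw xs w \<longleftrightarrow> set xs \<subseteq> S \<and> wprod xs = w \<and> length xs = len w"

lemma redw_Cons: assumes "w \<in> C" "s \<in> S" "s \<notin> DL w" "redw xs w" shows "redw (s # xs) (s \<cdot> w)"
  using assms nDL_len[of s w] by (auto simp: redw_def)

lemma redw_snoc: assumes "w \<in> C" "s \<in> S" "s \<notin> DR w" "redw xs w" shows "redw (xs @ [s]) (w \<cdot> s)"
  using assms nDR_len[of s w] wprod_snoc[of xs s] by (auto simp: redw_def)

lemma ex_redw: "w \<in> C \<Longrightarrow> \<exists>xs. redw xs w"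
proof (induction w rule: len_induct)
  case (less w)
  show ?case
  proof (cases "w = e")
    case True
    then show ?thesis by (intro exI[of _ "[]"]) (simp add: redw_def)
  next
    case False
    then obtain s where s: "s \<in> DL w" using ex_DL less.hyps by blast
    obtain v where v: "v \<in> C" "w = s \<cdot> v" "s \<notin> DL v" "len w = Suc (len v)" using factor_l[OF s less.hyps] by blast
    then obtain xs where "redw xs v" using less.IH by auto
    then show ?thesis using redw_Cons[OF v(1) DL_S[OF s] v(3)] v(2) by blast
  qed
qed

text \<open>Since lengths add, no letter is a descent on the way, and only the branch that evaluates
  at \<open>s x\<close> is met.\<close>

lemma fold_aop: "set xs \<subseteq> S \<Longrightarrow> y \<in> C \<Longrightarrow> len (wprod xs \<cdot> y) = length xs + len y \<Longrightarrow> fold aop xs g y = g (wprod xs \<cdot> y)"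
proof (induction xs arbitrary: g)
  case (Cons s xs)
  have C: "wprod xs \<in> C" "s \<in> S" using Cons by auto
  have a: "s \<cdot> wprod xs \<cdot> y = s \<cdot> (wprod xs \<cdot> y)" using C Cons.prems by (simp add: assoc)
  have "len (wprod xs \<cdot> y) \<le> length xs + len y" using len_mul_le[of "wprod xs" y] len_wprod[of xs] Cons.prems by auto
  then have l: "len (wprod xs \<cdot> y) = length xs + len y" "s \<notin> DL (wprod xs \<cdot> y)"
    using Cons.prems(3) len_l[of s "wprod xs \<cdot> y"] C Cons.prems(2) a by (auto simp: DL_def)
  have "fold aop (s # xs) g y = aop s g (wprod xs \<cdot> y)" using Cons.IH[OF _ Cons.prems(2) l(1)] Cons.prems(1) by simp
  also have "\<dots> = g (s \<cdot> wprod xs \<cdot> y)" using l(2) C Cons.prems(2) a by (simp add: aop_def Lop_def)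
  finally show ?case by simp
qed simp

lemma ex_fold_bop: assumes "y \<in> C" shows "\<exists>zs. set zs \<subseteq> S \<and> (\<forall>g. fold bop zs g e = g y)"
proof -
  have b: "cox.aop C (\<lambda>x y. y \<cdot> x) S len = bop" by (intro ext) (simp add: cox.aop_def[OF dual] bop_def dual_Lop)
  obtain zs where zs: "cox.redw (\<lambda>x y. y \<cdot> x) e S len zs y" using cox.ex_redw[OF dual assms] by blast
  note z = zs[unfolded cox.redw_def[OF dual]]
  have "fold bop zs g e = g y" for g
    using cox.fold_aop[OF dual, of zs e g, unfolded b] z assms by simp
  then show ?thesis using z by blast
qed

lemma fold_ab_comm: "set xs \<subseteq> S \<Longrightarrow> set zs \<subseteq> S \<Longrightarrow> fold bop zs (fold aop xs g) = fold aop xs (fold bop zs g)"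
proof -
  have 1: "t \<in> S \<Longrightarrow> set xs \<subseteq> S \<Longrightarrow> bop t (fold aop xs g) = fold aop xs (bop t g)" for t xs g
    by (induction xs arbitrary: g) (simp_all add: LR_comm[symmetric] aop_def bop_def)
  show "set xs \<subseteq> S \<Longrightarrow> set zs \<subseteq> S \<Longrightarrow> fold bop zs (fold aop xs g) = fold aop xs (fold bop zs g)"
    by (induction zs arbitrary: g) (simp_all add: 1)
qed

lemma fold_aop_indep: assumes "redw xs w" "redw ys w" "y \<in> C" shows "fold aop xs g y = fold aop ys g y"
proof -
  obtain zs where zs: "set zs \<subseteq> S" "\<And>g. fold bop zs g e = g y" using ex_fold_bop[OF assms(3)] by blast
  have "fold aop xs g y = fold bop zs g w" if x: "redw xs w" for xs
  proof -
    have w: "set xs \<subseteq> S" "wprod xs = w" "length xs = len w" using x by (auto simp: redw_def)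
    have "fold aop xs g y = fold aop xs (fold bop zs g) e" using zs fold_ab_comm[OF w(1) zs(1)] by metis
    also have "\<dots> = fold bop zs g w" using fold_aop[OF w(1), of e "fold bop zs g"] w by (metis add.right_neutral e_C e_r len_e0 wprod_C)
    finally show ?thesis .
  qed
  then show ?thesis using assms by simp
qed

definition twist :: "('a \<Rightarrow> int poly) \<Rightarrow> 'a \<Rightarrow> int poly" where "twist f x = (- qv) ^ len x * f x"

text \<open>Up to \<open>- q\<close> and the rescaling \<open>twist\<close>, \<open>Aop s\<close> is
  a right inverse of \<open>aop s\<close>; this is the quadratic relation of the Hecke algebra. It
  carries independence of the reduced word over from \<open>aop\<close> to the recursion for
  \<open>R\<close>.\<close>

lemma a_A: assumes "s \<in> S" shows "aop s (twist (Aop s f)) = (\<lambda>x. if x \<in> C then - qv * twist f x else 0)"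
proof
  fix x
  show "aop s (twist (Aop s f)) x = (if x \<in> C then - qv * twist f x else 0)"
  proof (cases "x \<in> C")
    case x: True
    then have C: "s \<cdot> x \<in> C" using assms by simp
    show ?thesis
    proof (cases "s \<in> DL x")
      case True
      have "len x = Suc (len (s \<cdot> x))" using DL_len[OF True x] .
      then show ?thesis using True x C assms by (simp add: aop_def Aop_def Lop_def twist_def algebra_simps)
    next
      case False
      have "len (s \<cdot> x) = Suc (len x)" using nDL_len[OF assms False x] .
      then show ?thesis using False x C assms by (simp add: aop_def Aop_def Lop_def twist_def algebra_simps)
    qed
  qed (simp add: aop_def Lop_def)
qed

lemma aop_inj: assumes "s \<in> S" "\<And>x. x \<in> C \<Longrightarrow> aop s g x = aop s h x" "x \<in> C" shows "g x = h x"
proof -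
  have "qv * g x = (if s \<in> DL x then qv * aop s g (s \<cdot> x) else aop s g (s \<cdot> x) - (qv - 1) * aop s g x)" for g
    using assms(1,3) by (simp add: aop_def Lop_def algebra_simps)
  then have "qv * g x = qv * h x" using assms by simp
  then show ?thesis by simp
qed

lemma fold_aop_inj: "set xs \<subseteq> S \<Longrightarrow> (\<And>x. x \<in> C \<Longrightarrow> fold aop xs g x = fold aop xs h x) \<Longrightarrow> x \<in> C \<Longrightarrow> g x = h x"
proof (induction xs arbitrary: g h x)
  case (Cons s xs)
  have "aop s g y = aop s h y" if "y \<in> C" for y using Cons.IH[of "aop s g" "aop s h" y] Cons.prems that by simp
  then show ?case using aop_inj[of s g h x] Cons.prems by simp
qed simp

lemma aop_cong: "s \<in> S \<Longrightarrow> (\<And>x. x \<in> C \<Longrightarrow> g x = h x) \<Longrightarrow> aop s g = aop s h"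
  by (rule ext) (simp add: aop_def Lop_def)

lemma fold_aop_cong: "set xs \<subseteq> S \<Longrightarrow> (\<And>x. x \<in> C \<Longrightarrow> g x = h x) \<Longrightarrow> x \<in> C \<Longrightarrow> fold aop xs g x = fold aop xs h x"
proof (cases xs)
  case (Cons s ys)
  moreover assume "set xs \<subseteq> S" "\<And>x. x \<in> C \<Longrightarrow> g x = h x"
  ultimately have "aop s g = aop s h" by (intro aop_cong) auto
  then show ?thesis using Cons by simp
qed simp

lemma fold_aop_scale: "set xs \<subseteq> S \<Longrightarrow> x \<in> C \<Longrightarrow> fold aop xs (\<lambda>x. c * g x) x = c * fold aop xs g x"
proof (induction xs arbitrary: g)
  case (Cons s xs)
  have "aop s (\<lambda>x. c * g x) = (\<lambda>x. c * aop s g x)" by (rule ext) (simp add: aop_def Lop_def algebra_simps)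
  then show ?case using Cons by simp
qed simp

lemma fold_a_A: "set xs \<subseteq> S \<Longrightarrow> x \<in> C \<Longrightarrow> fold aop xs (twist (foldr Aop xs f)) x = (- qv) ^ length xs * twist f x"
proof (induction xs)
  case (Cons s xs)
  have "fold aop (s # xs) (twist (foldr Aop (s # xs) f)) x = fold aop xs (aop s (twist (Aop s (foldr Aop xs f)))) x" by simp
  also have "\<dots> = fold aop xs (\<lambda>x. - qv * twist (foldr Aop xs f) x) x"
    by (rule fold_aop_cong) (use Cons.prems in \<open>simp_all add: a_A\<close>)
  also have "\<dots> = - qv * fold aop xs (twist (foldr Aop xs f)) x" by (rule fold_aop_scale) (use Cons.prems in auto)
  finally show ?case using Cons by simp
qed simp

lemma A_indep: assumes "redw xs w" "redw ys w" "x \<in> C" shows "foldr Aop xs f x = foldr Aop ys f x"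
proof -
  have S: "set xs \<subseteq> S" "set ys \<subseteq> S" "length xs = length ys" using assms by (auto simp: redw_def)
  have "fold aop xs (twist (foldr Aop xs f)) y = fold aop xs (twist (foldr Aop ys f)) y" if "y \<in> C" for y
    using fold_a_A[OF S(1) that] fold_a_A[OF S(2) that] fold_aop_indep[OF assms(1,2) that] S(3) by simp
  then have "twist (foldr Aop xs f) x = twist (foldr Aop ys f) x" using fold_aop_inj[OF S(1) _ assms(3)] by blast
  then show ?thesis by (simp add: twist_def)
qed

definition delta :: "'a \<Rightarrow> int poly" where "delta x = (if x = e then 1 else 0)"

text \<open>The recursion is run from the column of \<open>e\<close> along some reduced word; by
  \<open>A_indep\<close> the choice is immaterial.\<close>

definition Rp :: "'a \<Rightarrow> 'a \<Rightarrow> int poly" where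
  "Rp x w = (if x \<in> C \<and> w \<in> C then foldr Aop (SOME xs. redw xs w) delta x else 0)"

lemma Rp_redw: assumes "x \<in> C" "w \<in> C" "redw xs w" shows "Rp x w = foldr Aop xs delta x"
  unfolding Rp_def using A_indep[OF someI[of "\<lambda>xs. redw xs w", OF assms(3)] assms(3,1)] assms by simp

lemma Aop_cong: "s \<in> S \<Longrightarrow> (\<And>x. x \<in> C \<Longrightarrow> g x = h x) \<Longrightarrow> Aop s g = Aop s h"
  by (rule ext) (simp add: Aop_def Lop_def)

lemma Rp_left: assumes "x \<in> C" "w \<in> C" "s \<in> S" "s \<notin> DL w" shows "Rp x (s \<cdot> w) = Aop s (\<lambda>z. Rp z w) x"
proof -
  obtain xs where xs: "redw xs w" using ex_redw assms by blast
  have "Rp x (s \<cdot> w) = Aop s (foldr Aop xs delta) x" using Rp_redw[OF assms(1) _ redw_Cons[OF assms(2-4) xs]] assms by simp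
  also have "Aop s (foldr Aop xs delta) = Aop s (\<lambda>z. Rp z w)"
    by (rule Aop_cong[OF assms(3)]) (simp add: Rp_redw[OF _ assms(2) xs])
  finally show ?thesis .
qed

lemma Aop_delta: "s \<in> S \<Longrightarrow> Aop s delta = Bop s delta"
proof
  fix x assume s: "s \<in> S"
  show "Aop s delta x = Bop s delta x"
  proof (cases "x \<in> C")
    case x: True
    have 1: "s \<cdot> x = e \<longleftrightarrow> x = s" "x \<cdot> s = e \<longleftrightarrow> x = s" using s x cancel_l[OF s x] cancel_r[OF s x] inv_S[OF s] by (metis S_C e_r e_l)+
    show ?thesis using s x 1 by (auto simp: Aop_def Bop_def Lop_def Rop_def delta_def)
  qed (simp add: Aop_def Bop_def Lop_def Rop_def)
qed

text \<open>On \<open>delta\<close> a left and a right step agree, and a right step commutes past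
  all left steps. So the last letter can be treated first.\<close>

lemma Rp_right: assumes "x \<in> C" "w \<in> C" "s \<in> S" "s \<notin> DR w" shows "Rp x (w \<cdot> s) = Bop s (\<lambda>z. Rp z w) x"
proof -
  obtain xs where xs: "redw xs w" using ex_redw assms by blast
  have S: "set xs \<subseteq> S" using xs by (simp add: redw_def)
  have c: "foldr Aop ys (Bop s f) = Bop s (foldr Aop ys f)" if "set ys \<subseteq> S" for ys f
    using that by (induction ys) (simp_all add: LR_comm Aop_def Bop_def assms(3))
  have "Rp x (w \<cdot> s) = foldr Aop xs (Aop s delta) x" using Rp_redw[OF assms(1) _ redw_snoc[OF assms(2-4) xs]] assms by simp
  also have "\<dots> = Bop s (foldr Aop xs delta) x" using c[OF S] assms by (simp add: Aop_delta)
  also have "Bop s (foldr Aop xs delta) = Bop s (\<lambda>z. Rp z w)"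
    by (rule ext) (use Rp_redw[OF _ assms(2) xs] assms in \<open>simp add: Bop_def Rop_def\<close>)
  finally show ?thesis .
qed

lemma Rp_e: "x \<in> C \<Longrightarrow> Rp x e = delta x"
  using Rp_redw[of x e "[]"] by (simp add: redw_def)

lemma Rp_out: "x \<notin> C \<or> w \<notin> C \<Longrightarrow> Rp x w = 0" by (auto simp: Rp_def)

lemma Rp_DL: assumes "x \<in> C" "w \<in> C" "s \<in> DL w"
  shows "Rp x w = (if s \<in> DL x then Rp (s \<cdot> x) (s \<cdot> w) else qv * Rp (s \<cdot> x) (s \<cdot> w) + (qv - 1) * Rp x (s \<cdot> w))"
proof -
  obtain v where v: "v \<in> C" "w = s \<cdot> v" "s \<notin> DL v" using factor_l[OF assms(3,2)] by blast
  have S: "s \<in> S" using assms DL_S by blast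
  have "s \<cdot> w = v" using v S by simp
  then show ?thesis using Rp_left[OF assms(1) v(1) S v(3)] v(2) assms(1) by (simp add: Aop_def Lop_def)
qed

lemma Rp_DR: assumes "x \<in> C" "w \<in> C" "s \<in> DR w"
  shows "Rp x w = (if s \<in> DR x then Rp (x \<cdot> s) (w \<cdot> s) else qv * Rp (x \<cdot> s) (w \<cdot> s) + (qv - 1) * Rp x (w \<cdot> s))"
proof -
  obtain v where v: "v \<in> C" "w = v \<cdot> s" "s \<notin> DR v" using factor_r[OF assms(3,2)] by blast
  have S: "s \<in> S" using assms DR_S by blast
  have "w \<cdot> s = v" using v S by simp
  then show ?thesis using Rp_right[OF assms(1) v(1) S v(3)] v(2) assms(1) by (simp add: Bop_def Rop_def)
qed

lemma Rp_unique: assumes "\<And>x. x \<in> C \<Longrightarrow> F x e = delta x"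
  and "\<And>x w s. x \<in> C \<Longrightarrow> w \<in> C \<Longrightarrow> s \<in> DL w \<Longrightarrow>
    F x w = (if s \<in> DL x then F (s \<cdot> x) (s \<cdot> w) else qv * F (s \<cdot> x) (s \<cdot> w) + (qv - 1) * F x (s \<cdot> w))"
  and "x \<in> C" "w \<in> C"
  shows "F x w = Rp x w"
  using assms(4,3)
proof (induction w arbitrary: x rule: len_induct)
  case (less w)
  show ?case
  proof (cases "w = e")
    case True
    then show ?thesis using assms(1) Rp_e less by simp
  next
    case False
    then obtain s where s: "s \<in> DL w" using ex_DL less.hyps by blast
    have S: "s \<in> S" using s DL_S by blast
    have "s \<cdot> w \<in> C" "len (s \<cdot> w) < len w" using S less.hyps DL_len[OF s less.hyps] by auto
    then show ?thesis using assms(2)[OF less.prems less.hyps s] Rp_DL[OF less.prems less.hyps s] less.IH less.prems S by simp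
  qed
qed

text \<open>The mirrored polynomials satisfy the left recursion, because \<open>Rp\<close> satisfies
  the right one, and they agree at \<open>e\<close>. This makes mirror images of statements about
  \<open>Rp\<close> available.\<close>

lemma dual_Rp: "cox.Rp C (\<lambda>x y. y \<cdot> x) e S len = Rp"
proof (intro ext)
  fix x w
  show "cox.Rp C (\<lambda>x y. y \<cdot> x) e S len x w = Rp x w"
  proof (cases "x \<in> C \<and> w \<in> C")
    case True
    have d: "cox.delta e = delta" by (rule ext) (simp add: cox.delta_def[OF dual] delta_def)
    show ?thesis
    proof (rule Rp_unique)
      show "cox.Rp C (\<lambda>x y. y \<cdot> x) e S len x e = delta x" if "x \<in> C" for x
        using cox.Rp_e[OF dual that] d by simp
    qed (use True cox.Rp_DR[OF dual, unfolded dual_defs] in blast)+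
  next
    case False
    then show ?thesis using cox.Rp_out[OF dual, of x w] Rp_out[of x w] by auto
  qed
qed

lemma Rp_nle: assumes "\<not> x \<preceq> w" shows "Rp x w = 0"
proof (cases "x \<in> C \<and> w \<in> C")
  case True
  then have "w \<in> C" "x \<in> C" by auto
  then show ?thesis using assms
  proof (induction w arbitrary: x rule: len_induct)
    case (less w)
    show ?case
    proof (cases "w = e")
      case True
      then show ?thesis using Rp_e[of x] less.prems by (auto simp: delta_def)
    next
      case False
      then obtain s where s: "s \<in> DL w" using ex_DL less.hyps by blast
      have S: "s \<in> S" using s DL_S by blast
      have sw: "s \<cdot> w \<in> C" "len (s \<cdot> w) < len w" using S less.hyps DL_len[OF s less.hyps] by auto
      have ww: "s \<cdot> w \<preceq> w" using down_l[OF s less.hyps] .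
      have sxC: "s \<cdot> x \<in> C" using S less.prems by simp
      have "Rp x (s \<cdot> w) = 0" using less.IH[OF sw less.prems(1)] le_trans[OF _ ww] less.prems(2) by blast
      moreover have "\<not> s \<cdot> x \<preceq> s \<cdot> w"
      proof
        assume "s \<cdot> x \<preceq> s \<cdot> w"
        then have "s \<cdot> x \<preceq> w" using le_trans[OF _ ww] by blast
        then have "s \<cdot> (s \<cdot> x) \<preceq> w" using liftL2 s by blast
        then show False using less.prems S by simp
      qed
      then have "Rp (s \<cdot> x) (s \<cdot> w) = 0" using less.IH[OF sw sxC] by blast
      ultimately show ?thesis using Rp_DL[OF less.prems(1) less.hyps s] by simp
    qed
  qed
qed (use Rp_out[of x w] in auto)

lemma Rp_refl: "w \<in> C \<Longrightarrow> Rp w w = 1"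
proof (induction w rule: len_induct)
  case (less w)
  show ?case
  proof (cases "w = e")
    case True
    then show ?thesis by (simp add: Rp_e delta_def)
  next
    case False
    then obtain s where s: "s \<in> DL w" using ex_DL less.hyps by blast
    then show ?thesis using less.IH[of "s \<cdot> w"] Rp_DL[OF less.hyps less.hyps s] DL_len[OF s less.hyps] DL_S[OF s] less.hyps by simp
  qed
qed

end

subsection \<open>Kazhdan-Lusztig polynomials\<close>

lemma coeff_poly_reversal: "coeff (poly_reversal d p) i = (if i \<le> d then coeff p (d - i) else 0)"
proof -
  have "coeff (poly_reversal d p) i = (\<Sum>j\<le>d. if d - j = i then coeff p j else 0)"
    by (simp add: poly_reversal_def coeff_sum)
  also have "\<dots> = (\<Sum>j\<le>d. if j = d - i then (if i \<le> d then coeff p j else 0) else 0)"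
    by (intro sum.cong) auto
  also have "\<dots> = (if i \<le> d then coeff p (d - i) else 0)" by (subst sum.delta) auto
  finally show ?thesis .
qed

lemma poly_reversal_add: "poly_reversal d (p + r) = poly_reversal d p + poly_reversal d r"
  by (rule poly_eqI) (simp add: coeff_poly_reversal)
lemma poly_reversal_0[simp]: "poly_reversal d 0 = 0"
  by (rule poly_eqI) (simp add: coeff_poly_reversal)
lemma poly_reversal_sum: "poly_reversal d (\<Sum>x\<in>A. f x) = (\<Sum>x\<in>A. poly_reversal d (f x))"
  by (rule poly_eqI) (simp add: coeff_poly_reversal coeff_sum)

lemma poly_reversal_reflect: "degree p \<le> d \<Longrightarrow> poly_reversal d p = monom 1 (d - degree p) * reflect_poly p"
  by (rule poly_eqI) (auto simp: coeff_poly_reversal coeff_monom_mult coeff_reflect_poly coeff_eq_0)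

lemma poly_reversal_mult:
  assumes "degree p \<le> a" "degree r \<le> b" shows "poly_reversal (a + b) (p * r) = poly_reversal a p * poly_reversal b r"
proof (cases "p = 0 \<or> r = 0")
  case False
  then have d: "degree (p * r) = degree p + degree r" by (simp add: degree_mult_eq)
  have "poly_reversal (a + b) (p * r) = monom 1 (a + b - (degree p + degree r)) * (reflect_poly p * reflect_poly r)"
    using poly_reversal_reflect[of "p * r" "a + b"] assms d by (simp add: reflect_poly_mult)
  also have "monom (1::int) (a + b - (degree p + degree r)) = monom 1 (a - degree p) * monom 1 (b - degree r)"
    using assms by (simp add: mult_monom)
  finally show ?thesis using assms by (simp add: poly_reversal_reflect mult_ac)
qed auto

text \<open>The strictly lower half: \<open>i < (d + 1) div 2\<close> means \<open>2 i < d\<close>,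
  the degree bound for \<open>P\<close> at distance \<open>d\<close>.\<close>

definition trunc :: "nat \<Rightarrow> int poly \<Rightarrow> int poly" where "trunc d p = (\<Sum>i<(d + 1) div 2. monom (coeff p i) i)"

lemma coeff_trunc: "coeff (trunc d p) i = (if 2 * i < d then coeff p i else 0)"
proof -
  have "coeff (trunc d p) i = (\<Sum>j<(d + 1) div 2. if j = i then coeff p j else 0)" by (simp add: trunc_def coeff_sum)
  also have "\<dots> = (if i < (d + 1) div 2 then coeff p i else 0)" by simp
  also have "i < (d + 1) div 2 \<longleftrightarrow> 2 * i < d" by linarith
  finally show ?thesis .
qed

lemma degree_qv: "degree qv = 1" "degree (qv - 1) = 1" "degree (1 - qv) = 1"
  by (simp_all add: qv_def one_pCons)
lemma rev_qv: "poly_reversal 2 qv = qv" "poly_reversal 1 (qv - 1) = - (qv - 1)"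
proof -
  have 1: "coeff qv i = (if i = 1 then 1 else 0)" for i by (cases i) (auto simp: qv_def coeff_pCons split: nat.splits)
  have 2: "coeff 1 i = (if i = 0 then 1 else (0::int))" for i by simp
  show "poly_reversal 2 qv = qv" by (rule poly_eqI) (auto simp: coeff_poly_reversal 1)
  show "poly_reversal 1 (qv - 1) = - (qv - 1)" by (rule poly_eqI) (auto simp: coeff_poly_reversal 1 2)
qed

section \<open>Reversal and inversion of R, and the construction of P\<close>

context cox begin

lemma Rp_degree: assumes "x \<in> C" "w \<in> C" shows "degree (Rp x w) \<le> len w - len x"
  using assms(2,1)
proof (induction w arbitrary: x rule: len_induct)
  case (less w)
  show ?case
  proof (cases "w \<noteq> e \<and> x \<preceq> w")
    case False
    then show ?thesis using Rp_e[of x] Rp_nle[of x w] less.prems by (auto simp: delta_def)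
  next
    case True
    then obtain s where s: "s \<in> DL w" using ex_DL less.hyps by blast
    have S: "s \<in> S" using s DL_S by blast
    have l: "len w = Suc (len (s \<cdot> w))" using DL_len[OF s less.hyps] .
    have C: "s \<cdot> w \<in> C" "s \<cdot> x \<in> C" using S less by auto
    note IH = less.IH[OF C(1)]
    show ?thesis
    proof (cases "s \<in> DL x")
      case True
      then show ?thesis using Rp_DL[OF less.prems less.hyps s] IH[OF _ C(2)] l DL_len[OF True less.prems] by simp
    next
      case nx: False
      have lx: "len (s \<cdot> x) = Suc (len x)" using nDL_len[OF S nx less.prems] .
      have "x \<preceq> s \<cdot> w" using liftL1 True s nx by blast
      then have le: "len x \<le> len (s \<cdot> w)" using le_len_le by blast
      have 1: "degree (qv * Rp (s \<cdot> x) (s \<cdot> w)) \<le> len w - len x"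
      proof (cases "s \<cdot> x \<preceq> s \<cdot> w")
        case True
        then have "len (s \<cdot> x) \<le> len (s \<cdot> w)" using le_len_le by blast
        then show ?thesis using degree_mult_le[of qv "Rp (s \<cdot> x) (s \<cdot> w)"] degree_qv IH[OF _ C(2)] l lx by simp
      qed (simp add: Rp_nle)
      have 2: "degree ((qv - 1) * Rp x (s \<cdot> w)) \<le> len w - len x"
        using degree_mult_le[of "qv - 1" "Rp x (s \<cdot> w)"] degree_qv IH[OF _ less.prems] l le by simp
      show ?thesis using Rp_DL[OF less.prems less.hyps s] nx degree_add_le[OF 1 2] by simp
    qed
  qed
qed

text \<open>If \<open>s\<close> is no left descent of \<open>x\<close>, the distance drops by 2 from
  \<open>(x,w)\<close> to \<open>(s x, s w)\<close> and by 1 to \<open>(x, s w)\<close>. Accordingly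
  \<open>q\<close> is reversed in degree 2, which fixes it, and \<open>q - 1\<close> in degree 1,
  which negates it.\<close>

lemma Rp_reversal: assumes "x \<in> C" "w \<in> C" shows "poly_reversal (len w - len x) (Rp x w) = (-1) ^ (len w - len x) * Rp x w"
  using assms(2,1)
proof (induction w arbitrary: x rule: len_induct)
  case (less w)
  show ?case
  proof (cases "w \<noteq> e \<and> x \<preceq> w")
    case False
    have "poly_reversal 0 1 = 1" by (simp add: poly_reversal_reflect)
    then show ?thesis using False Rp_e[of x] Rp_nle[of x w] less.prems by (auto simp: delta_def)
  next
    case True
    then obtain s where s: "s \<in> DL w" using ex_DL less.hyps by blast
    have S: "s \<in> S" using s DL_S by blast
    have l: "len w = Suc (len (s \<cdot> w))" using DL_len[OF s less.hyps] .
    have C: "s \<cdot> w \<in> C" "s \<cdot> x \<in> C" using S less by auto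
    note IH = less.IH[OF C(1)]
    show ?thesis
    proof (cases "s \<in> DL x")
      case True
      then show ?thesis using Rp_DL[OF less.prems less.hyps s] IH[OF _ C(2)] l DL_len[OF True less.prems] by simp
    next
      case nx: False
      have lx: "len (s \<cdot> x) = Suc (len x)" using nDL_len[OF S nx less.prems] .
      have "x \<preceq> s \<cdot> w" using liftL1 True s nx by blast
      then have le: "len x \<le> len (s \<cdot> w)" using le_len_le by blast
      let ?d = "len w - len x"
      have 1: "poly_reversal ?d (qv * Rp (s \<cdot> x) (s \<cdot> w)) = (-1) ^ ?d * (qv * Rp (s \<cdot> x) (s \<cdot> w))"
      proof (cases "s \<cdot> x \<preceq> s \<cdot> w")
        case True
        then have "len (s \<cdot> x) \<le> len (s \<cdot> w)" using le_len_le by blast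
        then have d: "?d = 2 + (len (s \<cdot> w) - len (s \<cdot> x))" using l lx by simp
        show ?thesis unfolding d
          using poly_reversal_mult[of qv 2 "Rp (s \<cdot> x) (s \<cdot> w)"] degree_qv Rp_degree[OF C(2,1)] IH[OF _ C(2)] l rev_qv by simp
      qed (simp add: Rp_nle)
      have d: "?d = 1 + (len (s \<cdot> w) - len x)" using l le by simp
      have 2: "poly_reversal ?d ((qv - 1) * Rp x (s \<cdot> w)) = (-1) ^ ?d * ((qv - 1) * Rp x (s \<cdot> w))" unfolding d
        unfolding poly_reversal_mult[OF eq_refl[OF degree_qv(2)] Rp_degree[OF less.prems C(1)]] rev_qv(2)
        using IH[OF _ less.prems] l by (simp add: algebra_simps)
      show ?thesis using Rp_DL[OF less.prems less.hyps s] nx by (simp add: poly_reversal_add 1 2 distrib_left)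
    qed
  qed
qed

lemma finite_below: "y \<in> C \<Longrightarrow> finite {z. z \<preceq> y}"
proof (induction y rule: len_induct)
  case (less y)
  show ?case
  proof (cases "y = e")
    case True
    then have "{z. z \<preceq> y} \<subseteq> {e}" using le_e by auto
    then show ?thesis by (rule finite_subset) simp
  next
    case False
    then obtain s where s: "s \<in> DL y" using ex_DL less.hyps by blast
    have S: "s \<in> S" using s DL_S by blast
    have f: "finite {z. z \<preceq> s \<cdot> y}" using less.IH DL_len[OF s less.hyps] S less.hyps by simp
    have "{z. z \<preceq> y} \<subseteq> {z. z \<preceq> s \<cdot> y} \<union> (\<lambda>z. s \<cdot> z) ` {z. z \<preceq> s \<cdot> y}"
    proof
      fix z assume "z \<in> {z. z \<preceq> y}"
      then have z: "z \<preceq> y" by simp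
      show "z \<in> {z. z \<preceq> s \<cdot> y} \<union> (\<lambda>z. s \<cdot> z) ` {z. z \<preceq> s \<cdot> y}"
      proof (cases "s \<in> DL z")
        case True
        then have "s \<cdot> z \<preceq> s \<cdot> y" using liftL3 z s by blast
        moreover have "z = s \<cdot> (s \<cdot> z)" using S le_C1[OF z] by simp
        ultimately show ?thesis by blast
      next
        case False
        then show ?thesis using liftL1 z s by blast
      qed
    qed
    then show ?thesis using f by (meson finite_UnI finite_imageI finite_subset)
  qed
qed

text \<open>With these signs \<open>Rt\<close> is the inverse matrix of \<open>Rp\<close>; the transpose of the column recursion of \<open>Rp\<close>
  acts on the rows of \<open>Rt\<close>.\<close>

definition Rt :: "'a \<Rightarrow> 'a \<Rightarrow> int poly" where "Rt x z = (-1) ^ (len x + len z) * Rp x z"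

lemma Rt_row: assumes "x \<in> C" "z \<in> C" "s \<in> S"
  shows "Lop qv 0 1 (qv - 1) s (Rt x) z = (if s \<in> DL x then (qv - 1) * Rt x z + Rt (s \<cdot> x) z else qv * Rt (s \<cdot> x) z)"
proof -
  have C: "s \<cdot> x \<in> C" "s \<cdot> z \<in> C" using assms by auto
  have lx: "len x = Suc (len (s \<cdot> x))" if "s \<in> DL x" using DL_len[OF that assms(1)] .
  have lx': "len (s \<cdot> x) = Suc (len x)" if "s \<notin> DL x" using nDL_len[OF assms(3) that assms(1)] .
  have lz: "len z = Suc (len (s \<cdot> z))" if "s \<in> DL z" using DL_len[OF that assms(2)] .
  have lz': "len (s \<cdot> z) = Suc (len z)" if "s \<notin> DL z" using nDL_len[OF assms(3) that assms(2)] .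
  show ?thesis
  proof (cases "s \<in> DL z")
    case True
    then show ?thesis using Rp_DL[OF assms(1,2) True] Rp_DL[OF C(1) assms(2) True] lx lx' lz assms
      by (auto simp: Lop_def Rt_def algebra_simps)
  next
    case False
    then have "s \<in> DL (s \<cdot> z)" using assms by simp
    note r = Rp_DL[OF assms(1) C(2) this] Rp_DL[OF C(1) C(2) this]
    show ?thesis using r False lx lx' lz' assms by (auto simp: Lop_def Rt_def algebra_simps)
  qed
qed

text \<open>The difference of the two summands changes sign under the involution
  \<open>z \<mapsto> s z\<close> of \<open>Z\<close>, so it sums to zero.\<close>

lemma Aop_transpose: assumes "finite Z" "Z \<subseteq> C" "s \<in> S" "\<And>z. z \<in> Z \<Longrightarrow> s \<cdot> z \<in> Z"
  shows "(\<Sum>z\<in>Z. g z * Aop s f z) = (\<Sum>z\<in>Z. Lop qv 0 1 (qv - 1) s g z * f z)"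
proof -
  let ?k = "\<lambda>z. g z * Aop s f z - Lop qv 0 1 (qv - 1) s g z * f z"
  have k: "?k (s \<cdot> z) = - ?k z" if "z \<in> Z" for z
  proof -
    have "z \<in> C" using that assms by blast
    then show ?thesis using assms(3) by (auto simp: Aop_def Lop_def algebra_simps)
  qed
  have "sum ?k Z = sum (\<lambda>z. ?k (s \<cdot> z)) Z"
  proof (rule sum.reindex_bij_witness[of _ "\<lambda>z. s \<cdot> z" "\<lambda>z. s \<cdot> z"])
    fix z assume z: "z \<in> Z"
    then have "z \<in> C" using assms by blast
    then show "s \<cdot> (s \<cdot> z) = z" "?k (s \<cdot> (s \<cdot> z)) = ?k z" "s \<cdot> (s \<cdot> z) = z" using assms by simp_all
    show "s \<cdot> z \<in> Z" "s \<cdot> z \<in> Z" using assms z by auto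
  qed
  also have "\<dots> = - sum ?k Z" using k by (simp add: sum_negf[symmetric])
  finally have "sum ?k Z = 0" by simp
  then show ?thesis by (simp add: sum_subtractf)
qed

text \<open>A step of the column recursion for \<open>Rp\<close> is transposed onto the row of
  \<open>Rt\<close>, where \<open>Rt_row\<close> expresses it by the identities for
  \<open>v\<close>.\<close>

lemma Rp_inverse: assumes "x \<in> C" "y \<in> C" shows "(\<Sum>z | z \<preceq> y. Rt x z * Rp z y) = (if x = y then 1 else 0)"
  using assms(2,1)
proof (induction y arbitrary: x rule: len_induct)
  case (less y)
  show ?case
  proof (cases "y = e")
    case True
    have "{z. z \<preceq> e} = {e}" using le_e by auto
    then show ?thesis using True less.prems Rp_e[of x] Rp_refl[of e] by (auto simp: Rt_def delta_def)
  next
    case False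
    then obtain s where s: "s \<in> DL y" using ex_DL less.hyps by blast
    have S: "s \<in> S" using s DL_S by blast
    obtain v where v: "v \<in> C" "y = s \<cdot> v" "s \<notin> DL v" "len y = Suc (len v)" using factor_l[OF s less.hyps] by blast
    let ?Z = "{z. z \<preceq> y}"
    have vy: "v \<preceq> y" using up_l[OF S v(3,1)] v(2) by simp
    have IH: "(\<Sum>z\<in>?Z. Rt x z * Rp z v) = (if x = v then 1 else 0)" if "x \<in> C" for x
    proof -
      have "(\<Sum>z\<in>?Z. Rt x z * Rp z v) = (\<Sum>z | z \<preceq> v. Rt x z * Rp z v)"
        by (rule sum.mono_neutral_right) (use finite_below[OF less.hyps] le_trans[OF _ vy] Rp_nle in auto)
      then show ?thesis using less.IH[OF v(1) _ that] v by simp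
    qed
    have "(\<Sum>z\<in>?Z. Rt x z * Rp z y) = (\<Sum>z\<in>?Z. Rt x z * Aop s (\<lambda>z. Rp z v) z)"
      by (rule sum.cong) (use Rp_left[OF _ v(1) S v(3)] v(2) le_C1 in auto)
    also have "\<dots> = (\<Sum>z\<in>?Z. Lop qv 0 1 (qv - 1) s (Rt x) z * Rp z v)"
      by (rule Aop_transpose[OF finite_below[OF less.hyps] _ S]) (use liftL2[OF _ s] le_C1 in auto)
    also have "\<dots> = (if x = y then 1 else 0)"
    proof (cases "s \<in> DL x")
      case True
      have "(\<Sum>z\<in>?Z. Lop qv 0 1 (qv - 1) s (Rt x) z * Rp z v) = (\<Sum>z\<in>?Z. (qv - 1) * (Rt x z * Rp z v) + Rt (s \<cdot> x) z * Rp z v)"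
      proof (rule sum.cong)
        fix z assume "z \<in> ?Z"
        then have z: "z \<in> C" using le_C1 by blast
        show "Lop qv 0 1 (qv - 1) s (Rt x) z * Rp z v = (qv - 1) * (Rt x z * Rp z v) + Rt (s \<cdot> x) z * Rp z v"
          unfolding Rt_row[OF less.prems z S] using True by (simp add: distrib_right mult.assoc)
      qed simp
      also have "\<dots> = (qv - 1) * (\<Sum>z\<in>?Z. Rt x z * Rp z v) + (\<Sum>z\<in>?Z. Rt (s \<cdot> x) z * Rp z v)"
        by (simp add: sum.distrib sum_distrib_left)
      also have "\<dots> = (if s \<cdot> x = v then 1 else 0)" using IH[of x] IH[of "s \<cdot> x"] less.prems S True v(3) by auto
      also have "s \<cdot> x = v \<longleftrightarrow> x = y" using v(1,2) less.prems S by auto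
      finally show ?thesis .
    next
      case False
      have "(\<Sum>z\<in>?Z. Lop qv 0 1 (qv - 1) s (Rt x) z * Rp z v) = (\<Sum>z\<in>?Z. qv * (Rt (s \<cdot> x) z * Rp z v))"
        by (rule sum.cong) (use Rt_row[OF less.prems _ S] False le_C1 in \<open>auto simp: algebra_simps\<close>)
      also have "\<dots> = qv * (\<Sum>z\<in>?Z. Rt (s \<cdot> x) z * Rp z v)" by (simp add: sum_distrib_left)
      also have "\<dots> = 0"
      proof -
        have "s \<in> DL (s \<cdot> x)" using False S less.prems by simp
        then have "s \<cdot> x \<noteq> v" using v(3) by blast
        then show ?thesis using IH[of "s \<cdot> x"] less.prems S by simp
      qed
      also have "x \<noteq> y" using False s by blast
      ultimately show ?thesis by simp
    qed
    finally show ?thesis .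
  qed
qed

definition ivl :: "'a \<Rightarrow> 'a \<Rightarrow> 'a set" where "ivl x y = {z. x \<preceq> z \<and> z \<preceq> y}"

lemma finite_ivl: "finite (ivl x y)"
proof (cases "y \<in> C")
  case True
  then show ?thesis using finite_subset[OF _ finite_below[OF True], of "ivl x y"] by (auto simp: ivl_def)
next
  case False
  then have "ivl x y = {}" using le_C2 by (auto simp: ivl_def)
  then show ?thesis by simp
qed

lemma ivl_len: "z \<in> ivl x y - {x} \<Longrightarrow> len x < len z \<and> len z \<le> len y"
  using le_len[of x z] le_len_le[of z y] by (auto simp: ivl_def)

text \<open>In the defining identity the term \<open>z = x\<close> is \<open>KP x y\<close> itself.
  Reversal at distance \<open>d\<close> moves a polynomial of degree below \<open>d/2\<close>
  strictly above \<open>d/2\<close>, so \<open>KP x y\<close> must be minus the lower half of the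
  remaining sum.\<close>

function KP :: "'a \<Rightarrow> 'a \<Rightarrow> int poly" where
  "KP x y = (if x \<preceq> y then if x = y then 1 else - trunc (len y - len x) (\<Sum>z\<in>ivl x y - {x}. Rp x z * KP z y) else 0)"
  by auto
termination
proof (relation "Wellfounded.measure (\<lambda>(x, y). len y - len x)", goal_cases)
  case (2 x y z)
  then show ?case using ivl_len[of z x y] by (simp add: diff_less_mono2)
qed simp

declare KP.simps[simp del]

abbreviation KF :: "'a \<Rightarrow> 'a \<Rightarrow> int poly" where "KF x y \<equiv> \<Sum>z\<in>ivl x y - {x}. Rp x z * KP z y"

lemma KP_nle: "\<not> x \<preceq> y \<Longrightarrow> KP x y = 0" by (simp add: KP.simps)
lemma KP_refl: "x \<in> C \<Longrightarrow> KP x x = 1" by (simp add: KP.simps)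
lemma coeff_KP: "x \<preceq> y \<Longrightarrow> x \<noteq> y \<Longrightarrow> coeff (KP x y) i = (if 2 * i < len y - len x then - coeff (KF x y) i else 0)"
  by (subst KP.simps) (simp add: coeff_trunc)

lemma KP_degree: assumes "x \<preceq> y" "x \<noteq> y" shows "2 * degree (KP x y) + 1 \<le> len y - len x"
proof -
  have l: "len x < len y" using le_len assms by blast
  show ?thesis
  proof (cases "KP x y = 0")
    case False
    then have "coeff (KP x y) (degree (KP x y)) \<noteq> 0" by simp
    then show ?thesis using coeff_KP[OF assms] by (metis Suc_eq_plus1 Suc_leI)
  qed (use l in simp)
qed

lemma KP_degree': "degree (KP x y) \<le> len y - len x"
proof (cases "x \<preceq> y \<and> x \<noteq> y")
  case True
  then show ?thesis using KP_degree[of x y] by linarith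
qed (auto simp: KP.simps[of x y])

text \<open>The point is that \<open>KF\<close> is negated by reversal: its middle coefficient then
  vanishes and its upper half is the reversal of \<open>KP x y\<close>. Reversing each summand, by
  induction and \<open>Rp_reversal\<close>, brings in \<open>Rt\<close>, and
  \<open>Rp_inverse\<close> collapses the double sum.\<close>

lemma KP_reversal: assumes "x \<preceq> y" shows "poly_reversal (len y - len x) (KP x y) = (\<Sum>z\<in>ivl x y. Rp x z * KP z y)"
  using assms
proof (induction "len y - len x" arbitrary: x rule: less_induct)
  case less
  have C: "x \<in> C" "y \<in> C" using less.prems le_C1 le_C2 by blast+
  have xi: "x \<in> ivl x y" using less.prems C by (simp add: ivl_def)
  let ?d = "len y - len x" and ?I = "ivl x y - {x}"
  have split: "(\<Sum>z\<in>ivl x y. Rp x z * KP z y) = KP x y + KF x y"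
    using sum.remove[OF finite_ivl xi, of "\<lambda>z. Rp x z * KP z y"] Rp_refl[OF C(1)] by simp
  show ?case
  proof (cases "x = y")
    case True
    then have "?I = {}" using le_antisym by (auto simp: ivl_def)
    moreover have "poly_reversal 0 1 = 1" by (simp add: poly_reversal_reflect)
    ultimately show ?thesis unfolding split by (simp only: sum.empty) (use True KP_refl C in simp)
  next
    case ne: False
    have I: "x \<preceq> z" "z \<preceq> y" "z \<noteq> x" "z \<in> C" "len x < len z" "len z \<le> len y" if "z \<in> ?I" for z
      using that ivl_len[OF that] le_C1[of z y] by (auto simp: ivl_def)
    have 1: "poly_reversal ?d (Rp x z * KP z y) = (\<Sum>u\<in>?I. Rt x z * Rp z u * KP u y)" if z: "z \<in> ?I" for z
    proof -
      note zz = I[OF z]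
      have d: "?d = (len z - len x) + (len y - len z)" using zz by simp
      have sg: "(-1 :: int poly) ^ (len z - len x) = (-1) ^ (len x + len z)"
        using zz(5) by (metis add_diff_inverse_nat minus_one_power_iff even_add less_imp_not_less even_diff_nat)
      have sub: "ivl z y \<subseteq> ?I" using le_trans[OF zz(1)] le_antisym[OF zz(1)] zz(3) by (auto simp: ivl_def)
      have "poly_reversal ?d (Rp x z * KP z y) = poly_reversal (len z - len x) (Rp x z) * poly_reversal (len y - len z) (KP z y)"
        unfolding d by (rule poly_reversal_mult[OF Rp_degree[OF C(1) zz(4)] KP_degree'])
      also have "\<dots> = Rt x z * (\<Sum>u\<in>ivl z y. Rp z u * KP u y)"
        using Rp_reversal[OF C(1) zz(4)] less.hyps[of z] zz sg by (simp add: Rt_def)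
      also have "(\<Sum>u\<in>ivl z y. Rp z u * KP u y) = (\<Sum>u\<in>?I. Rp z u * KP u y)"
        by (rule sum.mono_neutral_left) (use finite_ivl sub Rp_nle in \<open>auto simp: ivl_def\<close>)
      finally show ?thesis by (simp add: sum_distrib_left mult.assoc)
    qed
    have "poly_reversal ?d (KF x y) = (\<Sum>z\<in>?I. \<Sum>u\<in>?I. Rt x z * Rp z u * KP u y)"
      unfolding poly_reversal_sum by (rule sum.cong) (simp_all only: 1)
    also have "\<dots> = (\<Sum>u\<in>?I. \<Sum>z\<in>?I. Rt x z * Rp z u * KP u y)" by (rule sum.swap)
    also have "\<dots> = (\<Sum>u\<in>?I. - (Rp x u * KP u y))"
    proof (rule sum.cong)
      fix u assume u: "u \<in> ?I"
      note uu = I[OF u]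
      have "(\<Sum>z\<in>?I. Rt x z * Rp z u) = (\<Sum>z\<in>{z. z \<preceq> u} - {x}. Rt x z * Rp z u)"
      proof (rule sum.mono_neutral_cong)
        fix z assume "z \<in> {z. z \<preceq> u} - {x} - ?I"
        then have "\<not> x \<preceq> z" using le_trans[OF _ uu(2), of z] by (auto simp: ivl_def)
        then show "Rt x z * Rp z u = 0" by (simp add: Rt_def Rp_nle)
      qed (use finite_ivl finite_below[OF uu(4)] Rp_nle in auto)
      also have "\<dots> = (\<Sum>z | z \<preceq> u. Rt x z * Rp z u) - Rt x x * Rp x u"
        using sum.remove[OF finite_below[OF uu(4)], of x "\<lambda>z. Rt x z * Rp z u"] uu(1) by simp
      also have "\<dots> = - Rp x u" using Rp_inverse[OF C(1) uu(4)] uu(3) C by (simp add: Rt_def Rp_refl)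
      finally show "(\<Sum>z\<in>?I. Rt x z * Rp z u * KP u y) = - (Rp x u * KP u y)" by (simp add: sum_distrib_right[symmetric])
    qed simp
    finally have F: "poly_reversal ?d (KF x y) = - KF x y" by (simp add: sum_negf)
    define F where "F = KF x y"
    have c: "(if i \<le> ?d then coeff F (?d - i) else 0) = - coeff F i" for i
      using F unfolding F_def[symmetric] by (metis coeff_poly_reversal coeff_minus)
    have k: "coeff (KP x y) i = (if 2 * i < ?d then - coeff F i else 0)" for i using coeff_KP[OF less.prems ne] F_def by simp
    show ?thesis unfolding split F_def[symmetric]
    proof (rule poly_eqI)
      fix i
      show "coeff (poly_reversal ?d (KP x y)) i = coeff (KP x y + F) i"
      proof (cases "i \<le> ?d")
        case True
        then have ci: "coeff F (?d - i) = - coeff F i" using c[of i] by simp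
        show ?thesis
        proof (cases "2 * i = ?d")
          case m: True
          then have "?d - i = i" by linarith
          then have "coeff F i = 0" using ci by simp
          then show ?thesis using True m \<open>?d - i = i\<close> by (simp add: coeff_poly_reversal k)
        next
          case False
          then have "2 * (?d - i) < ?d \<longleftrightarrow> \<not> 2 * i < ?d" using True by linarith
          then show ?thesis using True ci by (simp add: coeff_poly_reversal k)
        qed
      next
        case False
        then show ?thesis using c[of i] by (simp add: coeff_poly_reversal k)
      qed
    qed
  qed
qed

text \<open>The identity determines the difference of \<open>P x y\<close> and its reversal from
  values closer to \<open>y\<close>. Below half the distance the coefficients of this difference are
  those of \<open>P x y\<close> up to sign.\<close>

lemma KP_unique: assumes "\<And>x y. \<not> x \<preceq> y \<Longrightarrow> P x y = 0" "\<And>x. x \<in> C \<Longrightarrow> P x x = 1"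
  "\<And>x y. x \<preceq> y \<Longrightarrow> x \<noteq> y \<Longrightarrow> 2 * degree (P x y) + 1 \<le> len y - len x"
  "\<And>x y. x \<preceq> y \<Longrightarrow> poly_reversal (len y - len x) (P x y) = (\<Sum>z\<in>ivl x y. Rp x z * P z y)"
  shows "P x y = KP x y"
proof (induction "len y - len x" arbitrary: x rule: less_induct)
  case less
  show ?case
  proof (cases "x \<preceq> y \<and> x \<noteq> y")
    case False
    then show ?thesis
    proof (cases "x \<preceq> y")
      case True
      then have "x = y" "x \<in> C" using False le_C1 by blast+
      then show ?thesis using assms(2) KP_refl by simp
    qed (simp add: assms(1) KP_nle)
  next
    case True
    then have xy: "x \<preceq> y" "x \<noteq> y" by auto
    have C: "x \<in> C" using xy le_C1 by blast
    have xi: "x \<in> ivl x y" using xy C by (simp add: ivl_def)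
    let ?d = "len y - len x"
    have s: "(\<Sum>z\<in>ivl x y. Rp x z * Q z y) = Q x y + (\<Sum>z\<in>ivl x y - {x}. Rp x z * Q z y)" for Q
      using sum.remove[OF finite_ivl xi, of "\<lambda>z. Rp x z * Q z y"] Rp_refl[OF C] by simp
    have eq: "(\<Sum>z\<in>ivl x y - {x}. Rp x z * P z y) = KF x y"
    proof (rule sum.cong)
      fix z assume z: "z \<in> ivl x y - {x}"
      have "len y - len z < ?d" using ivl_len[OF z] by linarith
      then show "Rp x z * P z y = Rp x z * KP z y" using less by simp
    qed simp
    have e: "poly_reversal ?d (P x y) - P x y = poly_reversal ?d (KP x y) - KP x y"
      using assms(4)[OF xy(1)] KP_reversal[OF xy(1)] s[of P] s[of KP] eq by simp
    have low: "coeff (poly_reversal ?d Q - Q) i = - coeff Q i" if "2 * i < ?d" "2 * degree Q + 1 \<le> ?d" for Q i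
    proof -
      have "degree Q < ?d - i" using that by linarith
      then show ?thesis by (simp add: coeff_poly_reversal coeff_eq_0)
    qed
    show ?thesis
    proof (rule poly_eqI)
      fix i
      show "coeff (P x y) i = coeff (KP x y) i"
      proof (cases "2 * i < ?d")
        case True
        then show ?thesis using low[OF True assms(3)[OF xy]] low[OF True KP_degree[OF xy]] e by simp
      next
        case False
        then have "degree (P x y) < i" "degree (KP x y) < i" using assms(3)[OF xy] KP_degree[OF xy] by linarith+
        then show ?thesis by (simp add: coeff_eq_0)
      qed
    qed
  qed
qed

end

subsection \<open>The recursion along special matchings\<close>

text \<open>Distance 2 is exceptional: there \<open>s x\<close> and \<open>s w\<close> have the same
  length but differ, as only the former has the left descent \<open>s\<close>, so the term with
  factor \<open>q\<close> is missing.\<close>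

fun dihedral_R :: "nat \<Rightarrow> int poly" where
  "dihedral_R 0 = 1"
| "dihedral_R (Suc 0) = qv - 1"
| "dihedral_R (Suc (Suc 0)) = (qv - 1) * (qv - 1)"
| "dihedral_R (Suc (Suc (Suc n))) = (qv - 1) * dihedral_R (Suc (Suc n)) + qv * dihedral_R (Suc n)"

context cox begin

lemma Rp_dih: assumes "w \<in> C" "supp w \<subseteq> {a,b}" "x \<preceq> w" shows "Rp x w = dihedral_R (len w - len x)"
  using assms
proof (induction w arbitrary: x rule: len_induct)
  case (less w)
  have xC: "x \<in> C" using less.prems le_C1 by blast
  show ?case
  proof (cases "w = e")
    case True
    then have "x = e" using less.prems le_e by blast
    then show ?thesis using True Rp_refl[of e] by simp
  next
    case False
    then obtain s where s: "s \<in> DL w" using ex_DL less.hyps by blast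
    have S: "s \<in> S" using s DL_S by blast
    have sab: "s \<in> {a,b}" using s DL_pair[OF less.hyps less.prems(1)] by blast
    let ?v = "s \<cdot> w"
    have l: "len w = Suc (len ?v)" using DL_len[OF s less.hyps] .
    have C: "?v \<in> C" "s \<cdot> x \<in> C" using S less.hyps xC by auto
    have sv: "supp ?v \<subseteq> {a,b}" using supp_down_l[OF s less.hyps] less.prems by blast
    have sx: "supp x \<subseteq> {a,b}" using supp_mono[OF less.prems(2)] less.prems by blast
    have IH: "y \<preceq> ?v \<Longrightarrow> Rp y ?v = dihedral_R (len ?v - len y)" for y using less.IH[OF C(1) _ sv] l by simp
    show ?thesis
    proof (cases "s \<in> DL x")
      case True
      then show ?thesis using Rp_DL[OF xC less.hyps s] IH[OF liftL3[OF less.prems(2) s True]] l DL_len[OF True xC] by simp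
    next
      case nx: False
      have xv: "x \<preceq> ?v" using liftL1[OF less.prems(2) s nx] .
      have lx: "len (s \<cdot> x) = Suc (len x)" using nDL_len[OF S nx xC] .
      have ssx: "supp (s \<cdot> x) \<subseteq> {a,b}" using supp_up_l[OF S nx xC] sx sab by blast
      have R: "Rp x w = qv * Rp (s \<cdot> x) ?v + (qv - 1) * dihedral_R (len ?v - len x)"
        using Rp_DL[OF xC less.hyps s] nx IH[OF xv] by simp
      have le: "len x \<le> len ?v" using le_len_le[OF xv] .
      have "s \<in> DL (s \<cdot> x)" "s \<notin> DL ?v" using S nx xC s less.hyps by auto
      then have ne: "s \<cdot> x \<noteq> ?v" by metis
      show ?thesis
      proof (cases "len ?v - len x \<le> 1")
        case True
        then have "len ?v \<le> len (s \<cdot> x)" using lx by linarith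
        then have "\<not> s \<cdot> x \<preceq> ?v" using le_eq ne by blast
        moreover have "len ?v - len x = 0 \<or> len ?v - len x = Suc 0" using True by auto
        moreover have "len w - len x = Suc (len ?v - len x)" using l le by simp
        ultimately show ?thesis using R Rp_nle by auto
      next
        case False
        then obtain n where n: "len ?v - len x = Suc (Suc n)" by (metis One_nat_def Suc_leI le_Suc_ex not_less_eq_eq plus_nat.simps add_Suc_right Suc_diff_le diff_Suc_1 not0_implies_Suc le_zero_eq)
        then have "s \<cdot> x \<preceq> ?v" using dih_le[OF C(2,1) ssx sv] lx by simp
        moreover have "len ?v - len (s \<cdot> x) = Suc n" using n lx by linarith
        ultimately have "Rp (s \<cdot> x) ?v = dihedral_R (Suc n)" using IH by simp
        moreover have "len w - len x = Suc (Suc (Suc n))" using l n le by simp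
        ultimately show ?thesis using R n by simp
      qed
    qed
  qed
qed

end

section \<open>The recursion in the settled cases\<close>

context spm begin

definition computes :: bool where "computes \<longleftrightarrow> (\<forall>x. x \<preceq> w \<longrightarrow>
  Rp x w = (if up x then qv * Rp (M x) (M w) + (qv - 1) * Rp x (M w) else Rp (M x) (M w)))"

lemma dual_computes: "spm.computes C (\<lambda>x y. y \<cdot> x) e S len le M w = computes"
  unfolding spm.computes_def[OF dualM] computes_def dual_Rp ..

lemma special_below: assumes "v \<preceq> w" "\<not> up v" shows "spm C mul e S len le M v"
proof
  show "special M v" unfolding special_def
  proof (intro conjI allI impI)
    show "v \<in> C" using le_C1[OF assms(1)] .
  next
    fix x assume x: "x \<preceq> v"
    have xw: "x \<preceq> w" using le_trans[OF x assms(1)] .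
    show "M x \<preceq> v" using Mdown_le[OF x assms] .
    show "M (M x) = x" using MM[OF xw] .
    show "cov x (M x) \<or> cov (M x) x" using M_cov[OF xw] .
  next
    fix x y assume "cov x y" "y \<preceq> v" "M x \<noteq> y"
    then show "M x \<preceq> M y" using M_sp le_trans[OF _ assms(1)] by blast
  qed
qed

text \<open>Here \<open>a\<close>, \<open>b\<close>, \<open>c\<close>, \<open>d\<close> are the
  lengths of \<open>x\<close>, \<open>M x\<close>, \<open>x q\<close> and \<open>M (x q)\<close>.
  Opposite sides of the square can go in different directions only if \<open>x\<close> and
  \<open>M (x q)\<close> are its two bottoms or its two tops; the last assumption excludes
  both.\<close>

lemma square_arith: assumes "dx \<and> a = Suc c \<or> \<not> dx \<and> c = Suc a" "dM \<and> b = Suc d \<or> \<not> dM \<and> d = Suc b"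
  "ux \<and> b = Suc a \<or> \<not> ux \<and> a = Suc b" "uz \<and> d = Suc c \<or> \<not> uz \<and> c = Suc d" "ux \<and> dx \<or> \<not> ux \<and> \<not> dx \<or> \<not> ux \<and> \<not> uz"
  shows "(uz \<longleftrightarrow> ux) \<and> (dM \<longleftrightarrow> dx)"
  using assms by (elim disjE conjE) (blast | (rule FalseE, linarith))+

text \<open>An orbit of four elements is a square with parallel sides. Lengths force this, except
  when \<open>x\<close> lies at the bottom, where \<open>condR_up\<close> is used, or possibly at
  the top, where \<open>condR_up\<close> is applied to \<open>x q\<close>.\<close>

lemma orbitM: assumes q: "q \<in> DR w" and comm: "\<And>x. x \<preceq> w \<Longrightarrow> M (x \<cdot> q) = M x \<cdot> q" and x: "x \<preceq> w" "M x \<noteq> x \<cdot> q"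
  shows "(up (x \<cdot> q) \<longleftrightarrow> up x) \<and> (q \<in> DR (M x) \<longleftrightarrow> q \<in> DR x)"
proof -
  have qS: "q \<in> S" using q DR_S by blast
  have qw: "y \<cdot> q \<preceq> w" if "y \<preceq> w" for y using liftR2[OF that q] .
  have cnd: "condR q y" if "y \<preceq> w" "up y" "q \<notin> DR y" "M y \<noteq> y \<cdot> q" for y
    using that qS qw[OF that(1)] le_C1[OF that(1)] unfolding condR_def by blast
  have xC: "x \<in> C" "M x \<in> C" "x \<cdot> q \<in> C" and xqw: "x \<cdot> q \<preceq> w" using x le_C1 M_C qw qS by auto
  let ?z = "x \<cdot> q"
  have zq: "?z \<cdot> q = x" using xC qS by simp
  have Mz: "M ?z = M x \<cdot> q" using comm x by blast
  have Mzx: "M ?z \<noteq> ?z \<cdot> q"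
  proof
    assume "M ?z = ?z \<cdot> q"
    then have "M (M ?z) = M x" using zq by simp
    then show False using MM[OF xqw] x by simp
  qed
  have Mzq: "M ?z \<cdot> q = M x" unfolding Mz using xC qS by simp
  have lz: "q \<in> DR x \<and> len x = Suc (len ?z) \<or> q \<notin> DR x \<and> len ?z = Suc (len x)"
    using DR_len[of q x] nDR_len[of q x] xC qS by auto
  have lMz: "q \<in> DR (M x) \<and> len (M x) = Suc (len (M ?z)) \<or> q \<notin> DR (M x) \<and> len (M ?z) = Suc (len (M x))"
    unfolding Mz using DR_len[of q "M x"] nDR_len[of q "M x"] xC qS by auto
  have lx: "up x \<and> len (M x) = Suc (len x) \<or> \<not> up x \<and> len x = Suc (len (M x))" using up_len dn_len x by auto
  have lz': "up ?z \<and> len (M ?z) = Suc (len ?z) \<or> \<not> up ?z \<and> len ?z = Suc (len (M ?z))" using up_len dn_len xqw by auto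
  show ?thesis
  proof (cases "up x \<longleftrightarrow> q \<in> DR x")
    case True
    show ?thesis using square_arith[OF lz lMz lx lz'] True by blast
  next
    case False
    show ?thesis
    proof (cases "up x")
      case True
      then show ?thesis using condR_up[OF cnd[OF x(1) True _ x(2)]] False by blast
    next
      case nu: False
      then have qx: "q \<in> DR x" using False by blast
      have qz: "q \<notin> DR ?z" using qx qS xC by simp
      have nuz: "\<not> up ?z"
      proof
        assume "up ?z"
        then have "up (?z \<cdot> q)" using condR_up[OF cnd[OF xqw _ qz Mzx]] by blast
        then show False using nu zq by simp
      qed
      then show ?thesis using square_arith[OF lz lMz lx lz'] nu by blast
    qed
  qed
qed

text \<open>Expand along \<open>q\<close> first and then along \<open>M\<close> at
  \<open>w q\<close>, where induction applies because \<open>M\<close> lowers \<open>w q\<close>. By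
  \<open>orbitM\<close> the cases of the two expansions are independent on an orbit of four, so this
  agrees with expanding along \<open>M\<close> first; if \<open>M x = x q\<close>, both expansions
  have the same cases.\<close>

lemma computes_R: assumes q: "q \<in> DR w" and comm: "\<And>x. x \<preceq> w \<Longrightarrow> M (x \<cdot> q) = M x \<cdot> q" and ne: "M w \<noteq> w \<cdot> q"
  and IH: "spm C mul e S len le M (w \<cdot> q) \<Longrightarrow> spm.computes C mul e S len le M (w \<cdot> q)"
  shows computes
proof -
  let ?v = "w \<cdot> q"
  have qS: "q \<in> S" using q DR_S by blast
  have ww: "w \<preceq> w" using wC by simp
  have vw: "?v \<preceq> w" using down_r[OF q wC] .
  have o: "(up (z \<cdot> q) \<longleftrightarrow> up z) \<and> (q \<in> DR (M z) \<longleftrightarrow> q \<in> DR z)" if "z \<preceq> w" "M z \<noteq> z \<cdot> q" for z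
    using orbitM[OF q _ that] comm by blast
  have dv: "\<not> up ?v" using o[OF ww ne] w_dn by blast
  have V: "spm C mul e S len le M ?v" using special_below[OF vw dv] .
  have MwC: "M w \<in> C" using M_C[OF ww] .
  have qMw: "q \<in> DR (M w)" using o[OF ww ne] q by blast
  have Mv: "M ?v = M w \<cdot> q" using comm[OF ww] .
  have Mvv: "M ?v \<preceq> ?v" using dn_leM[OF vw dv] .
  \<comment> \<open>The induction hypothesis concerns elements below \<open>w q\<close> only; for
    the others every term is zero.\<close>
  have ext: "Rp z ?v = (if up z then qv * Rp (M z) (M ?v) + (qv - 1) * Rp z (M ?v) else Rp (M z) (M ?v))" if z: "z \<preceq> w" for z
  proof (cases "z \<preceq> ?v")
    case True
    then show ?thesis using IH[OF V] unfolding spm.computes_def[OF V] by blast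
  next
    case False
    have 1: "Rp z ?v = 0" "Rp z (M ?v) = 0" using False Rp_nle le_trans[OF _ Mvv, of z] by blast+
    have "\<not> M z \<preceq> M ?v"
    proof
      assume "M z \<preceq> M ?v"
      then have "M z \<preceq> ?v" using le_trans[OF _ Mvv] by blast
      then have "M (M z) \<preceq> ?v" using Mdown_le[OF _ vw dv] by blast
      then show False using MM[OF z] False by simp
    qed
    then have "Rp (M z) (M ?v) = 0" by (rule Rp_nle)
    then show ?thesis using 1 by simp
  qed
  show ?thesis unfolding computes_def
  proof (intro allI impI)
    fix x assume x: "x \<preceq> w"
    have xC: "x \<in> C" "M x \<in> C" using x le_C1 M_C by auto
    have xq: "x \<cdot> q \<preceq> w" using liftR2[OF x q] .
    have Mxq: "M (x \<cdot> q) = M x \<cdot> q" using comm[OF x] .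
    note A = Rp_DR[OF xC(1) wC q]
    note B = Rp_DR[OF xC(2) MwC qMw, folded Mv] Rp_DR[OF xC(1) MwC qMw, folded Mv]
    note E = ext[OF x] ext[OF xq, unfolded Mxq]
    show "Rp x w = (if up x then qv * Rp (M x) (M w) + (qv - 1) * Rp x (M w) else Rp (M x) (M w))"
    proof (cases "M x = x \<cdot> q")
      case False
      show ?thesis using o[OF x False] unfolding A B E by (auto simp: algebra_simps)
    next
      case True
      have xqq: "x \<cdot> q \<cdot> q = x" using xC qS by simp
      have u: "up (x \<cdot> q) \<longleftrightarrow> \<not> up x" using up_M[OF x] True by simp
      have d: "q \<in> DR (x \<cdot> q) \<longleftrightarrow> q \<notin> DR x" using xC qS by simp
      have ux: "up x \<longleftrightarrow> q \<notin> DR x" using True nDR_len[OF qS _ xC(1)] DR_len[OF _ xC(1)] by (auto simp: up_def)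
      show ?thesis using u d ux unfolding A B E unfolding True xqq by (auto simp: algebra_simps)
    qed
  qed
qed
lemmas computes_L = spm.computes_R[OF dualM, unfolded dualM_defs2 dual_computes]

lemma computes_rho: assumes "\<And>x. x \<preceq> w \<Longrightarrow> M x = x \<cdot> s" shows computes
proof -
  have ww: "w \<preceq> w" using wC by simp
  have sS: "s \<in> S" by simp
  have u: "up x \<longleftrightarrow> s \<notin> DR x" if "x \<preceq> w" for x
    using assms[OF that] nDR_len[OF sS _ le_C1[OF that]] DR_len[OF _ le_C1[OF that]] by (auto simp: up_def)
  have s: "s \<in> DR w" using u[OF ww] w_dn by blast
  show ?thesis unfolding computes_def
  proof (intro allI impI)
    fix x assume x: "x \<preceq> w"
    show "Rp x w = (if up x then qv * Rp (M x) (M w) + (qv - 1) * Rp x (M w) else Rp (M x) (M w))"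
      unfolding assms[OF x] assms[OF ww] Rp_DR[OF le_C1[OF x] wC s] using u[OF x] by simp
  qed
qed
lemmas computes_lam = spm.computes_rho[OF dualM, unfolded dual_computes]

text \<open>\<open>R\<close> depends on the distance only. The exception at distance 2 is met
  because \<open>M x\<close> and \<open>M w\<close> are then distinct and of equal length.\<close>

lemma computes_dih: assumes ab: "supp w \<subseteq> {a,b}" shows computes
  unfolding computes_def
proof (intro allI impI)
  fix x assume x: "x \<preceq> w"
  have ww: "w \<preceq> w" using wC by simp
  have Mw: "M w \<preceq> w" using M_le[OF ww] .
  have MwC: "M w \<in> C" using le_C1[OF Mw] .
  have lw: "len w = Suc (len (M w))" using dn_len[OF ww w_dn] .
  have sM: "supp (M w) \<subseteq> {a,b}" using supp_mono[OF Mw] ab by blast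
  have Mx: "M x \<preceq> w" "M x \<in> C" using M_le[OF x] le_C1 by blast+
  have sMx: "supp (M x) \<subseteq> {a,b}" using supp_mono[OF Mx(1)] ab by blast
  note D = Rp_dih[OF wC ab x] and D' = Rp_dih[OF MwC sM]
  show "Rp x w = (if up x then qv * Rp (M x) (M w) + (qv - 1) * Rp x (M w) else Rp (M x) (M w))"
  proof (cases "up x")
    case False
    have "M x \<preceq> M w" using Mlift3[OF x ww w_dn False] .
    moreover have "len x = Suc (len (M x))" using dn_len[OF x False] .
    ultimately show ?thesis using D D' False lw by simp
  next
    case True
    have xM: "x \<preceq> M w" using Mlift2[OF x ww w_dn True] .
    have lx: "len (M x) = Suc (len x)" using up_len[OF x True] .
    have "x \<noteq> w" using w_dn True by blast
    then have ne: "M x \<noteq> M w" using M_inj[OF x ww] by blast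
    have le: "len x \<le> len (M w)" using le_len_le[OF xM] .
    let ?d = "len (M w) - len x"
    have lw': "len w - len x = Suc ?d" using lw le by simp
    consider "?d = 0" | "?d = Suc 0" | n where "?d = Suc (Suc n)" by (metis not0_implies_Suc)
    then show ?thesis
    proof cases
      case 1
      then have "len (M w) \<le> len (M x)" using lx by linarith
      then have "\<not> M x \<preceq> M w" using le_eq ne by blast
      then show ?thesis using D D'[OF xM] True lw' 1 Rp_nle by simp
    next
      case 2
      then have "len (M w) \<le> len (M x)" using lx by linarith
      then have "\<not> M x \<preceq> M w" using le_eq ne by blast
      then show ?thesis using D D'[OF xM] True lw' 2 Rp_nle by simp
    next
      case (3 n)
      then have "M x \<preceq> M w" using dih_le[OF Mx(2) MwC sMx sM] lx by simp
      moreover have "len (M w) - len (M x) = Suc n" using 3 lx by simp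
      ultimately show ?thesis using D D'[OF xM] D' True lw' 3 by simp
    qed
  qed
qed

end

context cox begin

theorem special_computes: assumes "special M w" shows "spm.computes C mul e S len le M w"
proof -
  have "w \<in> C" using assms by (simp add: special_def)
  then show ?thesis using assms
  proof (induction w arbitrary: M rule: len_induct)
    case (less w)
    interpret W: spm C mul e S len le M w by unfold_locales (rule less.prems)
    have IH: "spm.computes C mul e S len le M v" if "spm C mul e S len le M v" "len v < len w" for v
    proof -
      have "special M v" using that(1) by (simp add: spm_def spm_axioms_def)
      then show ?thesis using less.IH[of v M] that(2) by (simp add: special_def)
    qed
    have dIH: "spm.computes C (\<lambda>x y. y \<cdot> x) e S len le M v" if v: "spm C (\<lambda>x y. y \<cdot> x) e S len le M v" "len v < len w" for v
    proof -
      have v': "spm C mul e S len le M v" using spm.dualM[OF v(1)] .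
      show ?thesis unfolding spm.dual_computes[OF v'] using IH[OF v' v(2)] .
    qed
    from W.settled[unfolded W.settled_def] show ?case
    proof (elim disjE bexE conjE)
      fix q assume q: "q \<in> DR w" "W.goodR q" "M w \<noteq> w \<cdot> q"
      show W.computes
      proof (rule W.computes_R[OF q(1) _ q(3)])
        show "M (x \<cdot> q) = M x \<cdot> q" if "x \<preceq> w" for x using W.comm_all_r[OF q(1) _ that] q(2) by (simp add: W.goodR_def)
        show "spm.computes C mul e S len le M (w \<cdot> q)" if "spm C mul e S len le M (w \<cdot> q)"
          using IH[OF that] DR_len[OF q(1) less.hyps] by simp
      qed
    next
      fix q assume q: "q \<in> DL w" "W.goodL q" "M w \<noteq> q \<cdot> w"
      show W.computes
      proof (rule W.computes_L[OF q(1) _ q(3)])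
        show "M (q \<cdot> x) = q \<cdot> M x" if "x \<preceq> w" for x using W.comm_all_l[OF q(1) _ that] q(2) by (simp add: W.goodL_def)
        show "spm.computes C (\<lambda>x y. y \<cdot> x) e S len le M (q \<cdot> w)" if "spm C (\<lambda>x y. y \<cdot> x) e S len le M (q \<cdot> w)"
          using dIH[OF that] DL_len[OF q(1) less.hyps] by simp
      qed
    next
      assume "\<forall>x. x \<preceq> w \<longrightarrow> M x = x \<cdot> M e"
      then show W.computes using W.computes_rho by blast
    next
      assume "\<forall>x. x \<preceq> w \<longrightarrow> M x = M e \<cdot> x"
      then show W.computes using W.computes_lam by blast
    next
      fix a b assume "supp w \<subseteq> {a,b}"
      then show W.computes using W.computes_dih by blast
    qed
  qed
qed

end

subsection \<open>From the presentation to the Bruhat order\<close>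

text \<open>The reflections \<open>t\<close> such that \<open>wt\<close> arises from the word \<open>w\<close> by deleting a letter. The parity of their
  multiplicities is invariant under inserting relators, which yields the strong exchange property.\<close>

fun refs :: "('a, 'c) monoid_scheme \<Rightarrow> 'a list \<Rightarrow> 'a list" where
  "refs W [] = []"
| "refs W (s # xs) = (inv\<^bsub>W\<^esub> word_prod W xs \<otimes>\<^bsub>W\<^esub> s \<otimes>\<^bsub>W\<^esub> word_prod W xs) # refs W xs"

locale coxsys =
  fixes W :: "('a, 'c) monoid_scheme" (structure) and S :: "'a set"
  assumes sys: "coxeter_system W S"
begin

sublocale group W using sys by (simp add: coxeter_system_def)

abbreviation wp :: "'a list \<Rightarrow> 'a" where "wp \<equiv> word_prod W"
abbreviation len :: "'a \<Rightarrow> nat" where "len \<equiv> cox_length W S"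
abbreviation le :: "'a \<Rightarrow> 'a \<Rightarrow> bool" (infix "\<preceq>" 50) where "le \<equiv> bruhat_le W S"
abbreviation rep :: "nat \<Rightarrow> 'a \<Rightarrow> 'a \<Rightarrow> 'a list" where "rep k s t \<equiv> concat (replicate k [s, t])"

lemma S_carrier: "s \<in> S \<Longrightarrow> s \<in> carrier W"
  using sys by (auto simp: coxeter_system_def)

lemma wp_Nil[simp]: "wp [] = \<one>" by (simp add: word_prod_def)
lemma wp_Cons[simp]: "wp (s # xs) = s \<otimes> wp xs" by (simp add: word_prod_def)
lemma wp_carrier[simp]: "set xs \<subseteq> S \<Longrightarrow> wp xs \<in> carrier W" by (induction xs) (auto simp: S_carrier)
lemma wp_append: "set xs \<subseteq> S \<Longrightarrow> set ys \<subseteq> S \<Longrightarrow> wp (xs @ ys) = wp xs \<otimes> wp ys"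
  by (induction xs) (auto simp: S_carrier m_assoc)

lemma rep_S: "s \<in> S \<Longrightarrow> t \<in> S \<Longrightarrow> set (rep k s t) \<subseteq> S"
  by (induction k) auto

lemma inv_cancel: "x \<in> carrier W \<Longrightarrow> z \<in> carrier W \<Longrightarrow> inv x \<otimes> (x \<otimes> z) = z"
  "x \<in> carrier W \<Longrightarrow> z \<in> carrier W \<Longrightarrow> x \<otimes> (inv x \<otimes> z) = z"
  by (simp_all add: m_assoc[symmetric])

text \<open>A function of words that ignores inserted relators is constant on the classes of the
  presentation. Quantifying over all powers of \<open>s t\<close> with trivial product keeps the
  Coxeter matrix out of the hypothesis.\<close>

lemma word_invariant:
  assumes inv: "\<And>us vs s t k. set us \<subseteq> S \<Longrightarrow> set vs \<subseteq> S \<Longrightarrow> s \<in> S \<Longrightarrow> t \<in> S \<Longrightarrow> wp (rep k s t) = \<one> \<Longrightarrow>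
      f (us @ rep k s t @ vs) = f (us @ vs)"
    and "set xs \<subseteq> S" "set ys \<subseteq> S" "wp xs = wp ys"
  shows "f xs = f ys"
proof -
  obtain m where m: "\<forall>xs\<in>lists S. \<forall>ys\<in>lists S. wp xs = wp ys \<longleftrightarrow> equivclp (relator_insertion S m) xs ys"
    using sys by (auto simp: coxeter_system_def)
  have one: "wp (rep (m s t) s t) = \<one>" if "s \<in> S" "t \<in> S" for s t
  proof -
    have "rep (m s t) s t \<in> lists S" unfolding in_lists_conv_set using rep_S[OF that] by blast
    moreover have "relator_insertion S m [] (rep (m s t) s t)" unfolding relator_insertion_def
      using that by (intro bexI[of _ "[]"] bexI[of _ s] bexI[of _ t]) auto
    ultimately have "wp [] = wp (rep (m s t) s t)" using m by (meson lists.Nil r_into_equivclp)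
    then show ?thesis by simp
  qed
  have step: "f a = f b" if "relator_insertion S m a b" for a b
  proof -
    from that obtain us vs s t where u: "us \<in> lists S" "vs \<in> lists S" "s \<in> S" "t \<in> S"
      and ab: "a = us @ vs" "b = us @ rep (m s t) s t @ vs" unfolding relator_insertion_def by blast
    have "set us \<subseteq> S" "set vs \<subseteq> S" using u by auto
    from inv[OF this u(3,4) one[OF u(3,4)]] show ?thesis using ab by metis
  qed
  have "equivclp (relator_insertion S m) xs ys" using m assms by (simp add: in_lists_conv_set subset_code(1))
  then show ?thesis by (induction rule: equivclp_induct) (use step in auto)
qed

lemma S_sq: "s \<in> S \<Longrightarrow> s \<otimes> s = \<one>"
proof -
  assume s: "s \<in> S"
  obtain m where m: "coxeter_matrix S m"
    "\<forall>xs\<in>lists S. \<forall>ys\<in>lists S. wp xs = wp ys \<longleftrightarrow> equivclp (relator_insertion S m) xs ys"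
    using sys by (auto simp: coxeter_system_def)
  have "m s s = 1" using m(1) s by (simp add: coxeter_matrix_def)
  then have "relator_insertion S m [] [s, s]" unfolding relator_insertion_def
    using s by (intro bexI[of _ "[]"] bexI[of _ s]) auto
  then have "wp [] = wp [s, s]" using m(2) s by (meson lists.Nil lists.Cons r_into_equivclp)
  then show ?thesis using S_carrier[OF s] by simp
qed

lemma inv_S: "s \<in> S \<Longrightarrow> inv s = s" using S_sq S_carrier inv_equality by blast

lemma S_cancel: "s \<in> S \<Longrightarrow> x \<in> carrier W \<Longrightarrow> s \<otimes> (s \<otimes> x) = x" "s \<in> S \<Longrightarrow> x \<in> carrier W \<Longrightarrow> x \<otimes> s \<otimes> s = x"
  using S_sq S_carrier by (simp_all add: m_assoc[symmetric], simp add: m_assoc)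

lemma wp_rev: "set xs \<subseteq> S \<Longrightarrow> wp (rev xs) = inv (wp xs)"
  by (induction xs) (auto simp: wp_append S_carrier inv_mult_group inv_S)

lemma ex_word: assumes "w \<in> carrier W" shows "\<exists>xs. set xs \<subseteq> S \<and> wp xs = w"
proof -
  have "w \<in> generate W S" using assms sys by (simp add: coxeter_system_def)
  then show ?thesis
  proof (induction rule: generate.induct)
    case one
    then show ?case by (intro exI[of _ "[]"]) simp
  next
    case (incl h)
    then show ?case by (intro exI[of _ "[h]"]) (simp add: S_carrier)
  next
    case (inv h)
    then show ?case by (intro exI[of _ "[h]"]) (simp add: S_carrier inv_S)
  next
    case (eng a b)
    then obtain xs ys where "set xs \<subseteq> S" "wp xs = a" "set ys \<subseteq> S" "wp ys = b" by blast
    then show ?case by (intro exI[of _ "xs @ ys"]) (simp add: wp_append)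
  qed
qed

lemma len_le: "set xs \<subseteq> S \<Longrightarrow> len (wp xs) \<le> length xs"
  unfolding cox_length_def by (rule Least_le) auto

lemma ex_reduced: assumes "w \<in> carrier W" shows "\<exists>xs. set xs \<subseteq> S \<and> wp xs = w \<and> length xs = len w"
proof -
  have "\<exists>n. \<exists>xs\<in>lists S. length xs = n \<and> wp xs = w" using ex_word[OF assms] by auto
  then have "\<exists>xs\<in>lists S. length xs = len w \<and> wp xs = w" unfolding cox_length_def by (rule LeastI_ex)
  then show ?thesis by auto
qed

lemma parity: "set xs \<subseteq> S \<Longrightarrow> set ys \<subseteq> S \<Longrightarrow> wp xs = wp ys \<Longrightarrow> even (length xs) = even (length ys)"
proof (rule word_invariant[where f = "\<lambda>xs. even (length xs)"])
  fix us vs s t k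
  have "length (rep k s t) = 2 * k" by (induction k) auto
  then show "even (length (us @ rep k s t @ vs)) = even (length (us @ vs))" by simp
qed

lemma len_inv: assumes "w \<in> carrier W" shows "len (inv w) = len w"
proof -
  have "len (inv w) \<le> len w" if w: "w \<in> carrier W" for w
  proof -
    obtain xs where xs: "set xs \<subseteq> S" "wp xs = w" "length xs = len w" using ex_reduced[OF w] by blast
    then show ?thesis using len_le[of "rev xs"] wp_rev[OF xs(1)] by simp
  qed
  from this[OF assms] this[of "inv w"] show ?thesis using assms by simp
qed

lemma len_r: assumes "s \<in> S" "x \<in> carrier W" shows "len (x \<otimes> s) = Suc (len x) \<or> len x = Suc (len (x \<otimes> s))"
proof -
  have le: "len (y \<otimes> s) \<le> Suc (len y)" if y: "y \<in> carrier W" for y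
  proof -
    obtain xs where xs: "set xs \<subseteq> S" "wp xs = y" "length xs = len y" using ex_reduced[OF y] by blast
    then show ?thesis using len_le[of "xs @ [s]"] assms(1) wp_append[of xs "[s]"] S_carrier by simp
  qed
  have xs: "x \<otimes> s \<in> carrier W" using assms S_carrier by simp
  obtain us where us: "set us \<subseteq> S" "wp us = x" "length us = len x" using ex_reduced[OF assms(2)] by blast
  obtain vs where vs: "set vs \<subseteq> S" "wp vs = x \<otimes> s" "length vs = len (x \<otimes> s)" using ex_reduced[OF xs] by blast
  have "wp (us @ [s]) = wp vs" using us vs wp_append[of us "[s]"] assms S_carrier by simp
  then have "even (length (us @ [s])) = even (length vs)" using parity[of "us @ [s]" vs] us vs assms by simp
  then have "len x \<noteq> len (x \<otimes> s)" using us vs by auto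
  moreover have "len (x \<otimes> s) \<le> Suc (len x)" "len x \<le> Suc (len (x \<otimes> s))" using le[OF assms(2)] le[OF xs] S_cancel assms by auto
  ultimately show ?thesis by linarith
qed

lemma len_0: assumes "x \<in> carrier W" shows "len x = 0 \<longleftrightarrow> x = \<one>"
proof
  assume "len x = 0"
  then show "x = \<one>" using ex_reduced[OF assms] by auto
next
  assume "x = \<one>"
  then show "len x = 0" using len_le[of "[]"] by simp
qed

lemma ex_l: assumes "x \<in> carrier W" "x \<noteq> \<one>" shows "\<exists>s\<in>S. len (s \<otimes> x) < len x"
proof -
  obtain xs where xs: "set xs \<subseteq> S" "wp xs = x" "length xs = len x" using ex_reduced[OF assms(1)] by blast
  then obtain s ys where ys: "xs = s # ys" using assms(2) by (cases xs) auto
  then have "s \<otimes> x = wp ys" using xs S_cancel by auto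
  then show ?thesis using len_le[of ys] xs ys by (intro bexI[of _ s]) auto
qed

lemma refs_carrier: "set xs \<subseteq> S \<Longrightarrow> set (refs W xs) \<subseteq> carrier W"
  by (induction xs) (auto simp: S_carrier)

lemma refs_append: "set xs \<subseteq> S \<Longrightarrow> set ys \<subseteq> S \<Longrightarrow>
  refs W (xs @ ys) = map (\<lambda>r. inv (wp ys) \<otimes> r \<otimes> wp ys) (refs W xs) @ refs W ys"
  by (induction xs) (auto simp: S_carrier wp_append inv_mult_group m_assoc)

lemma conj_eq: "p \<in> carrier W \<Longrightarrow> r \<in> carrier W \<Longrightarrow> \<tau> \<in> carrier W \<Longrightarrow> inv p \<otimes> r \<otimes> p = \<tau> \<longleftrightarrow> r = p \<otimes> \<tau> \<otimes> inv p"
  by (metis inv_closed inv_solve_left inv_solve_right m_assoc m_closed)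

lemma count_conj: "set zs \<subseteq> carrier W \<Longrightarrow> p \<in> carrier W \<Longrightarrow> \<tau> \<in> carrier W \<Longrightarrow>
  count_list (map (\<lambda>r. inv p \<otimes> r \<otimes> p) zs) \<tau> = count_list zs (p \<otimes> \<tau> \<otimes> inv p)"
  by (induction zs) (auto simp: conj_eq)

lemma wp_rep: "s \<in> S \<Longrightarrow> t \<in> S \<Longrightarrow> wp (rep k s t) = (s \<otimes> t) [^] k"
proof (induction k)
  case (Suc k)
  have C: "s \<in> carrier W" "t \<in> carrier W" "wp (rep k s t) \<in> carrier W" using Suc.prems S_carrier rep_S by auto
  have "wp (rep (Suc k) s t) = s \<otimes> t \<otimes> (s \<otimes> t) [^] k" using Suc C by (simp add: m_assoc)
  then show ?case using nat_pow_Suc2[of "s \<otimes> t" k] C by simp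
qed simp

lemma pow_shift: "s \<in> carrier W \<Longrightarrow> t \<in> carrier W \<Longrightarrow> t \<otimes> (s \<otimes> t) [^] (k::nat) = (t \<otimes> s) [^] k \<otimes> t"
proof (induction k)
  case (Suc k)
  have "t \<otimes> (s \<otimes> t) [^] Suc k = (t \<otimes> (s \<otimes> t) [^] k) \<otimes> (s \<otimes> t)" using Suc.prems by (simp add: m_assoc)
  also have "\<dots> = (t \<otimes> s) [^] k \<otimes> t \<otimes> (s \<otimes> t)" using Suc by simp
  also have "\<dots> = (t \<otimes> s) [^] Suc k \<otimes> t" using Suc.prems by (simp add: m_assoc)
  finally show ?case .
qed simp

lemma inv_pow: "s \<in> S \<Longrightarrow> t \<in> S \<Longrightarrow> inv ((s \<otimes> t) [^] (k::nat)) = (t \<otimes> s) [^] k"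
  using S_carrier by (simp add: nat_pow_inv[symmetric] inv_mult_group inv_S)

lemma count_rep: assumes st: "s \<in> S" "t \<in> S"
  shows "count_list (refs W (rep k s t)) \<tau> = count_list (map (\<lambda>j. (t \<otimes> s) [^] j \<otimes> t) [0..<2 * k]) \<tau>"
proof (induction k)
  case (Suc k)
  note C = S_carrier[OF st(1)] S_carrier[OF st(2)]
  let ?a = "t \<otimes> s" and ?p = "wp (rep k s t)"
  have a: "?a \<in> carrier W" using C by simp
  have p: "?p = (s \<otimes> t) [^] k" "inv ?p = ?a [^] k" using wp_rep[OF st] inv_pow[OF st] by simp_all
  have tp: "t \<otimes> ?p = ?a [^] k \<otimes> t" using p(1) pow_shift[OF C] by simp
  have pC: "?p \<in> carrier W" using p(1) C by simp
  have 1: "inv ?p \<otimes> t \<otimes> ?p = ?a [^] (2 * k) \<otimes> t"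
    using C pC a tp p(2) by (simp add: m_assoc nat_pow_mult[symmetric] mult_2)
  have "inv (t \<otimes> ?p) = ?a [^] k \<otimes> t" using C pC p(2) inv_S[OF st(2)] by (simp add: inv_mult_group)
  then have "inv (t \<otimes> ?p) \<otimes> s \<otimes> (t \<otimes> ?p) = ?a [^] k \<otimes> t \<otimes> s \<otimes> (?a [^] k \<otimes> t)" using tp by simp
  also have "\<dots> = ?a [^] Suc k \<otimes> ?a [^] k \<otimes> t" using C a by (simp add: m_assoc)
  also have "?a [^] Suc k \<otimes> ?a [^] k = ?a [^] Suc (2 * k)" using nat_pow_mult[OF a, of "Suc k" k] by (simp add: mult_2)
  finally have 2: "inv (t \<otimes> ?p) \<otimes> s \<otimes> (t \<otimes> ?p) = ?a [^] Suc (2 * k) \<otimes> t" .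
  have r: "refs W (rep (Suc k) s t) = (?a [^] Suc (2 * k) \<otimes> t) # (?a [^] (2 * k) \<otimes> t) # refs W (rep k s t)"
    using 1 2 by simp
  show ?case unfolding r using Suc.IH by (simp del: nat_pow_Suc)
qed simp

text \<open>As \<open>(t s)^k\<close> is trivial, the \<open>2 k\<close> reflections listed by
  \<open>count_rep\<close> run twice through the same \<open>k\<close> entries.\<close>

lemma even_count_rep: assumes "s \<in> S" "t \<in> S" "wp (rep k s t) = \<one>" shows "even (count_list (refs W (rep k s t)) \<tau>)"
proof -
  let ?f = "\<lambda>j. (t \<otimes> s) [^] (j::nat) \<otimes> t"
  have C: "t \<otimes> s \<in> carrier W" using assms S_carrier by simp
  have "(t \<otimes> s) [^] k = \<one>" using inv_pow[OF assms(1,2), of k] assms(3) wp_rep[OF assms(1,2)] by simp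
  then have p: "?f (j + k) = ?f j" for j using nat_pow_mult[OF C, of j k] C by simp
  have "map ?f [0..<2 * k] = map ?f [0..<k] @ map ?f [k..<k + k]"
    unfolding mult_2 using upt_add_eq_append[of 0 k k] by simp
  also have "map ?f [k..<k + k] = map ?f [0..<k]"
    unfolding map_add_upt[symmetric, of k k] using p by simp
  finally show ?thesis unfolding count_rep[OF assms(1,2)] by simp
qed

lemma odd_count_eq: assumes "set xs \<subseteq> S" "set ys \<subseteq> S" "wp xs = wp ys" "\<tau> \<in> carrier W"
  shows "odd (count_list (refs W xs) \<tau>) = odd (count_list (refs W ys) \<tau>)"
proof (rule word_invariant[where f = "\<lambda>xs. odd (count_list (refs W xs) \<tau>)", OF _ assms(1-3)])
  fix us vs s t k
  assume a: "set us \<subseteq> S" "set vs \<subseteq> S" "s \<in> S" "t \<in> S" "wp (rep k s t) = \<one>"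
  have r: "set (rep k s t) \<subseteq> S" using rep_S a by blast
  have wv: "wp (rep k s t @ vs) = wp vs" using wp_append[OF r a(2)] a by simp
  have rv: "set (rep k s t @ vs) \<subseteq> S" using r a by simp
  have v: "wp vs \<in> carrier W" using a by simp
  show "odd (count_list (refs W (us @ rep k s t @ vs)) \<tau>) = odd (count_list (refs W (us @ vs)) \<tau>)"
    unfolding refs_append[OF a(1) rv] refs_append[OF a(1,2)] refs_append[OF r a(2)] wv
    using even_count_rep[OF a(3-5)] count_conj[OF refs_carrier[OF r] v assms(4)] by simp
qed

text \<open>The reflection cocycle: by \<open>eta_len\<close> it holds exactly for the inversions
  \<open>\<tau>\<close> of \<open>w\<close>. The choice of the word is immaterial by
  \<open>odd_count_eq\<close>.\<close>

definition eta :: "'a \<Rightarrow> 'a \<Rightarrow> bool" where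
  "eta w \<tau> \<longleftrightarrow> odd (count_list (refs W (SOME xs. set xs \<subseteq> S \<and> wp xs = w)) \<tau>)"

lemma eta_wp: assumes "set xs \<subseteq> S" "\<tau> \<in> carrier W" shows "eta (wp xs) \<tau> = odd (count_list (refs W xs) \<tau>)"
proof -
  have "\<exists>ys. set ys \<subseteq> S \<and> wp ys = wp xs" using assms by blast
  from someI_ex[OF this] show ?thesis unfolding eta_def using odd_count_eq[OF _ assms(1) _ assms(2)] by blast
qed

lemma eta_mult: assumes "a \<in> carrier W" "b \<in> carrier W" "\<tau> \<in> carrier W"
  shows "eta (a \<otimes> b) \<tau> \<longleftrightarrow> (eta b \<tau> \<noteq> eta a (b \<otimes> \<tau> \<otimes> inv b))"
proof -
  obtain xs ys where w: "set xs \<subseteq> S" "wp xs = a" "set ys \<subseteq> S" "wp ys = b" using ex_word assms by metis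
  have c: "b \<otimes> \<tau> \<otimes> inv b \<in> carrier W" using assms by simp
  have "eta (a \<otimes> b) \<tau> = odd (count_list (refs W (xs @ ys)) \<tau>)"
    using eta_wp[of "xs @ ys" \<tau>] w wp_append[OF w(1,3)] assms by simp
  then show ?thesis
    using refs_append[OF w(1,3)] count_conj[OF refs_carrier[OF w(1)] assms(2,3)] eta_wp[OF w(3) assms(3)] eta_wp[OF w(1) c] w by auto
qed

text \<open>For the third claim, expand \<open>eta\<close> of \<open>u s inv u\<close> by the
  cocycle rule \<open>eta_mult\<close>. The contributions of \<open>u\<close> and of its inverse
  agree, since \<open>eta\<close> vanishes on the identity, and cancel; what remains is
  \<open>eta s s\<close>.\<close>

lemma refl_cases: assumes "\<tau> \<in> reflections W S" shows "\<tau> \<in> carrier W" "\<tau> \<otimes> \<tau> = \<one>" "eta \<tau> \<tau>" "inv \<tau> = \<tau>"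
proof -
  obtain u s where u: "u \<in> carrier W" "s \<in> S" "\<tau> = u \<otimes> s \<otimes> inv u" using assms by (auto simp: reflections_def)
  have s: "s \<in> carrier W" using S_carrier u by simp
  show C: "\<tau> \<in> carrier W" using u s by simp
  have "\<tau> \<otimes> \<tau> = u \<otimes> s \<otimes> (inv u \<otimes> u) \<otimes> s \<otimes> inv u" unfolding u(3) using u(1) s by (simp add: m_assoc inv_cancel)
  also have "\<dots> = \<one>" using u(1,2) s S_cancel(2)[of s u] by simp
  finally show sq: "\<tau> \<otimes> \<tau> = \<one>" .
  then show "inv \<tau> = \<tau>" using C inv_equality by blast
  have ut: "inv u \<otimes> \<tau> \<otimes> inv (inv u) = s" unfolding u(3) using u(1) s by (simp add: m_assoc inv_cancel)
  have ss: "s \<otimes> s \<otimes> inv s = s" using s by (simp add: m_assoc)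
  have us: "u \<otimes> s \<otimes> inv u = \<tau>" using u by simp
  have e1: "\<not> eta \<one> s" using eta_wp[of "[]" s] s by simp
  have es: "eta s s" using eta_wp[of "[s]" s] u s by simp
  have "eta (inv u \<otimes> u) s \<longleftrightarrow> (eta u s \<noteq> eta (inv u) \<tau>)" using eta_mult[of "inv u" u s] u(1) s us by simp
  then have n: "eta u s = eta (inv u) \<tau>" using e1 u(1) by simp
  have "eta (u \<otimes> s \<otimes> inv u) \<tau> \<longleftrightarrow> (eta (inv u) \<tau> \<noteq> eta (u \<otimes> s) s)" using eta_mult[of "u \<otimes> s" "inv u" \<tau>] u(1) s C ut by simp
  also have "eta (u \<otimes> s) s \<longleftrightarrow> (eta s s \<noteq> eta u s)" using eta_mult[of u s s] u(1) s ss by simp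
  finally show "eta \<tau> \<tau>" using us n es by simp
qed

lemma refs_delete: assumes "set xs \<subseteq> S" "\<tau> \<in> set (refs W xs)" shows "len (wp xs \<otimes> \<tau>) < length xs"
proof -
  have "\<exists>ys. set ys \<subseteq> S \<and> length xs = Suc (length ys) \<and> wp ys = wp xs \<otimes> \<tau>"
    using assms
  proof (induction xs)
    case (Cons s xs)
    have s: "s \<in> S" "s \<in> carrier W" "set xs \<subseteq> S" "wp xs \<in> carrier W" using Cons.prems S_carrier by auto
    show ?case
    proof (cases "\<tau> = inv wp xs \<otimes> s \<otimes> wp xs")
      case True
      have "wp (s # xs) \<otimes> \<tau> = s \<otimes> (s \<otimes> wp xs)" unfolding True using s by (simp add: m_assoc inv_cancel)
      then have "wp (s # xs) \<otimes> \<tau> = wp xs" using S_cancel s by simp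
      then show ?thesis using s by (intro exI[of _ xs]) simp
    next
      case False
      then have t: "\<tau> \<in> set (refs W xs)" using Cons.prems by simp
      then obtain ys where ys: "set ys \<subseteq> S" "length xs = Suc (length ys)" "wp ys = wp xs \<otimes> \<tau>" using Cons.IH s by blast
      have "\<tau> \<in> carrier W" using refs_carrier[OF s(3)] t by blast
      then show ?thesis using s ys by (intro exI[of _ "s # ys"]) (simp add: m_assoc)
    qed
  qed simp
  then obtain ys where "set ys \<subseteq> S" "length xs = Suc (length ys)" "wp ys = wp xs \<otimes> \<tau>" by blast
  then show ?thesis using len_le[of ys] by simp
qed

lemma eta_refs: assumes "set xs \<subseteq> S" "\<tau> \<in> carrier W" "eta (wp xs) \<tau>" shows "\<tau> \<in> set (refs W xs)"
proof -
  have "count_list (refs W xs) \<tau> \<noteq> 0" using eta_wp[OF assms(1,2)] assms(3) by (metis even_zero)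
  then show ?thesis by (simp add: count_list_0_iff)
qed

text \<open>If \<open>eta\<close> holds, \<open>w \<tau>\<close> arises from a reduced word of
  \<open>w\<close> by deleting a letter. If it fails, the cocycle rule and
  \<open>eta \<tau> \<tau>\<close> make it hold for \<open>w \<tau>\<close>.\<close>

lemma eta_len: assumes "w \<in> carrier W" "\<tau> \<in> reflections W S"
  shows "eta w \<tau> \<Longrightarrow> len (w \<otimes> \<tau>) < len w" "\<not> eta w \<tau> \<Longrightarrow> len w < len (w \<otimes> \<tau>)"
proof -
  note t = refl_cases[OF assms(2)]
  have down: "len (w \<otimes> \<tau>) < len w" if wC: "w \<in> carrier W" and e: "eta w \<tau>" for w
  proof -
    obtain xs where xs: "set xs \<subseteq> S" "wp xs = w" "length xs = len w" using ex_reduced[OF wC] by blast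
    then show ?thesis using refs_delete[OF xs(1) eta_refs[OF xs(1) t(1)]] e by simp
  qed
  show "eta w \<tau> \<Longrightarrow> len (w \<otimes> \<tau>) < len w" using down assms by blast
  assume n: "\<not> eta w \<tau>"
  have "eta (w \<otimes> \<tau>) \<tau> \<longleftrightarrow> (eta \<tau> \<tau> \<noteq> eta w (\<tau> \<otimes> \<tau> \<otimes> inv \<tau>))" using eta_mult[OF assms(1) t(1,1)] .
  also have "\<tau> \<otimes> \<tau> \<otimes> inv \<tau> = \<tau>" using t by simp
  finally have "eta (w \<otimes> \<tau>) \<tau>" using n t by simp
  then have "len (w \<otimes> \<tau> \<otimes> \<tau>) < len (w \<otimes> \<tau>)" using down[of "w \<otimes> \<tau>"] assms t by simp
  then show "len w < len (w \<otimes> \<tau>)" using assms t by (simp add: m_assoc)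
qed

lemma S_refl: assumes "s \<in> S" shows "s \<in> reflections W S"
proof -
  have "s = \<one> \<otimes> s \<otimes> inv \<one>" using S_carrier assms by simp
  then show ?thesis unfolding reflections_def using assms by blast
qed

lemma conj_refl: assumes "\<tau> \<in> reflections W S" "p \<in> carrier W" shows "p \<otimes> \<tau> \<otimes> inv p \<in> reflections W S"
proof -
  obtain u s where u: "u \<in> carrier W" "s \<in> S" "\<tau> = u \<otimes> s \<otimes> inv u" using assms by (auto simp: reflections_def)
  have "p \<otimes> \<tau> \<otimes> inv p = (p \<otimes> u) \<otimes> s \<otimes> inv (p \<otimes> u)" unfolding u(3) using u S_carrier assms by (simp add: inv_mult_group m_assoc)
  then show ?thesis unfolding reflections_def using u assms by blast
qed

text \<open>Put \<open>\<sigma> = s \<tau> s\<close>. If \<open>\<sigma>\<close> shortened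
  \<open>u s\<close>, it would be among the reflections of a reduced word of \<open>u\<close>
  followed by \<open>s\<close>. It is then \<open>s\<close>, so that \<open>\<tau> = s\<close>, or
  the conjugate of a reflection shortening \<open>u\<close>, which \<open>\<tau>\<close> is
  not.\<close>

lemma edge: assumes "u \<in> carrier W" "\<tau> \<in> reflections W S" "len u < len (u \<otimes> \<tau>)" "s \<in> S"
  shows "u \<otimes> s = u \<otimes> \<tau> \<or> (\<exists>\<sigma>\<in>reflections W S. u \<otimes> \<tau> \<otimes> s = u \<otimes> s \<otimes> \<sigma> \<and> len (u \<otimes> s) < len (u \<otimes> s \<otimes> \<sigma>))"
proof (rule ccontr)
  assume n: "\<not> ?thesis"
  have s: "s \<in> carrier W" using S_carrier assms by simp
  note t = refl_cases[OF assms(2)]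
  let ?\<sigma> = "s \<otimes> \<tau> \<otimes> inv s"
  have sg: "?\<sigma> \<in> reflections W S" using conj_refl assms s by simp
  note g = refl_cases[OF sg]
  have "u \<otimes> s \<otimes> ?\<sigma> = u \<otimes> s \<otimes> s \<otimes> \<tau> \<otimes> s" using assms(1) s t inv_S[OF assms(4)] by (simp add: m_assoc)
  then have eq: "u \<otimes> \<tau> \<otimes> s = u \<otimes> s \<otimes> ?\<sigma>" using S_cancel(2)[OF assms(4,1)] by simp
  have "\<not> len (u \<otimes> s) < len (u \<otimes> s \<otimes> ?\<sigma>)" using n eq sg by blast
  then have e: "eta (u \<otimes> s) ?\<sigma>" using eta_len(2)[of "u \<otimes> s", OF _ sg] assms s by auto
  obtain xs where xs: "set xs \<subseteq> S" "wp xs = u" "length xs = len u" using ex_reduced[OF assms(1)] by blast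
  have xs': "set (xs @ [s]) \<subseteq> S" "wp (xs @ [s]) = u \<otimes> s" using xs assms s wp_append[of xs "[s]"] by auto
  have "?\<sigma> \<in> set (refs W (xs @ [s]))" using eta_refs[OF xs'(1) g(1)] e xs'(2) by simp
  moreover have "refs W (xs @ [s]) = map (\<lambda>r. inv s \<otimes> r \<otimes> s) (refs W xs) @ [s]"
    using refs_append[OF xs(1), of "[s]"] assms(4) s by simp
  ultimately consider "?\<sigma> = s" | r where "r \<in> set (refs W xs)" "?\<sigma> = inv s \<otimes> r \<otimes> s" by auto
  then show False
  proof cases
    case 1
    then have "s \<otimes> \<tau> = s \<otimes> s" using s t by (simp add: inv_solve_right')
    then have "\<tau> = s" using s t by simp
    then show False using n by simp
  next
    case (2 r)
    have rC: "r \<in> carrier W" using refs_carrier[OF xs(1)] 2 by blast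
    have "s \<otimes> \<tau> \<otimes> s = s \<otimes> r \<otimes> s" using 2 inv_S[OF assms(4)] by simp
    then have "\<tau> = r" using s t rC by simp
    then have "len (u \<otimes> \<tau>) < len u" using refs_delete[OF xs(1)] 2 xs by simp
    then show False using assms by simp
  qed
qed

lemma le_carrier: "x \<preceq> y \<Longrightarrow> x \<in> carrier W \<and> y \<in> carrier W"
  by (induction rule: bruhat_le.induct) (auto simp: refl_cases(1))

lemma le_trans': assumes "y \<preceq> z" "x \<preceq> y" shows "x \<preceq> z"
  using assms by (induction rule: bruhat_le.induct) (auto intro: bruhat_le.step)

lemma le_len': "x \<preceq> y \<Longrightarrow> x = y \<or> len x < len y"
  by (induction rule: bruhat_le.induct) auto

lemma le_refl_mult: "w \<in> carrier W \<Longrightarrow> \<tau> \<in> reflections W S \<Longrightarrow> len w < len (w \<otimes> \<tau>) \<Longrightarrow> w \<preceq> w \<otimes> \<tau>"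
  by (intro bruhat_le.step bruhat_le.refl)

lemma le_up_r: "s \<in> S \<Longrightarrow> x \<in> carrier W \<Longrightarrow> len x < len (x \<otimes> s) \<Longrightarrow> x \<preceq> x \<otimes> s"
  using le_refl_mult S_refl by blast

text \<open>Free of conditions on descents, so that it can be proved step by step along the Bruhat
  order with \<open>edge\<close>. The first half gives \<open>mono_r\<close> through
  \<open>y \<le> y s\<close>, the second \<open>lift_r\<close> through
  \<open>x \<le> x s\<close>.\<close>

lemma mult_r_le: assumes "x \<preceq> y" "s \<in> S" shows "(x \<otimes> s \<preceq> y \<otimes> s \<or> x \<otimes> s \<preceq> y) \<and> (x \<otimes> s \<preceq> y \<otimes> s \<or> x \<preceq> y \<otimes> s)"
  using assms(1)
proof (induction rule: bruhat_le.induct)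
  case (refl u)
  have "u \<otimes> s \<preceq> u \<otimes> s" using refl S_carrier assms by (intro bruhat_le.refl) simp
  then show ?case by blast
next
  case (step u w t)
  have wC: "w \<in> carrier W" using le_carrier step.hyps by blast
  have up: "w \<preceq> w \<otimes> t" using le_refl_mult step wC by blast
  from edge[OF wC step.hyps(2,3) assms(2)] show ?case
  proof
    assume eq: "w \<otimes> s = w \<otimes> t"
    have "w \<otimes> t \<otimes> s = w" unfolding eq[symmetric] using S_cancel(2)[OF assms(2) wC] .
    then show ?thesis using step.IH step.hyps(1) eq le_trans'[OF up] by auto
  next
    assume "\<exists>\<sigma>\<in>reflections W S. w \<otimes> t \<otimes> s = w \<otimes> s \<otimes> \<sigma> \<and> len (w \<otimes> s) < len (w \<otimes> s \<otimes> \<sigma>)"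
    then obtain \<sigma> where sg: "\<sigma> \<in> reflections W S" "w \<otimes> t \<otimes> s = w \<otimes> s \<otimes> \<sigma>" "len (w \<otimes> s) < len (w \<otimes> s \<otimes> \<sigma>)" by blast
    have "w \<otimes> s \<preceq> w \<otimes> t \<otimes> s" unfolding sg(2) by (rule le_refl_mult) (use sg wC assms S_carrier in auto)
    then show ?thesis using step.IH le_trans'[OF up] le_trans'[of "w \<otimes> s" "w \<otimes> t \<otimes> s"] by blast
  qed
qed

lemma mono_r: assumes "s \<in> S" "x \<preceq> y" "len y < len (y \<otimes> s)" shows "x \<otimes> s \<preceq> y \<otimes> s"
  using mult_r_le[OF assms(2,1)] le_trans'[OF le_up_r[OF assms(1) _ assms(3)]] le_carrier[OF assms(2)] by blast

lemma lift_r: assumes "s \<in> S" "x \<preceq> y" "len x < len (x \<otimes> s)" shows "x \<preceq> y \<otimes> s"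
  using mult_r_le[OF assms(2,1)] le_trans'[OF _ le_up_r[OF assms(1) _ assms(3)]] le_carrier[OF assms(2)] by blast

lemma le_inv: "x \<preceq> y \<Longrightarrow> inv x \<preceq> inv y"
proof (induction rule: bruhat_le.induct)
  case (refl u)
  then show ?case by (intro bruhat_le.refl) simp
next
  case (step u w t)
  have wC: "w \<in> carrier W" using le_carrier step.hyps by blast
  note t = refl_cases[OF step.hyps(2)]
  have eq: "inv (w \<otimes> t) = inv w \<otimes> (w \<otimes> t \<otimes> inv w)" using wC t by (simp add: inv_mult_group m_assoc inv_cancel)
  have "len (inv w) < len (inv (w \<otimes> t))" using step.hyps(3) wC t len_inv by simp
  then show ?case using bruhat_le.step[OF step.IH conj_refl[OF step.hyps(2) wC]] eq by simp
qed

lemma left: assumes "s \<in> S" "x \<in> carrier W" shows "s \<otimes> x = inv (inv x \<otimes> s)" "len (s \<otimes> x) = len (inv x \<otimes> s)" "len (inv x) = len x"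
proof -
  have s: "s \<in> carrier W" using S_carrier assms by simp
  show eq: "s \<otimes> x = inv (inv x \<otimes> s)" using assms s by (simp add: inv_mult_group inv_S)
  show "len (s \<otimes> x) = len (inv x \<otimes> s)" unfolding eq using len_inv assms s by simp
  show "len (inv x) = len x" using len_inv assms by simp
qed

lemma ex_r: assumes "x \<in> carrier W" "x \<noteq> \<one>" shows "\<exists>s\<in>S. len (x \<otimes> s) < len x"
proof -
  have "inv x \<noteq> \<one>" using assms by simp
  then obtain s where "s \<in> S" "len (s \<otimes> inv x) < len (inv x)" using ex_l[of "inv x"] assms by auto
  then show ?thesis using left[of s "inv x"] assms by (metis inv_closed inv_inv)
qed

lemma is_cox: "cox (carrier W) (\<otimes>) \<one> S len le"
proof
  fix x y z s
  show "x \<preceq> y \<Longrightarrow> x \<in> carrier W" "x \<preceq> y \<Longrightarrow> y \<in> carrier W" using le_carrier by blast+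
  show "x \<preceq> y \<Longrightarrow> y \<preceq> z \<Longrightarrow> x \<preceq> z" by (rule le_trans')
  show "x \<preceq> y \<Longrightarrow> x = y \<or> len x < len y" by (rule le_len')
  show "x \<in> carrier W \<Longrightarrow> x \<preceq> x" by (rule bruhat_le.refl)
  show "x \<in> carrier W \<Longrightarrow> \<exists>y\<in>carrier W. y \<otimes> x = \<one> \<and> x \<otimes> y = \<one>" by (intro bexI[of _ "inv x"]) auto
  show "s \<in> S \<Longrightarrow> x \<in> carrier W \<Longrightarrow> len (s \<otimes> x) = Suc (len x) \<or> len x = Suc (len (s \<otimes> x))"
    using left[of s x] len_r[of s "inv x"] by simp
  show "s \<in> S \<Longrightarrow> x \<in> carrier W \<Longrightarrow> len x < len (s \<otimes> x) \<Longrightarrow> x \<preceq> s \<otimes> x"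
    using left[of s x] le_inv[OF le_up_r[of s "inv x"]] by simp
  show "s \<in> S \<Longrightarrow> x \<preceq> y \<Longrightarrow> len (s \<otimes> y) < len y \<Longrightarrow> len x < len (s \<otimes> x) \<Longrightarrow> x \<preceq> s \<otimes> y"
    using left[of s x] left[of s y] le_inv[OF lift_r[of s "inv x" "inv y"]] le_inv[of x y] le_carrier[of x y] by simp
  show "s \<in> S \<Longrightarrow> x \<preceq> y \<Longrightarrow> len y < len (s \<otimes> y) \<Longrightarrow> s \<otimes> x \<preceq> s \<otimes> y"
    using left[of s x] left[of s y] le_inv[OF mono_r[of s "inv x" "inv y"]] le_inv[of x y] le_carrier[of x y] by simp
qed (auto simp: S_carrier S_sq m_assoc len_0 len_r ex_l ex_r le_up_r lift_r mono_r)

end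

context cox begin

text \<open>Lifting gives all cases of the matching condition but one: if \<open>s\<close> is a left
  descent of \<open>z\<close> and not of \<open>x\<close>, then \<open>x = s z\<close> by length,
  and the matching exchanges the two.\<close>

lemma special_left: assumes "y \<in> C" "s \<in> DL y" shows "special (\<lambda>x. s \<cdot> x) y"
  unfolding special_def
proof (intro conjI allI impI)
  have S: "s \<in> S" using assms DL_S by blast
  show "y \<in> C" by fact
  fix x assume x: "x \<preceq> y"
  have xC: "x \<in> C" using x le_C1 by blast
  show "s \<cdot> x \<preceq> y" using liftL2 x assms by blast
  show "s \<cdot> (s \<cdot> x) = x" using S xC by simp
  show "cov x (s \<cdot> x) \<or> cov (s \<cdot> x) x"
    using up_l[OF S _ xC] nDL_len[OF S _ xC] down_l[OF _ xC] DL_len[OF _ xC] by (auto simp: cov_def)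
next
  have S: "s \<in> S" using assms DL_S by blast
  fix x z assume a: "cov x z" "z \<preceq> y" "s \<cdot> x \<noteq> z"
  note c = covD[OF a(1)]
  have C: "x \<in> C" "z \<in> C" using c le_C1 le_C2 by blast+
  show "s \<cdot> x \<preceq> s \<cdot> z"
  proof (cases "s \<in> DL z")
    case False
    then show ?thesis using liftL4[OF c(1) S] by blast
  next
    case True
    show ?thesis
    proof (cases "s \<in> DL x")
      case False
      then have "x \<preceq> s \<cdot> z" using liftL1[OF c(1) True] by blast
      then have "x = s \<cdot> z" using le_eq DL_len[OF True C(2)] c(2) by auto
      then show ?thesis using a(3) S C by simp
    qed (use liftL3[OF c(1) True] in blast)
  qed
qed

end

subsection \<open>Isomorphisms of lower intervals\<close>

locale coxiso = X: cox C mul e S len le + Y: cox C' mul' e' S' len' le'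
  for C :: "'a set" and mul :: "'a \<Rightarrow> 'a \<Rightarrow> 'a" (infixl "\<cdot>" 70) and e :: 'a
    and S :: "'a set" and len :: "'a \<Rightarrow> nat" and le :: "'a \<Rightarrow> 'a \<Rightarrow> bool" (infix "\<preceq>" 50)
    and C' :: "'b set" and mul' :: "'b \<Rightarrow> 'b \<Rightarrow> 'b" and e' :: 'b
    and S' :: "'b set" and len' :: "'b \<Rightarrow> nat" and le' :: "'b \<Rightarrow> 'b \<Rightarrow> bool" (infix "\<preceq>''" 50) +
  fixes \<psi> :: "'a \<Rightarrow> 'b" and v :: 'a and v' :: 'b
  assumes bij: "bij_betw \<psi> {z. z \<preceq> v} {z. z \<preceq>' v'}"
    and iso: "\<And>a b. a \<preceq> v \<Longrightarrow> b \<preceq> v \<Longrightarrow> a \<preceq> b \<longleftrightarrow> \<psi> a \<preceq>' \<psi> b"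
begin

lemma psi_le: "x \<preceq> v \<Longrightarrow> \<psi> x \<preceq>' v'" using bij_betwE[OF bij] by simp
lemma psi_C: "x \<preceq> v \<Longrightarrow> \<psi> x \<in> C'" using Y.le_C1[OF psi_le] .
lemma psi_eq: "x \<preceq> v \<Longrightarrow> y \<preceq> v \<Longrightarrow> \<psi> x = \<psi> y \<longleftrightarrow> x = y"
  using inj_on_eq_iff[OF bij_betw_imp_inj_on[OF bij]] by simp
lemma psi_surj: assumes "y \<preceq>' v'" shows "\<exists>x. x \<preceq> v \<and> \<psi> x = y"
proof -
  have "y \<in> \<psi> ` {z. z \<preceq> v}" unfolding bij_betw_imp_surj_on[OF bij] using assms by simp
  then show ?thesis by blast
qed

definition phi :: "'b \<Rightarrow> 'a" where "phi = inv_into {z. z \<preceq> v} \<psi>"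

lemma phi_psi: "x \<preceq> v \<Longrightarrow> phi (\<psi> x) = x"
  unfolding phi_def using inv_into_f_f[OF bij_betw_imp_inj_on[OF bij]] by simp

lemma sym: "coxiso C' mul' e' S' len' le' C mul e S len le phi v' v"
proof (rule coxiso.intro[OF Y.cox_axioms X.cox_axioms], rule coxiso_axioms.intro)
  show "bij_betw phi {z. z \<preceq>' v'} {z. z \<preceq> v}" unfolding phi_def using bij by (rule bij_betw_inv_into)
  fix a b assume a: "a \<preceq>' v'" "b \<preceq>' v'"
  obtain x where x: "x \<preceq> v" "\<psi> x = a" using psi_surj[OF a(1)] by blast
  obtain y where y: "y \<preceq> v" "\<psi> y = b" using psi_surj[OF a(2)] by blast
  show "a \<preceq>' b \<longleftrightarrow> phi a \<preceq> phi b" using iso[OF x(1) y(1)] phi_psi[OF x(1)] phi_psi[OF y(1)] x y by simp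
qed

text \<open>The isomorphism is known to respect the order only. A chain of descents from
  \<open>x\<close> to \<open>e\<close> has a strictly decreasing image, so lengths do not drop; the
  inverse isomorphism gives equality.\<close>

lemma len_ge: "x \<preceq> v \<Longrightarrow> len x \<le> len' (\<psi> x)"
proof (induction "len x" arbitrary: x rule: less_induct)
  case less
  have xC: "x \<in> C" using less.prems X.le_C1 by blast
  show ?case
  proof (cases "x = e")
    case False
    then obtain s where s: "s \<in> X.DL x" using X.ex_DL xC by blast
    note d = X.down_l[OF s xC] X.DL_len[OF s xC]
    have y: "s \<cdot> x \<preceq> v" using X.le_trans[OF d(1) less.prems] .
    have "s \<cdot> x \<noteq> x" using d(2) by auto
    then have "\<psi> (s \<cdot> x) \<preceq>' \<psi> x" "\<psi> (s \<cdot> x) \<noteq> \<psi> x" using iso[OF y less.prems] d(1) psi_eq[OF y less.prems] by auto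
    then have "len' (\<psi> (s \<cdot> x)) < len' (\<psi> x)" using Y.le_len by blast
    then show ?thesis using less.hyps[OF _ y] d(2) by linarith
  qed simp
qed

lemma len_psi: "x \<preceq> v \<Longrightarrow> len' (\<psi> x) = len x"
  using coxiso.len_ge[OF sym psi_le, of x] phi_psi[of x] len_ge[of x] by simp

lemma cov_psi: "x \<preceq> v \<Longrightarrow> y \<preceq> v \<Longrightarrow> Y.cov (\<psi> x) (\<psi> y) \<longleftrightarrow> X.cov x y"
  using iso len_psi by (simp add: X.cov_def Y.cov_def)

lemma special_psi: assumes y: "y \<preceq> v" and sp: "X.special M y"
  shows "\<exists>M'. Y.special M' (\<psi> y) \<and> (\<forall>x. x \<preceq> y \<longrightarrow> M' (\<psi> x) = \<psi> (M x))"
proof -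
  define N where "N x = \<psi> (M (phi x))" for x
  have yv: "x \<preceq> v" if "x \<preceq> y" for x using X.le_trans[OF that y] .
  have eq: "N (\<psi> x) = \<psi> (M x)" if "x \<preceq> y" for x
    using phi_psi[OF yv[OF that]] by (simp add: N_def)
  have pre: "\<exists>x. x \<preceq> y \<and> a = \<psi> x" if a: "a \<preceq>' \<psi> y" for a
  proof -
    obtain x where x: "x \<preceq> v" "\<psi> x = a" using psi_surj[OF Y.le_trans[OF a psi_le[OF y]]] by blast
    then show ?thesis using iso[OF x(1) y] a by blast
  qed
  have M: "M x \<preceq> y" "M (M x) = x" "X.cov x (M x) \<or> X.cov (M x) x" if "x \<preceq> y" for x
    using sp that unfolding X.special_def by blast+
  have Msp: "M x \<preceq> M z" if "X.cov x z" "z \<preceq> y" "M x \<noteq> z" for x z using sp that unfolding X.special_def by blast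
  have "Y.special N (\<psi> y)" unfolding Y.special_def
  proof (intro conjI allI impI)
    show "\<psi> y \<in> C'" using psi_C[OF y] .
  next
    fix a assume "a \<preceq>' \<psi> y"
    then obtain x where x: "x \<preceq> y" "a = \<psi> x" using pre by blast
    note m = M[OF x(1)]
    have e1: "N a = \<psi> (M x)" unfolding x(2) by (rule eq[OF x(1)])
    have e2: "N (\<psi> (M x)) = \<psi> (M (M x))" by (rule eq[OF m(1)])
    show "N a \<preceq>' \<psi> y" unfolding e1 using iso[OF yv[OF m(1)] y] m by simp
    show "N (N a) = a" unfolding e1 e2 unfolding x(2) m(2) by simp
    show "Y.cov a (N a) \<or> Y.cov (N a) a" unfolding e1 unfolding x(2)
      using m(3) cov_psi[OF yv[OF x(1)] yv[OF m(1)]] cov_psi[OF yv[OF m(1)] yv[OF x(1)]] by blast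
  next
    fix a b assume ab: "Y.cov a b" "b \<preceq>' \<psi> y" "N a \<noteq> b"
    obtain z where z: "z \<preceq> y" "b = \<psi> z" using pre[OF ab(2)] by blast
    obtain x where x: "x \<preceq> y" "a = \<psi> x" using pre[OF Y.le_trans[OF Y.covD(1)[OF ab(1)] ab(2)]] by blast
    have e1: "N a = \<psi> (M x)" unfolding x(2) by (rule eq[OF x(1)])
    have e2: "N b = \<psi> (M z)" unfolding z(2) by (rule eq[OF z(1)])
    have "X.cov x z" using ab(1) cov_psi[OF yv[OF x(1)] yv[OF z(1)]] unfolding x(2) z(2) by blast
    moreover have "M x \<noteq> z" using ab(3) e1 z(2) by metis
    ultimately have "M x \<preceq> M z" using Msp z(1) by blast
    then show "N a \<preceq>' N b" unfolding e1 e2 using iso[OF yv[OF M(1)[OF x(1)]] yv[OF M(1)[OF z(1)]]] by blast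
  qed
  then show ?thesis using eq by metis
qed

lemma Rp_psi: "y \<preceq> v \<Longrightarrow> x \<preceq> v \<Longrightarrow> Y.Rp (\<psi> x) (\<psi> y) = X.Rp x y"
proof (induction "len y" arbitrary: x y rule: less_induct)
  case less
  note yv = less.prems(1) and xv = less.prems(2)
  have C: "x \<in> C" "y \<in> C" using less.prems X.le_C1 by blast+
  have iso': "x \<preceq> y \<longleftrightarrow> \<psi> x \<preceq>' \<psi> y" using iso[OF xv yv] .
  show ?case
  proof (cases "x \<preceq> y")
    case False
    then show ?thesis using iso' X.Rp_nle Y.Rp_nle by simp
  next
    case xy: True
    show ?thesis
    proof (cases "y = e")
      case True
      then have "x = y" using xy X.le_e by blast
      then show ?thesis using X.Rp_refl[OF C(2)] Y.Rp_refl[OF psi_C[OF yv]] by simp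
    next
      case False
      then obtain s where s: "s \<in> X.DL y" using X.ex_DL C by blast
      have S: "s \<in> S" using s X.DL_S by blast
      obtain M' where M': "Y.special M' (\<psi> y)" "\<And>z. z \<preceq> y \<Longrightarrow> M' (\<psi> z) = \<psi> (s \<cdot> z)"
        using special_psi[OF yv X.special_left[OF C(2) s]] by blast
      interpret Z: spm C' mul' e' S' len' le' M' "\<psi> y" by unfold_locales (rule M'(1))
      have c: "Z.computes" using Y.special_computes[OF M'(1)] .
      have sy: "s \<cdot> y \<preceq> v" using X.le_trans[OF X.down_l[OF s C(2)] yv] .
      have sxy: "s \<cdot> x \<preceq> y" using X.liftL2[OF xy s] .
      have sx: "s \<cdot> x \<preceq> v" using X.le_trans[OF sxy yv] .
      have l: "len (s \<cdot> y) < len y" using X.DL_len[OF s C(2)] by simp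
      note IH = less.hyps[OF l sy]
      have Mx: "M' (\<psi> x) = \<psi> (s \<cdot> x)" "M' (\<psi> y) = \<psi> (s \<cdot> y)" using M'(2) xy X.le_refl[OF C(2)] by blast+
      have u: "Z.up (\<psi> x) \<longleftrightarrow> s \<notin> X.DL x" unfolding Z.up_def Mx len_psi[OF sx] len_psi[OF xv]
        using X.nDL_len[OF S _ C(1)] X.DL_len[OF _ C(1)] by auto
      have "Y.Rp (\<psi> x) (\<psi> y) = (if Z.up (\<psi> x) then qv * Y.Rp (M' (\<psi> x)) (M' (\<psi> y)) + (qv - 1) * Y.Rp (\<psi> x) (M' (\<psi> y))
          else Y.Rp (M' (\<psi> x)) (M' (\<psi> y)))"
        using c iso' xy unfolding Z.computes_def by blast
      also have "\<dots> = X.Rp x y" unfolding Mx u IH[OF sx] IH[OF xv] X.Rp_DL[OF C(1,2) s] by simp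
      finally show ?thesis .
    qed
  qed
qed

lemma KP_psi: "x \<preceq> v \<Longrightarrow> y \<preceq> v \<Longrightarrow> Y.KP (\<psi> x) (\<psi> y) = X.KP x y"
proof (induction "len y - len x" arbitrary: x rule: less_induct)
  case less
  note xv = less.prems(1) and yv = less.prems(2)
  have iv: "z \<preceq> v" if "z \<in> X.ivl x y" for z using that X.le_trans[OF _ yv] by (auto simp: X.ivl_def)
  have b: "bij_betw \<psi> (X.ivl x y - {x}) (Y.ivl (\<psi> x) (\<psi> y) - {\<psi> x})"
  proof (rule bij_betw_imageI)
    show "inj_on \<psi> (X.ivl x y - {x})" using psi_eq iv by (auto simp: inj_on_def)
    show "\<psi> ` (X.ivl x y - {x}) = Y.ivl (\<psi> x) (\<psi> y) - {\<psi> x}"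
    proof
      show "\<psi> ` (X.ivl x y - {x}) \<subseteq> Y.ivl (\<psi> x) (\<psi> y) - {\<psi> x}"
      proof
        fix b assume "b \<in> \<psi> ` (X.ivl x y - {x})"
        then obtain z where z: "z \<in> X.ivl x y" "z \<noteq> x" "b = \<psi> z" by blast
        note zv = iv[OF z(1)]
        show "b \<in> Y.ivl (\<psi> x) (\<psi> y) - {\<psi> x}"
          using z psi_eq[OF zv xv] iso[OF xv zv] iso[OF zv yv] by (simp add: X.ivl_def Y.ivl_def)
      qed
      show "Y.ivl (\<psi> x) (\<psi> y) - {\<psi> x} \<subseteq> \<psi> ` (X.ivl x y - {x})"
      proof
        fix a assume a: "a \<in> Y.ivl (\<psi> x) (\<psi> y) - {\<psi> x}"
        then have a': "\<psi> x \<preceq>' a" "a \<preceq>' \<psi> y" "a \<noteq> \<psi> x" by (auto simp: Y.ivl_def)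
        obtain z where z: "z \<preceq> v" "\<psi> z = a" using psi_surj[OF Y.le_trans[OF a'(2) psi_le[OF yv]]] by blast
        then have "z \<in> X.ivl x y - {x}" using a' iso[OF xv z(1)] iso[OF z(1) yv] by (auto simp: X.ivl_def)
        then show "a \<in> \<psi> ` (X.ivl x y - {x})" using z by blast
      qed
    qed
  qed
  have "(\<Sum>z\<in>Y.ivl (\<psi> x) (\<psi> y) - {\<psi> x}. Y.Rp (\<psi> x) z * Y.KP z (\<psi> y)) =
    (\<Sum>z\<in>X.ivl x y - {x}. Y.Rp (\<psi> x) (\<psi> z) * Y.KP (\<psi> z) (\<psi> y))"
    by (rule sum.reindex_bij_betw[OF b, symmetric])
  also have "\<dots> = (\<Sum>z\<in>X.ivl x y - {x}. X.Rp x z * X.KP z y)"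
  proof (rule sum.cong)
    fix z assume z: "z \<in> X.ivl x y - {x}"
    have zv: "z \<preceq> v" using iv z by blast
    have "len y - len z < len y - len x" using X.ivl_len[OF z] by linarith
    then show "Y.Rp (\<psi> x) (\<psi> z) * Y.KP (\<psi> z) (\<psi> y) = X.Rp x z * X.KP z y"
      using less.hyps[OF _ zv yv] Rp_psi[OF zv xv] by simp
  qed simp
  finally have s: "(\<Sum>z\<in>Y.ivl (\<psi> x) (\<psi> y) - {\<psi> x}. Y.Rp (\<psi> x) z * Y.KP z (\<psi> y)) = X.KF x y" .
  show ?case unfolding X.KP.simps[of x y] Y.KP.simps[of "\<psi> x" "\<psi> y"] s
    using iso[OF xv yv] psi_eq[OF xv yv] len_psi[OF xv] len_psi[OF yv] by simp
qed

end

context coxsys begin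

text \<open>The description by \<open>THE\<close> calls for existence and uniqueness. The defining
  recursion moves upward from \<open>x\<close> and \<open>y\<close>, whereas \<open>Rp_DL\<close>
  moves downward from \<open>w\<close>; the two are matched by multiplying by \<open>s\<close> once
  more.\<close>

lemma R_poly_eq: "R_poly W S = cox.Rp (carrier W) (\<otimes>) \<one> S len"
proof -
  interpret X: cox "carrier W" "(\<otimes>)" \<one> S len le by (rule is_cox)
  have q: "[:0, 1:] = qv" by (simp add: qv_def)
  have D: "s \<in> X.DL (s \<otimes> x)" "s \<notin> X.DL x" if "s \<in> S" "x \<in> carrier W" "len x < len (s \<otimes> x)" for s x
    using that by (auto simp: X.DL_def)
  show ?thesis unfolding R_poly_def
  proof (rule the_equality)
    show "is_R_family W S X.Rp" unfolding is_R_family_def q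
    proof (intro conjI allI ballI impI)
      show "X.Rp x y = 0" if "\<not> x \<preceq> y" for x y using X.Rp_nle[OF that] .
      show "X.Rp x x = 1" if "x \<in> carrier W" for x using X.Rp_refl[OF that] .
      fix s x y assume a: "s \<in> S" "x \<in> carrier W" "y \<in> carrier W" "len x < len (s \<otimes> x)" "len y < len (s \<otimes> y)"
      have C: "s \<otimes> x \<in> carrier W" "s \<otimes> y \<in> carrier W" using a S_carrier by auto
      note d = D[OF a(1,2,4)] D(1)[OF a(1,3,5)] S_cancel(1)[OF a(1,2)] S_cancel(1)[OF a(1,3)]
      show "X.Rp (s \<otimes> x) (s \<otimes> y) = X.Rp x y" using X.Rp_DL[OF C d(3)] d by simp
      show "X.Rp x (s \<otimes> y) = (qv - 1) * X.Rp x y + qv * X.Rp (s \<otimes> x) y" using X.Rp_DL[OF a(2) C(2) d(3)] d by simp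
    qed
  next
    fix F assume "is_R_family W S F"
    note F = this[unfolded is_R_family_def q]
    have Fr: "F (s \<otimes> a) (s \<otimes> b) = F a b" "F a (s \<otimes> b) = (qv - 1) * F a b + qv * F (s \<otimes> a) b"
      if "s \<in> S" "a \<in> carrier W" "b \<in> carrier W" "len a < len (s \<otimes> a)" "len b < len (s \<otimes> b)" for s a b
      using F that by blast+
    have F0: "\<not> x \<preceq> y \<Longrightarrow> F x y = 0" "x \<in> carrier W \<Longrightarrow> F x x = 1" for x y using F by blast+
    show "F = X.Rp"
    proof (intro ext)
      fix x y
      show "F x y = X.Rp x y"
      proof (cases "x \<preceq> y")
        case False
        then show ?thesis using F0 X.Rp_nle by simp
      next
        case True
        show ?thesis
        proof (rule X.Rp_unique)
          show "x \<in> carrier W" "y \<in> carrier W" using True le_carrier by blast+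
          show "F x \<one> = X.delta x" if "x \<in> carrier W" for x
            using F0(1)[of x \<one>] F0(2)[of x] X.le_e[of x] that by (auto simp: X.delta_def)
          fix x w s assume a: "x \<in> carrier W" "w \<in> carrier W" "s \<in> X.DL w"
          have S: "s \<in> S" using a X.DL_S by blast
          have C: "s \<otimes> x \<in> carrier W" "s \<otimes> w \<in> carrier W" using a S S_carrier by auto
          have w: "s \<otimes> (s \<otimes> w) = w" "len (s \<otimes> w) < len w" using S a S_cancel X.DL_len by auto
          have x: "s \<otimes> (s \<otimes> x) = x" using S a S_cancel by simp
          show "F x w = (if s \<in> X.DL x then F (s \<otimes> x) (s \<otimes> w) else qv * F (s \<otimes> x) (s \<otimes> w) + (qv - 1) * F x (s \<otimes> w))"
          proof (cases "s \<in> X.DL x")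
            case True
            then have "len (s \<otimes> x) < len x" using X.DL_len a by simp
            then have "F (s \<otimes> (s \<otimes> x)) (s \<otimes> (s \<otimes> w)) = F (s \<otimes> x) (s \<otimes> w)" using Fr(1)[OF S C] w x by simp
            then show ?thesis using True w x by simp
          next
            case False
            then have "len x < len (s \<otimes> x)" using X.nDL_len S a by simp
            then have "F x (s \<otimes> (s \<otimes> w)) = (qv - 1) * F x (s \<otimes> w) + qv * F (s \<otimes> x) (s \<otimes> w)" using Fr(2)[OF S a(1) C(2)] w by simp
            then show ?thesis using False w by simp
          qed
        qed
      qed
    qed
  qed
qed

lemma KL_poly_eq: "KL_poly W S = cox.KP (carrier W) (\<otimes>) \<one> S len le"
proof -
  interpret X: cox "carrier W" "(\<otimes>)" \<one> S len le by (rule is_cox)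
  have i: "bruhat_interval W S = X.ivl" by (intro ext) (simp add: bruhat_interval_def X.ivl_def)
  show ?thesis unfolding KL_poly_def is_KL_family_def R_poly_eq i
  proof (rule the_equality)
    show "(\<forall>x y. \<not> x \<preceq> y \<longrightarrow> X.KP x y = 0) \<and> (\<forall>x\<in>carrier W. X.KP x x = 1) \<and>
      (\<forall>x y. x \<preceq> y \<longrightarrow> x \<noteq> y \<longrightarrow> 2 * degree (X.KP x y) + 1 \<le> len y - len x) \<and>
      (\<forall>x y. x \<preceq> y \<longrightarrow> poly_reversal (len y - len x) (X.KP x y) = (\<Sum>z\<in>X.ivl x y. X.Rp x z * X.KP z y))"
      by (intro conjI allI ballI impI) (fact X.KP_nle X.KP_refl X.KP_degree X.KP_reversal)+
  next
    fix P assume P: "(\<forall>x y. \<not> x \<preceq> y \<longrightarrow> P x y = 0) \<and> (\<forall>x\<in>carrier W. P x x = 1) \<and>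
      (\<forall>x y. x \<preceq> y \<longrightarrow> x \<noteq> y \<longrightarrow> 2 * degree (P x y) + 1 \<le> len y - len x) \<and>
      (\<forall>x y. x \<preceq> y \<longrightarrow> poly_reversal (len y - len x) (P x y) = (\<Sum>z\<in>X.ivl x y. X.Rp x z * P z y))"
    note p = conjunct1[OF P] conjunct1[OF conjunct2[OF P]] conjunct1[OF conjunct2[OF conjunct2[OF P]]]
      conjunct2[OF conjunct2[OF conjunct2[OF P]]]
    show "P = X.KP"
    proof (intro ext)
      fix x y
      show "P x y = X.KP x y"
      proof (rule X.KP_unique)
        show "P x y = 0" if "\<not> x \<preceq> y" for x y using p(1)[rule_format, OF that] .
        show "P x x = 1" if "x \<in> carrier W" for x using p(2)[rule_format, OF that] .
        show "2 * degree (P x y) + 1 \<le> len y - len x" if "x \<preceq> y" "x \<noteq> y" for x y using p(3)[rule_format, OF that] .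
        show "poly_reversal (len y - len x) (P x y) = (\<Sum>z\<in>X.ivl x y. X.Rp x z * P z y)" if "x \<preceq> y" for x y
          using p(4)[rule_format, OF that] .
      qed
    qed
  qed
qed

lemma interval_one: "bruhat_interval W S \<one> v = {z. z \<preceq> v}"
proof -
  interpret X: cox "carrier W" "(\<otimes>)" \<one> S len le by (rule is_cox)
  show ?thesis using X.e_le X.le_C1 by (auto simp: bruhat_interval_def)
qed

end

theorem mainTheorem1:
  fixes W :: "('a, 'c) monoid_scheme" and S :: "'a set"
    and W' :: "('b, 'd) monoid_scheme" and S' :: "'b set"
    and \<psi> :: "'a \<Rightarrow> 'b"
  assumes "coxeter_system W S" and "coxeter_system W' S'"
    and "v \<in> carrier W" and "v' \<in> carrier W'"
    and "bij_betw \<psi> (bruhat_interval W S \<one>\<^bsub>W\<^esub> v) (bruhat_interval W' S' \<one>\<^bsub>W'\<^esub> v')"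
    and "\<And>a b. a \<in> bruhat_interval W S \<one>\<^bsub>W\<^esub> v \<Longrightarrow> b \<in> bruhat_interval W S \<one>\<^bsub>W\<^esub> v \<Longrightarrow>
           bruhat_le W S a b \<longleftrightarrow> bruhat_le W' S' (\<psi> a) (\<psi> b)"
  shows "\<forall>x \<in> bruhat_interval W S \<one>\<^bsub>W\<^esub> v. \<forall>y \<in> bruhat_interval W S \<one>\<^bsub>W\<^esub> v.
           KL_poly W S x y = KL_poly W' S' (\<psi> x) (\<psi> y) \<and>
           R_poly W S x y = R_poly W' S' (\<psi> x) (\<psi> y)"
proof -
  interpret X: coxsys W S by unfold_locales fact
  interpret Y: coxsys W' S' by unfold_locales fact
  note i = X.interval_one Y.interval_one
  interpret I: coxiso "carrier W" "(\<otimes>\<^bsub>W\<^esub>)" "\<one>\<^bsub>W\<^esub>" S "cox_length W S" "bruhat_le W S"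
      "carrier W'" "(\<otimes>\<^bsub>W'\<^esub>)" "\<one>\<^bsub>W'\<^esub>" S' "cox_length W' S'" "bruhat_le W' S'" \<psi> v v'
  proof (rule coxiso.intro[OF X.is_cox Y.is_cox], rule coxiso_axioms.intro)
    show "bij_betw \<psi> {z. bruhat_le W S z v} {z. bruhat_le W' S' z v'}" using assms(5) unfolding i .
    show "bruhat_le W S a b \<longleftrightarrow> bruhat_le W' S' (\<psi> a) (\<psi> b)" if "bruhat_le W S a v" "bruhat_le W S b v" for a b
      using assms(6)[of a b] that unfolding i mem_Collect_eq by blast
  qed
  show ?thesis unfolding i X.R_poly_eq Y.R_poly_eq X.KL_poly_eq Y.KL_poly_eq
    by (intro ballI conjI) (simp_all only: mem_Collect_eq I.KP_psi I.Rp_psi)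
qed

end
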